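(* Let $T$ be a strongly nondegenerate Jordan triple system over a unital commutative ring $\Phi$ containing $\frac16$. Then the maximal Jordan triple system of $\mathfrak M$-quotients $Q_m(T)$ of $T$ is the first (degree $1$) component of the maximal algebra of quotients of the TKK-algebra of the double Jordan pair $V(T)=(T,T)$ associated to $T$, i.e. $$Q_m(T)=\big(Q_m(\mathrm{TKK}(V(T)))\big)_1.$$
   Context: A Jordan triple system $T$ has a quadratic map $x\mapsto P_x\in\mathrm{End}(T)$ and triple product $\{x,y,z\}=P_{x+z}y-P_xy-P_zy$. It is strongly nondegenerate if $P_x=0$ implies $x=0$. An ideal $I$ of $T$ is a submodule with $P_IT+P_TI+\{T,T,I\}\subseteq I$; $T$ is semiprime if $P_II=0$ implies $I=0$ for ideals $I$ (strongly nondegenerate implies semiprime). $\mathrm{Ann}_T(I)=\{z\in T:\{z,I,T\}=\{z,T,I\}=\{T,z,I\}=0\}$. The double Jordan pair $V(T)=(T,T)$ has $Q_x=P_x$. A Jordan triple system $S$ containing a semiprime $T$ as a subsystem is a triple system of $\mathfrak M$-quotients of $T$ if for every $0\ne q\in S$ there is an ideal $I$ of $T$ with $\mathrm{Ann}_T(I)=0$ and $0\neq\{q,I,T\}+\{q,T,I\}+\{I,q,T\}\subseteq T$. The maximal one, $Q_m(T)$, is the triple system of $\mathfrak M$-quotients of $T$ (unique up to isomorphism over $T$) such that every triple system of $\mathfrak M$-quotients $S$ of $T$ admits a unique monomorphism $S\to Q_m(T)$ that is the identity on $T$. TKK-algebra: for a Jordan pair $V=(V^+,V^-)$ with $D_{x,y}z=\{x,y,z\}$,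 put $\delta(x,y)=(D_{x,y},-D_{y,x})$ for $(x,y)\in V^+\times V^-$ and let $\mathrm{IDer}(V)$ be the $\Phi$-span of all $\delta(x,y)$. $\mathrm{TKK}(V)=V^+\oplus\mathrm{IDer}(V)\oplus V^-$ is a Lie algebra with bracket $$[x^+\oplus\gamma\oplus x^-,\,y^+\oplus\mu\oplus y^-]=(\gamma_+y^+-\mu_+x^+)\oplus([\gamma,\mu]+\delta(x^+,y^-)-\delta(y^+,x^-))\oplus(\gamma_-y^--\mu_-x^-),$$ 3-graded with $V^+,\mathrm{IDer}(V),V^-$ in degrees $1,0,-1$. For a semiprime Lie algebra $L$ ($[I,I]\ne0$ for nonzero ideals $I$), $Q_m(L)=\varinjlim\mathrm{Der}(I,L)$ is the direct limit under restriction over essential ideals $I$ of $L$ (ideals meeting every nonzero ideal nontrivially), where $\mathrm{Der}(I,L)$ is the set of linear $\delta:I\to L$ with $\delta([x,y])=[\delta x,y]+[x,\delta y]$; the bracket of classes is $[\delta_I,\mu_J]=(\delta\mu-\mu\delta)_{[I\cap J,I\cap J]}$, and $L\subseteq Q_m(L)$ via $x\mapsto(\mathrm{ad}\,x)_L$. For $L=\mathrm{TKK}(V(T))$ with $T$ strongly nondegenerate, $L$ is semiprime and $Q_m(L)$ is 3-graded, $(Q_m(L))_k$ consisting of the classes $\delta_I$ with $I$ a graded essential ideal and $\delta(I_j)\subseteq L_{j+k}$ for all $j$. Triple structure on $(Q_m(L))_1$, $L=\mathrm{TKK}(V(T))$: the exchange automorphism $\theta$ of $L$, $\theta(x\oplus(\gamma_+,\gamma_-)\oplus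 y)=y\oplus(\gamma_-,\gamma_+)\oplus x$, extends to $Q_m(L)$ by $\theta(\delta_I)=(\theta\delta\theta^{-1})_{\theta(I)}$ and interchanges degrees $1$ and $-1$. The triple product on $(Q_m(L))_1$ is $\{x,y,z\}=[[x,\theta(y)],z]$, with $P_xy=\frac12\{x,y,x\}$; $T$ is embedded as $V(T)^+=L_1$. *)

theory Defs
  imports "HOL-Algebra.Module" "HOL-Library.FuncSet"
begin

section \<open>Modules\<close>

definition mspan :: "('k, 'r) ring_scheme \<Rightarrow> ('k, 'a, 'm) module_scheme \<Rightarrow> 'a set \<Rightarrow> 'a set" where
  "mspan \<Phi> M A = \<Inter>{N. submodule N \<Phi> M \<and> A \<subseteq> N}"

text \<open>Linear maps are extensional (\<open>undefined\<close> off the carrier), so that HOL equality is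
  equality of maps.\<close>

definition mod_hom ::
  "('k, 'r) ring_scheme \<Rightarrow> ('k, 'a, 'm) module_scheme \<Rightarrow> ('k, 'b, 'n) module_scheme \<Rightarrow> ('a \<Rightarrow> 'b) set" where
  "mod_hom \<Phi> M N = {f \<in> carrier M \<rightarrow>\<^sub>E carrier N.
     (\<forall>x\<in>carrier M. \<forall>y\<in>carrier M. f (x \<oplus>\<^bsub>M\<^esub> y) = f x \<oplus>\<^bsub>N\<^esub> f y) \<and>
     (\<forall>a\<in>carrier \<Phi>. \<forall>x\<in>carrier M. f (a \<odot>\<^bsub>M\<^esub> x) = a \<odot>\<^bsub>N\<^esub> f x)}"

definition mod_End :: "('k, 'r) ring_scheme \<Rightarrow> ('k, 'a, 'm) module_scheme \<Rightarrow> ('k, 'a \<Rightarrow> 'a) module" where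
  "mod_End \<Phi> M =
    \<lparr>carrier = mod_hom \<Phi> M M,
     mult = (\<lambda>f g. compose (carrier M) f g),
     one = (\<lambda>x\<in>carrier M. x),
     zero = (\<lambda>x\<in>carrier M. \<zero>\<^bsub>M\<^esub>),
     add = (\<lambda>f g. \<lambda>x\<in>carrier M. f x \<oplus>\<^bsub>M\<^esub> g x),
     smult = (\<lambda>a f. \<lambda>x\<in>carrier M. a \<odot>\<^bsub>M\<^esub> f x)\<rparr>"

definition mod_sum ::
  "('k, 'a, 'm) module_scheme \<Rightarrow> ('k, 'b, 'n) module_scheme \<Rightarrow> ('k, 'a \<times> 'b) module" where
  "mod_sum M N =
    \<lparr>carrier = carrier M \<times> carrier N,
     mult = (\<lambda>(x, y) (x', y'). (x \<otimes>\<^bsub>M\<^esub> x', y \<otimes>\<^bsub>N\<^esub> y')),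
     one = (\<one>\<^bsub>M\<^esub>, \<one>\<^bsub>N\<^esub>),
     zero = (\<zero>\<^bsub>M\<^esub>, \<zero>\<^bsub>N\<^esub>),
     add = (\<lambda>(x, y) (x', y'). (x \<oplus>\<^bsub>M\<^esub> x', y \<oplus>\<^bsub>N\<^esub> y')),
     smult = (\<lambda>a (x, y). (a \<odot>\<^bsub>M\<^esub> x, a \<odot>\<^bsub>N\<^esub> y))\<rparr>"


section \<open>Jordan triple systems\<close>

text \<open>\<open>quad T x y\<close> is $P_x y$.  The fields \<open>mult\<close> and \<open>one\<close> inherited from the record
  \<open>module\<close> play no role.\<close>

record ('k, 'a) jts = "('k, 'a) module" +
  quad :: "'a \<Rightarrow> 'a \<Rightarrow> 'a"

definition trip :: "('k, 'a, 'm) jts_scheme \<Rightarrow> 'a \<Rightarrow> 'a \<Rightarrow> 'a \<Rightarrow> 'a" where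
  "trip T x y z = quad T (x \<oplus>\<^bsub>T\<^esub> z) y \<ominus>\<^bsub>T\<^esub> quad T x y \<ominus>\<^bsub>T\<^esub> quad T z y"

text \<open>The defining identities JT1--JT3 of a quadratic Jordan triple system are required to hold in
  all scalar extensions, i.e. together with all their linearizations.  They have degree at most 4
  in each variable, so over a ring containing 1/6 the linearizations follow from the identities
  themselves, and only the latter are listed.\<close>

locale jordan_triple_system = module \<Phi> T
  for \<Phi> :: "('k, 'r) ring_scheme" and T :: "('k, 'a, 'm) jts_scheme" +
  assumes quad_closed: "\<lbrakk>x \<in> carrier T; y \<in> carrier T\<rbrakk> \<Longrightarrow> quad T x y \<in> carrier T"
    and quad_add: "\<lbrakk>x \<in> carrier T; y \<in> carrier T; z \<in> carrier T\<rbrakk> \<Longrightarrow>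
      quad T x (y \<oplus>\<^bsub>T\<^esub> z) = quad T x y \<oplus>\<^bsub>T\<^esub> quad T x z"
    and quad_smult: "\<lbrakk>a \<in> carrier \<Phi>; x \<in> carrier T; y \<in> carrier T\<rbrakk> \<Longrightarrow>
      quad T x (a \<odot>\<^bsub>T\<^esub> y) = a \<odot>\<^bsub>T\<^esub> quad T x y"
    and quad_homogeneous: "\<lbrakk>a \<in> carrier \<Phi>; x \<in> carrier T; y \<in> carrier T\<rbrakk> \<Longrightarrow>
      quad T (a \<odot>\<^bsub>T\<^esub> x) y = (a \<otimes>\<^bsub>\<Phi>\<^esub> a) \<odot>\<^bsub>T\<^esub> quad T x y"
    and trip_add: "\<lbrakk>x \<in> carrier T; x' \<in> carrier T; y \<in> carrier T; z \<in> carrier T\<rbrakk> \<Longrightarrow>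
      trip T (x \<oplus>\<^bsub>T\<^esub> x') y z = trip T x y z \<oplus>\<^bsub>T\<^esub> trip T x' y z"
    and trip_smult: "\<lbrakk>a \<in> carrier \<Phi>; x \<in> carrier T; y \<in> carrier T; z \<in> carrier T\<rbrakk> \<Longrightarrow>
      trip T (a \<odot>\<^bsub>T\<^esub> x) y z = a \<odot>\<^bsub>T\<^esub> trip T x y z"
    and JT1: "\<lbrakk>x \<in> carrier T; y \<in> carrier T; z \<in> carrier T\<rbrakk> \<Longrightarrow>
      trip T x y (quad T x z) = quad T x (trip T y x z)"
    and JT2: "\<lbrakk>x \<in> carrier T; y \<in> carrier T; z \<in> carrier T\<rbrakk> \<Longrightarrow>
      trip T (quad T x y) y z = trip T x (quad T y x) z"
    and JT3: "\<lbrakk>x \<in> carrier T; y \<in> carrier T; z \<in> carrier T\<rbrakk> \<Longrightarrow>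
      quad T (quad T x y) z = quad T x (quad T y (quad T x z))"

definition strongly_nondegenerate :: "('k, 'a, 'm) jts_scheme \<Rightarrow> bool" where
  "strongly_nondegenerate T \<longleftrightarrow>
     (\<forall>x\<in>carrier T. (\<forall>y\<in>carrier T. quad T x y = \<zero>\<^bsub>T\<^esub>) \<longrightarrow> x = \<zero>\<^bsub>T\<^esub>)"

definition jts_ideal :: "('k, 'r) ring_scheme \<Rightarrow> ('k, 'a, 'm) jts_scheme \<Rightarrow> 'a set \<Rightarrow> bool" where
  "jts_ideal \<Phi> T I \<longleftrightarrow> submodule I \<Phi> T \<and>
     (\<forall>x\<in>I. \<forall>y\<in>carrier T. quad T x y \<in> I \<and> quad T y x \<in> I) \<and>
     (\<forall>y\<in>carrier T. \<forall>z\<in>carrier T. \<forall>x\<in>I. trip T y z x \<in> I)"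

definition jts_semiprime :: "('k, 'r) ring_scheme \<Rightarrow> ('k, 'a, 'm) jts_scheme \<Rightarrow> bool" where
  "jts_semiprime \<Phi> T \<longleftrightarrow>
     (\<forall>I. jts_ideal \<Phi> T I \<and> (\<forall>x\<in>I. \<forall>y\<in>I. quad T x y = \<zero>\<^bsub>T\<^esub>) \<longrightarrow> I = {\<zero>\<^bsub>T\<^esub>})"

definition jts_ann :: "('k, 'a, 'm) jts_scheme \<Rightarrow> 'a set \<Rightarrow> 'a set" where
  "jts_ann T I = {z \<in> carrier T. \<forall>x\<in>I. \<forall>y\<in>carrier T.
     trip T z x y = \<zero>\<^bsub>T\<^esub> \<and> trip T z y x = \<zero>\<^bsub>T\<^esub> \<and> trip T y z x = \<zero>\<^bsub>T\<^esub>}"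

definition jts_subsystem :: "('k, 'r) ring_scheme \<Rightarrow> ('k, 'a, 'm) jts_scheme \<Rightarrow> 'a set \<Rightarrow> bool" where
  "jts_subsystem \<Phi> S K \<longleftrightarrow> submodule K \<Phi> S \<and> (\<forall>x\<in>K. \<forall>y\<in>K. quad S x y \<in> K)"

definition jts_mono ::
  "('k, 'r) ring_scheme \<Rightarrow> ('k, 'a, 'm) jts_scheme \<Rightarrow> ('k, 'b, 'n) jts_scheme \<Rightarrow> ('a \<Rightarrow> 'b) \<Rightarrow> bool" where
  "jts_mono \<Phi> T S f \<longleftrightarrow> f \<in> mod_hom \<Phi> T S \<and>
     (\<forall>x\<in>carrier T. \<forall>y\<in>carrier T. f (quad T x y) = quad S (f x) (f y)) \<and>
     inj_on f (carrier T)"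


section \<open>Triple systems of M-quotients\<close>

definition trips :: "('k, 'a, 'm) jts_scheme \<Rightarrow> 'a set \<Rightarrow> 'a set \<Rightarrow> 'a set \<Rightarrow> 'a set" where
  "trips S A B C = {trip S a b c | a b c. a \<in> A \<and> b \<in> B \<and> c \<in> C}"

definition M_quotients :: "('k, 'r) ring_scheme \<Rightarrow> 'a set \<Rightarrow> ('k, 'a, 'm) jts_scheme \<Rightarrow> bool" where
  "M_quotients \<Phi> K S \<longleftrightarrow>
     jordan_triple_system \<Phi> S \<and> jts_subsystem \<Phi> S K \<and> jts_semiprime \<Phi> (S\<lparr>carrier := K\<rparr>) \<and>
     (\<forall>q\<in>carrier S. q \<noteq> \<zero>\<^bsub>S\<^esub> \<longrightarrow>
       (\<exists>I. jts_ideal \<Phi> (S\<lparr>carrier := K\<rparr>) I \<and> jts_ann (S\<lparr>carrier := K\<rparr>) I = {\<zero>\<^bsub>S\<^esub>} \<and>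
         (let N = mspan \<Phi> S (trips S {q} I K \<union> trips S {q} K I \<union> trips S I {q} K)
          in N \<noteq> {\<zero>\<^bsub>S\<^esub>} \<and> N \<subseteq> K)))"

text \<open>Here \<open>T\<close> is identified with its image in \<open>S\<close> under the monomorphism \<open>f\<close>, so that
  \<open>S\<close> may live on another type.\<close>

definition M_quotients_of ::
  "('k, 'r) ring_scheme \<Rightarrow> ('k, 't, 'm) jts_scheme \<Rightarrow> ('k, 's, 'n) jts_scheme \<Rightarrow> ('t \<Rightarrow> 's) \<Rightarrow> bool" where
  "M_quotients_of \<Phi> T S f \<longleftrightarrow> jts_mono \<Phi> T S f \<and> M_quotients \<Phi> (f ` carrier T) S"


section \<open>Jordan pairs and their TKK-algebras\<close>

record ('k, 'p, 'm) jordan_pair =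
  Vplus :: "('k, 'p) module"
  Vminus :: "('k, 'm) module"
  Qplus :: "'p \<Rightarrow> 'm \<Rightarrow> 'p"
  Qminus :: "'m \<Rightarrow> 'p \<Rightarrow> 'm"

definition trip_plus :: "('k, 'p, 'm) jordan_pair \<Rightarrow> 'p \<Rightarrow> 'm \<Rightarrow> 'p \<Rightarrow> 'p" where
  "trip_plus V x y z =
     Qplus V (x \<oplus>\<^bsub>Vplus V\<^esub> z) y \<ominus>\<^bsub>Vplus V\<^esub> Qplus V x y \<ominus>\<^bsub>Vplus V\<^esub> Qplus V z y"

definition trip_minus :: "('k, 'p, 'm) jordan_pair \<Rightarrow> 'm \<Rightarrow> 'p \<Rightarrow> 'm \<Rightarrow> 'm" where
  "trip_minus V x y z =
     Qminus V (x \<oplus>\<^bsub>Vminus V\<^esub> z) y \<ominus>\<^bsub>Vminus V\<^esub> Qminus V x y \<ominus>\<^bsub>Vminus V\<^esub> Qminus V z y"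

definition double_pair :: "('k, 'a, 'm) jts_scheme \<Rightarrow> ('k, 'a, 'a) jordan_pair" where
  "double_pair T = \<lparr>Vplus = module.truncate T, Vminus = module.truncate T,
     Qplus = quad T, Qminus = quad T\<rparr>"

definition pair_delta :: "('k, 'p, 'm) jordan_pair \<Rightarrow> 'p \<Rightarrow> 'm \<Rightarrow> ('p \<Rightarrow> 'p) \<times> ('m \<Rightarrow> 'm)" where
  "pair_delta V x y = ((\<lambda>z\<in>carrier (Vplus V). trip_plus V x y z),
                       (\<lambda>z\<in>carrier (Vminus V). \<ominus>\<^bsub>Vminus V\<^esub> trip_minus V y x z))"

definition pair_End ::
  "('k, 'r) ring_scheme \<Rightarrow> ('k, 'p, 'm) jordan_pair \<Rightarrow> ('k, ('p \<Rightarrow> 'p) \<times> ('m \<Rightarrow> 'm)) module" where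
  "pair_End \<Phi> V = mod_sum (mod_End \<Phi> (Vplus V)) (mod_End \<Phi> (Vminus V))"

definition IDer ::
  "('k, 'r) ring_scheme \<Rightarrow> ('k, 'p, 'm) jordan_pair \<Rightarrow> ('k, ('p \<Rightarrow> 'p) \<times> ('m \<Rightarrow> 'm)) module" where
  "IDer \<Phi> V = (pair_End \<Phi> V)\<lparr>carrier := mspan \<Phi> (pair_End \<Phi> V)
     {pair_delta V x y | x y. x \<in> carrier (Vplus V) \<and> y \<in> carrier (Vminus V)}\<rparr>"

definition pair_commutator ::
  "('k, 'r) ring_scheme \<Rightarrow> ('k, 'p, 'm) jordan_pair \<Rightarrow>
   ('p \<Rightarrow> 'p) \<times> ('m \<Rightarrow> 'm) \<Rightarrow> ('p \<Rightarrow> 'p) \<times> ('m \<Rightarrow> 'm) \<Rightarrow> ('p \<Rightarrow> 'p) \<times> ('m \<Rightarrow> 'm)" where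
  "pair_commutator \<Phi> V \<gamma> \<mu> =
     (\<gamma> \<otimes>\<^bsub>pair_End \<Phi> V\<^esub> \<mu>) \<ominus>\<^bsub>pair_End \<Phi> V\<^esub> (\<mu> \<otimes>\<^bsub>pair_End \<Phi> V\<^esub> \<gamma>)"

type_synonym ('p, 'm) tkk = "'p \<times> (('p \<Rightarrow> 'p) \<times> ('m \<Rightarrow> 'm)) \<times> 'm"

text \<open>A Lie algebra is represented as a \<open>module\<close> record whose field \<open>mult\<close> is the Lie bracket;
  the field \<open>one\<close> plays no role.\<close>

definition TKK_bracket ::
  "('k, 'r) ring_scheme \<Rightarrow> ('k, 'p, 'm) jordan_pair \<Rightarrow> ('p, 'm) tkk \<Rightarrow> ('p, 'm) tkk \<Rightarrow> ('p, 'm) tkk" where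
  "TKK_bracket \<Phi> V = (\<lambda>(xp, \<gamma>, xm) (yp, \<mu>, ym).
     (fst \<gamma> yp \<ominus>\<^bsub>Vplus V\<^esub> fst \<mu> xp,
      pair_commutator \<Phi> V \<gamma> \<mu> \<oplus>\<^bsub>pair_End \<Phi> V\<^esub> pair_delta V xp ym \<ominus>\<^bsub>pair_End \<Phi> V\<^esub> pair_delta V yp xm,
      snd \<gamma> ym \<ominus>\<^bsub>Vminus V\<^esub> snd \<mu> xm))"

definition TKK ::
  "('k, 'r) ring_scheme \<Rightarrow> ('k, 'p, 'm) jordan_pair \<Rightarrow> ('k, ('p, 'm) tkk) module" where
  "TKK \<Phi> V = (mod_sum (Vplus V) (mod_sum (IDer \<Phi> V) (Vminus V)))\<lparr>mult := TKK_bracket \<Phi> V\<rparr>"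

definition TKK_deg ::
  "('k, 'r) ring_scheme \<Rightarrow> ('k, 'p, 'm) jordan_pair \<Rightarrow> int \<Rightarrow> ('p, 'm) tkk set" where
  "TKK_deg \<Phi> V k =
     (if k = 1 then carrier (Vplus V) \<times> {\<zero>\<^bsub>IDer \<Phi> V\<^esub>} \<times> {\<zero>\<^bsub>Vminus V\<^esub>}
      else if k = 0 then {\<zero>\<^bsub>Vplus V\<^esub>} \<times> carrier (IDer \<Phi> V) \<times> {\<zero>\<^bsub>Vminus V\<^esub>}
      else if k = -1 then {\<zero>\<^bsub>Vplus V\<^esub>} \<times> {\<zero>\<^bsub>IDer \<Phi> V\<^esub>} \<times> carrier (Vminus V)
      else {\<zero>\<^bsub>TKK \<Phi> V\<^esub>})"

definition exchange :: "('a, 'a) tkk \<Rightarrow> ('a, 'a) tkk" where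
  "exchange = (\<lambda>(x, (\<gamma>p, \<gamma>m), y). (y, (\<gamma>m, \<gamma>p), x))"


section \<open>The maximal algebra of quotients of a Lie algebra\<close>

definition lie_ideal :: "('k, 'r) ring_scheme \<Rightarrow> ('k, 'a, 'm) module_scheme \<Rightarrow> 'a set \<Rightarrow> bool" where
  "lie_ideal \<Phi> L I \<longleftrightarrow> submodule I \<Phi> L \<and> (\<forall>x\<in>carrier L. \<forall>y\<in>I. x \<otimes>\<^bsub>L\<^esub> y \<in> I)"

definition essential_ideal :: "('k, 'r) ring_scheme \<Rightarrow> ('k, 'a, 'm) module_scheme \<Rightarrow> 'a set \<Rightarrow> bool" where
  "essential_ideal \<Phi> L I \<longleftrightarrow> lie_ideal \<Phi> L I \<and>
     (\<forall>J. lie_ideal \<Phi> L J \<and> J \<noteq> {\<zero>\<^bsub>L\<^esub>} \<longrightarrow> I \<inter> J \<noteq> {\<zero>\<^bsub>L\<^esub>})"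

definition Der ::
  "('k, 'r) ring_scheme \<Rightarrow> ('k, 'a, 'm) module_scheme \<Rightarrow> 'a set \<Rightarrow> ('a \<Rightarrow> 'a) set" where
  "Der \<Phi> L I = {\<delta> \<in> mod_hom \<Phi> (L\<lparr>carrier := I\<rparr>) L.
     \<forall>x\<in>I. \<forall>y\<in>I. \<delta> (x \<otimes>\<^bsub>L\<^esub> y) = (\<delta> x \<otimes>\<^bsub>L\<^esub> y) \<oplus>\<^bsub>L\<^esub> (x \<otimes>\<^bsub>L\<^esub> \<delta> y)}"

definition partial_ders ::
  "('k, 'r) ring_scheme \<Rightarrow> ('k, 'a, 'm) module_scheme \<Rightarrow> ('a set \<times> ('a \<Rightarrow> 'a)) set" where
  "partial_ders \<Phi> L = (SIGMA I : {I. essential_ideal \<Phi> L I}. Der \<Phi> L I)"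

text \<open>The direct limit is the set of partial derivations modulo agreement after restriction to a
  common smaller essential ideal.\<close>

definition der_rel ::
  "('k, 'r) ring_scheme \<Rightarrow> ('k, 'a, 'm) module_scheme \<Rightarrow>
   (('a set \<times> ('a \<Rightarrow> 'a)) \<times> ('a set \<times> ('a \<Rightarrow> 'a))) set" where
  "der_rel \<Phi> L = {((I, \<delta>), (J, \<mu>)). (I, \<delta>) \<in> partial_ders \<Phi> L \<and> (J, \<mu>) \<in> partial_ders \<Phi> L \<and>
     (\<exists>K. essential_ideal \<Phi> L K \<and> K \<subseteq> I \<inter> J \<and> (\<forall>x\<in>K. \<delta> x = \<mu> x))}"

definition der_class ::
  "('k, 'r) ring_scheme \<Rightarrow> ('k, 'a, 'm) module_scheme \<Rightarrow> 'a set \<Rightarrow> ('a \<Rightarrow> 'a) \<Rightarrow>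
   ('a set \<times> ('a \<Rightarrow> 'a)) set" where
  "der_class \<Phi> L I \<delta> = der_rel \<Phi> L `` {(I, \<delta>)}"

definition lie_derived :: "('k, 'r) ring_scheme \<Rightarrow> ('k, 'a, 'm) module_scheme \<Rightarrow> 'a set \<Rightarrow> 'a set" where
  "lie_derived \<Phi> L I = mspan \<Phi> L {x \<otimes>\<^bsub>L\<^esub> y | x y. x \<in> I \<and> y \<in> I}"

text \<open>Intended for semiprime \<open>L\<close>; the results of the operations are then independent of the
  representatives, so that each union is over a single class.\<close>

definition Qm_lie ::
  "('k, 'r) ring_scheme \<Rightarrow> ('k, 'a, 'm) module_scheme \<Rightarrow> ('k, ('a set \<times> ('a \<Rightarrow> 'a)) set) module" where
  "Qm_lie \<Phi> L =
    \<lparr>carrier = partial_ders \<Phi> L // der_rel \<Phi> L,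
     mult = (\<lambda>X Y. \<Union>(I, \<delta>)\<in>X. \<Union>(J, \<mu>)\<in>Y.
       der_class \<Phi> L (lie_derived \<Phi> L (I \<inter> J))
         (\<lambda>x\<in>lie_derived \<Phi> L (I \<inter> J). \<delta> (\<mu> x) \<ominus>\<^bsub>L\<^esub> \<mu> (\<delta> x))),
     one = undefined,
     zero = der_class \<Phi> L (carrier L) (\<lambda>x\<in>carrier L. \<zero>\<^bsub>L\<^esub>),
     add = (\<lambda>X Y. \<Union>(I, \<delta>)\<in>X. \<Union>(J, \<mu>)\<in>Y.
       der_class \<Phi> L (I \<inter> J) (\<lambda>x\<in>I \<inter> J. \<delta> x \<oplus>\<^bsub>L\<^esub> \<mu> x)),
     smult = (\<lambda>a X. \<Union>(I, \<delta>)\<in>X. der_class \<Phi> L I (\<lambda>x\<in>I. a \<odot>\<^bsub>L\<^esub> \<delta> x))\<rparr>"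

definition ad_class ::
  "('k, 'r) ring_scheme \<Rightarrow> ('k, 'a, 'm) module_scheme \<Rightarrow> 'a \<Rightarrow> ('a set \<times> ('a \<Rightarrow> 'a)) set" where
  "ad_class \<Phi> L x = der_class \<Phi> L (carrier L) (\<lambda>y\<in>carrier L. x \<otimes>\<^bsub>L\<^esub> y)"

text \<open>\<open>G k\<close> is the homogeneous component of degree \<open>k\<close> of \<open>L\<close>.\<close>

definition graded_ideal ::
  "('k, 'r) ring_scheme \<Rightarrow> ('k, 'a, 'm) module_scheme \<Rightarrow> (int \<Rightarrow> 'a set) \<Rightarrow> 'a set \<Rightarrow> bool" where
  "graded_ideal \<Phi> L G I \<longleftrightarrow> lie_ideal \<Phi> L I \<and> I = mspan \<Phi> L (\<Union>j. I \<inter> G j)"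

definition Qm_deg ::
  "('k, 'r) ring_scheme \<Rightarrow> ('k, 'a, 'm) module_scheme \<Rightarrow> (int \<Rightarrow> 'a set) \<Rightarrow> int \<Rightarrow>
   ('a set \<times> ('a \<Rightarrow> 'a)) set set" where
  "Qm_deg \<Phi> L G k = {der_class \<Phi> L I \<delta> | I \<delta>.
     (I, \<delta>) \<in> partial_ders \<Phi> L \<and> graded_ideal \<Phi> L G I \<and> (\<forall>j. \<delta> ` (I \<inter> G j) \<subseteq> G (j + k))}"

definition Qm_extend ::
  "('k, 'r) ring_scheme \<Rightarrow> ('k, 'a, 'm) module_scheme \<Rightarrow> ('a \<Rightarrow> 'a) \<Rightarrow>
   ('a set \<times> ('a \<Rightarrow> 'a)) set \<Rightarrow> ('a set \<times> ('a \<Rightarrow> 'a)) set" where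
  "Qm_extend \<Phi> L \<theta> X = (\<Union>(I, \<delta>)\<in>X.
     der_class \<Phi> L (\<theta> ` I) (\<lambda>z\<in>\<theta> ` I. \<theta> (\<delta> (inv_into (carrier L) \<theta> z))))"


section \<open>The degree one component as a triple system\<close>

text \<open>The triple product is $\{x,y,z\} = [[x,\theta(y)],z]$ and $P_x y = \frac12\{x,y,x\}$.
  Since the degree one component is an abelian subalgebra, $\{x,y,z\}$ is symmetric in $x$ and $z$
  and is recovered as the linearization \<open>trip\<close> of \<open>quad\<close>.\<close>

definition Qm_trip ::
  "('k, 'r) ring_scheme \<Rightarrow> ('k, 'a, 'm) module_scheme \<Rightarrow> ('a \<Rightarrow> 'a) \<Rightarrow>
   ('a set \<times> ('a \<Rightarrow> 'a)) set \<Rightarrow> ('a set \<times> ('a \<Rightarrow> 'a)) set \<Rightarrow>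
   ('a set \<times> ('a \<Rightarrow> 'a)) set \<Rightarrow> ('a set \<times> ('a \<Rightarrow> 'a)) set" where
  "Qm_trip \<Phi> L \<theta> x y z = (x \<otimes>\<^bsub>Qm_lie \<Phi> L\<^esub> Qm_extend \<Phi> L \<theta> y) \<otimes>\<^bsub>Qm_lie \<Phi> L\<^esub> z"

type_synonym 'a tkk_quotient =
  "(('a, 'a) tkk set \<times> (('a, 'a) tkk \<Rightarrow> ('a, 'a) tkk)) set"

definition Qm_TKK_one ::
  "('k, 'r) ring_scheme \<Rightarrow> ('k, 'a, 'm) jts_scheme \<Rightarrow> ('k, 'a tkk_quotient) jts" where
  "Qm_TKK_one \<Phi> T =
    (let V = double_pair T; L = TKK \<Phi> V; Q = Qm_lie \<Phi> L in
     \<lparr>carrier = Qm_deg \<Phi> L (TKK_deg \<Phi> V) 1,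
      mult = mult Q, one = one Q, zero = zero Q, add = add Q, smult = smult Q,
      quad = (\<lambda>x y. inv\<^bsub>\<Phi>\<^esub> (\<one>\<^bsub>\<Phi>\<^esub> \<oplus>\<^bsub>\<Phi>\<^esub> \<one>\<^bsub>\<Phi>\<^esub>) \<odot>\<^bsub>Q\<^esub> Qm_trip \<Phi> L exchange x y x)\<rparr>)"

definition TKK_embed ::
  "('k, 'r) ring_scheme \<Rightarrow> ('k, 'a, 'm) jts_scheme \<Rightarrow> 'a \<Rightarrow> 'a tkk_quotient" where
  "TKK_embed \<Phi> T = (\<lambda>x\<in>carrier T.
     ad_class \<Phi> (TKK \<Phi> (double_pair T)) (x, \<zero>\<^bsub>IDer \<Phi> (double_pair T)\<^esub>, \<zero>\<^bsub>T\<^esub>))"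

end

(*
  The algebra L = TKK(V(T)) is 3-graded and nondegenerate in degree one. This makes L semiprime and
  forces every partial derivation of degree two to vanish on an essential ideal, so that Q_m(L)_1 is
  abelian and [[x, theta y], z] is a Jordan triple product on it. If q in Q_m(L)_1 is represented by
  a derivation on a graded theta-invariant essential ideal E, then the ideal E_1 of T has zero
  annihilator and multiplies q into T; hence Q_m(L)_1 is a triple system of M-quotients of T.

  Conversely, let S be a triple system of M-quotients of T. An element of S annihilated by an ideal
  of T with zero annihilator vanishes. Therefore a derivation pair of S that kills T is zero, and L
  embeds in M = TKK(V(S)). If J is an ideal of denominators of q in S, then ad q maps the essential
  ideal of L generated by J into the normaliser of L in M, and so it maps the derived ideal, which is
  again essential, into L. The element q is sent to the class of this derivation. The separation
  property of denominator ideals also gives the uniqueness of the map.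
*)
theory Submission
  imports Defs
begin


section \<open>Modules over a ring containing 1/6\<close>

text \<open>Everything in \<open>L\<close> rests on one consequence of nondegeneracy: an element u
  of degree 1 or -1 in an ideal I vanishes once [y,[w,u]] = 0 for all y, w in I of the opposite
  degree. It follows from the fundamental formula, read as an identity between words in
  \<open>ad\<close>, and I may be inhomogeneous.

  The main obstacle is degree two. \<open>L\<close> has no component there, but a partial derivation
  e could still send degree -1 to degree 1. For such an e the trilinear map [x,[y,e z]] is symmetric
  with zero diagonal, so six times it vanishes.

  In the converse direction nothing is known about nondegeneracy of S. Its TKK-algebra is therefore
  only an ambient Lie algebra, and every vanishing statement is tested on T. The normaliser is
  forced upon the argument: the bracket of q with an element of degree -1 coming from a denominator
  is an inner derivation of V(S) that preserves T, but it need not be induced by an inner derivation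
  of V(T).\<close>

context abelian_group
begin

lemma diff_zero: "a \<in> carrier G \<Longrightarrow> a \<ominus> \<zero> = a"
  by (simp add: a_minus_def)

lemma uminus_eq_diff: "a \<in> carrier G \<Longrightarrow> \<ominus> a = \<zero> \<ominus> a"
  by (simp add: a_minus_def)

lemma add_diff: "\<lbrakk>a \<in> carrier G; b \<in> carrier G; c \<in> carrier G\<rbrakk> \<Longrightarrow> a \<oplus> (b \<ominus> c) = (a \<oplus> b) \<ominus> c"
  by (simp add: a_minus_def a_assoc)

lemma diff_add: "\<lbrakk>a \<in> carrier G; b \<in> carrier G; c \<in> carrier G\<rbrakk> \<Longrightarrow> (a \<ominus> b) \<oplus> c = (a \<oplus> c) \<ominus> b"
  by (simp add: a_minus_def a_ac)

lemma diff_diff: "\<lbrakk>a \<in> carrier G; b \<in> carrier G; c \<in> carrier G\<rbrakk> \<Longrightarrow> a \<ominus> (b \<ominus> c) = (a \<oplus> c) \<ominus> b"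
  by (simp add: a_minus_def minus_add a_ac)

lemma diff_diff2: "\<lbrakk>a \<in> carrier G; b \<in> carrier G; c \<in> carrier G\<rbrakk> \<Longrightarrow> (a \<ominus> b) \<ominus> c = a \<ominus> (b \<oplus> c)"
  by (simp add: a_minus_def minus_add a_ac)

lemma diff_eq: "\<lbrakk>a \<in> carrier G; b \<in> carrier G; c \<in> carrier G\<rbrakk> \<Longrightarrow> (a \<ominus> b = c) = (a = c \<oplus> b)"
proof
  assume h: "a \<in> carrier G" "b \<in> carrier G" "c \<in> carrier G" "a \<ominus> b = c"
  then show "a = c \<oplus> b"
    by (metis a_assoc a_inv_closed a_minus_def l_neg r_zero)
next
  assume h: "a \<in> carrier G" "b \<in> carrier G" "c \<in> carrier G" "a = c \<oplus> b"
  then show "a \<ominus> b = c"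
    by (simp add: a_minus_def a_assoc r_neg)
qed

lemma eq_diff: "\<lbrakk>a \<in> carrier G; b \<in> carrier G; c \<in> carrier G\<rbrakk> \<Longrightarrow> (c = a \<ominus> b) = (c \<oplus> b = a)"
  using diff_eq by metis

text \<open>Each side of an equation is brought into the form \<open>P \<ominus> N\<close> with sums \<open>P\<close>, \<open>N\<close>, and
  \<open>N\<close> is moved to the other side: this decides equations in a free abelian group.\<close>

lemmas ab_simps = uminus_eq_diff add_diff diff_add diff_diff diff_diff2 diff_eq eq_diff diff_zero a_ac

lemma diff_eq_zero: "\<lbrakk>a \<in> carrier G; b \<in> carrier G\<rbrakk> \<Longrightarrow> (a \<ominus> b = \<zero>) = (a = b)"
  by (simp add: diff_eq)

end

text \<open>Bare functions that are additive on carriers are allowed, so the lemma applies to every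
  partial application of a product without first forming a homomorphism.\<close>

lemma additive_zero_gen:
  assumes "abelian_group G" "abelian_group H" "f \<in> carrier G \<rightarrow> carrier H"
    "\<And>x y. \<lbrakk>x \<in> carrier G; y \<in> carrier G\<rbrakk> \<Longrightarrow> f (x \<oplus>\<^bsub>G\<^esub> y) = f x \<oplus>\<^bsub>H\<^esub> f y"
  shows "f \<zero>\<^bsub>G\<^esub> = \<zero>\<^bsub>H\<^esub>"
proof -
  interpret G: abelian_group G by fact
  interpret H: abelian_group H by fact
  have "f \<zero>\<^bsub>G\<^esub> = f \<zero>\<^bsub>G\<^esub> \<oplus>\<^bsub>H\<^esub> f \<zero>\<^bsub>G\<^esub>"
    using assms(4)[of "\<zero>\<^bsub>G\<^esub>" "\<zero>\<^bsub>G\<^esub>"] by simp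
  then show ?thesis using assms(3) by (metis PiE H.add.r_cancel_one' G.zero_closed)
qed

lemma additive_uminus_gen:
  assumes "abelian_group G" "abelian_group H" "f \<in> carrier G \<rightarrow> carrier H"
    "\<And>x y. \<lbrakk>x \<in> carrier G; y \<in> carrier G\<rbrakk> \<Longrightarrow> f (x \<oplus>\<^bsub>G\<^esub> y) = f x \<oplus>\<^bsub>H\<^esub> f y"
    "x \<in> carrier G"
  shows "f (\<ominus>\<^bsub>G\<^esub> x) = \<ominus>\<^bsub>H\<^esub> f x"
proof -
  interpret G: abelian_group G by fact
  interpret H: abelian_group H by fact
  have "f (\<ominus>\<^bsub>G\<^esub> x) \<oplus>\<^bsub>H\<^esub> f x = \<zero>\<^bsub>H\<^esub>"
    using assms(4)[of "\<ominus>\<^bsub>G\<^esub> x" x] assms(5) additive_zero_gen[OF assms(1-4)] by (simp add: G.l_neg)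
  then show ?thesis using assms(3,5) by (metis PiE H.minus_equality G.a_inv_closed)
qed

lemma additive_diff_gen:
  assumes "abelian_group G" "abelian_group H" "f \<in> carrier G \<rightarrow> carrier H"
    "\<And>x y. \<lbrakk>x \<in> carrier G; y \<in> carrier G\<rbrakk> \<Longrightarrow> f (x \<oplus>\<^bsub>G\<^esub> y) = f x \<oplus>\<^bsub>H\<^esub> f y"
    "x \<in> carrier G" "y \<in> carrier G"
  shows "f (x \<ominus>\<^bsub>G\<^esub> y) = f x \<ominus>\<^bsub>H\<^esub> f y"
proof -
  interpret G: abelian_group G by fact
  interpret H: abelian_group H by fact
  show ?thesis using additive_uminus_gen[OF assms(1-4)] assms(4)[of x "\<ominus>\<^bsub>G\<^esub> y"] assms(5,6)
    by (simp add: a_minus_def)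
qed

context module
begin

lemma smult_diff: "\<lbrakk>a \<in> carrier R; x \<in> carrier M; y \<in> carrier M\<rbrakk> \<Longrightarrow>
    a \<odot>\<^bsub>M\<^esub> (x \<ominus>\<^bsub>M\<^esub> y) = a \<odot>\<^bsub>M\<^esub> x \<ominus>\<^bsub>M\<^esub> a \<odot>\<^bsub>M\<^esub> y"
  by (simp add: a_minus_def smult_r_distr smult_r_minus)

lemma submodule_in: "\<lbrakk>submodule U R M; x \<in> U\<rbrakk> \<Longrightarrow> x \<in> carrier M"
  by (rule subsetD[OF submoduleE(1)])

lemma submodule_add: "\<lbrakk>submodule U R M; x \<in> U; y \<in> U\<rbrakk> \<Longrightarrow> x \<oplus>\<^bsub>M\<^esub> y \<in> U"
  by (rule submoduleE(5))

lemma submodule_smult: "\<lbrakk>submodule U R M; a \<in> carrier R; x \<in> U\<rbrakk> \<Longrightarrow> a \<odot>\<^bsub>M\<^esub> x \<in> U"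
  by (rule submoduleE(4))

lemma submodule_uminus: "\<lbrakk>submodule U R M; x \<in> U\<rbrakk> \<Longrightarrow> \<ominus>\<^bsub>M\<^esub> x \<in> U"
  by (rule submoduleE(3))

lemma submodule_diff: "\<lbrakk>submodule U R M; x \<in> U; y \<in> U\<rbrakk> \<Longrightarrow> x \<ominus>\<^bsub>M\<^esub> y \<in> U"
  unfolding a_minus_def by (rule submodule_add[OF _ _ submodule_uminus])

lemma submodule_zero:
  assumes "submodule U R M"
  shows "\<zero>\<^bsub>M\<^esub> \<in> U"
proof -
  obtain x where x: "x \<in> U" using submoduleE(2)[OF assms] by blast
  have "x \<oplus>\<^bsub>M\<^esub> \<ominus>\<^bsub>M\<^esub> x \<in> U" by (rule submodule_add[OF assms x submodule_uminus[OF assms x]])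
  then show ?thesis using M.r_neg[OF submodule_in[OF assms x]] by simp
qed

lemmas submodule_intros = submodule_add submodule_smult submodule_uminus submodule_diff submodule_zero

lemma submodule_carrier: "submodule (carrier M) R M"
  by (rule carrier_is_submodule)

lemma submodule_inter:
  assumes "submodule U R M" "submodule V R M"
  shows "submodule (U \<inter> V) R M"
  by (rule submoduleI)
    (use submodule_in[OF assms(1)] in \<open>auto intro: submodule_intros[OF assms(1)] submodule_intros[OF assms(2)]\<close>)

lemma submodule_zero_set: "submodule {\<zero>\<^bsub>M\<^esub>} R M"
  by (rule submoduleI) auto

lemma submodule_Inter:
  assumes sub: "\<And>N. N \<in> F \<Longrightarrow> submodule N R M" and "F \<noteq> {}"
  shows "submodule (\<Inter>F) R M"
proof (rule submoduleI)
  obtain N where "N \<in> F" using assms(2) by blast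
  then show "\<Inter>F \<subseteq> carrier M" using submodule_in[OF sub] by blast
qed (auto intro: submodule_intros[OF sub])

lemma mspan_submodule: "A \<subseteq> carrier M \<Longrightarrow> submodule (mspan R M A) R M"
  unfolding mspan_def using submodule_carrier by (intro submodule_Inter) auto

lemma mspan_incl: "x \<in> A \<Longrightarrow> x \<in> mspan R M A"
  unfolding mspan_def by auto

lemma mspan_least: "\<lbrakk>submodule N R M; A \<subseteq> N\<rbrakk> \<Longrightarrow> mspan R M A \<subseteq> N"
  unfolding mspan_def by auto

text \<open>The standard device for statements about a span: the elements with the desired property
  form a submodule by this lemma, the generators lie in it, and \<open>mspan_least\<close> does the
  rest. Linearity is required only on \<open>U\<close>, since maps such as partial derivations are
  defined only there.\<close>

lemma submodule_linear_set:
  assumes U: "submodule U R M" and H: "module R H" and f: "f \<in> U \<rightarrow> carrier H"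
    and add: "\<And>x y. \<lbrakk>x \<in> U; y \<in> U\<rbrakk> \<Longrightarrow> f (x \<oplus>\<^bsub>M\<^esub> y) = f x \<oplus>\<^bsub>H\<^esub> f y"
    and sm: "\<And>a x. \<lbrakk>a \<in> carrier R; x \<in> U\<rbrakk> \<Longrightarrow> f (a \<odot>\<^bsub>M\<^esub> x) = a \<odot>\<^bsub>H\<^esub> f x"
    and V: "submodule V R H"
  shows "submodule {x \<in> U. f x \<in> V} R M"
proof -
  interpret H: module R H by fact
  have z: "f \<zero>\<^bsub>M\<^esub> = \<zero>\<^bsub>H\<^esub>"
  proof -
    have "f \<zero>\<^bsub>M\<^esub> \<oplus>\<^bsub>H\<^esub> f \<zero>\<^bsub>M\<^esub> = f \<zero>\<^bsub>M\<^esub>" using add[of "\<zero>\<^bsub>M\<^esub>" "\<zero>\<^bsub>M\<^esub>"] submodule_zero[OF U] by simp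
    moreover have "f \<zero>\<^bsub>M\<^esub> \<in> carrier H" using f submodule_zero[OF U] by auto
    ultimately show ?thesis by simp
  qed
  have neg: "f (\<ominus>\<^bsub>M\<^esub> x) = \<ominus>\<^bsub>H\<^esub> f x" if x: "x \<in> U" for x
  proof -
    have mx: "\<ominus>\<^bsub>M\<^esub> x \<in> U" and xc: "x \<in> carrier M"
      using submodule_uminus[OF U x] submodule_in[OF U x] by auto
    have "f (\<ominus>\<^bsub>M\<^esub> x) \<oplus>\<^bsub>H\<^esub> f x = \<zero>\<^bsub>H\<^esub>"
      using add[of "\<ominus>\<^bsub>M\<^esub> x" x] x mx xc z by (simp add: M.l_neg)
    moreover have "f x \<in> carrier H" "f (\<ominus>\<^bsub>M\<^esub> x) \<in> carrier H" using f x mx by auto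
    ultimately show ?thesis using H.M.minus_equality by simp
  qed
  show ?thesis
  proof (rule submoduleI)
    show "{x \<in> U. f x \<in> V} \<subseteq> carrier M" using submodule_in[OF U] by auto
  qed (auto simp: z neg add sm intro: submodule_intros[OF U] H.submodule_intros[OF V])
qed

end

text \<open>The module is bundled with the unit 6, so that 2 and 3 can be cancelled wherever the
  module lives: T, the Lie algebras and their quotients all instantiate this locale.\<close>

locale module6 = module \<Phi> M for \<Phi> :: "('k, 'r) ring_scheme" and M :: "('k, 'a, 'm) module_scheme" (structure) +
  assumes six_unit: "[(6::nat)] \<cdot>\<^bsub>\<Phi>\<^esub> \<one>\<^bsub>\<Phi>\<^esub> \<in> Units \<Phi>"
begin

abbreviation half where "half \<equiv> inv\<^bsub>\<Phi>\<^esub> (\<one>\<^bsub>\<Phi>\<^esub> \<oplus>\<^bsub>\<Phi>\<^esub> \<one>\<^bsub>\<Phi>\<^esub>)"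

lemma unit_factor:
  assumes "a \<in> carrier \<Phi>" "b \<in> carrier \<Phi>" "a \<otimes>\<^bsub>\<Phi>\<^esub> b \<in> Units \<Phi>"
  shows "a \<in> Units \<Phi>"
proof -
  define c where "c = b \<otimes>\<^bsub>\<Phi>\<^esub> inv\<^bsub>\<Phi>\<^esub> (a \<otimes>\<^bsub>\<Phi>\<^esub> b)"
  have c: "c \<in> carrier \<Phi>" using assms by (simp add: c_def)
  have "a \<otimes>\<^bsub>\<Phi>\<^esub> c = \<one>\<^bsub>\<Phi>\<^esub>" using assms by (simp add: c_def R.m_assoc[symmetric])
  then show ?thesis using assms(1) c R.m_comm unfolding Units_def by force
qed

lemma six_eq: "[(6::nat)] \<cdot>\<^bsub>\<Phi>\<^esub> \<one>\<^bsub>\<Phi>\<^esub> =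
  (\<one>\<^bsub>\<Phi>\<^esub> \<oplus>\<^bsub>\<Phi>\<^esub> \<one>\<^bsub>\<Phi>\<^esub>) \<otimes>\<^bsub>\<Phi>\<^esub> (\<one>\<^bsub>\<Phi>\<^esub> \<oplus>\<^bsub>\<Phi>\<^esub> \<one>\<^bsub>\<Phi>\<^esub> \<oplus>\<^bsub>\<Phi>\<^esub> \<one>\<^bsub>\<Phi>\<^esub>)"
  by (simp add: numeral_eq_Suc R.l_distr R.r_distr R.a_ac)

lemma two_unit: "\<one>\<^bsub>\<Phi>\<^esub> \<oplus>\<^bsub>\<Phi>\<^esub> \<one>\<^bsub>\<Phi>\<^esub> \<in> Units \<Phi>"
  by (rule unit_factor[OF _ _ six_unit[unfolded six_eq]]) simp_all

lemma three_unit: "\<one>\<^bsub>\<Phi>\<^esub> \<oplus>\<^bsub>\<Phi>\<^esub> \<one>\<^bsub>\<Phi>\<^esub> \<oplus>\<^bsub>\<Phi>\<^esub> \<one>\<^bsub>\<Phi>\<^esub> \<in> Units \<Phi>"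
proof (rule unit_factor)
  show "(\<one>\<^bsub>\<Phi>\<^esub> \<oplus>\<^bsub>\<Phi>\<^esub> \<one>\<^bsub>\<Phi>\<^esub> \<oplus>\<^bsub>\<Phi>\<^esub> \<one>\<^bsub>\<Phi>\<^esub>) \<otimes>\<^bsub>\<Phi>\<^esub> (\<one>\<^bsub>\<Phi>\<^esub> \<oplus>\<^bsub>\<Phi>\<^esub> \<one>\<^bsub>\<Phi>\<^esub>) \<in> Units \<Phi>"
    using six_unit unfolding six_eq by (subst R.m_comm) simp_all
qed simp_all

lemma half_closed [simp]: "half \<in> carrier \<Phi>"
  using two_unit by simp

lemma unit_cancel: "\<lbrakk>u \<in> Units \<Phi>; x \<in> carrier M; u \<odot> x = \<zero>\<rbrakk> \<Longrightarrow> x = \<zero>"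
  by (metis R.Units_closed R.Units_inv_closed R.Units_l_inv smult_assoc1 smult_one smult_r_null)

lemma two_cancel: "\<lbrakk>x \<in> carrier M; x \<oplus> x = \<zero>\<rbrakk> \<Longrightarrow> x = \<zero>"
  using unit_cancel[OF two_unit, of x] by (simp add: smult_l_distr)

lemma three_cancel: "\<lbrakk>x \<in> carrier M; x \<oplus> x \<oplus> x = \<zero>\<rbrakk> \<Longrightarrow> x = \<zero>"
  using unit_cancel[OF three_unit, of x] by (simp add: smult_l_distr)

lemma three_cancel_eq:
  assumes "x \<in> carrier M" "y \<in> carrier M" "x \<oplus> x \<oplus> x = y \<oplus> y \<oplus> y"
  shows "x = y"
proof -
  have "(x \<ominus> y) \<oplus> (x \<ominus> y) \<oplus> (x \<ominus> y) = \<zero>" using assms by (simp add: M.ab_simps)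
  then show ?thesis using three_cancel[of "x \<ominus> y"] assms by (simp add: M.diff_eq_zero)
qed

lemma half_double: "x \<in> carrier M \<Longrightarrow> half \<odot> (x \<oplus> x) = x"
  by (metis R.Units_closed R.Units_l_inv R.one_closed half_closed smult_assoc1 smult_l_distr smult_one two_unit)

text \<open>\<open>U\<close> is only an additively closed subset because identities are polarized on
  homogeneous components as well as on whole modules.\<close>

lemma polarize2:
  assumes U: "U \<subseteq> carrier M" "\<And>x y. \<lbrakk>x \<in> U; y \<in> U\<rbrakk> \<Longrightarrow> x \<oplus> y \<in> U"
    and c: "\<And>x y. \<lbrakk>x \<in> U; y \<in> U\<rbrakk> \<Longrightarrow> F x y \<in> carrier M"
    and a1: "\<And>x x' y. \<lbrakk>x \<in> U; x' \<in> U; y \<in> U\<rbrakk> \<Longrightarrow> F (x \<oplus> x') y = F x y \<oplus> F x' y"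
    and a2: "\<And>x y y'. \<lbrakk>x \<in> U; y \<in> U; y' \<in> U\<rbrakk> \<Longrightarrow> F x (y \<oplus> y') = F x y \<oplus> F x y'"
    and z: "\<And>x. x \<in> U \<Longrightarrow> F x x = \<zero>"
    and xy: "x \<in> U" "y \<in> U"
  shows "F x y \<oplus> F y x = \<zero>"
  using z[OF U(2)[OF xy]] z[OF xy(1)] z[OF xy(2)] xy by (simp add: U c a1 a2 M.a_ac)

text \<open>No division takes place: the outcome is the sum over all six orderings, and the
  symmetries of the concrete \<open>F\<close> decide which multiple of a single value this
  is.\<close>

lemma polarize3:
  assumes U: "U \<subseteq> carrier M" "\<And>x y. \<lbrakk>x \<in> U; y \<in> U\<rbrakk> \<Longrightarrow> x \<oplus> y \<in> U"
    and c: "\<And>x y z. \<lbrakk>x \<in> U; y \<in> U; z \<in> U\<rbrakk> \<Longrightarrow> F x y z \<in> carrier M"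
    and a1: "\<And>x x' y z. \<lbrakk>x \<in> U; x' \<in> U; y \<in> U; z \<in> U\<rbrakk> \<Longrightarrow> F (x \<oplus> x') y z = F x y z \<oplus> F x' y z"
    and a2: "\<And>x y y' z. \<lbrakk>x \<in> U; y \<in> U; y' \<in> U; z \<in> U\<rbrakk> \<Longrightarrow> F x (y \<oplus> y') z = F x y z \<oplus> F x y' z"
    and a3: "\<And>x y z z'. \<lbrakk>x \<in> U; y \<in> U; z \<in> U; z' \<in> U\<rbrakk> \<Longrightarrow> F x y (z \<oplus> z') = F x y z \<oplus> F x y z'"
    and zero: "\<And>x. x \<in> U \<Longrightarrow> F x x x = \<zero>"
    and xyz: "x \<in> U" "y \<in> U" "z \<in> U"
  shows "F x y z \<oplus> F y x z \<oplus> F x z y \<oplus> F z x y \<oplus> F y z x \<oplus> F z y x = \<zero>"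
proof -
  \<comment> \<open>\<open>G x y\<close> collects the mixed terms of the expansion of
    \<open>F\<close> on the diagonal at \<open>x \<oplus> y\<close>. Its defect from additivity in
    the first argument is the six-term sum.\<close>
  define G where "G = (\<lambda>x y. F x x y \<oplus> F x y x \<oplus> F y x x \<oplus> F x y y \<oplus> F y x y \<oplus> F y y x)"
  have G: "G x y = \<zero>" if "x \<in> U" "y \<in> U" for x y
    using zero[OF U(2)[OF that]] zero[OF that(1)] zero[OF that(2)] that by (simp add: G_def U c a1 a2 a3 M.a_ac)
  have "G (x \<oplus> y) z = (F x y z \<oplus> F y x z \<oplus> F x z y \<oplus> F z x y \<oplus> F y z x \<oplus> F z y x) \<oplus> G x z \<oplus> G y z"
    using xyz by (simp add: G_def U c a1 a2 a3 M.a_ac)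
  then show ?thesis using G xyz U c by simp
qed

end


section \<open>The triple product\<close>

text \<open>The linear form of a Jordan triple system: a symmetric trilinear product satisfying the
  five-linear identity. The product is a bare function on a module, so that the locale serves both
  for \<open>trip T\<close> and for the bracket product \<open>trQ\<close> on the quotient
  algebra.\<close>

locale ljts = module6 \<Phi> T for \<Phi> :: "('k, 'r) ring_scheme" and T :: "('k, 'a, 'm) module_scheme" (structure) +
  fixes tr :: "'a \<Rightarrow> 'a \<Rightarrow> 'a \<Rightarrow> 'a"
  assumes tr_closed [simp, intro]: "\<lbrakk>x \<in> carrier T; y \<in> carrier T; z \<in> carrier T\<rbrakk> \<Longrightarrow> tr x y z \<in> carrier T"
    and tr_add1: "\<lbrakk>x \<in> carrier T; x' \<in> carrier T; y \<in> carrier T; z \<in> carrier T\<rbrakk> \<Longrightarrow>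
      tr (x \<oplus> x') y z = tr x y z \<oplus> tr x' y z"
    and tr_add2: "\<lbrakk>x \<in> carrier T; y \<in> carrier T; y' \<in> carrier T; z \<in> carrier T\<rbrakk> \<Longrightarrow>
      tr x (y \<oplus> y') z = tr x y z \<oplus> tr x y' z"
    and tr_smult1: "\<lbrakk>a \<in> carrier \<Phi>; x \<in> carrier T; y \<in> carrier T; z \<in> carrier T\<rbrakk> \<Longrightarrow>
      tr (a \<odot> x) y z = a \<odot> tr x y z"
    and tr_smult2: "\<lbrakk>a \<in> carrier \<Phi>; x \<in> carrier T; y \<in> carrier T; z \<in> carrier T\<rbrakk> \<Longrightarrow>
      tr x (a \<odot> y) z = a \<odot> tr x y z"
    and tr_sym: "\<lbrakk>x \<in> carrier T; y \<in> carrier T; z \<in> carrier T\<rbrakk> \<Longrightarrow> tr x y z = tr z y x"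
    and tr5: "\<lbrakk>x \<in> carrier T; y \<in> carrier T; u \<in> carrier T; v \<in> carrier T; w \<in> carrier T\<rbrakk> \<Longrightarrow>
      tr x y (tr u v w) = tr (tr x y u) v w \<ominus> tr u (tr y x v) w \<oplus> tr u v (tr x y w)"
begin

lemma tr_add3: "\<lbrakk>x \<in> carrier T; y \<in> carrier T; z \<in> carrier T; z' \<in> carrier T\<rbrakk> \<Longrightarrow>
    tr x y (z \<oplus> z') = tr x y z \<oplus> tr x y z'"
  using tr_add1[of z z' y x] by (simp add: tr_sym[of x])

lemma tr_smult3: "\<lbrakk>a \<in> carrier \<Phi>; x \<in> carrier T; y \<in> carrier T; z \<in> carrier T\<rbrakk> \<Longrightarrow>
    tr x y (a \<odot> z) = a \<odot> tr x y z"
  using tr_smult1[of a z y x] by (simp add: tr_sym[of x])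

lemma tr_diff1: "\<lbrakk>x \<in> carrier T; x' \<in> carrier T; y \<in> carrier T; z \<in> carrier T\<rbrakk> \<Longrightarrow>
    tr (x \<ominus> x') y z = tr x y z \<ominus> tr x' y z"
  by (rule additive_diff_gen[of T T "\<lambda>x. tr x y z"]) (auto simp: tr_add1 M.abelian_group_axioms)

lemma tr_diff2: "\<lbrakk>x \<in> carrier T; y \<in> carrier T; y' \<in> carrier T; z \<in> carrier T\<rbrakk> \<Longrightarrow>
    tr x (y \<ominus> y') z = tr x y z \<ominus> tr x y' z"
  by (rule additive_diff_gen[of T T "\<lambda>y. tr x y z"]) (auto simp: tr_add2 M.abelian_group_axioms)

lemma tr_diff3: "\<lbrakk>x \<in> carrier T; y \<in> carrier T; z \<in> carrier T; z' \<in> carrier T\<rbrakk> \<Longrightarrow>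
    tr x y (z \<ominus> z') = tr x y z \<ominus> tr x y z'"
  by (rule additive_diff_gen[of T T "\<lambda>z. tr x y z"]) (auto simp: tr_add3 M.abelian_group_axioms)

lemma tr_zero [simp]: "\<lbrakk>y \<in> carrier T; z \<in> carrier T\<rbrakk> \<Longrightarrow> tr \<zero> y z = \<zero>"
  "\<lbrakk>y \<in> carrier T; z \<in> carrier T\<rbrakk> \<Longrightarrow> tr y \<zero> z = \<zero>"
  "\<lbrakk>y \<in> carrier T; z \<in> carrier T\<rbrakk> \<Longrightarrow> tr y z \<zero> = \<zero>"
  using additive_zero_gen[of T T "\<lambda>x. tr x y z"] additive_zero_gen[of T T "\<lambda>x. tr y x z"]
    additive_zero_gen[of T T "\<lambda>x. tr y z x"]
  by (auto simp: tr_add1 tr_add2 tr_add3 M.abelian_group_axioms)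

lemmas tr_lin = tr_add1 tr_add2 tr_add3 tr_smult1 tr_smult2 tr_smult3 tr_diff1 tr_diff2 tr_diff3

text \<open>\<open>tr5\<close> solved for the term that has a product in its middle slot.\<close>

lemma tr5_mid: "\<lbrakk>x' \<in> carrier T; y' \<in> carrier T; u \<in> carrier T; v \<in> carrier T; w \<in> carrier T\<rbrakk> \<Longrightarrow>
    tr u (tr y' x' v) w = tr (tr x' y' u) v w \<oplus> tr u v (tr x' y' w) \<ominus> tr x' y' (tr u v w)"
  using tr5[of x' y' u v w] by (simp add: M.ab_simps)

text \<open>With a = {x y {x z x}}, b = {x z {x y x}} and c = {x {y x z} x}, the five-linear
  identity gives a + c = 2b. Since c is symmetric in y and z, exchanging them gives b + c = 2a,
  hence 3a = 3c.\<close>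

lemma tr_JT1:
  assumes [simp]: "x \<in> carrier T" "y \<in> carrier T" "z \<in> carrier T"
  shows "tr x y (tr x z x) = tr x (tr y x z) x"
proof (rule three_cancel_eq)
  have A: "tr x y (tr x z x) \<oplus> tr x (tr y x z) x = tr x z (tr x y x) \<oplus> tr x z (tr x y x)"
    if [simp]: "y \<in> carrier T" "z \<in> carrier T" for y z
    using tr5[of x y x z x] by (simp add: tr_sym[of "tr x y x" z x] M.ab_simps)
  define a where "a = tr x y (tr x z x)"
  define b where "b = tr x z (tr x y x)"
  define c where "c = tr x (tr y x z) x"
  have [simp]: "a \<in> carrier T" "b \<in> carrier T" "c \<in> carrier T" by (simp_all add: a_def b_def c_def)
  have 1: "a \<oplus> c = b \<oplus> b" using A[of y z] by (simp add: a_def b_def c_def)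
  have 2: "b \<oplus> c = a \<oplus> a" using A[of z y] by (simp add: a_def b_def c_def tr_sym[of z])
  have "(b \<oplus> c) \<oplus> (b \<oplus> c) = (a \<oplus> a) \<oplus> (a \<oplus> a)" using 2 by simp
  then have "(a \<oplus> c) \<oplus> (c \<oplus> c) = (a \<oplus> a) \<oplus> (a \<oplus> a)" unfolding 1 by (simp add: M.a_ac)
  then have "c \<oplus> c \<oplus> c = a \<oplus> a \<oplus> a" by (simp add: M.a_ac)
  then show "tr x y (tr x z x) \<oplus> tr x y (tr x z x) \<oplus> tr x y (tr x z x) =
    tr x (tr y x z) x \<oplus> tr x (tr y x z) x \<oplus> tr x (tr y x z) x"
    by (simp add: a_def c_def)
qed simp_all

lemma tr_JT2:
  assumes [simp]: "x \<in> carrier T" "y \<in> carrier T" "z \<in> carrier T"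
  shows "tr (tr x y x) y z = tr x (tr y x y) z"
  using tr5[of x y x y z] by (simp add: M.ab_simps)

text \<open>Both sides reduce to 2 {x {y x m} x} - {x {z x {y x y}} x} with m = {z x y}: the left
  one by the five-linear identity and JT1, the right one by solving for {y {x z x} y}.\<close>

lemma tr_JT3:
  assumes [simp]: "x \<in> carrier T" "y \<in> carrier T" "z \<in> carrier T"
  shows "tr (tr x y x) z (tr x y x) = tr x (tr y (tr x z x) y) x"
proof -
  define c where "c = tr x y x"
  define m where "m = tr z x y"
  have [simp]: "c \<in> carrier T" "m \<in> carrier T" by (simp_all add: c_def m_def)
  have cz: "tr c z x = tr x m x"
    using tr_JT1[of x z y] by (simp add: c_def m_def tr_sym[of "tr x y x" z])
  have 1: "tr c z (tr x y x) = tr x y (tr x m x) \<oplus> tr x y (tr x m x) \<ominus> tr x (tr z c y) x"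
    using tr5[of c z x y x] by (simp add: cz tr_sym[of "tr x m x" y x] M.ab_simps)
  have 2: "tr z c y = tr z x (tr y x y)"
    using tr5_mid[of y x z x y] by (simp add: c_def tr_sym[of "tr z x y" x y] tr_sym[of y x z] M.ab_simps)
  have 3: "tr y (tr x z x) y = tr y x m \<oplus> tr y x m \<ominus> tr z x (tr y x y)"
    using tr5_mid[of z x y x y] by (simp add: m_def tr_sym[of "tr z x y" x y])
  have "tr c z c = tr x (tr y (tr x z x) y) x"
    using 1 by (simp add: 2 3 tr_JT1 tr_lin flip: c_def)
  then show ?thesis by (simp add: c_def)
qed

end

text \<open>The factor 1/2 in \<open>quad\<close> makes the linearization of the quadratic map equal
  to \<open>tr\<close> itself, so that the JT identities transfer. \<open>S\<close> is a second
  record over the same operations because \<open>T\<close> carries no quadratic map.\<close>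

lemma (in ljts) jordan_triple_systemI:
  fixes S :: "('k, 'a, 'n) jts_scheme"
  assumes S: "carrier S = carrier T" "add S = add T" "zero S = zero T" "smult S = smult T"
    and q: "\<And>x y. \<lbrakk>x \<in> carrier T; y \<in> carrier T\<rbrakk> \<Longrightarrow> quad S x y = half \<odot>\<^bsub>T\<^esub> tr x y x"
    and mod: "module \<Phi> S"
  shows "jordan_triple_system \<Phi> S"
    and "\<And>x y z. \<lbrakk>x \<in> carrier S; y \<in> carrier S; z \<in> carrier S\<rbrakk> \<Longrightarrow> trip S x y z = tr x y z"
proof -
  interpret S: module \<Phi> S by fact
  have [simp]: "a_minus S = a_minus T" using S by (simp add: a_minus_def a_inv_def fun_eq_iff m_inv_def)
  have t: "trip S x y z = tr x y z" if [simp]: "x \<in> carrier T" "y \<in> carrier T" "z \<in> carrier T" for x y z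
  proof -
    have "half \<odot>\<^bsub>T\<^esub> tr (x \<oplus>\<^bsub>T\<^esub> z) y (x \<oplus>\<^bsub>T\<^esub> z) =
        half \<odot>\<^bsub>T\<^esub> tr x y x \<oplus>\<^bsub>T\<^esub> half \<odot>\<^bsub>T\<^esub> tr z y z \<oplus>\<^bsub>T\<^esub> half \<odot>\<^bsub>T\<^esub> (tr x y z \<oplus>\<^bsub>T\<^esub> tr x y z)"
      by (simp add: tr_lin smult_r_distr tr_sym[of z y x] M.a_ac)
    then show ?thesis by (simp add: trip_def S q half_double M.ab_simps)
  qed
  then show "\<And>x y z. \<lbrakk>x \<in> carrier S; y \<in> carrier S; z \<in> carrier S\<rbrakk> \<Longrightarrow> trip S x y z = tr x y z"
    by (simp add: S)
  have comm: "half \<odot>\<^bsub>T\<^esub> (a \<odot>\<^bsub>T\<^esub> x) = a \<odot>\<^bsub>T\<^esub> (half \<odot>\<^bsub>T\<^esub> x)" if "a \<in> carrier \<Phi>" "x \<in> carrier T" for a x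
    using that by (simp add: R.m_comm flip: smult_assoc1)
  show "jordan_triple_system \<Phi> S"
  proof unfold_locales
    fix a x y assume [simp]: "a \<in> carrier \<Phi>" "x \<in> carrier S" "y \<in> carrier S"
    then have [simp]: "x \<in> carrier T" "y \<in> carrier T" by (simp_all add: S)
    show "quad S x (a \<odot>\<^bsub>S\<^esub> y) = a \<odot>\<^bsub>S\<^esub> quad S x y"
      "quad S (a \<odot>\<^bsub>S\<^esub> x) y = (a \<otimes>\<^bsub>\<Phi>\<^esub> a) \<odot>\<^bsub>S\<^esub> quad S x y"
      by (simp_all add: S q tr_lin comm[of a] smult_assoc1)
  qed (simp_all add: S q t tr_lin smult_r_distr tr_JT1 tr_JT2 tr_JT3)
qed

locale jts6 = module6 \<Phi> T + jordan_triple_system \<Phi> T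
  for \<Phi> :: "('k, 'r) ring_scheme" and T :: "('k, 'a, 'm) jts_scheme" (structure)
begin

lemma trip_closed [simp, intro]: "\<lbrakk>x \<in> carrier T; y \<in> carrier T; z \<in> carrier T\<rbrakk> \<Longrightarrow> trip T x y z \<in> carrier T"
  unfolding trip_def by (simp add: quad_closed)

lemma trip_sym: "\<lbrakk>x \<in> carrier T; y \<in> carrier T; z \<in> carrier T\<rbrakk> \<Longrightarrow> trip T x y z = trip T z y x"
  unfolding trip_def by (simp add: quad_closed M.ab_simps)

lemma trip_add2: "\<lbrakk>x \<in> carrier T; y \<in> carrier T; y' \<in> carrier T; z \<in> carrier T\<rbrakk> \<Longrightarrow>
    trip T x (y \<oplus> y') z = trip T x y z \<oplus> trip T x y' z"
  unfolding trip_def by (simp add: quad_closed quad_add M.ab_simps)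

lemma trip_smult2: "\<lbrakk>a \<in> carrier \<Phi>; x \<in> carrier T; y \<in> carrier T; z \<in> carrier T\<rbrakk> \<Longrightarrow>
    trip T x (a \<odot> y) z = a \<odot> trip T x y z"
  unfolding trip_def by (simp add: quad_closed quad_smult smult_diff)

lemma trip_add3: "\<lbrakk>x \<in> carrier T; y \<in> carrier T; z \<in> carrier T; z' \<in> carrier T\<rbrakk> \<Longrightarrow>
    trip T x y (z \<oplus> z') = trip T x y z \<oplus> trip T x y z'"
  using trip_add[of z z' y x] by (simp add: trip_sym[of x])

lemma quad_double:
  assumes [simp]: "x \<in> carrier T" "y \<in> carrier T"
  shows "quad T x y \<oplus> quad T x y = trip T x y x"
proof -
  have "quad T ((\<one>\<^bsub>\<Phi>\<^esub> \<oplus>\<^bsub>\<Phi>\<^esub> \<one>\<^bsub>\<Phi>\<^esub>) \<odot> x) y = quad T x y \<oplus> quad T x y \<oplus> quad T x y \<oplus> quad T x y"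
    by (subst quad_homogeneous) (simp_all add: quad_closed smult_l_distr R.l_distr M.a_ac)
  then show ?thesis by (simp add: trip_def quad_closed smult_l_distr M.ab_simps)
qed

lemma quad_eq: "\<lbrakk>x \<in> carrier T; y \<in> carrier T\<rbrakk> \<Longrightarrow> quad T x y = half \<odot> trip T x y x"
  by (simp add: half_double quad_closed flip: quad_double)

lemma trip_JT1: "\<lbrakk>x \<in> carrier T; y \<in> carrier T; z \<in> carrier T\<rbrakk> \<Longrightarrow>
    trip T x y (trip T x z x) = trip T x (trip T y x z) x"
  by (simp add: quad_closed trip_add3 JT1 flip: quad_double)

lemma trip_JT2: "\<lbrakk>x \<in> carrier T; y \<in> carrier T; z \<in> carrier T\<rbrakk> \<Longrightarrow>
    trip T (trip T x y x) y z = trip T x (trip T y x y) z"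
  by (simp add: quad_closed trip_add trip_add2 JT2 flip: quad_double)

text \<open>Polarizing JT1 in its cubic variable gives six terms. Symmetry of the triple product
  makes them equal in pairs, and the common factor 2 is cancelled.\<close>

lemma JT1_linear:
  assumes [simp]: "a \<in> carrier T" "b \<in> carrier T" "c \<in> carrier T" "y \<in> carrier T" "v \<in> carrier T"
  shows "trip T a y (trip T b v c) \<oplus> trip T b y (trip T a v c) \<oplus> trip T c y (trip T a v b) =
    trip T b (trip T y a v) c \<oplus> trip T a (trip T y b v) c \<oplus> trip T a (trip T y c v) b"
proof -
  define F where "F = (\<lambda>a b c. trip T a y (trip T b v c) \<ominus> trip T b (trip T y a v) c)"
  have "F a b c \<oplus> F b a c \<oplus> F a c b \<oplus> F c a b \<oplus> F b c a \<oplus> F c b a = \<zero>"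
    by (rule polarize3[where U = "carrier T"])
      (simp_all add: F_def trip_add trip_add2 trip_add3 M.ab_simps trip_JT1)
  moreover have "F a c b = F a b c" "F c b a = F c a b" "F b c a = F b a c"
    by (simp_all add: F_def trip_sym[of c v b] trip_sym[of c _ b] trip_sym[of c _ a] trip_sym[of b _ a])
  ultimately have "(F a b c \<oplus> F b a c \<oplus> F c a b) \<oplus> (F a b c \<oplus> F b a c \<oplus> F c a b) = \<zero>"
    by (simp add: F_def M.a_ac)
  then have "F a b c \<oplus> F b a c \<oplus> F c a b = \<zero>"
    by (rule two_cancel[rotated]) (simp add: F_def)
  then show ?thesis by (simp add: F_def M.ab_simps)
qed

text \<open>JT2 is quadratic in each of two variables, so it is polarized twice. Symmetry of the
  triple product turns the result into twice the claimed identity.\<close>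

lemma JT2_linear:
  assumes [simp]: "a \<in> carrier T" "b \<in> carrier T" "c \<in> carrier T" "y \<in> carrier T" "v \<in> carrier T"
  shows "trip T a v (trip T b y c) \<oplus> trip T a y (trip T b v c) =
    trip T a (trip T y b v) c \<oplus> trip T a (trip T y c v) b"
proof -
  define F where "F = (\<lambda>b c y v. trip T (trip T b y c) v a \<ominus> trip T b (trip T y c v) a)"
  have [simp]: "F b c y v \<in> carrier T" if "b \<in> carrier T" "c \<in> carrier T" "y \<in> carrier T" "v \<in> carrier T" for b c y v
    using that by (simp add: F_def)
  have "F b b y v \<oplus> F b b v y = \<zero>" if [simp]: "b \<in> carrier T" for b
    by (rule polarize2[where U = "carrier T"])
      (simp_all add: F_def trip_add trip_add2 trip_add3 M.ab_simps trip_JT2)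
  then have "(F b c y v \<oplus> F b c v y) \<oplus> (F c b y v \<oplus> F c b v y) = \<zero>"
    by (intro polarize2[where U = "carrier T" and F = "\<lambda>b c. F b c y v \<oplus> F b c v y"])
      (simp_all, simp_all add: F_def trip_add trip_add2 trip_add3 M.ab_simps)
  moreover have "trip T (trip T c y b) v a = trip T (trip T b y c) v a"
    "trip T (trip T c v b) y a = trip T (trip T b v c) y a"
    "trip T b (trip T v c y) a = trip T b (trip T y c v) a"
    "trip T c (trip T v b y) a = trip T c (trip T y b v) a"
    by (simp_all add: trip_sym[of c _ b] trip_sym[of v _ y])
  ultimately have "((trip T (trip T b y c) v a \<oplus> trip T (trip T b v c) y a) \<ominus>
      (trip T b (trip T y c v) a \<oplus> trip T c (trip T y b v) a)) \<oplus>
     ((trip T (trip T b y c) v a \<oplus> trip T (trip T b v c) y a) \<ominus>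
      (trip T b (trip T y c v) a \<oplus> trip T c (trip T y b v) a)) = \<zero>"
    by (simp add: F_def M.ab_simps)
  then have "(trip T (trip T b y c) v a \<oplus> trip T (trip T b v c) y a) \<ominus>
      (trip T b (trip T y c v) a \<oplus> trip T c (trip T y b v) a) = \<zero>"
    by (rule two_cancel[rotated]) simp
  then show ?thesis
    by (simp add: M.diff_eq_zero trip_sym[of a _ "trip T b y c"] trip_sym[of a _ "trip T b v c"]
        trip_sym[of a _ b] trip_sym[of a _ c] M.a_ac)
qed

text \<open>\<open>JT1_linear\<close> and \<open>JT2_linear\<close> share the terms
  \<open>M1'\<close>, \<open>N2\<close> and \<open>N3\<close>; eliminating them leaves this
  identity. It is the bridge from the quadratic axioms to Lie brackets.\<close>

lemma five_linear:
  assumes [simp]: "x \<in> carrier T" "y \<in> carrier T" "u \<in> carrier T" "v \<in> carrier T" "w \<in> carrier T"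
  shows "trip T x y (trip T u v w) =
    trip T (trip T x y u) v w \<ominus> trip T u (trip T y x v) w \<oplus> trip T u v (trip T x y w)"
proof -
  have "trip T x y (trip T u v w) \<oplus> trip T u (trip T y x v) w =
      trip T w v (trip T u y x) \<oplus> trip T u v (trip T x y w)"
  proof -
    define M1 where "M1 = trip T x y (trip T u v w)"
    define M1' where "M1' = trip T x v (trip T u y w)"
    define M2 where "M2 = trip T u v (trip T x y w)"
    define M3 where "M3 = trip T w v (trip T u y x)"
    define N1 where "N1 = trip T u (trip T y x v) w"
    define N2 where "N2 = trip T x (trip T y u v) w"
    define N3 where "N3 = trip T x (trip T y w v) u"
    have [simp]: "M1 \<in> carrier T" "M1' \<in> carrier T" "M2 \<in> carrier T" "M3 \<in> carrier T"
      "N1 \<in> carrier T" "N2 \<in> carrier T" "N3 \<in> carrier T"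
      by (simp_all add: M1_def M1'_def M2_def M3_def N1_def N2_def N3_def)
    have 1: "M1' \<oplus> M2 \<oplus> M3 = N1 \<oplus> N2 \<oplus> N3"
      using JT1_linear[of x u w v y]
      by (simp add: M1'_def M2_def M3_def N1_def N2_def N3_def trip_sym[of v _ y] trip_sym[of x y u])
    have 2: "M1' \<oplus> M1 = N2 \<oplus> N3"
      using JT2_linear[of x u w y v] by (simp add: M1_def M1'_def N2_def N3_def)
    have "M1' \<oplus> (M1 \<oplus> N1) = M1' \<oplus> (M3 \<oplus> M2)"
    proof -
      have "M1' \<oplus> (M1 \<oplus> N1) = (M1' \<oplus> M1) \<oplus> N1" by (simp add: M.a_ac)
      also have "\<dots> = M1' \<oplus> M2 \<oplus> M3" unfolding 1 2 by (simp add: M.a_ac)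
      finally show ?thesis by (simp add: M.a_ac)
    qed
    then show ?thesis by (simp add: M1_def M2_def M3_def N1_def)
  qed
  then show ?thesis by (simp add: trip_sym[of "trip T x y u" v w] trip_sym[of u y x] M.ab_simps)
qed

sublocale J: ljts \<Phi> T "trip T"
  by unfold_locales
    ((rule trip_closed trip_add trip_add2 trip_smult trip_smult2 trip_sym five_linear; assumption)+)

end


section \<open>Lie algebras and their maximal algebras of quotients\<close>

locale lie = module6 \<Phi> L for \<Phi> :: "('k, 'r) ring_scheme" and L :: "('k, 'a, 'm) module_scheme" (structure) +
  assumes br_closed [simp, intro]: "\<lbrakk>x \<in> carrier L; y \<in> carrier L\<rbrakk> \<Longrightarrow> x \<otimes> y \<in> carrier L"
    and br_add1: "\<lbrakk>x \<in> carrier L; x' \<in> carrier L; y \<in> carrier L\<rbrakk> \<Longrightarrow> (x \<oplus> x') \<otimes> y = (x \<otimes> y) \<oplus> (x' \<otimes> y)"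
    and br_add2: "\<lbrakk>x \<in> carrier L; y \<in> carrier L; y' \<in> carrier L\<rbrakk> \<Longrightarrow> x \<otimes> (y \<oplus> y') = (x \<otimes> y) \<oplus> (x \<otimes> y')"
    and br_smult1: "\<lbrakk>a \<in> carrier \<Phi>; x \<in> carrier L; y \<in> carrier L\<rbrakk> \<Longrightarrow> (a \<odot> x) \<otimes> y = a \<odot> (x \<otimes> y)"
    and br_self [simp]: "x \<in> carrier L \<Longrightarrow> x \<otimes> x = \<zero>"
    and br_jacobi: "\<lbrakk>x \<in> carrier L; y \<in> carrier L; z \<in> carrier L\<rbrakk> \<Longrightarrow>
      x \<otimes> (y \<otimes> z) = (x \<otimes> y) \<otimes> z \<oplus> y \<otimes> (x \<otimes> z)"
begin

lemma br_anti: "\<lbrakk>x \<in> carrier L; y \<in> carrier L\<rbrakk> \<Longrightarrow> x \<otimes> y = \<ominus> (y \<otimes> x)"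
  using br_self[of "x \<oplus> y"] br_self[of x] br_self[of y]
  by (simp add: br_add1 br_add2 M.ab_simps del: br_self)

lemma br_diff1: "\<lbrakk>x \<in> carrier L; x' \<in> carrier L; y \<in> carrier L\<rbrakk> \<Longrightarrow> (x \<ominus> x') \<otimes> y = (x \<otimes> y) \<ominus> (x' \<otimes> y)"
  by (rule additive_diff_gen[of L L "\<lambda>x. x \<otimes> y"]) (auto simp: br_add1 M.abelian_group_axioms)

lemma br_diff2: "\<lbrakk>x \<in> carrier L; y \<in> carrier L; y' \<in> carrier L\<rbrakk> \<Longrightarrow> x \<otimes> (y \<ominus> y') = (x \<otimes> y) \<ominus> (x \<otimes> y')"
  by (rule additive_diff_gen[of L L "\<lambda>y. x \<otimes> y"]) (auto simp: br_add2 M.abelian_group_axioms)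

lemma br_uminus1: "\<lbrakk>x \<in> carrier L; y \<in> carrier L\<rbrakk> \<Longrightarrow> (\<ominus> x) \<otimes> y = \<ominus> (x \<otimes> y)"
  by (rule additive_uminus_gen[of L L "\<lambda>x. x \<otimes> y"]) (auto simp: br_add1 M.abelian_group_axioms)

lemma br_uminus2: "\<lbrakk>x \<in> carrier L; y \<in> carrier L\<rbrakk> \<Longrightarrow> x \<otimes> (\<ominus> y) = \<ominus> (x \<otimes> y)"
  by (rule additive_uminus_gen[of L L "\<lambda>y. x \<otimes> y"]) (auto simp: br_add2 M.abelian_group_axioms)

lemma br_zero [simp]: "x \<in> carrier L \<Longrightarrow> \<zero> \<otimes> x = \<zero>" "x \<in> carrier L \<Longrightarrow> x \<otimes> \<zero> = \<zero>"
  using additive_zero_gen[of L L "\<lambda>y. y \<otimes> x"] additive_zero_gen[of L L "\<lambda>y. x \<otimes> y"]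
  by (auto simp: br_add1 br_add2 M.abelian_group_axioms)

lemma br_smult2: "\<lbrakk>a \<in> carrier \<Phi>; x \<in> carrier L; y \<in> carrier L\<rbrakk> \<Longrightarrow> x \<otimes> (a \<odot> y) = a \<odot> (x \<otimes> y)"
  using br_smult1[of a y x] by (simp add: br_anti[of x] smult_r_minus)

lemmas br_lin = br_add1 br_add2 br_smult1 br_smult2 br_diff1 br_diff2 br_uminus1 br_uminus2

lemma br_jacobi1: "\<lbrakk>x \<in> carrier L; y \<in> carrier L; z \<in> carrier L\<rbrakk> \<Longrightarrow>
    (x \<otimes> y) \<otimes> z = x \<otimes> (y \<otimes> z) \<ominus> y \<otimes> (x \<otimes> z)"
  using br_jacobi[of x y z] by (simp add: M.ab_simps)

lemma idealD:
  assumes "lie_ideal \<Phi> L I"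
  shows "submodule I \<Phi> L" and "\<And>x y. \<lbrakk>x \<in> carrier L; y \<in> I\<rbrakk> \<Longrightarrow> x \<otimes> y \<in> I"
    and "\<And>x y. \<lbrakk>x \<in> carrier L; y \<in> I\<rbrakk> \<Longrightarrow> y \<otimes> x \<in> I" and "\<And>x. x \<in> I \<Longrightarrow> x \<in> carrier L"
proof -
  show s: "submodule I \<Phi> L" and 2: "\<And>x y. \<lbrakk>x \<in> carrier L; y \<in> I\<rbrakk> \<Longrightarrow> x \<otimes> y \<in> I"
    using assms unfolding lie_ideal_def by auto
  show c: "\<And>x. x \<in> I \<Longrightarrow> x \<in> carrier L" by (rule submodule_in[OF s])
  show "y \<otimes> x \<in> I" if "x \<in> carrier L" "y \<in> I" for x y
    using submodule_uminus[OF s 2[OF that]] that c br_anti[of y x] by simp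
qed

lemma ideal_sub: "lie_ideal \<Phi> L I \<Longrightarrow> I \<subseteq> carrier L"
  using idealD(4) by blast

lemma ideal_inter: "\<lbrakk>lie_ideal \<Phi> L I; lie_ideal \<Phi> L J\<rbrakk> \<Longrightarrow> lie_ideal \<Phi> L (I \<inter> J)"
  unfolding lie_ideal_def using submodule_inter by simp

lemma ideal_carrier: "lie_ideal \<Phi> L (carrier L)"
  unfolding lie_ideal_def using submodule_carrier by simp

lemma ideal_mspanI:
  assumes A: "A \<subseteq> carrier L" and "\<And>x y. \<lbrakk>x \<in> carrier L; y \<in> A\<rbrakk> \<Longrightarrow> x \<otimes> y \<in> mspan \<Phi> L A"
  shows "lie_ideal \<Phi> L (mspan \<Phi> L A)"
  unfolding lie_ideal_def
proof (intro conjI ballI)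
  show s: "submodule (mspan \<Phi> L A) \<Phi> L" by (rule mspan_submodule[OF A])
  fix x y assume x: "x \<in> carrier L" and y: "y \<in> mspan \<Phi> L A"
  have "submodule {z \<in> carrier L. x \<otimes> z \<in> mspan \<Phi> L A} \<Phi> L"
    by (rule submodule_linear_set[OF submodule_carrier module_axioms _ _ _ s]) (auto simp: x br_lin)
  moreover have "A \<subseteq> {z \<in> carrier L. x \<otimes> z \<in> mspan \<Phi> L A}" using assms x by auto
  ultimately show "x \<otimes> y \<in> mspan \<Phi> L A" using mspan_least y by blast
qed

lemma derived_br: "\<lbrakk>x \<in> I; y \<in> I\<rbrakk> \<Longrightarrow> x \<otimes> y \<in> lie_derived \<Phi> L I"
  unfolding lie_derived_def by (rule mspan_incl) auto

lemma derived_gens: "I \<subseteq> carrier L \<Longrightarrow> {x \<otimes> y |x y. x \<in> I \<and> y \<in> I} \<subseteq> carrier L"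
  by auto

lemma derived_mono: "\<lbrakk>A \<subseteq> B; B \<subseteq> carrier L\<rbrakk> \<Longrightarrow> lie_derived \<Phi> L A \<subseteq> lie_derived \<Phi> L B"
  unfolding lie_derived_def
  by (intro mspan_least mspan_submodule) (auto intro!: mspan_incl)

lemma derived_ideal:
  assumes I: "lie_ideal \<Phi> L I"
  shows "lie_ideal \<Phi> L (lie_derived \<Phi> L I)"
proof -
  have IL: "I \<subseteq> carrier L" using ideal_sub[OF I] .
  have s: "submodule (lie_derived \<Phi> L I) \<Phi> L"
    unfolding lie_derived_def by (rule mspan_submodule[OF derived_gens[OF IL]])
  show ?thesis
    unfolding lie_derived_def
  proof (rule ideal_mspanI[OF derived_gens[OF IL]], fold lie_derived_def, safe)
    fix x a b assume x: "x \<in> carrier L" and ab: "a \<in> I" "b \<in> I"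
    have "x \<otimes> (a \<otimes> b) = (x \<otimes> a) \<otimes> b \<oplus> a \<otimes> (x \<otimes> b)"
      using br_jacobi x ab IL by blast
    then show "x \<otimes> (a \<otimes> b) \<in> lie_derived \<Phi> L I"
      using ab x by (simp add: submodule_add[OF s] derived_br idealD(2)[OF I])
  qed
qed

lemma derived_sub: "lie_ideal \<Phi> L I \<Longrightarrow> lie_derived \<Phi> L I \<subseteq> I"
  unfolding lie_derived_def using idealD by (intro mspan_least) auto

lemma essD: "essential_ideal \<Phi> L E \<Longrightarrow> lie_ideal \<Phi> L E"
  unfolding essential_ideal_def by simp

lemma ess_carrier: "essential_ideal \<Phi> L (carrier L)"
  unfolding essential_ideal_def using ideal_carrier idealD(4) by blast

lemma ess_inter:
  assumes "essential_ideal \<Phi> L E" "essential_ideal \<Phi> L F"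
  shows "essential_ideal \<Phi> L (E \<inter> F)"
  unfolding essential_ideal_def
proof (intro conjI allI impI)
  show "lie_ideal \<Phi> L (E \<inter> F)" using assms essD ideal_inter by blast
  fix J assume "lie_ideal \<Phi> L J \<and> J \<noteq> {\<zero>}"
  then have "lie_ideal \<Phi> L (F \<inter> J)" "F \<inter> J \<noteq> {\<zero>}"
    using assms(2) unfolding essential_ideal_def using ideal_inter by auto
  then show "E \<inter> F \<inter> J \<noteq> {\<zero>}" using assms(1) unfolding essential_ideal_def by (metis Int_assoc)
qed

lemma ideal_nonzeroE:
  assumes "lie_ideal \<Phi> L J" "J \<noteq> {\<zero>}"
  obtains x where "x \<in> J" "x \<noteq> \<zero>"
  using assms submodule_zero[OF idealD(1)] by blast

end

section \<open>Partial derivations on essential ideals and their classes\<close>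

locale lie_sp = lie \<Phi> L for \<Phi> :: "('k, 'r) ring_scheme" and L :: "('k, 'a, 'm) module_scheme" (structure) +
  assumes semiprime: "\<lbrakk>lie_ideal \<Phi> L I; \<And>x y. \<lbrakk>x \<in> I; y \<in> I\<rbrakk> \<Longrightarrow> x \<otimes> y = \<zero>\<rbrakk> \<Longrightarrow> I = {\<zero>}"
begin

text \<open>For a nonzero ideal J, semiprimeness gives a nonzero bracket of two elements of E
  \<inter> J, and it lies both in J and in [E,E]. Every composition of partial derivations costs one
  passage to a derived ideal, so all of them rely on this.\<close>

lemma ess_derived:
  assumes E: "essential_ideal \<Phi> L E"
  shows "essential_ideal \<Phi> L (lie_derived \<Phi> L E)"
  unfolding essential_ideal_def
proof (intro conjI allI impI)
  show "lie_ideal \<Phi> L (lie_derived \<Phi> L E)" using derived_ideal essD[OF E] .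
  fix J assume J: "lie_ideal \<Phi> L J \<and> J \<noteq> {\<zero>}"
  define D where "D = E \<inter> J"
  have D: "lie_ideal \<Phi> L D" "D \<noteq> {\<zero>}"
    using E J ideal_inter essD[OF E] unfolding essential_ideal_def D_def by auto
  then obtain x y where xy: "x \<in> D" "y \<in> D" "x \<otimes> y \<noteq> \<zero>" using semiprime by blast
  then have "x \<otimes> y \<in> lie_derived \<Phi> L E" "x \<otimes> y \<in> J"
    using derived_br idealD[of J] J unfolding D_def by auto
  then show "lie_derived \<Phi> L E \<inter> J \<noteq> {\<zero>}" using xy by blast
qed

lemma ideal_centralizer:
  assumes E: "lie_ideal \<Phi> L E"
  shows "lie_ideal \<Phi> L {x \<in> carrier L. \<forall>y\<in>E. x \<otimes> y = \<zero>}"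
  unfolding lie_ideal_def
proof (intro conjI ballI)
  have E': "\<And>y. y \<in> E \<Longrightarrow> y \<in> carrier L" using idealD(4)[OF E] .
  show "submodule {x \<in> carrier L. \<forall>y\<in>E. x \<otimes> y = \<zero>} \<Phi> L"
    by (rule submoduleI) (auto simp: E' br_lin)
  fix z x assume z: "z \<in> carrier L" and "x \<in> {x \<in> carrier L. \<forall>y\<in>E. x \<otimes> y = \<zero>}"
  then show "z \<otimes> x \<in> {x \<in> carrier L. \<forall>y\<in>E. x \<otimes> y = \<zero>}"
    using idealD(2)[OF E z] by (auto simp: E' br_jacobi1 M.diff_zero)
qed

text \<open>The centralizer C of E is an ideal, and E \<inter> C is abelian, hence zero;
  essentiality of E then forces C = 0.\<close>

lemma ess_ann:
  assumes E: "essential_ideal \<Phi> L E" and x: "x \<in> carrier L" "\<And>y. y \<in> E \<Longrightarrow> x \<otimes> y = \<zero>"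
  shows "x = \<zero>"
proof -
  define C where "C = {x \<in> carrier L. \<forall>y\<in>E. x \<otimes> y = \<zero>}"
  have C: "lie_ideal \<Phi> L C" unfolding C_def by (rule ideal_centralizer[OF essD[OF E]])
  have "E \<inter> C = {\<zero>}"
    by (rule semiprime[OF ideal_inter[OF essD[OF E] C]]) (auto simp: C_def)
  then have "C = {\<zero>}" using E C unfolding essential_ideal_def by blast
  then show ?thesis using x unfolding C_def by blast
qed

lemma ess_cancel:
  assumes E: "essential_ideal \<Phi> L E" and x: "x \<in> carrier L" "x' \<in> carrier L" "\<And>y. y \<in> E \<Longrightarrow> x \<otimes> y = x' \<otimes> y"
  shows "x = x'"
  using ess_ann[OF E, of "x \<ominus> x'"] x idealD(4)[OF essD[OF E]] by (auto simp: br_lin M.diff_eq_zero)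

text \<open>Unlike a member of \<open>Der\<close>, the map \<open>d\<close> may take any values
  outside E, so plain lambda terms and restrictions to smaller ideals qualify. \<open>cls\<close>
  truncates to E before passing to \<open>der_class\<close>.\<close>

definition pder :: "'a set \<Rightarrow> ('a \<Rightarrow> 'a) \<Rightarrow> bool" where
  "pder E d \<longleftrightarrow> essential_ideal \<Phi> L E \<and> d \<in> E \<rightarrow> carrier L \<and>
     (\<forall>x\<in>E. \<forall>y\<in>E. d (x \<oplus> y) = d x \<oplus> d y) \<and> (\<forall>a\<in>carrier \<Phi>. \<forall>x\<in>E. d (a \<odot> x) = a \<odot> d x) \<and>
     (\<forall>x\<in>E. \<forall>y\<in>E. d (x \<otimes> y) = (d x \<otimes> y) \<oplus> (x \<otimes> d y))"

lemma pderD: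
  assumes "pder E d"
  shows "essential_ideal \<Phi> L E" "lie_ideal \<Phi> L E" "\<And>x. x \<in> E \<Longrightarrow> d x \<in> carrier L"
    "\<And>x. x \<in> E \<Longrightarrow> x \<in> carrier L"
    "\<And>x y. \<lbrakk>x \<in> E; y \<in> E\<rbrakk> \<Longrightarrow> d (x \<oplus> y) = d x \<oplus> d y"
    "\<And>a x. \<lbrakk>a \<in> carrier \<Phi>; x \<in> E\<rbrakk> \<Longrightarrow> d (a \<odot> x) = a \<odot> d x"
    "\<And>x y. \<lbrakk>x \<in> E; y \<in> E\<rbrakk> \<Longrightarrow> d (x \<otimes> y) = (d x \<otimes> y) \<oplus> (x \<otimes> d y)"
  using assms essD idealD(4) unfolding pder_def by (auto simp: Pi_iff)

lemma pder_zero: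
  assumes d: "pder E d"
  shows "d \<zero> = \<zero>"
proof -
  have z: "\<zero> \<in> E" using submodule_zero idealD(1) pderD(2)[OF d] by blast
  then have "d \<zero> \<oplus> d \<zero> = d \<zero>" using pderD(5)[OF d z z] by simp
  then show ?thesis using pderD(3)[OF d z] by simp
qed

lemma pder_diff:
  assumes d: "pder E d" and x: "x \<in> E" "y \<in> E"
  shows "d (x \<ominus> y) = d x \<ominus> d y"
proof -
  have s: "submodule E \<Phi> L" using idealD(1) pderD(2)[OF d] by blast
  have "d ((x \<ominus> y) \<oplus> y) = d (x \<ominus> y) \<oplus> d y" by (intro pderD(5)[OF d] submodule_diff[OF s] x)
  moreover have "(x \<ominus> y) \<oplus> y = x" using x pderD(4)[OF d] by (simp add: M.ab_simps)
  ultimately show ?thesis using pderD(3)[OF d] x submodule_diff[OF s] by (simp add: M.ab_simps)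
qed

lemma pder_mono: "\<lbrakk>pder E d; essential_ideal \<Phi> L F; F \<subseteq> E\<rbrakk> \<Longrightarrow> pder F d"
  unfolding pder_def by (auto simp: subset_iff Pi_iff)

lemma pder_cong:
  assumes d: "pder E d" and e: "\<And>x. x \<in> E \<Longrightarrow> e x = d x"
  shows "pder E e"
proof -
  have s: "submodule E \<Phi> L" using idealD(1) pderD(2)[OF d] by blast
  have "x \<otimes> y \<in> E" if "x \<in> E" "y \<in> E" for x y
    using that idealD(2)[OF pderD(2)[OF d]] pderD(4)[OF d] by blast
  then show ?thesis
    using d unfolding pder_def by (auto simp: e submodule_intros[OF s] Pi_iff)
qed

lemma pder_restrict: "pder E d \<Longrightarrow> pder E (restrict d E)"
  by (rule pder_cong) auto

lemma partial_ders_iff: "(E, d) \<in> partial_ders \<Phi> L \<longleftrightarrow> pder E d \<and> d \<in> extensional E"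
proof -
  have "a \<odot> x \<in> E" "x \<oplus> y \<in> E" if "essential_ideal \<Phi> L E" "a \<in> carrier \<Phi>" "x \<in> E" "y \<in> E" for a x y
    using that essD idealD(1) submodule_intros by blast+
  then show ?thesis
    unfolding partial_ders_def Der_def mod_hom_def pder_def PiE_def by auto
qed

definition cls :: "'a set \<Rightarrow> ('a \<Rightarrow> 'a) \<Rightarrow> ('a set \<times> ('a \<Rightarrow> 'a)) set" where
  "cls E d = der_class \<Phi> L E (restrict d E)"

text \<open>For k in K the two derivations agree at k and at [x,k], so the difference of their
  values at x commutes with K and vanishes because K is essential. Hence the existential in
  \<open>der_rel\<close> amounts to agreement on the whole common domain.\<close>

lemma agree_extend:
  assumes d: "pder E d" and e: "pder F e" and K: "essential_ideal \<Phi> L K" "K \<subseteq> E \<inter> F"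
    and eq: "\<And>x. x \<in> K \<Longrightarrow> d x = e x" and x: "x \<in> E" "x \<in> F"
  shows "d x = e x"
proof (rule ess_cancel[OF K(1)])
  show c: "d x \<in> carrier L" "e x \<in> carrier L" using pderD d e x by auto
  fix k assume k: "k \<in> K"
  have kc: "k \<in> carrier L" "x \<in> carrier L" using K k x pderD(4)[OF d] by auto
  have ek: "e k \<in> carrier L" using k K pderD(3)[OF e] by auto
  have "x \<otimes> k \<in> K" using idealD(2)[OF essD[OF K(1)]] kc k by blast
  then have "d (x \<otimes> k) = e (x \<otimes> k)" using eq by blast
  moreover have "k \<in> E" "k \<in> F" "d k = e k" using K(2) k eq by auto
  ultimately have "(d x \<otimes> k) \<oplus> (x \<otimes> e k) = (e x \<otimes> k) \<oplus> (x \<otimes> e k)"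
    using pderD(7)[OF d x(1), of k] pderD(7)[OF e x(2), of k] by simp
  then show "d x \<otimes> k = e x \<otimes> k" using kc c ek by simp
qed

lemma der_rel_iff: "((E, d), (F, e)) \<in> der_rel \<Phi> L \<longleftrightarrow>
    (E, d) \<in> partial_ders \<Phi> L \<and> (F, e) \<in> partial_ders \<Phi> L \<and> (\<forall>x\<in>E \<inter> F. d x = e x)"
proof -
  have "(\<exists>K. essential_ideal \<Phi> L K \<and> K \<subseteq> E \<inter> F \<and> (\<forall>x\<in>K. d x = e x)) \<longleftrightarrow> (\<forall>x\<in>E \<inter> F. d x = e x)"
    if "(E, d) \<in> partial_ders \<Phi> L" "(F, e) \<in> partial_ders \<Phi> L"
  proof -
    have de: "pder E d" "pder F e" using that partial_ders_iff by auto
    then have "essential_ideal \<Phi> L (E \<inter> F)" using pderD(1) ess_inter by blast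
    then show ?thesis using agree_extend[OF de] by blast
  qed
  then show ?thesis unfolding der_rel_def by auto
qed

lemma der_rel_equiv: "equiv (partial_ders \<Phi> L) (der_rel \<Phi> L)"
proof (rule equivI)
  show "der_rel \<Phi> L \<subseteq> partial_ders \<Phi> L \<times> partial_ders \<Phi> L" unfolding der_rel_def by auto
  show "refl_on (partial_ders \<Phi> L) (der_rel \<Phi> L)"
    by (rule refl_onI) (auto simp: der_rel_iff)
  show "sym (der_rel \<Phi> L)"
    by (rule symI) (auto simp: der_rel_iff)
  show "trans (der_rel \<Phi> L)"
  proof (rule transI, clarify)
    fix E d F e G g assume h: "((E, d), (F, e)) \<in> der_rel \<Phi> L" "((F, e), (G, g)) \<in> der_rel \<Phi> L"
    then have p: "pder E d" "pder F e" "pder G g" by (auto simp: der_rel_iff partial_ders_iff)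
    have "d x = g x" if "x \<in> E \<inter> G" for x
    proof (rule agree_extend[OF p(1,3), of "E \<inter> F \<inter> G"])
      show "essential_ideal \<Phi> L (E \<inter> F \<inter> G)" using ess_inter pderD(1) p by blast
    qed (use h that in \<open>auto simp: der_rel_iff\<close>)
    then show "((E, d), (G, g)) \<in> der_rel \<Phi> L" using h by (auto simp: der_rel_iff)
  qed
qed

lemma pder_partial: "pder E d \<Longrightarrow> (E, restrict d E) \<in> partial_ders \<Phi> L"
  using partial_ders_iff pder_restrict by auto

lemma cls_eq_iff:
  assumes "pder E d" "pder F e"
  shows "cls E d = cls F e \<longleftrightarrow> (\<forall>x\<in>E \<inter> F. d x = e x)"
  unfolding cls_def der_class_def
  using eq_equiv_class_iff[OF der_rel_equiv pder_partial[OF assms(1)] pder_partial[OF assms(2)]]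
    assms[THEN pder_partial] by (simp add: der_rel_iff)

lemma cls_memD:
  assumes d: "pder E d" and I: "(I, \<delta>) \<in> cls E d"
  shows "pder I \<delta>" "\<And>x. \<lbrakk>x \<in> E; x \<in> I\<rbrakk> \<Longrightarrow> \<delta> x = d x" "restrict \<delta> I = \<delta>"
  using assms unfolding cls_def der_class_def
  by (auto simp: der_rel_iff partial_ders_iff restrict_apply extensional_restrict split: if_splits)

lemma cls_mem: "pder E d \<Longrightarrow> (E, restrict d E) \<in> cls E d"
  unfolding cls_def der_class_def using pder_partial by (auto simp: der_rel_iff)

lemma cls_mono: "\<lbrakk>pder E d; essential_ideal \<Phi> L F; F \<subseteq> E\<rbrakk> \<Longrightarrow> cls F d = cls E d"
  using cls_eq_iff pder_mono by blast

abbreviation Q where "Q \<equiv> Qm_lie \<Phi> L"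

lemma Q_carrier: "carrier Q = {cls E d | E d. pder E d}"
proof -
  have "X \<in> {cls E d | E d. pder E d}" if X: "X \<in> partial_ders \<Phi> L // der_rel \<Phi> L" for X
  proof -
    obtain p where p: "p \<in> partial_ders \<Phi> L" "X = der_rel \<Phi> L `` {p}" using X by (rule quotientE)
    obtain E d where ed: "p = (E, d)" by (cases p)
    then have "pder E d" "restrict d E = d" using p by (auto simp: partial_ders_iff extensional_restrict)
    then have "X = cls E d" using p ed unfolding cls_def der_class_def by simp
    then show ?thesis using \<open>pder E d\<close> by blast
  qed
  moreover have "cls E d \<in> partial_ders \<Phi> L // der_rel \<Phi> L" if "pder E d" for E d
    unfolding cls_def der_class_def by (rule quotientI[OF pder_partial[OF that]])
  ultimately have "partial_ders \<Phi> L // der_rel \<Phi> L = {cls E d | E d. pder E d}" by blast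
  then show ?thesis unfolding Qm_lie_def by simp
qed

lemma cls_in_Q: "pder E d \<Longrightarrow> cls E d \<in> carrier Q"
  using Q_carrier by blast

lemma Q_memE:
  assumes "X \<in> carrier Q"
  obtains E d where "pder E d" "X = cls E d"
  using assms Q_carrier by blast

lemma Q_memE2:
  assumes "X \<in> carrier Q" "Y \<in> carrier Q"
  obtains E d e where "pder E d" "pder E e" "X = cls E d" "Y = cls E e"
proof -
  obtain E d where d: "pder E d" "X = cls E d" using Q_memE[OF assms(1)] .
  obtain F e where e: "pder F e" "Y = cls F e" using Q_memE[OF assms(2)] .
  have p: "pder E d" "pder F e" and X: "X = cls E d" "Y = cls F e" using d e by auto
  have "essential_ideal \<Phi> L (E \<inter> F)" by (rule ess_inter[OF pderD(1)[OF p(1)] pderD(1)[OF p(2)]])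
  then show ?thesis using that[of "E \<inter> F" d e] p X cls_mono pder_mono by (metis Int_lower1 Int_lower2)
qed

lemma Q_memE3:
  assumes "X \<in> carrier Q" "Y \<in> carrier Q" "Z \<in> carrier Q"
  obtains E d e f where "pder E d" "pder E e" "pder E f" "X = cls E d" "Y = cls E e" "Z = cls E f"
proof -
  obtain E d e where p: "pder E d" "pder E e" and X: "X = cls E d" "Y = cls E e"
    using Q_memE2[OF assms(1,2)] by metis
  obtain F f where q: "pder F f" "Z = cls F f" using assms(3) Q_memE by metis
  then have "essential_ideal \<Phi> L (E \<inter> F)" using p pderD(1) ess_inter by blast
  then show ?thesis
    using that[of "E \<inter> F" d e f] p X q cls_mono pder_mono by (metis Int_lower1 Int_lower2)
qed

lemma pder_add:
  assumes d: "pder E d" and e: "pder E e"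
  shows "pder E (\<lambda>x. d x \<oplus> e x)"
proof -
  note [simp] = pderD(3-7)[OF d] pderD(3,5-7)[OF e]
  show ?thesis unfolding pder_def using pderD(1)[OF d] by (auto simp: br_lin smult_r_distr M.a_ac)
qed

lemma pder_smult:
  assumes d: "pder E d" and a: "a \<in> carrier \<Phi>"
  shows "pder E (\<lambda>x. a \<odot> d x)"
proof -
  note [simp] = pderD(3-7)[OF d] a
  have "a \<odot> (b \<odot> y) = b \<odot> (a \<odot> y)" if "b \<in> carrier \<Phi>" "y \<in> carrier L" for b y
    using that by (simp add: R.m_comm flip: smult_assoc1)
  then show ?thesis unfolding pder_def using pderD(1)[OF d] by (auto simp: br_lin smult_r_distr)
qed

lemma pder_const_zero: "essential_ideal \<Phi> L E \<Longrightarrow> pder E (\<lambda>x. \<zero>)"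
  unfolding pder_def using idealD(4)[OF essD] by auto

text \<open>d [x,y] = [d x,y] + [x,d y] lies in F because F is an ideal. This is why composites of
  partial derivations make sense on derived ideals.\<close>

lemma pder_derived_into:
  assumes d: "pder E d" and F: "lie_ideal \<Phi> L F" "F \<subseteq> E" and x: "x \<in> lie_derived \<Phi> L F"
  shows "d x \<in> F"
proof -
  have sF: "submodule F \<Phi> L" and sE: "submodule E \<Phi> L" using idealD(1) F pderD(2)[OF d] by auto
  have "submodule {x \<in> E. d x \<in> F} \<Phi> L"
    by (rule submodule_linear_set[OF sE module_axioms _ _ _ sF]) (auto simp: pderD[OF d])
  moreover have "{x \<otimes> y |x y. x \<in> F \<and> y \<in> F} \<subseteq> {x \<in> E. d x \<in> F}"
    using F idealD[OF F(1)] pderD[OF d] by (auto simp: subset_iff intro!: submodule_add[OF sF])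
  ultimately show ?thesis using x mspan_least unfolding lie_derived_def by blast
qed

lemma pder_br:
  assumes d: "pder E d" and e: "pder E e"
  shows "pder (lie_derived \<Phi> L E) (\<lambda>x. d (e x) \<ominus> e (d x))"
proof -
  have E: "lie_ideal \<Phi> L E" using pderD(2)[OF d] .
  have sE: "submodule E \<Phi> L" using idealD(1)[OF E] .
  note [simp] = pderD(3-7)[OF d] pderD(3,5-7)[OF e] subsetD[OF derived_sub[OF E]]
    pder_derived_into[OF d E subset_refl] pder_derived_into[OF e E subset_refl]
    idealD(2,3)[OF E] submodule_smult[OF sE] submodule_add[OF sE]
  show ?thesis unfolding pder_def using ess_derived[OF pderD(1)[OF d]]
    by (auto simp: br_lin smult_diff M.ab_simps)
qed

text \<open>The operations of \<open>Qm_lie\<close> are unions over all pairs of representatives;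
  once all pairs yield the same class, the union is that class.\<close>

lemma union2_const:
  assumes "\<And>I \<delta> J \<mu>. \<lbrakk>(I, \<delta>) \<in> X; (J, \<mu>) \<in> Y\<rbrakk> \<Longrightarrow> H I \<delta> J \<mu> = Z" "X \<noteq> {}" "Y \<noteq> {}"
  shows "(\<Union>(I, \<delta>)\<in>X. \<Union>(J, \<mu>)\<in>Y. H I \<delta> J \<mu>) = Z"
  using assms by fastforce

lemma Q_add:
  assumes d: "pder E d" and e: "pder E e"
  shows "cls E d \<oplus>\<^bsub>Q\<^esub> cls E e = cls E (\<lambda>x. d x \<oplus> e x)"
proof -
  have "der_class \<Phi> L (I \<inter> J) (\<lambda>x\<in>I \<inter> J. \<delta> x \<oplus> \<mu> x) = cls E (\<lambda>x. d x \<oplus> e x)"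
    if "(I, \<delta>) \<in> cls E d" "(J, \<mu>) \<in> cls E e" for I \<delta> J \<mu>
  proof -
    note I = cls_memD[OF d that(1)] and J = cls_memD[OF e that(2)]
    have K: "essential_ideal \<Phi> L (I \<inter> J)" by (rule ess_inter[OF pderD(1)[OF I(1)] pderD(1)[OF J(1)]])
    have "pder (I \<inter> J) (\<lambda>x. \<delta> x \<oplus> \<mu> x)"
      using pder_add[OF pder_mono[OF I(1) K] pder_mono[OF J(1) K]] by simp
    then have "cls (I \<inter> J) (\<lambda>x. \<delta> x \<oplus> \<mu> x) = cls E (\<lambda>x. d x \<oplus> e x)"
      using pder_add[OF d e] I J by (subst cls_eq_iff) auto
    then show ?thesis unfolding cls_def .
  qed
  then show ?thesis
    unfolding Qm_lie_def using cls_mem[OF d] cls_mem[OF e] by (simp, intro union2_const) auto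
qed

lemma Q_br:
  assumes d: "pder E d" and e: "pder E e"
  shows "cls E d \<otimes>\<^bsub>Q\<^esub> cls E e = cls (lie_derived \<Phi> L E) (\<lambda>x. d (e x) \<ominus> e (d x))"
proof -
  have "der_class \<Phi> L (lie_derived \<Phi> L (I \<inter> J)) (\<lambda>x\<in>lie_derived \<Phi> L (I \<inter> J). \<delta> (\<mu> x) \<ominus> \<mu> (\<delta> x)) =
      cls (lie_derived \<Phi> L E) (\<lambda>x. d (e x) \<ominus> e (d x))"
    if "(I, \<delta>) \<in> cls E d" "(J, \<mu>) \<in> cls E e" for I \<delta> J \<mu>
  proof -
    note I = cls_memD[OF d that(1)] and J = cls_memD[OF e that(2)]
    have K: "essential_ideal \<Phi> L (I \<inter> J)" by (rule ess_inter[OF pderD(1)[OF I(1)] pderD(1)[OF J(1)]])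
    have KE: "essential_ideal \<Phi> L (I \<inter> J \<inter> E)" using K pderD(1)[OF d] ess_inter by blast
    have p: "pder (lie_derived \<Phi> L (I \<inter> J)) (\<lambda>x. \<delta> (\<mu> x) \<ominus> \<mu> (\<delta> x))"
      using pder_br[OF pder_mono[OF I(1) K] pder_mono[OF J(1) K]] by simp
    \<comment> \<open>The composites can be compared only where the value computed first stays in
      all three domains, that is on the derived ideal of \<open>I \<inter> J \<inter> E\<close>;
      \<open>agree_extend\<close> then widens the agreement.\<close>
    have "\<delta> (\<mu> x) \<ominus> \<mu> (\<delta> x) = d (e x) \<ominus> e (d x)" if x: "x \<in> lie_derived \<Phi> L (I \<inter> J \<inter> E)" for x
    proof -
      have x': "x \<in> I" "x \<in> J" "x \<in> E" using x derived_sub[OF essD[OF KE]] by auto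
      then have "\<delta> x = d x" "\<mu> x = e x" using I J by auto
      moreover have "\<delta> x \<in> I \<inter> J \<inter> E" "\<mu> x \<in> I \<inter> J \<inter> E"
        using pder_derived_into[OF I(1) essD[OF KE] _ x] pder_derived_into[OF J(1) essD[OF KE] _ x] by auto
      ultimately show ?thesis using I J by auto
    qed
    then have "cls (lie_derived \<Phi> L (I \<inter> J)) (\<lambda>x. \<delta> (\<mu> x) \<ominus> \<mu> (\<delta> x)) =
        cls (lie_derived \<Phi> L E) (\<lambda>x. d (e x) \<ominus> e (d x))"
      using agree_extend[OF p pder_br[OF d e] ess_derived[OF KE]]
        derived_mono[of "I \<inter> J \<inter> E" "I \<inter> J"] derived_mono[of "I \<inter> J \<inter> E" E]
        ideal_sub[OF essD[OF K]] ideal_sub[OF pderD(2)[OF d]] p pder_br[OF d e]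
      by (subst cls_eq_iff) auto
    then show ?thesis unfolding cls_def .
  qed
  then show ?thesis
    unfolding Qm_lie_def using cls_mem[OF d] cls_mem[OF e] by (simp, intro union2_const) auto
qed

lemma Q_smult:
  assumes d: "pder E d" and a: "a \<in> carrier \<Phi>"
  shows "a \<odot>\<^bsub>Q\<^esub> cls E d = cls E (\<lambda>x. a \<odot> d x)"
proof -
  have "der_class \<Phi> L I (\<lambda>x\<in>I. a \<odot> \<delta> x) = cls E (\<lambda>x. a \<odot> d x)"
    if "(I, \<delta>) \<in> cls E d" for I \<delta>
  proof -
    note I = cls_memD[OF d that]
    have "cls I (\<lambda>x. a \<odot> \<delta> x) = cls E (\<lambda>x. a \<odot> d x)"
      using pder_smult[OF d a] pder_smult[OF I(1) a] I by (subst cls_eq_iff) auto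
    then show ?thesis unfolding cls_def .
  qed
  then show ?thesis unfolding Qm_lie_def using cls_mem[OF d] by fastforce
qed

lemma Q_zero: "\<zero>\<^bsub>Q\<^esub> = cls (carrier L) (\<lambda>x. \<zero>)"
  unfolding Qm_lie_def cls_def by simp

lemma cls_zero: "essential_ideal \<Phi> L E \<Longrightarrow> cls E (\<lambda>x. \<zero>) = \<zero>\<^bsub>Q\<^esub>"
  unfolding Q_zero using pder_const_zero ess_carrier by (simp add: cls_eq_iff)

lemma cls_eq_zero_iff:
  assumes "pder E d"
  shows "cls E d = \<zero>\<^bsub>Q\<^esub> \<longleftrightarrow> (\<forall>x\<in>E. d x = \<zero>)"
  unfolding Q_zero using assms pder_const_zero[OF ess_carrier] pderD(4)[OF assms]
  by (subst cls_eq_iff) auto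

lemma cls_eqI: "\<lbrakk>pder E d; \<And>x. x \<in> E \<Longrightarrow> d x = e x\<rbrakk> \<Longrightarrow> cls E d = cls E e"
  using pder_cong by (subst cls_eq_iff) auto

lemma Q_module: "module \<Phi> Q"
proof (rule moduleI)
  show "cring \<Phi>" by (rule R.is_cring)
  show "abelian_group Q"
  proof (rule abelian_groupI)
    fix X Y assume XY: "X \<in> carrier Q" "Y \<in> carrier Q"
    then obtain E d e where p: "pder E d" "pder E e" and X: "X = cls E d" "Y = cls E e" by (rule Q_memE2)
    show "X \<oplus>\<^bsub>Q\<^esub> Y \<in> carrier Q" using p by (simp add: X Q_add cls_in_Q pder_add)
    show "X \<oplus>\<^bsub>Q\<^esub> Y = Y \<oplus>\<^bsub>Q\<^esub> X"
      using p pder_add[OF p] by (auto simp: X Q_add M.a_comm pderD intro!: cls_eqI)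
    fix Z assume "Z \<in> carrier Q"
    with XY obtain E d e f where p: "pder E d" "pder E e" "pder E f" and X: "X = cls E d" "Y = cls E e" "Z = cls E f"
      by (rule Q_memE3)
    show "X \<oplus>\<^bsub>Q\<^esub> Y \<oplus>\<^bsub>Q\<^esub> Z = X \<oplus>\<^bsub>Q\<^esub> (Y \<oplus>\<^bsub>Q\<^esub> Z)"
      using p pderD(3) by (auto simp: X Q_add pder_add M.a_assoc intro!: cls_eqI)
  next
    show "\<zero>\<^bsub>Q\<^esub> \<in> carrier Q" unfolding Q_zero by (intro cls_in_Q pder_const_zero ess_carrier)
    fix X assume "X \<in> carrier Q"
    then obtain E d where p: "pder E d" and X: "X = cls E d" by (rule Q_memE)
    note z = pder_const_zero[OF pderD(1)[OF p]]
    show "\<zero>\<^bsub>Q\<^esub> \<oplus>\<^bsub>Q\<^esub> X = X"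
      unfolding X cls_zero[OF pderD(1)[OF p], symmetric] Q_add[OF z p]
      using pder_add[OF z p] pderD(3)[OF p] by (auto intro!: cls_eqI)
    have m: "pder E (\<lambda>x. \<ominus>\<^bsub>\<Phi>\<^esub> \<one>\<^bsub>\<Phi>\<^esub> \<odot> d x)" using pder_smult[OF p] by simp
    have "cls E (\<lambda>x. \<ominus>\<^bsub>\<Phi>\<^esub> \<one>\<^bsub>\<Phi>\<^esub> \<odot> d x) \<oplus>\<^bsub>Q\<^esub> X = \<zero>\<^bsub>Q\<^esub>"
      unfolding X Q_add[OF m p] cls_eq_zero_iff[OF pder_add[OF m p]]
      using pderD(3)[OF p] by (auto simp: smult_l_minus M.l_neg)
    then show "\<exists>Y\<in>carrier Q. Y \<oplus>\<^bsub>Q\<^esub> X = \<zero>\<^bsub>Q\<^esub>" using cls_in_Q[OF m] by blast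
  qed
next
  fix a X Y assume a: "a \<in> carrier \<Phi>" and "X \<in> carrier Q" "Y \<in> carrier Q"
  then obtain E d e where p: "pder E d" "pder E e" and X: "X = cls E d" "Y = cls E e" using Q_memE2 by metis
  show "a \<odot>\<^bsub>Q\<^esub> (X \<oplus>\<^bsub>Q\<^esub> Y) = a \<odot>\<^bsub>Q\<^esub> X \<oplus>\<^bsub>Q\<^esub> a \<odot>\<^bsub>Q\<^esub> Y"
    using p a pderD(3) by (auto simp: X Q_add Q_smult pder_add pder_smult smult_r_distr intro!: cls_eqI)
next
  fix a X assume a: "a \<in> carrier \<Phi>" and "X \<in> carrier Q"
  then obtain E d where p: "pder E d" and X: "X = cls E d" using Q_memE by metis
  show "a \<odot>\<^bsub>Q\<^esub> X \<in> carrier Q" using p a by (simp add: X Q_smult cls_in_Q pder_smult)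
  fix b assume b: "b \<in> carrier \<Phi>"
  show "(a \<oplus>\<^bsub>\<Phi>\<^esub> b) \<odot>\<^bsub>Q\<^esub> X = a \<odot>\<^bsub>Q\<^esub> X \<oplus>\<^bsub>Q\<^esub> b \<odot>\<^bsub>Q\<^esub> X"
    "(a \<otimes>\<^bsub>\<Phi>\<^esub> b) \<odot>\<^bsub>Q\<^esub> X = a \<odot>\<^bsub>Q\<^esub> (b \<odot>\<^bsub>Q\<^esub> X)"
    using p a b pderD(3) pder_smult[OF p]
    by (auto simp: X Q_add Q_smult pder_add pder_smult smult_l_distr smult_assoc1 intro!: cls_eqI)
next
  fix X assume "X \<in> carrier Q"
  then obtain E d where p: "pder E d" and X: "X = cls E d" using Q_memE by metis
  show "\<one>\<^bsub>\<Phi>\<^esub> \<odot>\<^bsub>Q\<^esub> X = X"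
    using p pderD(3)[OF p] pder_smult[OF p] by (auto simp: X Q_smult intro!: cls_eqI)
qed

sublocale Q: lie \<Phi> "Qm_lie \<Phi> L"
proof (intro lie.intro module6.intro Q_module module6_axioms.intro six_unit lie_axioms.intro)
  fix X Y assume XY: "X \<in> carrier Q" "Y \<in> carrier Q"
  then obtain E d e where p: "pder E d" "pder E e" and X: "X = cls E d" "Y = cls E e" by (rule Q_memE2)
  have E': "essential_ideal \<Phi> L (lie_derived \<Phi> L E)" "lie_ideal \<Phi> L E" "lie_derived \<Phi> L E \<subseteq> E"
    using ess_derived derived_sub pderD(1,2)[OF p(1)] by auto
  show "X \<otimes>\<^bsub>Q\<^esub> Y \<in> carrier Q" using p by (simp add: X Q_br cls_in_Q pder_br)
  show "X \<otimes>\<^bsub>Q\<^esub> X = \<zero>\<^bsub>Q\<^esub>"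
    unfolding X Q_br[OF p(1) p(1)] cls_eq_zero_iff[OF pder_br[OF p(1) p(1)]]
    using pder_derived_into[OF p(1) E'(2) subset_refl] pderD(3)[OF p(1)] by (simp add: M.diff_eq_zero)
  fix Z assume Z: "Z \<in> carrier Q"
  obtain E d e f where p: "pder E d" "pder E e" "pder E f" and X: "X = cls E d" "Y = cls E e" "Z = cls E f"
    using Q_memE3[OF XY Z] by metis
  define E' where "E' = lie_derived \<Phi> L E"
  \<comment> \<open>The Jacobi identity involves threefold composites, so two derivations must be
    applied without leaving E. The second derived ideal provides this.\<close>
  define E'' where "E'' = lie_derived \<Phi> L E'"
  have E': "essential_ideal \<Phi> L E'" "lie_ideal \<Phi> L E" "E' \<subseteq> E"
    using ess_derived derived_sub pderD(1,2)[OF p(1)] unfolding E'_def by auto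
  have E'': "E'' \<subseteq> E'" using derived_sub[OF essD[OF E'(1)]] unfolding E''_def .
  have sub: "pder E' g" if "pder E g" for g using pder_mono[OF that E'(1,3)] .
  have cl: "cls E g = cls E' g" if "pder E g" for g using cls_mono[OF that E'(1,3)] by simp
  have in1: "g x \<in> E" if "pder E g" "x \<in> E'" for g x
    using pder_derived_into[OF that(1) E'(2) subset_refl] that(2) unfolding E'_def .
  have in2: "g x \<in> E'" if "pder E g" "x \<in> E''" for g x
    using pder_derived_into[OF that(1) essD[OF E'(1)] E'(3)] that(2) unfolding E''_def .
  have br: "cls E g \<otimes>\<^bsub>Q\<^esub> cls E h = cls E' (\<lambda>x. g (h x) \<ominus> h (g x))"
    "pder E' (\<lambda>x. g (h x) \<ominus> h (g x))" if "pder E g" "pder E h" for g h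
    using Q_br[OF that] pder_br[OF that] unfolding E'_def by auto
  have br': "cls E' g \<otimes>\<^bsub>Q\<^esub> cls E' h = cls E'' (\<lambda>x. g (h x) \<ominus> h (g x))"
    "pder E'' (\<lambda>x. g (h x) \<ominus> h (g x))" if "pder E' g" "pder E' h" for g h
    using Q_br[OF that] pder_br[OF that] unfolding E''_def by auto
  note cp = pderD(3)[OF p(1)] pderD(3)[OF p(2)] pderD(3)[OF p(3)]
  note ip = in1[OF p(1)] in1[OF p(2)] in1[OF p(3)]
  show "(X \<oplus>\<^bsub>Q\<^esub> Y) \<otimes>\<^bsub>Q\<^esub> Z = X \<otimes>\<^bsub>Q\<^esub> Z \<oplus>\<^bsub>Q\<^esub> Y \<otimes>\<^bsub>Q\<^esub> Z"
  proof -
    note a = pder_add[OF p(1,2)]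
    show ?thesis unfolding X Q_add[OF p(1,2)] br(1)[OF a p(3)] br(1)[OF p(1,3)] br(1)[OF p(2,3)]
        Q_add[OF br(2)[OF p(1,3)] br(2)[OF p(2,3)]]
      by (rule cls_eqI[OF br(2)[OF a p(3)]])
        (use E'(3) in \<open>auto simp: ip cp pderD(5)[OF p(3)] M.ab_simps subset_iff\<close>)
  qed
  show "X \<otimes>\<^bsub>Q\<^esub> (Y \<oplus>\<^bsub>Q\<^esub> Z) = X \<otimes>\<^bsub>Q\<^esub> Y \<oplus>\<^bsub>Q\<^esub> X \<otimes>\<^bsub>Q\<^esub> Z"
  proof -
    note a = pder_add[OF p(2,3)]
    show ?thesis unfolding X Q_add[OF p(2,3)] br(1)[OF p(1) a] br(1)[OF p(1,2)] br(1)[OF p(1,3)]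
        Q_add[OF br(2)[OF p(1,2)] br(2)[OF p(1,3)]]
      by (rule cls_eqI[OF br(2)[OF p(1) a]])
        (use E'(3) in \<open>auto simp: ip cp pderD(5)[OF p(1)] M.ab_simps subset_iff\<close>)
  qed
  show "a \<odot>\<^bsub>Q\<^esub> X \<otimes>\<^bsub>Q\<^esub> Y = a \<odot>\<^bsub>Q\<^esub> (X \<otimes>\<^bsub>Q\<^esub> Y)" if a: "a \<in> carrier \<Phi>" for a
  proof -
    note s = pder_smult[OF p(1) a]
    show ?thesis unfolding X Q_smult[OF p(1) a] br(1)[OF s p(2)] br(1)[OF p(1,2)] Q_smult[OF br(2)[OF p(1,2)] a]
      by (rule cls_eqI[OF br(2)[OF s p(2)]])
        (use E'(3) in \<open>auto simp: ip cp a pderD(6)[OF p(2)] smult_diff subset_iff\<close>)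
  qed
  show "X \<otimes>\<^bsub>Q\<^esub> (Y \<otimes>\<^bsub>Q\<^esub> Z) = X \<otimes>\<^bsub>Q\<^esub> Y \<otimes>\<^bsub>Q\<^esub> Z \<oplus>\<^bsub>Q\<^esub> Y \<otimes>\<^bsub>Q\<^esub> (X \<otimes>\<^bsub>Q\<^esub> Z)"
  proof -
    note q = sub[OF p(1)] sub[OF p(2)] sub[OF p(3)]
    note b12 = br(2)[OF p(1,2)] and b13 = br(2)[OF p(1,3)] and b23 = br(2)[OF p(2,3)]
    have X': "X = cls E' d" "Y = cls E' e" "Z = cls E' f" using X cl p by auto
    have m: "\<And>x. x \<in> E'' \<Longrightarrow> x \<in> E'" "\<And>x. x \<in> E'' \<Longrightarrow> x \<in> E" "\<And>x. x \<in> E' \<Longrightarrow> x \<in> E" using E'' E' by auto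
    have Xb: "X \<otimes>\<^bsub>Q\<^esub> Y = cls E' (\<lambda>x. d (e x) \<ominus> e (d x))"
      "X \<otimes>\<^bsub>Q\<^esub> Z = cls E' (\<lambda>x. d (f x) \<ominus> f (d x))"
      "Y \<otimes>\<^bsub>Q\<^esub> Z = cls E' (\<lambda>x. e (f x) \<ominus> f (e x))"
      using X br(1) p by auto
    show ?thesis
      unfolding Xb unfolding X' br'(1)[OF q(1) b23] br'(1)[OF b12 q(3)] br'(1)[OF q(2) b13]
        Q_add[OF br'(2)[OF b12 q(3)] br'(2)[OF q(2) b13]]
      by (rule cls_eqI[OF br'(2)[OF q(1) b23]])
        (simp add: m ip cp in2[OF p(1)] in2[OF p(2)] in2[OF p(3)]
          pder_diff[OF p(1)] pder_diff[OF p(2)] pder_diff[OF p(3)] M.ab_simps)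
  qed
qed

section \<open>The adjoint embedding into the algebra of quotients\<close>

abbreviation adc where "adc \<equiv> ad_class \<Phi> L"

lemma adc_cls: "adc x = cls (carrier L) (\<lambda>y. x \<otimes> y)"
  unfolding ad_class_def cls_def ..

lemma pder_ad: "x \<in> carrier L \<Longrightarrow> pder (carrier L) (\<lambda>y. x \<otimes> y)"
  unfolding pder_def using ess_carrier br_jacobi[of x] by (simp add: br_lin)

lemma adc_in_Q [simp, intro]: "x \<in> carrier L \<Longrightarrow> adc x \<in> carrier Q"
  unfolding adc_cls by (rule cls_in_Q[OF pder_ad])

lemma adc_inj: "\<lbrakk>x \<in> carrier L; y \<in> carrier L; adc x = adc y\<rbrakk> \<Longrightarrow> x = y"
  unfolding adc_cls by (rule ess_cancel[OF ess_carrier]) (auto simp: cls_eq_iff pder_ad)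

lemma adc_add: "\<lbrakk>x \<in> carrier L; y \<in> carrier L\<rbrakk> \<Longrightarrow> adc (x \<oplus> y) = adc x \<oplus>\<^bsub>Q\<^esub> adc y"
  unfolding adc_cls by (auto simp: Q_add pder_ad br_lin intro!: cls_eqI)

lemma adc_smult: "\<lbrakk>a \<in> carrier \<Phi>; x \<in> carrier L\<rbrakk> \<Longrightarrow> adc (a \<odot> x) = a \<odot>\<^bsub>Q\<^esub> adc x"
  unfolding adc_cls by (auto simp: Q_smult pder_ad br_lin intro!: cls_eqI)

lemma adc_zero: "adc \<zero> = \<zero>\<^bsub>Q\<^esub>"
  unfolding adc_cls by (auto simp: Q_zero intro!: cls_eqI pder_ad)

lemma adc_eq_zero_iff: "x \<in> carrier L \<Longrightarrow> adc x = \<zero>\<^bsub>Q\<^esub> \<longleftrightarrow> x = \<zero>"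
  using adc_inj[of x \<zero>] adc_zero by auto

text \<open>Since [d, ad x] = ad (d x), bracketing with an embedded element evaluates the
  derivation. Later computations in \<open>Q\<close> that involve elements of \<open>L\<close>
  thereby become computations with values of representatives.\<close>

lemma cls_act:
  assumes d: "pder E d" and x: "x \<in> E"
  shows "cls E d \<otimes>\<^bsub>Q\<^esub> adc x = adc (d x)"
proof -
  have xc: "x \<in> carrier L" "d x \<in> carrier L" using pderD d x by auto
  have E: "E \<subseteq> carrier L" "lie_ideal \<Phi> L E" "essential_ideal \<Phi> L E" using pderD[OF d] by auto
  have ax: "adc x = cls E (\<lambda>y. x \<otimes> y)" "pder E (\<lambda>y. x \<otimes> y)"
    unfolding adc_cls using cls_mono[OF pder_ad[OF xc(1)] E(3,1)] pder_mono[OF pder_ad[OF xc(1)] E(3,1)] by auto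
  have dE: "lie_derived \<Phi> L E \<subseteq> E" using derived_sub E by blast
  have "cls (lie_derived \<Phi> L E) (\<lambda>y. d (x \<otimes> y) \<ominus> x \<otimes> d y) = cls (lie_derived \<Phi> L E) (\<lambda>y. d x \<otimes> y)"
    using dE pderD[OF d] x xc by (intro cls_eqI[OF pder_br[OF d ax(2)]]) (auto simp: subset_iff M.ab_simps)
  also have "\<dots> = adc (d x)" unfolding adc_cls
    using cls_mono[OF pder_ad[OF xc(2)] ess_derived[OF E(3)]] dE E by blast
  finally show ?thesis unfolding ax(1) Q_br[OF d ax(2)] .
qed

lemma adc_br: "\<lbrakk>x \<in> carrier L; y \<in> carrier L\<rbrakk> \<Longrightarrow> adc (x \<otimes> y) = adc x \<otimes>\<^bsub>Q\<^esub> adc y"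
  using cls_act[OF pder_ad, of x y] by (simp flip: adc_cls)

end


section \<open>Nondegenerate 3-graded Lie algebras\<close>

text \<open>The axioms isolate what is used of TKK(V(T)): \<open>faithful\<close> reflects that
  degree zero consists of pairs of endomorphisms, \<open>nondegenerate\<close> is strong
  nondegeneracy written with brackets, and the involution \<open>\<theta>\<close> carries the degree
  1 hypothesis over to degree -1.\<close>

locale gr3 = lie \<Phi> L for \<Phi> :: "('k, 'r) ring_scheme" and L :: "('k, 'a, 'm) module_scheme" (structure) +
  fixes G :: "int \<Rightarrow> 'a set" and p :: "int \<Rightarrow> 'a \<Rightarrow> 'a" and \<theta> :: "'a \<Rightarrow> 'a"
  assumes G_sub: "submodule (G k) \<Phi> L"
    and G_trivial: "\<lbrakk>k \<noteq> 1; k \<noteq> 0; k \<noteq> -1\<rbrakk> \<Longrightarrow> G k = {\<zero>}"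
    and G_br: "\<lbrakk>x \<in> G i; y \<in> G j\<rbrakk> \<Longrightarrow> x \<otimes> y \<in> G (i + j)"
    and p_deg: "x \<in> carrier L \<Longrightarrow> p k x \<in> G k"
    and p_add: "\<lbrakk>x \<in> carrier L; y \<in> carrier L\<rbrakk> \<Longrightarrow> p k (x \<oplus> y) = p k x \<oplus> p k y"
    and p_smult: "\<lbrakk>a \<in> carrier \<Phi>; x \<in> carrier L\<rbrakk> \<Longrightarrow> p k (a \<odot> x) = a \<odot> p k x"
    and p_same: "x \<in> G k \<Longrightarrow> p k x = x"
    and p_other: "\<lbrakk>x \<in> G j; j \<noteq> k\<rbrakk> \<Longrightarrow> p k x = \<zero>"
    and p_decomp: "x \<in> carrier L \<Longrightarrow> p 1 x \<oplus> p 0 x \<oplus> p (-1) x = x"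
    and faithful: "\<lbrakk>w \<in> G 0; \<And>x. x \<in> G 1 \<Longrightarrow> w \<otimes> x = \<zero>; \<And>x. x \<in> G (-1) \<Longrightarrow> w \<otimes> x = \<zero>\<rbrakk> \<Longrightarrow> w = \<zero>"
    and nondegenerate: "\<lbrakk>x \<in> G 1; \<And>y. y \<in> G (-1) \<Longrightarrow> x \<otimes> (x \<otimes> y) = \<zero>\<rbrakk> \<Longrightarrow> x = \<zero>"
    and th_closed [simp, intro]: "x \<in> carrier L \<Longrightarrow> \<theta> x \<in> carrier L"
    and th_add: "\<lbrakk>x \<in> carrier L; y \<in> carrier L\<rbrakk> \<Longrightarrow> \<theta> (x \<oplus> y) = \<theta> x \<oplus> \<theta> y"
    and th_smult: "\<lbrakk>a \<in> carrier \<Phi>; x \<in> carrier L\<rbrakk> \<Longrightarrow> \<theta> (a \<odot> x) = a \<odot> \<theta> x"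
    and th_br: "\<lbrakk>x \<in> carrier L; y \<in> carrier L\<rbrakk> \<Longrightarrow> \<theta> (x \<otimes> y) = \<theta> x \<otimes> \<theta> y"
    and th_th [simp]: "x \<in> carrier L \<Longrightarrow> \<theta> (\<theta> x) = x"
    and th_deg: "x \<in> G k \<Longrightarrow> \<theta> x \<in> G (- k)"
begin

text \<open>A right-associative copy of the bracket, so that
  \<open>x \<bullet> x \<bullet> y\<close> reads as a word in operators \<open>ad\<close> applied to
  \<open>y\<close>.\<close>

abbreviation ad :: "'a \<Rightarrow> 'a \<Rightarrow> 'a" (infixr "\<bullet>" 75) where "x \<bullet> y \<equiv> x \<otimes> y"

lemma G_in: "x \<in> G k \<Longrightarrow> x \<in> carrier L"
  by (rule submodule_in[OF G_sub])

lemmas G_intros = submodule_intros[OF G_sub]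

lemma G_eq_zero: "\<lbrakk>x \<in> G k; k \<noteq> 1; k \<noteq> 0; k \<noteq> -1\<rbrakk> \<Longrightarrow> x = \<zero>"
  using G_trivial by blast

lemma G_br0: "\<lbrakk>x \<in> G 0; y \<in> G k\<rbrakk> \<Longrightarrow> x \<bullet> y \<in> G k" "\<lbrakk>x \<in> G k; y \<in> G 0\<rbrakk> \<Longrightarrow> x \<bullet> y \<in> G k"
  using G_br[of x 0 y k] G_br[of x k y 0] by auto

lemma G_br_pm: "\<lbrakk>x \<in> G s; y \<in> G (- s)\<rbrakk> \<Longrightarrow> x \<bullet> y \<in> G 0" "\<lbrakk>x \<in> G (- s); y \<in> G s\<rbrakk> \<Longrightarrow> x \<bullet> y \<in> G 0"
  using G_br[of x s y "- s"] G_br[of x "- s" y s] by auto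

lemma G_br_same:
  assumes "x \<in> G s" "y \<in> G s" "s = 1 \<or> s = -1"
  shows "x \<bullet> y = \<zero>"
  using G_br[OF assms(1,2)] assms(3) by (intro G_eq_zero[of _ "s + s"]) auto

lemma th_zero: "\<theta> \<zero> = \<zero>"
  by (rule additive_zero_gen[of L L]) (auto simp: th_add M.abelian_group_axioms)

lemma th_diff: "\<lbrakk>x \<in> carrier L; y \<in> carrier L\<rbrakk> \<Longrightarrow> \<theta> (x \<ominus> y) = \<theta> x \<ominus> \<theta> y"
  by (rule additive_diff_gen[of L L]) (auto simp: th_add M.abelian_group_axioms)

lemma th_eq_zero_iff: "x \<in> carrier L \<Longrightarrow> \<theta> x = \<zero> \<longleftrightarrow> x = \<zero>"
  by (metis th_th th_zero)

lemma nd: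
  assumes s: "s = 1 \<or> s = -1" and x: "x \<in> G s" "\<And>y. y \<in> G (- s) \<Longrightarrow> x \<bullet> x \<bullet> y = \<zero>"
  shows "x = \<zero>"
proof (cases "s = 1")
  case True
  then show ?thesis using nondegenerate x by auto
next
  case False
  then have s: "s = -1" using s by simp
  have xc: "x \<in> carrier L" using G_in x by blast
  have "\<theta> x = \<zero>"
  proof (rule nondegenerate)
    show "\<theta> x \<in> G 1" using th_deg[OF x(1)] s by simp
    fix y assume y: "y \<in> G (-1)"
    then have "x \<bullet> x \<bullet> \<theta> y = \<zero>" using x(2)[of "\<theta> y"] th_deg[OF y] s by simp
    then have "\<theta> (x \<bullet> x \<bullet> \<theta> y) = \<zero>" by (simp add: th_zero)
    then show "\<theta> x \<bullet> \<theta> x \<bullet> y = \<zero>" using xc G_in[OF y] by (simp add: th_br)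
  qed
  then show ?thesis using th_eq_zero_iff xc by simp
qed

text \<open>This is [X,[X,Y]] = XXY - 2 XYX + YXX for X = ad x and Y = ad y, applied to w.\<close>

lemma ad_square:
  assumes "x \<in> carrier L" "y \<in> carrier L" "w \<in> carrier L"
  shows "(x \<bullet> x \<bullet> y) \<bullet> w = x \<bullet> x \<bullet> y \<bullet> w \<ominus> (x \<bullet> y \<bullet> x \<bullet> w \<oplus> x \<bullet> y \<bullet> x \<bullet> w) \<oplus> y \<bullet> x \<bullet> x \<bullet> w"
  using assms by (simp add: br_jacobi1 br_lin M.ab_simps)

text \<open>The elements x and c = [x,[x,y]] have the same degree s, so ad x and ad c commute. With
  A and B the two sides of the claim, expanding ad x (ad c w) = ad c (ad x w) gives B - 2A = A - 2B,
  hence 3A = 3B.\<close>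

lemma ad_cube:
  assumes s: "s = 1 \<or> s = -1" and x: "x \<in> G s" and y: "y \<in> G (- s)" and w: "w \<in> G (- s)"
  shows "x \<bullet> x \<bullet> y \<bullet> x \<bullet> w = x \<bullet> y \<bullet> x \<bullet> x \<bullet> w"
proof -
  have s': "- s = 1 \<or> - s = -1" using s by auto
  have [simp]: "x \<in> carrier L" "y \<in> carrier L" "w \<in> carrier L" using G_in x y w by auto
  have c: "x \<bullet> x \<bullet> y \<in> G s" using G_br0(2)[OF x G_br_pm(1)[OF x y]] .
  have "x \<bullet> (x \<bullet> x \<bullet> y) = \<zero>" using G_br_same[OF x c s] .
  then have comm: "x \<bullet> (x \<bullet> x \<bullet> y) \<bullet> w = (x \<bullet> x \<bullet> y) \<bullet> x \<bullet> w"
    using br_jacobi[of x "x \<bullet> x \<bullet> y" w] by simp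
  have yw: "y \<bullet> w = \<zero>" using G_br_same[OF y w s'] .
  have "x \<bullet> x \<bullet> w \<in> G s" using G_br0(2)[OF x G_br_pm(1)[OF x w]] .
  then have xxx: "x \<bullet> x \<bullet> x \<bullet> w = \<zero>" using G_br_same[OF x _ s] by blast
  define A where "A = x \<bullet> x \<bullet> y \<bullet> x \<bullet> w"
  define B where "B = x \<bullet> y \<bullet> x \<bullet> x \<bullet> w"
  have [simp]: "A \<in> carrier L" "B \<in> carrier L" by (simp_all add: A_def B_def)
  have "B \<ominus> (A \<oplus> A) = A \<ominus> (B \<oplus> B)"
    using comm by (simp add: ad_square br_lin yw xxx A_def B_def M.ab_simps)
  then have "A \<oplus> A \<oplus> A = B \<oplus> B \<oplus> B" by (simp add: M.ab_simps)
  then have "A = B" by (rule three_cancel_eq[rotated 2]) simp_all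
  then show ?thesis unfolding A_def B_def .
qed

text \<open>This is \<open>P_{P_x y} = P_x P_y P_x\<close>, since \<open>(ad x)\<^sup>2 y = -2 P_x y\<close>.\<close>

lemma fundamental:
  assumes s: "s = 1 \<or> s = -1" and x: "x \<in> G s" and y: "y \<in> G (- s)" and z: "z \<in> G (- s)"
  shows "(x \<bullet> x \<bullet> y) \<bullet> (x \<bullet> x \<bullet> y) \<bullet> z = x \<bullet> x \<bullet> y \<bullet> y \<bullet> x \<bullet> x \<bullet> z"
proof -
  have s': "- s = 1 \<or> - s = -1" using s by auto
  have [simp]: "x \<in> carrier L" "y \<in> carrier L" "z \<in> carrier L" using G_in x y z by auto
  have xz: "x \<bullet> z \<in> G 0" using G_br_pm(1)[OF x z] .
  have yxz: "y \<bullet> x \<bullet> z \<in> G (- s)" using G_br0(2)[OF y xz] .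
  have A: "x \<bullet> y \<bullet> x \<bullet> z \<in> G 0" using G_br_pm(1)[OF x yxz] .
  have xxz: "x \<bullet> x \<bullet> z \<in> G s" using G_br0(2)[OF x xz] .
  have B: "y \<bullet> x \<bullet> x \<bullet> z \<in> G 0" using G_br_pm(2)[OF y xxz] .
  have yz: "y \<bullet> z = \<zero>" using G_br_same[OF y z s'] .
  have c0: "(x \<bullet> x \<bullet> y) \<bullet> w = x \<bullet> x \<bullet> y \<bullet> w \<ominus> (x \<bullet> y \<bullet> x \<bullet> w \<oplus> x \<bullet> y \<bullet> x \<bullet> w)" if w: "w \<in> G 0" for w
  proof -
    have "x \<bullet> x \<bullet> w = \<zero>" using G_br_same[OF x G_br0(2)[OF x w] s] .
    then show ?thesis using G_in[OF w] by (simp add: ad_square)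
  qed
  \<comment> \<open>By \<open>ad_cube\<close> all unwanted words coincide with \<open>S\<close>.
    They enter with total coefficient -2 through \<open>cB\<close> and +2 through \<open>cA\<close>,
    and so cancel.\<close>
  define S where "S = x \<bullet> y \<bullet> x \<bullet> y \<bullet> x \<bullet> x \<bullet> z"
  have [simp]: "S \<in> carrier L" by (simp add: S_def)
  have S1: "x \<bullet> y \<bullet> x \<bullet> x \<bullet> y \<bullet> x \<bullet> z = S" by (simp add: S_def ad_cube[OF s x y z])
  have S2: "x \<bullet> x \<bullet> y \<bullet> x \<bullet> y \<bullet> x \<bullet> z = S" using S1 by (simp add: ad_cube[OF s x y yxz])
  have cz: "(x \<bullet> x \<bullet> y) \<bullet> z = y \<bullet> x \<bullet> x \<bullet> z \<ominus> (x \<bullet> y \<bullet> x \<bullet> z \<oplus> x \<bullet> y \<bullet> x \<bullet> z)"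
    by (simp add: ad_square yz M.ab_simps)
  have cA: "(x \<bullet> x \<bullet> y) \<bullet> (x \<bullet> y \<bullet> x \<bullet> z) = S \<ominus> (S \<oplus> S)"
    unfolding c0[OF A] S1 S2 ..
  have cB: "(x \<bullet> x \<bullet> y) \<bullet> (y \<bullet> x \<bullet> x \<bullet> z) = x \<bullet> x \<bullet> y \<bullet> y \<bullet> x \<bullet> x \<bullet> z \<ominus> (S \<oplus> S)"
    unfolding c0[OF B] S_def ..
  have "(x \<bullet> x \<bullet> y) \<bullet> (x \<bullet> x \<bullet> y) \<bullet> z =
      (x \<bullet> x \<bullet> y) \<bullet> (y \<bullet> x \<bullet> x \<bullet> z) \<ominus> ((x \<bullet> x \<bullet> y) \<bullet> (x \<bullet> y \<bullet> x \<bullet> z) \<oplus> (x \<bullet> x \<bullet> y) \<bullet> (x \<bullet> y \<bullet> x \<bullet> z))"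
    unfolding cz by (simp add: br_add2 br_diff2)
  also have "\<dots> = x \<bullet> x \<bullet> y \<bullet> y \<bullet> x \<bullet> x \<bullet> z"
    unfolding cA cB by (simp add: M.ab_simps)
  finally show ?thesis .
qed

lemma ideal_br_deg:
  assumes I: "lie_ideal \<Phi> L I" and x: "x \<in> I" "x \<in> G i" and y: "y \<in> G j"
  shows "x \<bullet> y \<in> I \<inter> G (i + j)" "y \<bullet> x \<in> I \<inter> G (i + j)"
  using idealD(2,3)[OF I G_in[OF y] x(1)] G_br[OF x(2) y] G_br[OF y x(2)] by (auto simp: add.commute)

text \<open>The element is killed in stages. The hypothesis yields (ad w)^2 (ad u)^2 y = 0 for w in
  I; by the fundamental formula and \<open>nd\<close>, (ad u)^2 then kills the part of I of degree
  -s. Since (ad x)^2 (ad u)^2 y lies in that part, the same argument shows that (ad u)^2 kills all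
  of degree -s, and a last use of \<open>nd\<close> gives u = 0.\<close>

lemma ideal_separating:
  assumes s: "s = 1 \<or> s = -1" and I: "lie_ideal \<Phi> L I" and u: "u \<in> I" "u \<in> G s"
    and zero: "\<And>y w. \<lbrakk>y \<in> I; y \<in> G (- s); w \<in> I; w \<in> G (- s)\<rbrakk> \<Longrightarrow> y \<bullet> w \<bullet> u = \<zero>"
  shows "u = \<zero>"
proof -
  have s': "- s = 1 \<or> - s = -1" using s by auto
  have uc [simp]: "u \<in> carrier L" using G_in u by blast
  have 1: "w \<bullet> w \<bullet> u \<bullet> u \<bullet> y = \<zero>" if w: "w \<in> I" "w \<in> G (- s)" and y: "y \<in> G (- s)" for w y
  proof -
    have [simp]: "w \<in> carrier L" "y \<in> carrier L" using G_in w y by auto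
    \<comment> \<open>Moving w past u costs d = [w,u]. The hypothesis says directly that w commutes
      with d, and for the pair [d,y], w it gives [d,[d,y]] = 0.\<close>
    define d where "d = w \<bullet> u"
    have d: "d \<in> I" "d \<in> G 0" using ideal_br_deg(2)[OF I u w(2)] unfolding d_def by auto
    have dc [simp]: "d \<in> carrier L" using G_in d by blast
    have wd: "w \<bullet> d = \<zero>" using zero w unfolding d_def by blast
    have dy: "d \<bullet> y \<in> I" "d \<bullet> y \<in> G (- s)" using ideal_br_deg(1)[OF I d y] by auto
    have "(d \<bullet> y) \<bullet> d = \<zero>" using zero[OF dy w] unfolding d_def .
    then have ddy: "d \<bullet> d \<bullet> y = \<zero>" using br_anti[of d "d \<bullet> y"] by simp
    have wu: "w \<bullet> u \<bullet> v = d \<bullet> v \<oplus> u \<bullet> w \<bullet> v" if "v \<in> carrier L" for v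
      using br_jacobi[of w u v] that by (simp add: d_def)
    have wdv: "w \<bullet> d \<bullet> v = d \<bullet> w \<bullet> v" if "v \<in> carrier L" for v
      using br_jacobi[of w d v] that by (simp add: wd)
    have wy: "w \<bullet> y = \<zero>" using G_br_same[OF w(2) y s'] .
    have wdy: "w \<bullet> d \<bullet> y = \<zero>" using G_br_same[OF w(2) dy(2) s'] .
    have wuy: "w \<bullet> u \<bullet> y = d \<bullet> y" using wu[of y] by (simp add: wy)
    have wuuy: "w \<bullet> u \<bullet> u \<bullet> y = d \<bullet> u \<bullet> y \<oplus> u \<bullet> d \<bullet> y" using wu[of "u \<bullet> y"] by (simp add: wuy)
    have "w \<bullet> d \<bullet> u \<bullet> y = \<zero>" using wdv[of "u \<bullet> y"] by (simp add: wuy ddy)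
    moreover have "w \<bullet> u \<bullet> d \<bullet> y = \<zero>" using wu[of "d \<bullet> y"] by (simp add: wdy ddy)
    ultimately show ?thesis unfolding wuuy by (simp add: br_add2)
  qed
  have 2: "u \<bullet> u \<bullet> w = \<zero>" if w: "w \<in> I" "w \<in> G (- s)" for w
  proof (rule nd[OF s])
    show "u \<bullet> u \<bullet> w \<in> G s" using G_br0(2)[OF u(2) G_br_pm(1)[OF u(2) w(2)]] .
    fix y assume y: "y \<in> G (- s)"
    show "(u \<bullet> u \<bullet> w) \<bullet> (u \<bullet> u \<bullet> w) \<bullet> y = \<zero>"
      unfolding fundamental[OF s u(2) w(2) y] 1[OF w y] by simp
  qed
  have 3: "u \<bullet> u \<bullet> x = \<zero>" if x: "x \<in> G (- s)" for x
  proof (rule nd[OF s])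
    show "u \<bullet> u \<bullet> x \<in> G s" using G_br0(2)[OF u(2) G_br_pm(1)[OF u(2) x]] .
    fix y assume y: "y \<in> G (- s)"
    have uy: "u \<bullet> y \<in> I" "u \<bullet> y \<in> G 0" using ideal_br_deg(1)[OF I u y] by auto
    have uuy: "u \<bullet> u \<bullet> y \<in> I" "u \<bullet> u \<bullet> y \<in> G s" using ideal_br_deg(2)[OF I uy u(2)] by auto
    have xuuy: "x \<bullet> u \<bullet> u \<bullet> y \<in> I" "x \<bullet> u \<bullet> u \<bullet> y \<in> G 0" using ideal_br_deg(2)[OF I uuy x] by auto
    have "x \<bullet> x \<bullet> u \<bullet> u \<bullet> y \<in> I" "x \<bullet> x \<bullet> u \<bullet> u \<bullet> y \<in> G (- s)" using ideal_br_deg(2)[OF I xuuy x] by auto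
    then show "(u \<bullet> u \<bullet> x) \<bullet> (u \<bullet> u \<bullet> x) \<bullet> y = \<zero>"
      unfolding fundamental[OF s u(2) x y] by (rule 2)
  qed
  show ?thesis by (rule nd[OF s u(2) 3])
qed

lemma separating:
  assumes s: "s = 1 \<or> s = -1" and u: "u \<in> G s"
    and zero: "\<And>y w. \<lbrakk>y \<in> G (- s); w \<in> G (- s)\<rbrakk> \<Longrightarrow> y \<bullet> w \<bullet> u = \<zero>"
  shows "u = \<zero>"
  using ideal_separating[OF s ideal_carrier G_in[OF u] u] zero by blast

text \<open>If w kills degree s, then for y of degree -s and x, z of degree s the element [x,[w,y]]
  = [w,[x,y]] kills z, since [x,y] preserves degree s. So [w,y] meets the hypothesis of
  \<open>separating\<close>.\<close>

lemma faithful_half: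
  assumes s: "s = 1 \<or> s = -1" and w: "w \<in> G 0" and zero: "\<And>x. x \<in> G s \<Longrightarrow> w \<bullet> x = \<zero>"
  shows "w = \<zero>"
proof -
  have s': "- s = 1 \<or> - s = -1" using s by auto
  have [simp]: "w \<in> carrier L" using G_in w by blast
  have "w \<bullet> y = \<zero>" if y: "y \<in> G (- s)" for y
  proof (rule separating[OF s' G_br0(1)[OF w y]])
    fix z x assume z: "z \<in> G (- (- s))" and x: "x \<in> G (- (- s))"
    then have zx: "z \<in> G s" "x \<in> G s" by auto
    have [simp]: "z \<in> carrier L" "x \<in> carrier L" "y \<in> carrier L" using G_in x y z by auto
    have xy: "x \<bullet> y \<in> G 0" using G_br_pm(1)[OF zx(2) y] .
    have "w \<bullet> x \<bullet> y = x \<bullet> w \<bullet> y" using br_jacobi[of w x y] zero[OF zx(2)] by simp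
    moreover have "(w \<bullet> x \<bullet> y) \<bullet> z = \<zero>"
      using br_jacobi1[of w "x \<bullet> y" z] zero[OF zx(1)] zero[OF G_br0(1)[OF xy zx(1)]] by (simp add: M.diff_zero)
    ultimately have "(x \<bullet> w \<bullet> y) \<bullet> z = \<zero>" by simp
    then show "z \<bullet> x \<bullet> w \<bullet> y = \<zero>" using br_anti[of z "x \<bullet> w \<bullet> y"] by simp
  qed
  then show ?thesis using faithful[OF w] zero s by auto
qed

lemma ideal_meets_G1:
  assumes I: "lie_ideal \<Phi> L I" and x: "x \<in> I" "x \<noteq> \<zero>"
  obtains u where "u \<in> I" "u \<in> G 1" "u \<noteq> \<zero>"
proof (rule ccontr)
  note found = that
  assume "\<not> thesis"
  then have no: "u = \<zero>" if "u \<in> I" "u \<in> G 1" for u using found that by blast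
  have xc [simp]: "x \<in> carrier L" using idealD(4)[OF I x(1)] .
  have px: "p 1 x \<in> G 1" "p 0 x \<in> G 0" "p (-1) x \<in> G (-1)" using p_deg xc by auto
  have [simp]: "p 1 x \<in> carrier L" "p 0 x \<in> carrier L" "p (-1) x \<in> carrier L" using G_in px by blast+
  have yx: "y \<bullet> x = y \<bullet> p 0 x \<oplus> y \<bullet> p (-1) x" if y: "y \<in> G 1" for y
  proof -
    have "y \<bullet> p 1 x = \<zero>" using G_br_same[OF y px(1)] by simp
    then show ?thesis using G_in[OF y] arg_cong[OF p_decomp[OF xc], of "\<lambda>x. y \<bullet> x"] by (simp add: br_add2)
  qed
  have yyx: "y \<bullet> y \<bullet> p (-1) x = \<zero>" if y: "y \<in> G 1" for y
  proof -
    have [simp]: "y \<in> carrier L" using G_in y .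
    have "y \<bullet> y \<bullet> p 0 x = \<zero>" using G_br_same[OF y G_br0(2)[OF y px(2)]] by simp
    then have "y \<bullet> y \<bullet> x = y \<bullet> y \<bullet> p (-1) x" by (simp add: yx[OF y] br_add2)
    moreover have "y \<bullet> y \<bullet> x \<in> I" using idealD(2)[OF I] x by simp
    moreover have "y \<bullet> y \<bullet> p (-1) x \<in> G 1" using G_br0(2)[OF y G_br_pm(1)[OF y px(3)]] .
    ultimately show ?thesis using no by simp
  qed
  have "p (-1) x = \<zero>"
  proof (rule separating[OF _ px(3)])
    fix y w assume "y \<in> G (- (- 1))" "w \<in> G (- (- 1))"
    then have yw: "y \<in> G 1" "w \<in> G 1" by auto
    have [simp]: "y \<in> carrier L" "w \<in> carrier L" using G_in yw by auto
    \<comment> \<open>Elements of degree 1 commute, so the two polarized terms are equal and 2 can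
      be cancelled.\<close>
    have "y \<bullet> w \<bullet> p (-1) x \<oplus> w \<bullet> y \<bullet> p (-1) x = \<zero>"
      by (rule polarize2[where U = "G 1" and F = "\<lambda>y w. y \<bullet> w \<bullet> p (-1) x"])
        (auto simp: G_in yyx yw br_lin intro: G_intros)
    moreover have "y \<bullet> w \<bullet> p (-1) x = w \<bullet> y \<bullet> p (-1) x"
      using br_jacobi[of y w "p (-1) x"] G_br_same[OF yw] by simp
    ultimately show "y \<bullet> w \<bullet> p (-1) x = \<zero>" by (intro two_cancel[of "y \<bullet> w \<bullet> p (-1) x"]) simp_all
  qed simp
  then have yx': "y \<bullet> x = y \<bullet> p 0 x" if "y \<in> G 1" for y using yx[OF that] G_in[OF that] by simp
  have "p 0 x = \<zero>"
  proof (rule faithful_half[of 1, OF _ px(2)])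
    fix y assume y: "y \<in> G 1"
    have "y \<bullet> p 0 x = \<zero>"
      using no[of "y \<bullet> p 0 x"] idealD(2)[OF I G_in[OF y] x(1)] yx'[OF y] G_br0(2)[OF y px(2)] by simp
    then show "p 0 x \<bullet> y = \<zero>" using br_anti[of "p 0 x" y] G_in[OF y] by simp
  qed simp
  then have "x = p 1 x" using p_decomp[OF xc] \<open>p (-1) x = \<zero>\<close> by simp
  then show False using no[of x] x px(1) by simp
qed

sublocale lie_sp \<Phi> L
proof
  fix I assume I: "lie_ideal \<Phi> L I" and ab: "\<And>x y. \<lbrakk>x \<in> I; y \<in> I\<rbrakk> \<Longrightarrow> x \<otimes> y = \<zero>"
  show "I = {\<zero>}"
  proof (rule ccontr)
    assume "I \<noteq> {\<zero>}"
    then obtain x where "x \<in> I" "x \<noteq> \<zero>" using ideal_nonzeroE[OF I] by blast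
    then obtain u where u: "u \<in> I" "u \<in> G 1" "u \<noteq> \<zero>" using ideal_meets_G1[OF I] by blast
    have "u \<bullet> u \<bullet> y = \<zero>" if "y \<in> G (-1)" for y
      using ab[OF u(1) idealD(3)[OF I G_in[OF that] u(1)]] .
    then show False using nondegenerate u by blast
  qed
qed

text \<open>As e kills degree 0 of I, the derivation rule gives e [a,[a,x]] = [b,[a,x]] with b = e
  a. By \<open>nd\<close> and the fundamental formula it suffices that (ad a)^2 (ad b)^2 (ad a)^2 x
  = 0, and the two operators ad b are traded for applications of e.\<close>

lemma degree_two_square_zero:
  assumes e: "pder I e" and deg: "\<And>j x. \<lbrakk>x \<in> I; x \<in> G j\<rbrakk> \<Longrightarrow> e x \<in> G (j + 2)"
    and a: "a \<in> I" "a \<in> G (-1)"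
  shows "a \<bullet> a \<bullet> e a = \<zero>"
proof -
  note I = pderD(2)[OF e]
  define b where "b = e a"
  have b: "b \<in> G 1" using deg[OF a] unfolding b_def by simp
  have [simp]: "a \<in> carrier L" "b \<in> carrier L" using G_in a b by auto
  have e0: "e x = \<zero>" if "x \<in> I" "x \<in> G 0" for x
    using deg[OF that] by (intro G_eq_zero) auto
  have e1: "e w \<in> G 1" if "w \<in> I" "w \<in> G (-1)" for w using deg[OF that] by simp
  have ew: "a \<bullet> e w = \<ominus> (b \<bullet> w)" if w: "w \<in> I" "w \<in> G (-1)" for w
  proof -
    have "a \<bullet> w = \<zero>" using G_br_same a w by simp
    then have "b \<bullet> w \<oplus> a \<bullet> e w = \<zero>" using pderD(7)[OF e a(1) w(1)] pder_zero[OF e] b_def by simp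
    moreover have "b \<bullet> w \<in> carrier L" "a \<bullet> e w \<in> carrier L" using G_in w e1[OF w] by auto
    ultimately show ?thesis using M.minus_equality M.a_comm by metis
  qed
  have aa: "a \<bullet> x \<in> I" "a \<bullet> x \<in> G 0" "a \<bullet> a \<bullet> x \<in> I" "a \<bullet> a \<bullet> x \<in> G (-1)" if x: "x \<in> G 1" for x
  proof -
    show ax: "a \<bullet> x \<in> I" "a \<bullet> x \<in> G 0" using ideal_br_deg(1)[OF I a x] by auto
    show "a \<bullet> a \<bullet> x \<in> I" "a \<bullet> a \<bullet> x \<in> G (-1)" using ideal_br_deg(2)[OF I ax a(2)] by auto
  qed
  have eaa: "e (a \<bullet> a \<bullet> x) = b \<bullet> a \<bullet> x" if x: "x \<in> G 1" for x
    using pderD(7)[OF e a(1) aa(1)[OF x]] e0[OF aa(1,2)[OF x]] G_in[OF x] pderD(3)[OF e a(1)] by (simp add: b_def)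
  \<comment> \<open>This is the argument that e receives once (ad b)^2 (ad a)^2 x has been rewritten
    by \<open>bbw\<close> and \<open>eaa\<close>.\<close>
  have U: "a \<bullet> a \<bullet> b \<bullet> a \<bullet> x = \<zero>" if x: "x \<in> G 1" for x
  proof -
    have [simp]: "x \<in> carrier L" using G_in x .
    define u where "u = a \<bullet> a \<bullet> b \<bullet> a \<bullet> x"
    define v where "v = a \<bullet> b \<bullet> a \<bullet> a \<bullet> x"
    define c where "c = a \<bullet> a \<bullet> b"
    have [simp]: "u \<in> carrier L" "v \<in> carrier L" "c \<in> carrier L" by (simp_all add: u_def v_def c_def)
    have "a \<bullet> e (a \<bullet> a \<bullet> x) = \<ominus> (b \<bullet> a \<bullet> a \<bullet> x)" using ew[OF aa(3,4)[OF x]] .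
    then have v: "v = \<ominus> u" unfolding eaa[OF x] u_def v_def by (simp add: br_uminus2)
    have c: "c \<in> G (-1)" using aa(4)[OF b] unfolding c_def .
    have bx: "b \<bullet> x = \<zero>" using G_br_same b x by simp
    have aaax: "a \<bullet> a \<bullet> a \<bullet> x = \<zero>" using G_br_same a aa(4)[OF x] by simp
    \<comment> \<open>Expanding both sides of \<open>a \<bullet> c \<bullet> x = c \<bullet> a \<bullet> x\<close> gives \<open>-3u = 3u\<close>.\<close>
    have "a \<bullet> c = \<zero>" using G_br_same a c by simp
    then have "a \<bullet> c \<bullet> x = c \<bullet> a \<bullet> x" using br_jacobi[of a c x] by simp
    moreover have "a \<bullet> c \<bullet> x = v \<ominus> (u \<oplus> u)"
      unfolding c_def by (simp add: ad_square bx br_lin u_def v_def M.ab_simps)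
    moreover have "c \<bullet> a \<bullet> x = u \<ominus> (v \<oplus> v)"
      unfolding c_def by (simp add: ad_square aaax u_def v_def M.ab_simps)
    ultimately have "v \<ominus> (u \<oplus> u) = u \<ominus> (v \<oplus> v)" by simp
    then have "(u \<oplus> u \<oplus> u) \<oplus> (u \<oplus> u \<oplus> u) = \<zero>" unfolding v by (simp add: M.ab_simps)
    then have "u \<oplus> u \<oplus> u = \<zero>" by (rule two_cancel[rotated]) simp_all
    then have "u = \<zero>" by (rule three_cancel[rotated]) simp_all
    then show ?thesis unfolding u_def .
  qed
  have bbw: "b \<bullet> b \<bullet> w = \<ominus> e (a \<bullet> a \<bullet> e w)" if w: "w \<in> I" "w \<in> G (-1)" for w
  proof -
    have "e (a \<bullet> a \<bullet> e w) = b \<bullet> a \<bullet> e w" using eaa[OF e1[OF w]] .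
    also have "\<dots> = \<ominus> (b \<bullet> b \<bullet> w)" using G_in w by (simp add: ew[OF w] br_uminus2)
    finally show ?thesis using G_in w by simp
  qed
  show ?thesis unfolding b_def[symmetric]
  proof (rule nd[of "-1"])
    show "a \<bullet> a \<bullet> b \<in> G (-1)" using aa(4)[OF b] .
    fix x assume "x \<in> G (- (- 1))"
    then have x: "x \<in> G 1" by simp
    have "b \<bullet> b \<bullet> a \<bullet> a \<bullet> x = \<zero>"
      unfolding bbw[OF aa(3,4)[OF x]] eaa[OF x] U[OF x] by (simp add: pder_zero[OF e])
    then show "(a \<bullet> a \<bullet> b) \<bullet> (a \<bullet> a \<bullet> b) \<bullet> x = \<zero>"
      using fundamental[of "-1" a b x] a b x by simp
  qed simp
qed

text \<open>On the degree -1 part of I the map (x,y,z) to [x,[y,e z]] is symmetric: x and y commute,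
  and e [y,z] = 0 gives [y,e z] = [z,e y]. Its diagonal vanishes, so six times it is zero. Then
  \<open>ideal_separating\<close> applies to e z, which is why e z has to lie in I.\<close>

lemma degree_two_zero:
  assumes e: "pder I e" and deg: "\<And>j x. \<lbrakk>x \<in> I; x \<in> G j\<rbrakk> \<Longrightarrow> e x \<in> G (j + 2)"
    and z: "z \<in> I" "z \<in> G (-1)" "e z \<in> I"
  shows "e z = \<zero>"
proof (rule ideal_separating[of 1, OF _ pderD(2)[OF e] z(3)])
  note I = pderD(2)[OF e]
  define U where "U = I \<inter> G (-1)"
  have Us: "submodule U \<Phi> L" unfolding U_def by (rule submodule_inter[OF idealD(1)[OF I] G_sub])
  have U1: "e w \<in> G 1" "e w \<in> carrier L" "w \<in> carrier L" "w \<in> I" "w \<in> G (-1)" if "w \<in> U" for w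
    using that deg[of w "-1"] G_in unfolding U_def by auto
  show "e z \<in> G 1" using deg[OF z(1,2)] by simp
  fix x y assume "x \<in> I" "x \<in> G (-1)" "y \<in> I" "y \<in> G (-1)"
  then have xyz: "x \<in> U" "y \<in> U" "z \<in> U" using z unfolding U_def by auto
  define F where "F = (\<lambda>x y z. x \<bullet> y \<bullet> e z)"
  have Fc: "F x y z \<in> carrier L" if "x \<in> U" "y \<in> U" "z \<in> U" for x y z
    using that U1 unfolding F_def by auto
  have "F x y z \<oplus> F y x z \<oplus> F x z y \<oplus> F z x y \<oplus> F y z x \<oplus> F z y x = \<zero>"
    by (rule polarize3[where U = U])
      (use U1 xyz submodule_intros[OF Us] pderD(5)[OF e] degree_two_square_zero[OF e deg]
        in \<open>auto simp: F_def br_lin\<close>)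
  moreover have sw1: "F x y z = F y x z" if h: "x \<in> U" "y \<in> U" "z \<in> U" for x y z
  proof -
    have "x \<bullet> y = \<zero>" using G_br_same[OF U1(5)[OF h(1)] U1(5)[OF h(2)]] by simp
    then show ?thesis using br_jacobi[of x y "e z"] U1[OF h(1)] U1[OF h(2)] U1[OF h(3)] unfolding F_def by simp
  qed
  moreover have sw2: "F x y z = F x z y" if h: "x \<in> U" "y \<in> U" "z \<in> U" for x y z
  proof -
    have "y \<bullet> z = \<zero>" using G_br_same[OF U1(5)[OF h(2)] U1(5)[OF h(3)]] by simp
    then have "e y \<bullet> z \<oplus> y \<bullet> e z = \<zero>" using pderD(7)[OF e, of y z] U1(4) h pder_zero[OF e] by simp
    then have "y \<bullet> e z = \<ominus> (e y \<bullet> z)"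
      using U1[OF h(2)] U1[OF h(3)] M.minus_equality M.a_comm by (metis br_closed)
    then have "y \<bullet> e z = z \<bullet> e y" using br_anti[of z "e y"] U1[OF h(2)] U1[OF h(3)] by simp
    then show ?thesis unfolding F_def by simp
  qed
  define f where "f = F x y z"
  have fc: "f \<in> carrier L" unfolding f_def using Fc xyz by blast
  have "F y x z = f" "F x z y = f" "F z x y = f" "F y z x = f" "F z y x = f"
    using sw1 sw2 xyz unfolding f_def by metis+
  ultimately have "f \<oplus> f \<oplus> f \<oplus> f \<oplus> f \<oplus> f = \<zero>" unfolding f_def by simp
  then have "(f \<oplus> f \<oplus> f) \<oplus> (f \<oplus> f \<oplus> f) = \<zero>" using fc by (simp add: M.a_ac)
  then have "f \<oplus> f \<oplus> f = \<zero>" by (rule two_cancel[rotated]) (simp_all add: fc)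
  then show "x \<bullet> y \<bullet> e z = \<zero>" using three_cancel[OF fc] unfolding f_def F_def by simp
qed simp

end


section \<open>Subsystems of Jordan triple systems\<close>

context module
begin

text \<open>Negation and subtraction are defined through the carrier, so they have to be compared
  after shrinking it. \<open>N\<close> is any record over the same operations, which covers carrier
  updates as well as separately built records such as \<open>Q1\<close>.\<close>

lemma submodule_module:
  fixes N :: "('a, 'c, 'x) module_scheme"
  assumes U: "submodule U R M" and N: "carrier N = U" "add N = add M" "zero N = zero M" "smult N = smult M"
  shows "module R N" and "\<And>x. x \<in> U \<Longrightarrow> \<ominus>\<^bsub>N\<^esub> x = \<ominus>\<^bsub>M\<^esub> x"
    and "\<And>x y. \<lbrakk>x \<in> U; y \<in> U\<rbrakk> \<Longrightarrow> x \<ominus>\<^bsub>N\<^esub> y = x \<ominus>\<^bsub>M\<^esub> y"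
proof -
  note i = submodule_in[OF U] submodule_intros[OF U]
  show mod: "module R N"
  proof (rule moduleI[OF R.is_cring])
    show "abelian_group N"
    proof (rule abelian_groupI)
      fix x assume "x \<in> carrier N"
      then show "\<exists>y\<in>carrier N. y \<oplus>\<^bsub>N\<^esub> x = \<zero>\<^bsub>N\<^esub>"
        using i by (auto simp: N M.l_neg intro!: bexI[of _ "\<ominus>\<^bsub>M\<^esub> x"])
    qed (auto simp: N i M.a_assoc intro: M.a_comm)
  qed (auto simp: N i smult_l_distr smult_r_distr smult_assoc1)
  interpret N: module R N by fact
  show neg: "\<ominus>\<^bsub>N\<^esub> x = \<ominus>\<^bsub>M\<^esub> x" if "x \<in> U" for x
    using that i by (intro N.M.minus_equality) (auto simp: N M.l_neg)
  show "x \<ominus>\<^bsub>N\<^esub> y = x \<ominus>\<^bsub>M\<^esub> y" if "x \<in> U" "y \<in> U" for x y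
    using that by (simp add: a_minus_def neg N)
qed

lemma submodule_restrict:
  fixes N :: "('a, 'c, 'x) module_scheme"
  assumes U: "submodule U R M" and N: "carrier N = U" "add N = add M" "zero N = zero M" "smult N = smult M"
    and V: "submodule V R M" "V \<subseteq> U"
  shows "submodule V R N"
proof -
  interpret N: module R N by (rule submodule_module[OF U N])
  have n: "\<ominus>\<^bsub>N\<^esub> x = \<ominus>\<^bsub>M\<^esub> x" if "x \<in> V" for x
    using submodule_module(2)[OF U N] that V(2) by auto
  show ?thesis
    by (rule N.submoduleI) (use V in \<open>auto simp: n N intro: submodule_intros[OF V(1)]\<close>)
qed

lemma submodule_unrestrict:
  assumes U: "submodule U R M" and V: "submodule V R (M\<lparr>carrier := U\<rparr>)"
  shows "submodule V R M" "V \<subseteq> U"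
proof -
  interpret N: module R "M\<lparr>carrier := U\<rparr>" by (rule submodule_module[OF U]) simp_all
  show VU: "V \<subseteq> U" using N.submodule_in[OF V] by auto
  have n: "\<ominus>\<^bsub>M\<^esub> x \<in> V" if "x \<in> V" for x
    using N.submodule_uminus[OF V that] submodule_module(2)[OF U, of "M\<lparr>carrier := U\<rparr>" x] that VU by auto
  show "submodule V R M"
    by (rule submoduleI)
      (use VU submodule_in[OF U] n N.submodule_zero[OF V] N.submodule_add[OF V] N.submodule_smult[OF V] in auto)
qed

end

context jts6
begin

lemma subsystem_trip:
  assumes K: "jts_subsystem \<Phi> T K" and x: "x \<in> K" "y \<in> K" "z \<in> K"
  shows "trip (T\<lparr>carrier := K\<rparr>) x y z = trip T x y z" "trip T x y z \<in> K"
proof -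
  have s: "submodule K \<Phi> T" and q: "\<And>x y. \<lbrakk>x \<in> K; y \<in> K\<rbrakk> \<Longrightarrow> quad T x y \<in> K"
    using K unfolding jts_subsystem_def by auto
  note d = submodule_module(3)[OF s, of "T\<lparr>carrier := K\<rparr>"]
  show "trip (T\<lparr>carrier := K\<rparr>) x y z = trip T x y z"
    unfolding trip_def using x by (simp add: d q submodule_intros[OF s])
  show "trip T x y z \<in> K"
    unfolding trip_def using x by (simp add: q submodule_intros[OF s])
qed

lemma subsystem_jts6:
  assumes K: "jts_subsystem \<Phi> T K"
  shows "jts6 \<Phi> (T\<lparr>carrier := K\<rparr>)"
proof -
  have s: "submodule K \<Phi> T" and q: "\<And>x y. \<lbrakk>x \<in> K; y \<in> K\<rbrakk> \<Longrightarrow> quad T x y \<in> K"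
    using K unfolding jts_subsystem_def by auto
  interpret N: module \<Phi> "T\<lparr>carrier := K\<rparr>" by (rule submodule_module(1)[OF s]) simp_all
  note t = subsystem_trip[OF K]
  have c: "x \<in> carrier T" if "x \<in> K" for x using submodule_in[OF s that] .
  show ?thesis
    by unfold_locales
      (use q c t submodule_intros[OF s] in
        \<open>simp_all add: six_unit quad_add quad_smult quad_homogeneous trip_add trip_smult JT1 JT2 JT3\<close>)
qed

text \<open>\<open>quad\<close> is half a triple product, so closure under the trilinear product
  suffices.\<close>

lemma jts_idealI:
  assumes I: "submodule I \<Phi> T"
    and t: "\<And>x y z. \<lbrakk>x \<in> I; y \<in> carrier T; z \<in> carrier T\<rbrakk> \<Longrightarrow> trip T x y z \<in> I"
      "\<And>x y z. \<lbrakk>x \<in> I; y \<in> carrier T; z \<in> carrier T\<rbrakk> \<Longrightarrow> trip T y x z \<in> I"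
  shows "jts_ideal \<Phi> T I"
  unfolding jts_ideal_def
proof (intro conjI ballI I)
  fix x y assume x: "x \<in> I" and y: "y \<in> carrier T"
  have xc: "x \<in> carrier T" using submodule_in[OF I x] .
  show "quad T x y \<in> I" "quad T y x \<in> I"
    using x y xc t by (auto simp: quad_eq intro!: submodule_smult[OF I])
  fix z assume z: "z \<in> carrier T"
  show "trip T z y x \<in> I" if "x \<in> I" for x using t(1)[OF that y z] trip_sym[of z y x] y z submodule_in[OF I that] by simp
qed

lemma jts_idealD:
  assumes I: "jts_ideal \<Phi> T I" and x: "x \<in> I" "y \<in> carrier T" "z \<in> carrier T"
  shows "trip T x y z \<in> I" "trip T y x z \<in> I" "trip T y z x \<in> I" "x \<in> carrier T"
proof -
  have s: "submodule I \<Phi> T" using I unfolding jts_ideal_def by simp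
  show xc: "x \<in> carrier T" using submodule_in[OF s x(1)] .
  show "trip T y z x \<in> I" using I x unfolding jts_ideal_def by simp
  have "trip T z y x \<in> I" using I x unfolding jts_ideal_def by simp
  then show "trip T x y z \<in> I" using trip_sym x xc by simp
  show "trip T y x z \<in> I" unfolding trip_def
    using I x unfolding jts_ideal_def by (intro submodule_diff[OF s]) auto
qed

text \<open>For x in an ideal I with P_I I = 0, the fundamental formula gives P_{P_x y} z = P_x (P_y
  P_x z) = 0, because P_y P_x z lies in I. Nondegeneracy is then used twice, for P_x y and for
  x.\<close>

lemma strongly_nondegenerate_semiprime:
  assumes "strongly_nondegenerate T"
  shows "jts_semiprime \<Phi> T"
  unfolding jts_semiprime_def
proof (intro allI impI, elim conjE)
  fix I assume I: "jts_ideal \<Phi> T I" and zero: "\<forall>x\<in>I. \<forall>y\<in>I. quad T x y = \<zero>"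
  have s: "submodule I \<Phi> T" using I unfolding jts_ideal_def by simp
  have q: "quad T x y \<in> I" "quad T y x \<in> I" if "x \<in> I" "y \<in> carrier T" for x y
    using I that unfolding jts_ideal_def by auto
  have c: "\<And>x. x \<in> I \<Longrightarrow> x \<in> carrier T" using submodule_in[OF s] .
  have "x = \<zero>" if x: "x \<in> I" for x
  proof -
    have "quad T x y = \<zero>" if y: "y \<in> carrier T" for y
    proof -
      have "quad T (quad T x y) z = \<zero>" if z: "z \<in> carrier T" for z
      proof -
        have "quad T y (quad T x z) \<in> I" using q x y z by blast
        then show ?thesis using JT3[OF c[OF x] y z] zero x by simp
      qed
      then show ?thesis using assms quad_closed[OF c[OF x] y] unfolding strongly_nondegenerate_def by blast
    qed
    then show ?thesis using assms c[OF x] unfolding strongly_nondegenerate_def by blast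
  qed
  then show "I = {\<zero>}" using submodule_zero[OF s] by blast
qed

end

section \<open>The degree one component of the algebra of quotients\<close>

context gr3
begin

abbreviation graded :: "'a set \<Rightarrow> bool" where "graded \<equiv> graded_ideal \<Phi> L G"

text \<open>Replaces the span in \<open>graded_ideal\<close> by closure under the projections, the
  form that passes easily to intersections and to images under \<open>\<theta>\<close>.\<close>

lemma gradedD:
  assumes "graded I"
  shows "lie_ideal \<Phi> L I" "\<And>x k. x \<in> I \<Longrightarrow> p k x \<in> I"
proof -
  show I: "lie_ideal \<Phi> L I" using assms unfolding graded_ideal_def by simp
  have eq: "I = mspan \<Phi> L (\<Union>j. I \<inter> G j)" using assms unfolding graded_ideal_def by simp
  note s = idealD(1)[OF I]
  show "p k x \<in> I" if "x \<in> I" for x k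
  proof -
    have "submodule {x \<in> carrier L. p k x \<in> I} \<Phi> L"
      by (rule submodule_linear_set[OF submodule_carrier module_axioms _ _ _ s])
        (auto simp: p_add p_smult G_in[OF p_deg])
    moreover have "(\<Union>j. I \<inter> G j) \<subseteq> {x \<in> carrier L. p k x \<in> I}"
    proof safe
      fix x j assume x: "x \<in> I" "x \<in> G j"
      then show "x \<in> carrier L" using G_in by blast
      show "p k x \<in> I" using x p_same[of x k] p_other[of x j k] submodule_zero[OF s] by (cases "j = k") auto
    qed
    ultimately show ?thesis using mspan_least that eq by blast
  qed
qed

lemma gradedI:
  assumes I: "lie_ideal \<Phi> L I" and pI: "\<And>x k. x \<in> I \<Longrightarrow> p k x \<in> I"
  shows "graded I"
  unfolding graded_ideal_def
proof (intro conjI I subset_antisym)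
  have sub: "(\<Union>j. I \<inter> G j) \<subseteq> carrier L" using G_in by blast
  show "I \<subseteq> mspan \<Phi> L (\<Union>j. I \<inter> G j)"
  proof
    fix x assume x: "x \<in> I"
    then have xc: "x \<in> carrier L" using idealD(4)[OF I] by blast
    have "p k x \<in> mspan \<Phi> L (\<Union>j. I \<inter> G j)" for k
      using pI[OF x] p_deg[OF xc] by (intro mspan_incl) auto
    then have "p 1 x \<oplus> p 0 x \<oplus> p (-1) x \<in> mspan \<Phi> L (\<Union>j. I \<inter> G j)"
      by (intro submodule_add[OF mspan_submodule[OF sub]])
    then show "x \<in> mspan \<Phi> L (\<Union>j. I \<inter> G j)" using p_decomp[OF xc] by simp
  qed
  show "mspan \<Phi> L (\<Union>j. I \<inter> G j) \<subseteq> I" by (rule mspan_least[OF idealD(1)[OF I]]) blast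
qed

lemma graded_carrier: "graded (carrier L)"
  by (rule gradedI[OF ideal_carrier]) (rule G_in[OF p_deg])

lemma graded_inter: "\<lbrakk>graded I; graded J\<rbrakk> \<Longrightarrow> graded (I \<inter> J)"
  by (rule gradedI) (auto intro: ideal_inter gradedD)

lemma graded_derived:
  assumes "graded I"
  shows "graded (lie_derived \<Phi> L I)"
  unfolding graded_ideal_def
proof (intro conjI subset_antisym)
  note I = gradedD[OF assms]
  define D where "D = lie_derived \<Phi> L I"
  define N where "N = mspan \<Phi> L (\<Union>j. D \<inter> G j)"
  show D: "lie_ideal \<Phi> L (lie_derived \<Phi> L I)" using derived_ideal[OF I(1)] .
  show "mspan \<Phi> L (\<Union>j. lie_derived \<Phi> L I \<inter> G j) \<subseteq> lie_derived \<Phi> L I"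
    by (rule mspan_least[OF idealD(1)[OF D]]) blast
  have "(\<Union>j. D \<inter> G j) \<subseteq> carrier L" using G_in by blast
  then have s: "submodule N \<Phi> L" unfolding N_def by (rule mspan_submodule)
  have "x \<bullet> y \<in> N" if x: "x \<in> I" and y: "y \<in> I" for x y
  proof -
    have xc: "x \<in> carrier L" "y \<in> carrier L" using idealD(4)[OF I(1)] x y by auto
    have [simp]: "p i x \<in> carrier L" "p i y \<in> carrier L" for i using G_in[OF p_deg] xc by blast+
    have t: "p i x \<bullet> p j y \<in> N" for i j
      using derived_br[OF I(2)[OF x] I(2)[OF y]] G_br[OF p_deg[OF xc(1)] p_deg[OF xc(2)]]
      unfolding N_def D_def by (intro mspan_incl) blast
    \<comment> \<open>Expanding gives nine brackets, each homogeneous and contained in the derived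
      ideal.\<close>
    have "(p 1 x \<oplus> p 0 x \<oplus> p (-1) x) \<bullet> (p 1 y \<oplus> p 0 y \<oplus> p (-1) y) \<in> N"
      by (simp add: br_add1 br_add2 t submodule_add[OF s])
    then show ?thesis using p_decomp xc by simp
  qed
  then have "mspan \<Phi> L {x \<otimes> y |x y. x \<in> I \<and> y \<in> I} \<subseteq> N"
    by (intro mspan_least[OF s]) auto
  then show "lie_derived \<Phi> L I \<subseteq> mspan \<Phi> L (\<Union>j. lie_derived \<Phi> L I \<inter> G j)"
    unfolding N_def D_def lie_derived_def[of \<Phi> L I, symmetric] .
qed

lemma p_th:
  assumes x: "x \<in> carrier L"
  shows "p k (\<theta> x) = \<theta> (p (- k) x)"
proof -
  have px: "p 1 x \<in> G 1" "p 0 x \<in> G 0" "p (-1) x \<in> G (-1)" using p_deg x by auto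
  have pc: "p 1 x \<in> carrier L" "p 0 x \<in> carrier L" "p (-1) x \<in> carrier L" using G_in px by blast+
  have t: "\<theta> (p 1 x) \<in> G (-1)" "\<theta> (p 0 x) \<in> G 0" "\<theta> (p (-1) x) \<in> G 1" using th_deg px by force+
  have "p k (\<theta> x) = p k (\<theta> (p 1 x) \<oplus> \<theta> (p 0 x) \<oplus> \<theta> (p (-1) x))"
    using p_decomp[OF x] pc by (simp flip: th_add)
  also have "\<dots> = p k (\<theta> (p 1 x)) \<oplus> p k (\<theta> (p 0 x)) \<oplus> p k (\<theta> (p (-1) x))"
    using pc by (simp add: p_add)
  also have "\<dots> = \<theta> (p (- k) x)"
  proof -
    consider "k = 1" | "k = 0" | "k = -1" | "k \<noteq> 1" "k \<noteq> 0" "k \<noteq> -1" by blast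
    then show ?thesis
    proof cases
      case 4
      then have "p (- k) x = \<zero>" using G_eq_zero[OF p_deg[OF x, of "- k"]] by auto
      then show ?thesis using 4 p_other t th_zero by auto
    qed (use p_same p_other t pc in auto)
  qed
  finally show ?thesis .
qed

lemma th_image: "I \<subseteq> carrier L \<Longrightarrow> \<theta> ` I = {x \<in> carrier L. \<theta> x \<in> I}"
  by (force simp: image_iff)

lemma th_image_ideal:
  assumes I: "lie_ideal \<Phi> L I"
  shows "lie_ideal \<Phi> L (\<theta> ` I)"
proof -
  have s: "submodule {x \<in> carrier L. \<theta> x \<in> I} \<Phi> L"
    by (rule submodule_linear_set[OF submodule_carrier module_axioms _ _ _ idealD(1)[OF I]])
      (auto simp: th_add th_smult)
  then show ?thesis
    unfolding th_image[OF ideal_sub[OF I]] lie_ideal_def using idealD(2)[OF I] by (auto simp: th_br)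
qed

lemma th_image_ess:
  assumes E: "essential_ideal \<Phi> L E"
  shows "essential_ideal \<Phi> L (\<theta> ` E)"
  unfolding essential_ideal_def
proof (intro conjI allI impI)
  show "lie_ideal \<Phi> L (\<theta> ` E)" using th_image_ideal essD[OF E] by blast
  fix J assume J: "lie_ideal \<Phi> L J \<and> J \<noteq> {\<zero>}"
  then obtain x where x: "x \<in> J" "x \<noteq> \<zero>" using ideal_nonzeroE by blast
  have xc: "x \<in> carrier L" using J x idealD(4) by blast
  have "\<theta> ` J \<noteq> {\<zero>}" using x th_eq_zero_iff[OF xc] by blast
  then have ne: "E \<inter> \<theta> ` J \<noteq> {\<zero>}" and I: "lie_ideal \<Phi> L (E \<inter> \<theta> ` J)"
    using E J th_image_ideal ideal_inter unfolding essential_ideal_def by auto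
  obtain y where "y \<in> E \<inter> \<theta> ` J" and y0: "y \<noteq> \<zero>" using ideal_nonzeroE[OF I ne] .
  then have y: "y \<in> E" "y \<in> \<theta> ` J" "y \<noteq> \<zero>" by auto
  have yc: "y \<in> carrier L" using idealD(4)[OF essD[OF E] y(1)] .
  have "\<theta> y \<in> J" using y(2) J idealD(4) by auto
  then have "\<theta> y \<in> \<theta> ` E \<inter> J" using y(1) by blast
  then show "\<theta> ` E \<inter> J \<noteq> {\<zero>}" using y(3) th_eq_zero_iff[OF yc] by blast
qed

lemma th_image_graded:
  assumes I: "graded I"
  shows "graded (\<theta> ` I)"
proof (rule gradedI[OF th_image_ideal[OF gradedD(1)[OF I]]])
  fix x k assume "x \<in> \<theta> ` I"
  then obtain y where y: "y \<in> I" "x = \<theta> y" by blast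
  then show "p k x \<in> \<theta> ` I" using p_th idealD(4)[OF gradedD(1)[OF I]] gradedD(2)[OF I] by auto
qed

section \<open>Homogeneous classes of partial derivations\<close>

definition pdeg :: "int \<Rightarrow> 'a set \<Rightarrow> ('a \<Rightarrow> 'a) \<Rightarrow> bool" where
  "pdeg k E d \<longleftrightarrow> pder E d \<and> graded E \<and> (\<forall>j. \<forall>x\<in>E \<inter> G j. d x \<in> G (j + k))"

lemma pdegD:
  assumes "pdeg k E d"
  shows "pder E d" "graded E" "\<And>j x. \<lbrakk>x \<in> E; x \<in> G j\<rbrakk> \<Longrightarrow> d x \<in> G (j + k)"
  using assms unfolding pdeg_def by auto

abbreviation Qdeg where "Qdeg \<equiv> Qm_deg \<Phi> L G"

lemma Qdeg_eq: "Qdeg k = {cls E d | E d. pdeg k E d}"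
proof (intro subset_antisym subsetI)
  fix X assume "X \<in> Qdeg k"
  then obtain E d where "X = der_class \<Phi> L E d" "pder E d" "restrict d E = d" "graded E"
    "\<forall>j. d ` (E \<inter> G j) \<subseteq> G (j + k)"
    unfolding Qm_deg_def partial_ders_iff by (auto simp: extensional_restrict)
  then have "X = cls E d" "pdeg k E d" unfolding cls_def pdeg_def by auto
  then show "X \<in> {cls E d | E d. pdeg k E d}" by blast
next
  fix X assume "X \<in> {cls E d | E d. pdeg k E d}"
  then obtain E d where X: "X = cls E d" "pdeg k E d" by blast
  then have "(E, restrict d E) \<in> partial_ders \<Phi> L" using pdegD(1) pder_partial by blast
  then show "X \<in> Qdeg k" using X pdegD unfolding Qm_deg_def cls_def
    by (intro CollectI exI[of _ E] exI[of _ "restrict d E"]) auto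
qed

lemma Qdeg_memE:
  assumes "X \<in> Qdeg k"
  obtains E d where "pdeg k E d" "X = cls E d"
  using assms Qdeg_eq by blast

lemma cls_Qdeg: "pdeg k E d \<Longrightarrow> cls E d \<in> Qdeg k"
  using Qdeg_eq by blast

lemma pdeg_mono: "\<lbrakk>pdeg k E d; essential_ideal \<Phi> L F; graded F; F \<subseteq> E\<rbrakk> \<Longrightarrow> pdeg k F d"
  unfolding pdeg_def using pder_mono by blast

lemma Qdeg_memE2:
  assumes "X \<in> Qdeg k" "Y \<in> Qdeg l"
  obtains E d e where "pdeg k E d" "pdeg l E e" "X = cls E d" "Y = cls E e"
proof -
  obtain E d where d: "pdeg k E d" "X = cls E d" using Qdeg_memE[OF assms(1)] .
  obtain F e where e: "pdeg l F e" "Y = cls F e" using Qdeg_memE[OF assms(2)] .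
  have EF: "essential_ideal \<Phi> L (E \<inter> F)"
    by (rule ess_inter[OF pderD(1)[OF pdegD(1)[OF d(1)]] pderD(1)[OF pdegD(1)[OF e(1)]]])
  have gr: "graded (E \<inter> F)" by (rule graded_inter[OF pdegD(2)[OF d(1)] pdegD(2)[OF e(1)]])
  show ?thesis
    by (rule that[OF pdeg_mono[OF d(1) EF gr] pdeg_mono[OF e(1) EF gr]])
      (use d e cls_mono[OF pdegD(1)[OF d(1)] EF] cls_mono[OF pdegD(1)[OF e(1)] EF] in auto)
qed

lemma Qdeg_in_Q: "X \<in> Qdeg k \<Longrightarrow> X \<in> carrier Q"
  by (elim Qdeg_memE) (simp add: cls_in_Q[OF pdegD(1)])

lemma Qdeg_submodule: "submodule (Qdeg k) \<Phi> Q"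
proof (rule Q.submoduleI)
  show "Qdeg k \<subseteq> carrier Q" using Qdeg_in_Q by blast
  show "\<zero>\<^bsub>Q\<^esub> \<in> Qdeg k" unfolding Q_zero
    by (rule cls_Qdeg) (auto simp: pdeg_def pder_const_zero ess_carrier graded_carrier G_intros)
  fix X assume X: "X \<in> Qdeg k"
  show sm: "a \<odot>\<^bsub>Q\<^esub> X \<in> Qdeg k" if a: "a \<in> carrier \<Phi>" for a
  proof -
    obtain E d where d: "pdeg k E d" "X = cls E d" using Qdeg_memE[OF X] .
    show ?thesis unfolding d(2) Q_smult[OF pdegD(1)[OF d(1)] a]
      using d(1) a by (intro cls_Qdeg) (auto simp: pdeg_def pder_smult G_intros)
  qed
  show "\<ominus>\<^bsub>Q\<^esub> X \<in> Qdeg k" using sm[of "\<ominus>\<^bsub>\<Phi>\<^esub> \<one>\<^bsub>\<Phi>\<^esub>"] Qdeg_in_Q[OF X] by (simp add: Q.smult_l_minus)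
  fix Y assume Y: "Y \<in> Qdeg k"
  obtain E d e where d: "pdeg k E d" "pdeg k E e" "X = cls E d" "Y = cls E e" using Qdeg_memE2[OF X Y] .
  show "X \<oplus>\<^bsub>Q\<^esub> Y \<in> Qdeg k" unfolding d Q_add[OF pdegD(1)[OF d(1)] pdegD(1)[OF d(2)]]
    using d(1,2) by (intro cls_Qdeg) (auto simp: pdeg_def pder_add G_intros)
qed

lemma Qdeg_br:
  assumes "X \<in> Qdeg k" "Y \<in> Qdeg l"
  shows "X \<otimes>\<^bsub>Q\<^esub> Y \<in> Qdeg (k + l)"
proof -
  obtain E d e where d: "pdeg k E d" "pdeg l E e" "X = cls E d" "Y = cls E e" using Qdeg_memE2[OF assms] .
  note p = pdegD(1)[OF d(1)] pdegD(1)[OF d(2)]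
  note E = pderD(2)[OF p(1)]
  have "d (e x) \<ominus> e (d x) \<in> G (j + (k + l))" if x: "x \<in> lie_derived \<Phi> L E" "x \<in> G j" for x j
  proof -
    have xE: "x \<in> E" "d x \<in> E" "e x \<in> E"
      using derived_sub[OF E] pder_derived_into[OF p(1) E subset_refl x(1)]
        pder_derived_into[OF p(2) E subset_refl x(1)] x by auto
    have "d (e x) \<in> G (j + l + k)" "e (d x) \<in> G (j + k + l)"
      using pdegD(3)[OF d(1)] pdegD(3)[OF d(2)] xE x(2) by blast+
    then show ?thesis by (intro G_intros) (simp_all add: algebra_simps)
  qed
  then show ?thesis unfolding d Q_br[OF p]
    using pder_br[OF p] graded_derived[OF pdegD(2)[OF d(1)]] by (intro cls_Qdeg) (auto simp: pdeg_def)
qed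

lemma graded_eq_zero:
  assumes d: "pder E d" and E: "graded E"
    and z: "\<And>x j. \<lbrakk>x \<in> E; x \<in> G j; j = 1 \<or> j = 0 \<or> j = -1\<rbrakk> \<Longrightarrow> d x = \<zero>" and x: "x \<in> E"
  shows "d x = \<zero>"
proof -
  have xc: "x \<in> carrier L" using pderD(4)[OF d x] .
  note s = idealD(1)[OF pderD(2)[OF d]]
  have px: "p k x \<in> E" for k using gradedD(2)[OF E x] .
  have "d (p 1 x \<oplus> p 0 x \<oplus> p (-1) x) = d (p 1 x) \<oplus> d (p 0 x) \<oplus> d (p (-1) x)"
    by (simp add: pderD(5)[OF d] px submodule_add[OF s])
  also have "\<dots> = \<zero>" using z[OF px p_deg[OF xc]] by simp
  finally show ?thesis using p_decomp[OF xc] by simp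
qed

text \<open>Only the action from degree -1 to degree 1 can be nonzero, since all other target
  components vanish. Passing to the derived ideal of I makes the values land in I, as
  \<open>degree_two_zero\<close> demands.\<close>

lemma Qdeg_two:
  assumes "X \<in> Qdeg 2"
  shows "X = \<zero>\<^bsub>Q\<^esub>"
proof -
  obtain I e where e: "pdeg 2 I e" "X = cls I e" using Qdeg_memE[OF assms] .
  note p = pdegD(1)[OF e(1)] and deg = pdegD(3)[OF e(1)]
  note I = pderD(2)[OF p]
  define F where "F = lie_derived \<Phi> L I"
  have F: "essential_ideal \<Phi> L F" "F \<subseteq> I" "graded F"
    unfolding F_def using ess_derived[OF pderD(1)[OF p]] derived_sub[OF I] graded_derived[OF pdegD(2)[OF e(1)]] by auto
  have pF: "pder F e" using pder_mono[OF p F(1,2)] .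
  have "e x = \<zero>" if x: "x \<in> F" for x
  proof (rule graded_eq_zero[OF pF F(3) _ x])
    fix x j assume x: "x \<in> F" "x \<in> G j" and j: "j = 1 \<or> j = 0 \<or> j = (-1 :: int)"
    have xI: "x \<in> I" using x F by blast
    show "e x = \<zero>"
    proof (cases "j = -1")
      case True
      have "e x \<in> I" using pder_derived_into[OF p I subset_refl] x(1) unfolding F_def by blast
      then show ?thesis using degree_two_zero[OF p deg xI] x True by simp
    next
      case False
      then show ?thesis using G_eq_zero[OF deg[OF xI x(2)]] j by auto
    qed
  qed
  then have "cls F e = \<zero>\<^bsub>Q\<^esub>" using cls_eq_zero_iff[OF pF] by simp
  then show ?thesis using cls_mono[OF p F(1,2)] e(2) by simp
qed

lemma adc_deg: "x \<in> G k \<Longrightarrow> adc x \<in> Qdeg k"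
  unfolding adc_cls using G_br[of x k] G_in pder_ad graded_carrier
  by (intro cls_Qdeg) (auto simp: pdeg_def add.commute)

section \<open>Extension of the involution to the algebra of quotients\<close>

abbreviation thQ where "thQ \<equiv> Qm_extend \<Phi> L \<theta>"

lemma th_inj: "inj_on \<theta> (carrier L)"
  by (rule inj_onI) (metis th_th)

lemma pder_th:
  assumes d: "pder E d"
  shows "pder (\<theta> ` E) (\<lambda>z. \<theta> (d (\<theta> z)))"
proof -
  note [simp] = pderD(3-7)[OF d]
  show ?thesis unfolding pder_def
    using th_image_ess[OF pderD(1)[OF d]] by (auto simp: th_add th_smult th_br simp flip: th_add th_smult th_br)
qed

lemma thQ_cls:
  assumes d: "pder E d"
  shows "thQ (cls E d) = cls (\<theta> ` E) (\<lambda>z. \<theta> (d (\<theta> z)))"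
proof -
  have "der_class \<Phi> L (\<theta> ` I) (\<lambda>z\<in>\<theta> ` I. \<theta> (\<delta> (inv_into (carrier L) \<theta> z))) = cls (\<theta> ` E) (\<lambda>z. \<theta> (d (\<theta> z)))"
    if "(I, \<delta>) \<in> cls E d" for I \<delta>
  proof -
    note I = cls_memD[OF d that]
    have inv: "inv_into (carrier L) \<theta> z = \<theta> z" if z: "z \<in> \<theta> ` I" for z
    proof -
      obtain y where y: "y \<in> I" "z = \<theta> y" using z by blast
      then have "y \<in> carrier L" using pderD(4)[OF I(1)] by blast
      then show ?thesis using y inv_into_f_f[OF th_inj] by simp
    qed
    have "(\<lambda>z\<in>\<theta> ` I. \<theta> (\<delta> (inv_into (carrier L) \<theta> z))) = (\<lambda>z\<in>\<theta> ` I. \<theta> (\<delta> (\<theta> z)))"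
      using inv by (auto simp: restrict_def fun_eq_iff)
    then have "der_class \<Phi> L (\<theta> ` I) (\<lambda>z\<in>\<theta> ` I. \<theta> (\<delta> (inv_into (carrier L) \<theta> z))) =
        cls (\<theta> ` I) (\<lambda>z. \<theta> (\<delta> (\<theta> z)))" unfolding cls_def by simp
    also have "\<dots> = cls (\<theta> ` E) (\<lambda>z. \<theta> (d (\<theta> z)))"
    proof (subst cls_eq_iff[OF pder_th[OF I(1)] pder_th[OF d]], rule ballI)
      fix z assume "z \<in> \<theta> ` I \<inter> \<theta> ` E"
      then have "\<theta> z \<in> I" "\<theta> z \<in> E"
        unfolding th_image[OF ideal_sub[OF pderD(2)[OF d]]] th_image[OF ideal_sub[OF pderD(2)[OF I(1)]]]
        by simp_all
      then show "\<theta> (\<delta> (\<theta> z)) = \<theta> (d (\<theta> z))" using I(2) by simp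
    qed
    finally show ?thesis .
  qed
  then show ?thesis unfolding Qm_extend_def using cls_mem[OF d] by fastforce
qed

lemma thQ_closed [simp, intro]:
  assumes "X \<in> carrier Q"
  shows "thQ X \<in> carrier Q"
proof -
  obtain E d where d: "pder E d" "X = cls E d" using Q_memE[OF assms] .
  then show ?thesis using thQ_cls[OF d(1)] cls_in_Q[OF pder_th[OF d(1)]] by simp
qed

lemma thQ_add:
  assumes "X \<in> carrier Q" "Y \<in> carrier Q"
  shows "thQ (X \<oplus>\<^bsub>Q\<^esub> Y) = thQ X \<oplus>\<^bsub>Q\<^esub> thQ Y"
proof -
  obtain E d e where d: "pder E d" "pder E e" "X = cls E d" "Y = cls E e" using Q_memE2[OF assms] .
  show ?thesis
    unfolding d Q_add[OF d(1,2)] thQ_cls[OF pder_add[OF d(1,2)]] thQ_cls[OF d(1)] thQ_cls[OF d(2)]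
      Q_add[OF pder_th[OF d(1)] pder_th[OF d(2)]]
    by (rule cls_eqI[OF pder_th[OF pder_add[OF d(1,2)]]])
      (use pderD(3)[OF d(1)] pderD(3)[OF d(2)] pderD(4)[OF d(1)] in \<open>auto simp: th_add\<close>)
qed

lemma thQ_smult:
  assumes "a \<in> carrier \<Phi>" "X \<in> carrier Q"
  shows "thQ (a \<odot>\<^bsub>Q\<^esub> X) = a \<odot>\<^bsub>Q\<^esub> thQ X"
proof -
  obtain E d where d: "pder E d" "X = cls E d" using Q_memE[OF assms(2)] .
  show ?thesis
    unfolding d Q_smult[OF d(1) assms(1)] thQ_cls[OF pder_smult[OF d(1) assms(1)]] thQ_cls[OF d(1)]
      Q_smult[OF pder_th[OF d(1)] assms(1)]
    by (rule cls_eqI[OF pder_th[OF pder_smult[OF d(1) assms(1)]]])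
      (use pderD(3)[OF d(1)] pderD(4)[OF d(1)] assms(1) in \<open>auto simp: th_smult\<close>)
qed

lemma thQ_br:
  assumes "X \<in> carrier Q" "Y \<in> carrier Q"
  shows "thQ (X \<otimes>\<^bsub>Q\<^esub> Y) = thQ X \<otimes>\<^bsub>Q\<^esub> thQ Y"
proof -
  obtain E d e where d: "pder E d" "pder E e" "X = cls E d" "Y = cls E e" using Q_memE2[OF assms] .
  note E = pderD(2)[OF d(1)]
  show ?thesis
    unfolding d Q_br[OF d(1,2)] thQ_cls[OF pder_br[OF d(1,2)]] thQ_cls[OF d(1)] thQ_cls[OF d(2)]
      Q_br[OF pder_th[OF d(1)] pder_th[OF d(2)]]
  proof (subst cls_eq_iff[OF pder_th[OF pder_br[OF d(1,2)]] pder_br[OF pder_th[OF d(1)] pder_th[OF d(2)]]], rule ballI)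
    fix z assume "z \<in> \<theta> ` lie_derived \<Phi> L E \<inter> lie_derived \<Phi> L (\<theta> ` E)"
    then obtain y where y: "y \<in> lie_derived \<Phi> L E" "z = \<theta> y" by blast
    have yE: "y \<in> E" "d y \<in> E" "e y \<in> E"
      using derived_sub[OF E] pder_derived_into[OF d(1) E subset_refl y(1)]
        pder_derived_into[OF d(2) E subset_refl y(1)] y(1) by auto
    then show "\<theta> (d (e (\<theta> z)) \<ominus> e (d (\<theta> z))) =
      \<theta> (d (\<theta> (\<theta> (e (\<theta> z))))) \<ominus> \<theta> (e (\<theta> (\<theta> (d (\<theta> z)))))"
      using pderD(3,4)[OF d(1)] pderD(3)[OF d(2)] y(2) by (simp add: th_diff)
  qed
qed

lemma thQ_thQ [simp]:
  assumes "X \<in> carrier Q"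
  shows "thQ (thQ X) = X"
proof -
  obtain E d where d: "pder E d" "X = cls E d" using Q_memE[OF assms] .
  show ?thesis unfolding d thQ_cls[OF d(1)] thQ_cls[OF pder_th[OF d(1)]]
    using pderD(3,4)[OF d(1)]
    by (subst cls_eq_iff[OF pder_th[OF pder_th[OF d(1)]] d(1)]) auto
qed

lemma thQ_deg:
  assumes "X \<in> Qdeg k"
  shows "thQ X \<in> Qdeg (- k)"
proof -
  obtain E d where d: "pdeg k E d" "X = cls E d" using Qdeg_memE[OF assms] .
  note p = pdegD(1)[OF d(1)]
  have "\<theta> (d (\<theta> x)) \<in> G (j - k)" if "x \<in> \<theta> ` E" "x \<in> G j" for x j
  proof -
    have "\<theta> x \<in> E" using that pderD(4)[OF p] by auto
    then have "d (\<theta> x) \<in> G (- j + k)" using pdegD(3)[OF d(1)] th_deg[OF that(2)] by blast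
    then show ?thesis using th_deg by fastforce
  qed
  then show ?thesis unfolding d(2) thQ_cls[OF p]
    using pder_th[OF p] th_image_graded[OF pdegD(2)[OF d(1)]] by (intro cls_Qdeg) (auto simp: pdeg_def)
qed

lemma thQ_adc:
  assumes x: "x \<in> carrier L"
  shows "thQ (adc x) = adc (\<theta> x)"
proof -
  have "\<theta> ` carrier L = carrier L" using th_image[of "carrier L"] by auto
  then show ?thesis unfolding adc_cls thQ_cls[OF pder_ad[OF x]]
    using cls_eqI[OF pder_ad[OF th_closed[OF x]], of "\<lambda>z. \<theta> (x \<otimes> \<theta> z)"] x by (simp add: th_br)
qed

end


section \<open>The triple product on degree one of the quotient algebra\<close>

context gr3
begin

abbreviation trQ where "trQ \<equiv> Qm_trip \<Phi> L \<theta>"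

definition Q1 :: "('k, ('a set \<times> ('a \<Rightarrow> 'a)) set) jts" where
  "Q1 = \<lparr>carrier = Qdeg 1, mult = mult Q, one = one Q, zero = zero Q, add = add Q, smult = smult Q,
     quad = (\<lambda>X Y. half \<odot>\<^bsub>Q\<^esub> trQ X Y X)\<rparr>"

lemma Q1_simps [simp]:
  "carrier Q1 = Qdeg 1" "add Q1 = add Q" "zero Q1 = zero Q" "smult Q1 = smult Q"
  "quad Q1 X Y = half \<odot>\<^bsub>Q\<^esub> trQ X Y X"
  unfolding Q1_def by simp_all

lemma trQ_deg:
  assumes "X \<in> Qdeg 1" "Y \<in> Qdeg 1" "Z \<in> Qdeg 1"
  shows "trQ X Y Z \<in> Qdeg 1"
  using Qdeg_br[OF Qdeg_br[OF assms(1) thQ_deg[OF assms(2)]] assms(3)] unfolding Qm_trip_def by simp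

text \<open>Degree one is abelian by \<open>Qdeg_two\<close>, so the Jacobi identity lets X pass to
  the outside. Symmetry of the product in its outer arguments is read off from this form.\<close>

lemma trQ_alt:
  assumes "X \<in> Qdeg 1" "Y \<in> Qdeg 1" "Z \<in> Qdeg 1"
  shows "trQ X Y Z = X \<otimes>\<^bsub>Q\<^esub> (thQ Y \<otimes>\<^bsub>Q\<^esub> Z)"
proof -
  have c: "X \<in> carrier Q" "Y \<in> carrier Q" "Z \<in> carrier Q" "thQ Y \<in> carrier Q" using assms Qdeg_in_Q by auto
  have "X \<otimes>\<^bsub>Q\<^esub> Z = \<zero>\<^bsub>Q\<^esub>" using Qdeg_br[OF assms(1,3)] by (intro Qdeg_two) simp
  then show ?thesis using Q.br_jacobi1[OF c(1,4,3)] c unfolding Qm_trip_def by (simp add: Q.M.diff_zero)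
qed

lemma trQ_sym:
  assumes X: "X \<in> Qdeg 1" and Y: "Y \<in> Qdeg 1" and Z: "Z \<in> Qdeg 1"
  shows "trQ X Y Z = trQ Z Y X"
proof -
  have c: "X \<in> carrier Q" "Y \<in> carrier Q" "Z \<in> carrier Q" "thQ Y \<in> carrier Q" using assms Qdeg_in_Q by auto
  have "trQ Z Y X = \<ominus>\<^bsub>Q\<^esub> (X \<otimes>\<^bsub>Q\<^esub> (Z \<otimes>\<^bsub>Q\<^esub> thQ Y))"
    unfolding Qm_trip_def using Q.br_anti[of "Z \<otimes>\<^bsub>Q\<^esub> thQ Y" X] c by simp
  also have "\<dots> = X \<otimes>\<^bsub>Q\<^esub> (thQ Y \<otimes>\<^bsub>Q\<^esub> Z)" using Q.br_anti[of "thQ Y" Z] c by (simp add: Q.br_uminus2)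
  finally show ?thesis using trQ_alt[OF X Y Z] by simp
qed

text \<open>D = [X, \<theta> Y] acts as a derivation of \<open>Q\<close>, and applying \<theta>
  shows [D, \<theta> V] = - \<theta> {Y X V}; this accounts for the negative middle term.\<close>

lemma trQ_five:
  assumes X: "X \<in> Qdeg 1" and Y: "Y \<in> Qdeg 1" and U: "U \<in> Qdeg 1" and V: "V \<in> Qdeg 1" and W: "W \<in> Qdeg 1"
  shows "trQ X Y (trQ U V W) =
    trQ (trQ X Y U) V W \<ominus>\<^bsub>Q\<^esub> trQ U (trQ Y X V) W \<oplus>\<^bsub>Q\<^esub> trQ U V (trQ X Y W)"
proof -
  have c [simp]: "X \<in> carrier Q" "Y \<in> carrier Q" "U \<in> carrier Q" "V \<in> carrier Q" "W \<in> carrier Q"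
    using assms Qdeg_in_Q by auto
  define D where "D = X \<otimes>\<^bsub>Q\<^esub> thQ Y"
  have [simp]: "D \<in> carrier Q" by (simp add: D_def)
  have DV: "D \<otimes>\<^bsub>Q\<^esub> thQ V = \<ominus>\<^bsub>Q\<^esub> thQ (trQ Y X V)"
    unfolding Qm_trip_def D_def
    by (simp add: thQ_br Q.br_anti[of X "thQ Y"] Q.br_uminus1)
  have 1: "D \<otimes>\<^bsub>Q\<^esub> (U \<otimes>\<^bsub>Q\<^esub> thQ V) = (D \<otimes>\<^bsub>Q\<^esub> U) \<otimes>\<^bsub>Q\<^esub> thQ V \<ominus>\<^bsub>Q\<^esub> U \<otimes>\<^bsub>Q\<^esub> thQ (trQ Y X V)"
    using Q.br_jacobi[of D U "thQ V"] trQ_deg[OF Y X V] Qdeg_in_Q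
    by (simp add: DV Q.br_uminus2 a_minus_def)
  have "D \<otimes>\<^bsub>Q\<^esub> ((U \<otimes>\<^bsub>Q\<^esub> thQ V) \<otimes>\<^bsub>Q\<^esub> W) =
      (D \<otimes>\<^bsub>Q\<^esub> (U \<otimes>\<^bsub>Q\<^esub> thQ V)) \<otimes>\<^bsub>Q\<^esub> W \<oplus>\<^bsub>Q\<^esub> (U \<otimes>\<^bsub>Q\<^esub> thQ V) \<otimes>\<^bsub>Q\<^esub> (D \<otimes>\<^bsub>Q\<^esub> W)"
    by (rule Q.br_jacobi) simp_all
  then show ?thesis
    using trQ_deg[OF Y X V] Qdeg_in_Q unfolding 1 by (simp add: Q.br_diff1 Qm_trip_def flip: D_def)
qed

lemma Q1_module: "module \<Phi> Q1"
  by (rule Q.submodule_module(1)[OF Qdeg_submodule[of 1]]) simp_all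

lemma Q1_ljts: "ljts \<Phi> Q1 trQ"
proof (intro ljts.intro module6.intro module6_axioms.intro ljts_axioms.intro Q1_module six_unit)
  note c = Qdeg_in_Q
  note d = Q.submodule_module(3)[OF Qdeg_submodule[of 1], of Q1]
  fix X Y Z assume "X \<in> carrier Q1" "Y \<in> carrier Q1" "Z \<in> carrier Q1"
  then have X: "X \<in> Qdeg 1" "Y \<in> Qdeg 1" "Z \<in> Qdeg 1" by simp_all
  show "trQ X Y Z \<in> carrier Q1" using trQ_deg[OF X] by simp
  show "trQ X Y Z = trQ Z Y X" using trQ_sym[OF X] .
  show "trQ (X \<oplus>\<^bsub>Q1\<^esub> X') Y Z = trQ X Y Z \<oplus>\<^bsub>Q1\<^esub> trQ X' Y Z" if "X' \<in> carrier Q1" for X'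
    using X that c unfolding Qm_trip_def by (simp add: Q.br_add1)
  show "trQ X (Y \<oplus>\<^bsub>Q1\<^esub> Y') Z = trQ X Y Z \<oplus>\<^bsub>Q1\<^esub> trQ X Y' Z" if "Y' \<in> carrier Q1" for Y'
    using X that c unfolding Qm_trip_def by (simp add: Q.br_add1 Q.br_add2 thQ_add)
  show "trQ (a \<odot>\<^bsub>Q1\<^esub> X) Y Z = a \<odot>\<^bsub>Q1\<^esub> trQ X Y Z" if "a \<in> carrier \<Phi>" for a
    using X that c unfolding Qm_trip_def by (simp add: Q.br_smult1)
  show "trQ X (a \<odot>\<^bsub>Q1\<^esub> Y) Z = a \<odot>\<^bsub>Q1\<^esub> trQ X Y Z" if "a \<in> carrier \<Phi>" for a
    using X that c unfolding Qm_trip_def by (simp add: Q.br_smult1 Q.br_smult2 thQ_smult)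
  fix V W assume "V \<in> carrier Q1" "W \<in> carrier Q1"
  then have VW: "V \<in> Qdeg 1" "W \<in> Qdeg 1" by simp_all
  show "trQ X Y (trQ Z V W) =
      trQ (trQ X Y Z) V W \<ominus>\<^bsub>Q1\<^esub> trQ Z (trQ Y X V) W \<oplus>\<^bsub>Q1\<^esub> trQ Z V (trQ X Y W)"
    using trQ_five[OF X VW] trQ_deg X VW by (simp add: d)
qed

lemma Q1_jts: "jordan_triple_system \<Phi> Q1"
  and Q1_trip: "\<lbrakk>X \<in> Qdeg 1; Y \<in> Qdeg 1; Z \<in> Qdeg 1\<rbrakk> \<Longrightarrow> trip Q1 X Y Z = trQ X Y Z"
  using ljts.jordan_triple_systemI[OF Q1_ljts, of Q1] Q1_module by simp_all

lemma Q1_jts6: "jts6 \<Phi> Q1"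
  using Q1_jts Q1_module six_unit by (intro jts6.intro module6.intro module6_axioms.intro)

lemma trQ_adc: "\<lbrakk>x \<in> carrier L; y \<in> carrier L; z \<in> carrier L\<rbrakk> \<Longrightarrow>
    trQ (adc x) (adc y) (adc z) = adc ((x \<bullet> \<theta> y) \<otimes> z)"
  unfolding Qm_trip_def by (simp add: thQ_adc adc_br)

lemma G1_triple: "\<lbrakk>x \<in> G 1; y \<in> G 1; z \<in> G 1\<rbrakk> \<Longrightarrow> (x \<bullet> \<theta> y) \<otimes> z \<in> G 1"
  using th_deg[of y 1] by (auto intro: G_br0 G_br_pm)

lemma adc_image_submodule:
  assumes U: "submodule U \<Phi> L"
  shows "submodule (adc ` U) \<Phi> Q"
proof (rule Q.submoduleI)
  note c = submodule_in[OF U] and i = submodule_intros[OF U]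
  show "adc ` U \<subseteq> carrier Q" using c by auto
  show "\<zero>\<^bsub>Q\<^esub> \<in> adc ` U" using i(5) adc_zero by (metis image_eqI)
  fix X assume "X \<in> adc ` U"
  then obtain x where x: "x \<in> U" "X = adc x" by blast
  show sm: "a \<odot>\<^bsub>Q\<^esub> X \<in> adc ` U" if "a \<in> carrier \<Phi>" for a
    using x c i(2) that by (auto simp flip: adc_smult)
  show "\<ominus>\<^bsub>Q\<^esub> X \<in> adc ` U" using sm[of "\<ominus>\<^bsub>\<Phi>\<^esub> \<one>\<^bsub>\<Phi>\<^esub>"] x c by (simp add: Q.smult_l_minus)
  fix Y assume "Y \<in> adc ` U"
  then obtain y where y: "y \<in> U" "Y = adc y" by blast
  show "X \<oplus>\<^bsub>Q\<^esub> Y \<in> adc ` U" using x y c i(1) by (auto simp flip: adc_add)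
qed

text \<open>Commuting with degree -1 of E is enough. For degree 1 there is nothing to show. For x in
  degree 0 of E and w in degree -1 of E, both terms of [w,[a,x]] = [[w,a],x] + [a,[w,x]] vanish, so
  \<open>ideal_separating\<close> kills [a,x].\<close>

lemma ess_graded_ann:
  assumes E: "essential_ideal \<Phi> L E" "graded E" and a: "a \<in> G 1"
    and zero: "\<And>y. \<lbrakk>y \<in> E; y \<in> G (-1)\<rbrakk> \<Longrightarrow> a \<bullet> y = \<zero>"
  shows "a = \<zero>"
proof (rule ess_ann[OF E(1) G_in[OF a]])
  note I = essD[OF E(1)]
  have ac [simp]: "a \<in> carrier L" using G_in a .
  fix x assume x: "x \<in> E"
  have xc: "x \<in> carrier L" using idealD(4)[OF I x] .
  have px: "p k x \<in> E" "p k x \<in> G k" for k using gradedD(2)[OF E(2) x] p_deg[OF xc] by auto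
  have pc [simp]: "p k x \<in> carrier L" for k using G_in[OF px(2)] .
  have "a \<bullet> p 0 x = \<zero>"
  proof (rule ideal_separating[OF _ I])
    show "a \<bullet> p 0 x \<in> E" "a \<bullet> p 0 x \<in> G 1" using idealD(2)[OF I ac px(1)] G_br0(2)[OF a px(2)] by auto
    fix y w assume yw: "y \<in> E" "y \<in> G (- 1)" "w \<in> E" "w \<in> G (- 1)"
    have wc: "w \<in> carrier L" "y \<in> carrier L" using G_in yw by auto
    have "w \<bullet> p 0 x \<in> E" "w \<bullet> p 0 x \<in> G (-1)" using idealD(2)[OF I wc(1) px(1)] G_br0(2)[OF yw(4) px(2)] by auto
    then have "a \<bullet> w \<bullet> p 0 x = \<zero>" by (rule zero)
    moreover have "w \<bullet> a = \<zero>" using zero[OF yw(3,4)] br_anti[of w a] wc by simp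
    ultimately have "w \<bullet> a \<bullet> p 0 x = \<zero>" using br_jacobi[of w a "p 0 x"] wc by simp
    then show "y \<bullet> w \<bullet> a \<bullet> p 0 x = \<zero>" using wc by simp
  qed simp
  moreover have "a \<bullet> p 1 x = \<zero>" using G_br_same[OF a px(2)] by simp
  moreover have "a \<bullet> p (-1) x = \<zero>" using zero px by blast
  ultimately have "a \<bullet> (p 1 x \<oplus> p 0 x \<oplus> p (-1) x) = \<zero>" by (simp add: br_add2)
  then show "a \<otimes> x = \<zero>" using p_decomp[OF xc] by simp
qed

abbreviation K1 where "K1 \<equiv> adc ` G 1"

lemma K1_sub: "K1 \<subseteq> Qdeg 1"
  using adc_deg by auto

lemma K1_submodule: "submodule K1 \<Phi> Q1"
  by (rule Q.submodule_restrict[OF Qdeg_submodule[of 1] _ _ _ _ adc_image_submodule[OF G_sub] K1_sub]) simp_all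

lemma K1_subsystem: "jts_subsystem \<Phi> Q1 K1"
  unfolding jts_subsystem_def
proof (intro conjI ballI K1_submodule)
  fix X Y assume "X \<in> K1" "Y \<in> K1"
  then obtain x y where x: "x \<in> G 1" "X = adc x" "y \<in> G 1" "Y = adc y" by blast
  have "trQ X Y X = adc ((x \<bullet> \<theta> y) \<otimes> x)" using x trQ_adc G_in by simp
  then have "trQ X Y X \<in> K1" using G1_triple x by simp
  then show "quad Q1 X Y \<in> K1" using Q.submodule_smult[OF adc_image_submodule[OF G_sub]] by simp
qed

lemma K1_jts6: "jts6 \<Phi> (Q1\<lparr>carrier := K1\<rparr>)"
  by (rule jts6.subsystem_jts6[OF Q1_jts6 K1_subsystem])

lemma K1_trip: "\<lbrakk>x \<in> G 1; y \<in> G 1; z \<in> G 1\<rbrakk> \<Longrightarrow>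
    trip (Q1\<lparr>carrier := K1\<rparr>) (adc x) (adc y) (adc z) = adc ((x \<bullet> \<theta> y) \<otimes> z)"
  using jts6.subsystem_trip(1)[OF Q1_jts6 K1_subsystem, of "adc x" "adc y" "adc z"]
    Q1_trip[of "adc x" "adc y" "adc z"] adc_deg trQ_adc G_in by auto

text \<open>Obtained from strong nondegeneracy of \<open>K1\<close>, which is the axiom
  \<open>nondegenerate\<close> transported along \<open>adc\<close>.\<close>

lemma K1_semiprime: "jts_semiprime \<Phi> (Q1\<lparr>carrier := K1\<rparr>)"
proof -
  interpret N: jts6 \<Phi> "Q1\<lparr>carrier := K1\<rparr>" by (rule K1_jts6)
  show ?thesis
  proof (rule N.strongly_nondegenerate_semiprime, unfold strongly_nondegenerate_def, intro ballI impI)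
    fix X assume "X \<in> carrier (Q1\<lparr>carrier := K1\<rparr>)"
      and zero: "\<forall>Y\<in>carrier (Q1\<lparr>carrier := K1\<rparr>). quad (Q1\<lparr>carrier := K1\<rparr>) X Y = \<zero>\<^bsub>Q1\<lparr>carrier := K1\<rparr>\<^esub>"
    then obtain x where x: "x \<in> G 1" "X = adc x" by auto
    have xc: "x \<in> carrier L" using G_in x by blast
    have "x = \<zero>"
    proof (rule nondegenerate[OF x(1)])
      fix y assume y: "y \<in> G (-1)"
      have ty: "\<theta> y \<in> G 1" using th_deg[OF y] by simp
      have yc: "y \<in> carrier L" "\<theta> y \<in> carrier L" using G_in y ty by auto
      have XY: "X \<in> carrier (Q1\<lparr>carrier := K1\<rparr>)" "adc (\<theta> y) \<in> carrier (Q1\<lparr>carrier := K1\<rparr>)" using x ty by auto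
      have z: "quad (Q1\<lparr>carrier := K1\<rparr>) X (adc (\<theta> y)) = \<zero>\<^bsub>Q1\<lparr>carrier := K1\<rparr>\<^esub>" using zero XY(2) by blast
      have "trip (Q1\<lparr>carrier := K1\<rparr>) X (adc (\<theta> y)) X = \<zero>\<^bsub>Q1\<lparr>carrier := K1\<rparr>\<^esub>"
        by (rule trans[OF sym[OF N.quad_double[OF XY, unfolded z]] N.M.l_zero[OF N.M.zero_closed]])
      then have "trip (Q1\<lparr>carrier := K1\<rparr>) X (adc (\<theta> y)) X = \<zero>\<^bsub>Q\<^esub>" by simp
      then have "adc ((x \<bullet> y) \<otimes> x) = \<zero>\<^bsub>Q\<^esub>" using K1_trip[OF x(1) ty x(1)] x(2) yc by simp
      then have "(x \<bullet> y) \<otimes> x = \<zero>" using adc_eq_zero_iff xc yc by simp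
      then show "x \<otimes> (x \<otimes> y) = \<zero>" using br_anti[of x "x \<bullet> y"] xc yc by simp
    qed
    then show "X = \<zero>\<^bsub>Q1\<lparr>carrier := K1\<rparr>\<^esub>" using x adc_zero by simp
  qed
qed

text \<open>If q is the class of d on E, brackets of q with embedded elements of E are values of d,
  so the three kinds of products lie in \<open>K1\<close> by degree reasons. The domain is first
  intersected with its image under \<theta>, so that d applies to \<theta> x for x in the degree 1
  part.\<close>

lemma Q1_denominators:
  assumes q: "q \<in> Qdeg 1" "q \<noteq> \<zero>\<^bsub>Q\<^esub>"
  shows "\<exists>I. jts_ideal \<Phi> (Q1\<lparr>carrier := K1\<rparr>) I \<and> jts_ann (Q1\<lparr>carrier := K1\<rparr>) I = {\<zero>\<^bsub>Q1\<^esub>} \<and>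
    (let N = mspan \<Phi> Q1 (trips Q1 {q} I K1 \<union> trips Q1 {q} K1 I \<union> trips Q1 I {q} K1)
     in N \<noteq> {\<zero>\<^bsub>Q1\<^esub>} \<and> N \<subseteq> K1)"
proof -
  obtain E' d where d': "pdeg 1 E' d" "q = cls E' d" using Qdeg_memE[OF q(1)] .
  define E where "E = E' \<inter> \<theta> ` E'"
  have ess': "essential_ideal \<Phi> L E'" "graded E'" using d'(1) pdegD(1,2) pderD(1) by blast+
  have E: "essential_ideal \<Phi> L E" "graded E" "E \<subseteq> E'"
    unfolding E_def using ess' ess_inter th_image_ess graded_inter th_image_graded by auto
  have d: "pdeg 1 E d" "q = cls E d"
    using pdeg_mono[OF d'(1) E] cls_mono[OF pdegD(1)[OF d'(1)] E(1,3)] d'(2) by auto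
  note pd = pdegD(1)[OF d(1)] and I = essD[OF E(1)]
  have Ec: "x \<in> carrier L" if "x \<in> E" for x using idealD(4)[OF I that] .
  have thE: "\<theta> x \<in> E" if "x \<in> E" for x
    using that Ec[OF that] unfolding E_def by (auto simp: idealD(4)[OF essD[OF ess'(1)]])
  have thimE: "\<theta> ` E = E" using thE Ec by force
  define J where "J = E \<inter> G 1"
  have J: "x \<in> E" "x \<in> G 1" "x \<in> carrier L" "\<theta> x \<in> E" "\<theta> x \<in> G (-1)" if "x \<in> J" for x
    using that thE G_in th_deg[of x 1] unfolding J_def by auto
  have Jsub: "submodule J \<Phi> L" unfolding J_def by (rule submodule_inter[OF idealD(1)[OF I] G_sub])
  define N where "N = Q1\<lparr>carrier := K1\<rparr>"
  interpret S: jts6 \<Phi> Q1 by (rule Q1_jts6)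
  interpret N: jts6 \<Phi> N unfolding N_def by (rule K1_jts6)
  have Nc: "carrier N = K1" "zero N = \<zero>\<^bsub>Q\<^esub>" unfolding N_def by simp_all
  have IK: "adc ` J \<subseteq> K1" unfolding J_def by auto
  have Is: "submodule (adc ` J) \<Phi> N"
    unfolding N_def
    by (rule Q.submodule_restrict[OF adc_image_submodule[OF G_sub] _ _ _ _ adc_image_submodule[OF Jsub] IK]) simp_all
  have ideal: "jts_ideal \<Phi> N (adc ` J)"
  proof (rule N.jts_idealI[OF Is])
    fix X Y Z assume "X \<in> adc ` J" "Y \<in> carrier N" "Z \<in> carrier N"
    then obtain x y z where x: "x \<in> J" "X = adc x" "y \<in> G 1" "Y = adc y" "z \<in> G 1" "Z = adc z"
      unfolding Nc by auto
    have c: "y \<in> carrier L" "z \<in> carrier L" using G_in x by auto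
    have "(x \<bullet> \<theta> y) \<otimes> z \<in> J" "(y \<bullet> \<theta> x) \<otimes> z \<in> J"
      using x J[OF x(1)] c idealD(2,3)[OF I] G1_triple unfolding J_def by auto
    then show "trip N X Y Z \<in> adc ` J" "trip N Y X Z \<in> adc ` J"
      using K1_trip x J unfolding N_def by auto
  qed
  have ann: "jts_ann N (adc ` J) = {\<zero>\<^bsub>Q\<^esub>}"
  proof (intro subset_antisym subsetI)
    fix X assume X: "X \<in> jts_ann N (adc ` J)"
    then obtain a where a: "a \<in> G 1" "X = adc a" unfolding jts_ann_def Nc by auto
    have ac: "a \<in> carrier L" using G_in a by blast
    have "a = \<zero>"
    proof (rule ess_graded_ann[OF E(1,2) a(1)])
      fix y assume y: "y \<in> E" "y \<in> G (-1)"
      have yc: "y \<in> carrier L" using Ec y by blast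
      have ty: "\<theta> y \<in> J" using thE[OF y(1)] th_deg[OF y(2)] unfolding J_def by simp
      show "a \<bullet> y = \<zero>"
      proof (rule faithful_half[of 1])
        show "a \<bullet> y \<in> G 0" using G_br_pm(1)[OF a(1) y(2)] .
        fix t assume t: "t \<in> G 1"
        have "trip N X (adc (\<theta> y)) (adc t) = \<zero>\<^bsub>Q\<^esub>" using X ty t unfolding jts_ann_def Nc by auto
        then have "adc ((a \<bullet> y) \<otimes> t) = \<zero>\<^bsub>Q\<^esub>"
          using K1_trip[OF a(1) J(2)[OF ty] t] a(2) yc unfolding N_def by simp
        then show "(a \<bullet> y) \<bullet> t = \<zero>" using adc_eq_zero_iff ac yc G_in[OF t] by simp
      qed simp
    qed
    then show "X \<in> {\<zero>\<^bsub>Q\<^esub>}" using a adc_zero by simp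
  next
    fix X assume "X \<in> {\<zero>\<^bsub>Q\<^esub>}"
    then have "X = \<zero>\<^bsub>N\<^esub>" unfolding Nc by simp
    moreover have "x \<in> carrier N" if "x \<in> adc ` J" for x using that IK Nc(1) by blast
    ultimately show "X \<in> jts_ann N (adc ` J)"
      unfolding jts_ann_def using N.M.zero_closed by (simp del: image_iff)
  qed
  have qx: "trQ q (adc x) (adc t) = adc (d (\<theta> x) \<otimes> t)" "d (\<theta> x) \<otimes> t \<in> G 1"
    if x: "x \<in> J" and t: "t \<in> G 1" for x t
  proof -
    have dx: "d (\<theta> x) \<in> G 0" using pdegD(3)[OF d(1) J(4,5)[OF x]] by simp
    then show "d (\<theta> x) \<otimes> t \<in> G 1" using G_br0(1)[OF dx t] by simp
    show "trQ q (adc x) (adc t) = adc (d (\<theta> x) \<otimes> t)"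
      unfolding Qm_trip_def thQ_adc[OF J(3)[OF x]] d(2) cls_act[OF pd J(4)[OF x]]
      using adc_br[OF G_in[OF dx] G_in[OF t]] by simp
  qed
  \<comment> \<open>Regrouping by \<open>trQ_alt\<close> lets d act on [\<theta> t, x], which lies
    in E, whereas \<theta> t itself may lie outside the domain of d.\<close>
  have qt: "trQ q (adc t) (adc x) \<in> K1" if x: "x \<in> J" and t: "t \<in> G 1" for x t
  proof -
    have tt: "\<theta> t \<in> G (-1)" using th_deg[OF t] by simp
    have y: "\<theta> t \<bullet> x \<in> E" "\<theta> t \<bullet> x \<in> G 0"
      using idealD(2)[OF I G_in[OF tt] J(1)[OF x]] G_br_pm(2)[OF tt J(2)[OF x]] by auto
    have "trQ q (adc t) (adc x) = q \<otimes>\<^bsub>Q\<^esub> (adc (\<theta> t) \<otimes>\<^bsub>Q\<^esub> adc x)"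
      using trQ_alt[OF q(1) adc_deg[OF t] adc_deg[OF J(2)[OF x]]] thQ_adc[OF G_in[OF t]] by simp
    also have "\<dots> = adc (d (\<theta> t \<bullet> x))"
      unfolding adc_br[OF G_in[OF tt] J(3)[OF x], symmetric] d(2) cls_act[OF pd y(1)] ..
    finally show ?thesis using pdegD(3)[OF d(1) y] by simp
  qed
  \<comment> \<open>Here q sits in the middle slot, so the conjugate derivation sending z to
    \<theta> (d (\<theta> z)) acts on x; its domain is again E.\<close>
  have xq: "trQ (adc x) q (adc t) \<in> K1" if x: "x \<in> J" and t: "t \<in> G 1" for x t
  proof -
    have "d (\<theta> x) \<in> G 0" using pdegD(3)[OF d(1) J(4,5)[OF x]] by simp
    then have y: "\<theta> (d (\<theta> x)) \<in> G 0" using th_deg by fastforce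
    have thq: "thQ q = cls E (\<lambda>z. \<theta> (d (\<theta> z)))" "pder E (\<lambda>z. \<theta> (d (\<theta> z)))"
      using thQ_cls[OF pd] pder_th[OF pd] unfolding thimE d(2) by auto
    have qc: "thQ q \<in> carrier Q" "adc x \<in> carrier Q" using Qdeg_in_Q[OF q(1)] J[OF x] by auto
    have "adc x \<otimes>\<^bsub>Q\<^esub> thQ q = \<ominus>\<^bsub>Q\<^esub> (thQ q \<otimes>\<^bsub>Q\<^esub> adc x)" by (rule Q.br_anti[OF qc(2,1)])
    also have "thQ q \<otimes>\<^bsub>Q\<^esub> adc x = adc (\<theta> (d (\<theta> x)))" unfolding thq(1) by (rule cls_act[OF thq(2) J(1)[OF x]])
    finally have "trQ (adc x) q (adc t) = \<ominus>\<^bsub>Q\<^esub> adc (\<theta> (d (\<theta> x)) \<otimes> t)"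
      unfolding Qm_trip_def using G_in[OF y] G_in[OF t] by (simp add: Q.br_uminus1 adc_br)
    moreover have "adc (\<theta> (d (\<theta> x)) \<otimes> t) \<in> K1" using G_br0(1)[OF y t] by simp
    ultimately show ?thesis using Q.submodule_uminus[OF adc_image_submodule[OF G_sub]] by simp
  qed
  define A where "A = trips Q1 {q} (adc ` J) K1 \<union> trips Q1 {q} K1 (adc ` J) \<union> trips Q1 (adc ` J) {q} K1"
  have A: "A \<subseteq> K1"
  proof -
    have "trip Q1 q (adc x) (adc t) \<in> K1" "trip Q1 q (adc t) (adc x) \<in> K1" "trip Q1 (adc x) q (adc t) \<in> K1"
      if "x \<in> J" "t \<in> G 1" for x t
      using Q1_trip q(1) adc_deg[OF J(2)[OF that(1)]] adc_deg[OF that(2)] qx[OF that] qt[OF that] xq[OF that] by auto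
    then show ?thesis unfolding A_def trips_def by auto
  qed
  \<comment> \<open>The products {q,x,t} alone force d to vanish on E: in degree -1 through
    \<open>faithful_half\<close>; in degree 0 through \<open>ess_graded_ann\<close>, because [y,d x]
    = d [y,x] - [d y,x] = 0 for y of degree -1; and in degree 1 because there is no degree
    2.\<close>
  have "mspan \<Phi> Q1 A \<noteq> {\<zero>\<^bsub>Q\<^esub>}"
  proof
    assume z: "mspan \<Phi> Q1 A = {\<zero>\<^bsub>Q\<^esub>}"
    have dth: "d (\<theta> x) = \<zero>" if x: "x \<in> J" for x
    proof (rule faithful_half[of 1])
      show "d (\<theta> x) \<in> G 0" using pdegD(3)[OF d(1) J(4,5)[OF x]] by simp
      fix t assume t: "t \<in> G 1"
      have "trip Q1 q (adc x) (adc t) \<in> A" unfolding A_def trips_def using x t by blast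
      then have "trQ q (adc x) (adc t) = \<zero>\<^bsub>Q\<^esub>"
        using S.mspan_incl[of _ A] z Q1_trip[OF q(1) adc_deg[OF J(2)[OF x]] adc_deg[OF t]] by auto
      then show "d (\<theta> x) \<bullet> t = \<zero>" using qx[OF x t] adc_eq_zero_iff G_in by metis
    qed simp
    have dm: "d y = \<zero>" if y: "y \<in> E" "y \<in> G (-1)" for y
    proof -
      have "\<theta> y \<in> J" using thE[OF y(1)] th_deg[OF y(2)] unfolding J_def by simp
      then show ?thesis using dth[of "\<theta> y"] Ec[OF y(1)] by simp
    qed
    have "d x = \<zero>" if "x \<in> E" for x
    proof (rule graded_eq_zero[OF pd E(2) _ that])
      fix x j assume x: "x \<in> E" "x \<in> G j" and j: "j = 1 \<or> j = 0 \<or> j = (-1 :: int)"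
      consider "j = 1" | "j = 0" | "j = -1" using j by blast
      then show "d x = \<zero>"
      proof cases
        case 1
        then show ?thesis using G_eq_zero[OF pdegD(3)[OF d(1) x]] by auto
      next
        case 2
        have dx: "d x \<in> G 1" using pdegD(3)[OF d(1) x] 2 by simp
        show ?thesis
        proof (rule ess_graded_ann[OF E(1,2) dx])
          fix y assume y: "y \<in> E" "y \<in> G (-1)"
          have c: "x \<in> carrier L" "y \<in> carrier L" "d x \<in> carrier L" using Ec x y G_in[OF dx] by auto
          have "y \<bullet> x \<in> E" "y \<bullet> x \<in> G (-1)" using idealD(2)[OF I c(2) x(1)] G_br0(2)[OF y(2)] x 2 by auto
          then have "y \<bullet> d x = \<zero>" using dm pderD(7)[OF pd y(1) x(1)] dm[OF y] c by simp
          then show "d x \<bullet> y = \<zero>" using br_anti[of "d x" y] c by simp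
        qed
      next
        case 3
        then show ?thesis using dm x by blast
      qed
    qed
    then show False using q(2) d(2) cls_eq_zero_iff[OF pd] by simp
  qed
  then show ?thesis
    using ideal ann S.mspan_least[OF K1_submodule A]
    by (intro exI[of _ "adc ` J"]) (simp add: Let_def flip: N_def A_def)
qed

theorem Q1_M_quotients: "M_quotients \<Phi> K1 Q1"
  unfolding M_quotients_def using Q1_jts K1_subsystem K1_semiprime Q1_denominators by auto

end


section \<open>Triple systems of M-quotients\<close>

locale jts_quotients = T: jts6 \<Phi> T + S: jts6 \<Phi> S
  for \<Phi> :: "('k, 'r) ring_scheme" and T :: "('k, 't, 'm) jts_scheme" (structure) and S :: "('k, 's, 'n) jts_scheme" +
  fixes f :: "'t \<Rightarrow> 's"
  assumes quotients: "M_quotients_of \<Phi> T S f"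
begin

abbreviation K where "K \<equiv> f ` carrier T"

lemma f_mono: "jts_mono \<Phi> T S f" and f_quotients: "M_quotients \<Phi> K S"
  using quotients unfolding M_quotients_of_def by auto

lemma f_closed [simp, intro]: "x \<in> carrier T \<Longrightarrow> f x \<in> carrier S"
  and f_add: "\<lbrakk>x \<in> carrier T; y \<in> carrier T\<rbrakk> \<Longrightarrow> f (x \<oplus> y) = f x \<oplus>\<^bsub>S\<^esub> f y"
  and f_smult: "\<lbrakk>a \<in> carrier \<Phi>; x \<in> carrier T\<rbrakk> \<Longrightarrow> f (a \<odot> x) = a \<odot>\<^bsub>S\<^esub> f x"
  and f_quad: "\<lbrakk>x \<in> carrier T; y \<in> carrier T\<rbrakk> \<Longrightarrow> f (quad T x y) = quad S (f x) (f y)"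
  and f_inj: "inj_on f (carrier T)"
  using f_mono unfolding jts_mono_def mod_hom_def by auto

lemma f_zero: "f \<zero> = \<zero>\<^bsub>S\<^esub>"
  by (rule additive_zero_gen[of T S]) (auto simp: f_add T.M.abelian_group_axioms S.M.abelian_group_axioms)

lemma f_diff: "\<lbrakk>x \<in> carrier T; y \<in> carrier T\<rbrakk> \<Longrightarrow> f (x \<ominus> y) = f x \<ominus>\<^bsub>S\<^esub> f y"
  by (rule additive_diff_gen[of T S]) (auto simp: f_add T.M.abelian_group_axioms S.M.abelian_group_axioms)

lemma f_uminus: "x \<in> carrier T \<Longrightarrow> f (\<ominus> x) = \<ominus>\<^bsub>S\<^esub> f x"
  by (rule additive_uminus_gen[of T S]) (auto simp: f_add T.M.abelian_group_axioms S.M.abelian_group_axioms)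

lemma f_trip: "\<lbrakk>x \<in> carrier T; y \<in> carrier T; z \<in> carrier T\<rbrakk> \<Longrightarrow> f (trip T x y z) = trip S (f x) (f y) (f z)"
  unfolding trip_def by (simp add: f_diff f_add f_quad T.quad_closed)

lemma f_eq_iff: "\<lbrakk>x \<in> carrier T; y \<in> carrier T\<rbrakk> \<Longrightarrow> f x = f y \<longleftrightarrow> x = y"
  using f_inj by (auto dest: inj_onD)

lemma f_eq_zero_iff: "x \<in> carrier T \<Longrightarrow> f x = \<zero>\<^bsub>S\<^esub> \<longleftrightarrow> x = \<zero>"
  using f_eq_iff[of x \<zero>] f_zero by simp

lemma K_subsystem: "jts_subsystem \<Phi> S K"
  using f_quotients unfolding M_quotients_def by simp

lemma K_submodule: "submodule K \<Phi> S"
  using K_subsystem unfolding jts_subsystem_def by simp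

text \<open>The ideal is pulled back along \<open>f\<close>, and the conditions on the span are
  unfolded to elements: a span different from zero has a nonzero generator.\<close>

lemma denominators:
  assumes q: "q \<in> carrier S" "q \<noteq> \<zero>\<^bsub>S\<^esub>"
  obtains J where "jts_ideal \<Phi> T J" "jts_ann T J = {\<zero>}"
    "\<And>x t. \<lbrakk>x \<in> J; t \<in> carrier T\<rbrakk> \<Longrightarrow>
      trip S q (f x) (f t) \<in> K \<and> trip S q (f t) (f x) \<in> K \<and> trip S (f x) q (f t) \<in> K"
    "\<exists>x\<in>J. \<exists>t\<in>carrier T. trip S q (f x) (f t) \<noteq> \<zero>\<^bsub>S\<^esub> \<or> trip S q (f t) (f x) \<noteq> \<zero>\<^bsub>S\<^esub> \<or>
      trip S (f x) q (f t) \<noteq> \<zero>\<^bsub>S\<^esub>"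
proof -
  define N where "N = S\<lparr>carrier := K\<rparr>"
  define A where "A = (\<lambda>I. trips S {q} I K \<union> trips S {q} K I \<union> trips S I {q} K)"
  have "\<exists>I. jts_ideal \<Phi> N I \<and> jts_ann N I = {\<zero>\<^bsub>S\<^esub>} \<and> mspan \<Phi> S (A I) \<noteq> {\<zero>\<^bsub>S\<^esub>} \<and> mspan \<Phi> S (A I) \<subseteq> K"
    using f_quotients q unfolding M_quotients_def Let_def N_def A_def by blast
  then obtain I where I: "jts_ideal \<Phi> N I" "jts_ann N I = {\<zero>\<^bsub>S\<^esub>}" "mspan \<Phi> S (A I) \<noteq> {\<zero>\<^bsub>S\<^esub>}"
    "mspan \<Phi> S (A I) \<subseteq> K" by blast
  interpret N: jts6 \<Phi> N unfolding N_def by (rule S.subsystem_jts6[OF K_subsystem])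
  have Nc: "carrier N = K" and Nz: "\<zero>\<^bsub>N\<^esub> = \<zero>\<^bsub>S\<^esub>" by (simp_all add: N_def)
  have Nt: "trip N x y z = trip S x y z" if "x \<in> K" "y \<in> K" "z \<in> K" for x y z
    using S.subsystem_trip(1)[OF K_subsystem that] unfolding N_def .
  have "submodule I \<Phi> N" using I(1) unfolding jts_ideal_def by simp
  then have Is: "submodule I \<Phi> S" "I \<subseteq> K"
    using S.submodule_unrestrict[OF K_submodule] unfolding N_def by blast+
  define J where "J = {x \<in> carrier T. f x \<in> I}"
  have fJ: "f ` J = I" using Is(2) unfolding J_def by auto
  have J: "x \<in> carrier T" "f x \<in> I" if "x \<in> J" for x using that unfolding J_def by auto
  have "submodule J \<Phi> T" unfolding J_def
    by (rule T.submodule_linear_set[OF T.submodule_carrier S.module_axioms _ _ _ Is(1)]) (auto simp: f_add f_smult)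
  then have "jts_ideal \<Phi> T J"
  proof (rule T.jts_idealI)
    fix x y z assume x: "x \<in> J" and yz: "y \<in> carrier T" "z \<in> carrier T"
    then have "trip N (f x) (f y) (f z) \<in> I" "trip N (f y) (f x) (f z) \<in> I"
      using N.jts_idealD[OF I(1) J(2)[OF x]] unfolding Nc by auto
    then show "trip T x y z \<in> J" "trip T y x z \<in> J"
      using J[OF x] yz by (auto simp: J_def f_trip Nt)
  qed
  moreover have "jts_ann T J = {\<zero>}"
  proof (intro subset_antisym subsetI)
    fix z assume z: "z \<in> jts_ann T J"
    then have zc: "z \<in> carrier T" unfolding jts_ann_def by simp
    have "f z \<in> jts_ann N I"
    proof -
      have "trip N (f z) (f x) (f y) = \<zero>\<^bsub>N\<^esub> \<and> trip N (f z) (f y) (f x) = \<zero>\<^bsub>N\<^esub> \<and> trip N (f y) (f z) (f x) = \<zero>\<^bsub>N\<^esub>"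
        if x: "x \<in> J" and y: "y \<in> carrier T" for x y
      proof -
        have "trip T z x y = \<zero>" "trip T z y x = \<zero>" "trip T y z x = \<zero>" using z x y unfolding jts_ann_def by auto
        then show ?thesis using zc J(1)[OF x] y by (simp add: Nt Nz f_zero flip: f_trip)
      qed
      then show ?thesis using zc unfolding jts_ann_def Nc fJ[symmetric] by auto
    qed
    then show "z \<in> {\<zero>}" using I(2) f_eq_zero_iff[OF zc] by simp
  next
    fix z assume "z \<in> {\<zero>}"
    then show "z \<in> jts_ann T J" unfolding jts_ann_def using J(1) by auto
  qed
  moreover have "trip S q (f x) (f t) \<in> A I \<and> trip S q (f t) (f x) \<in> A I \<and> trip S (f x) q (f t) \<in> A I"
    if "x \<in> J" "t \<in> carrier T" for x t
    using J(2)[OF that(1)] that(2) unfolding A_def trips_def by blast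
  then have "trip S q (f x) (f t) \<in> K \<and> trip S q (f t) (f x) \<in> K \<and> trip S (f x) q (f t) \<in> K"
    if "x \<in> J" "t \<in> carrier T" for x t
    using that I(4) S.mspan_incl[of _ "A I"] by blast
  moreover have "\<exists>x\<in>J. \<exists>t\<in>carrier T. trip S q (f x) (f t) \<noteq> \<zero>\<^bsub>S\<^esub> \<or> trip S q (f t) (f x) \<noteq> \<zero>\<^bsub>S\<^esub> \<or>
      trip S (f x) q (f t) \<noteq> \<zero>\<^bsub>S\<^esub>"
  proof (rule ccontr)
    assume no: "\<not> ?thesis"
    have "A I \<subseteq> {\<zero>\<^bsub>S\<^esub>}" using no unfolding A_def trips_def fJ[symmetric] by auto
    then have "mspan \<Phi> S (A I) \<subseteq> {\<zero>\<^bsub>S\<^esub>}" by (rule S.mspan_least[OF S.submodule_zero_set])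
    moreover have "A I \<subseteq> carrier S" using \<open>A I \<subseteq> {\<zero>\<^bsub>S\<^esub>}\<close> by auto
    then have "\<zero>\<^bsub>S\<^esub> \<in> mspan \<Phi> S (A I)" by (intro S.submodule_zero S.mspan_submodule)
    ultimately show False using I(3) by blast
  qed
  ultimately show ?thesis using that by blast
qed

text \<open>If r were nonzero, its own denominators would produce a nonzero c in \<open>K\<close> of
  the form {r,x,t}, {r,t,x} or {x,r,t}. The five-linear identity moves an element of
  \<open>FJ\<close> inside c, where it meets r in products that are zero by hypothesis. So J
  annihilates c, and c = 0.\<close>

lemma separation:
  assumes J: "jts_ideal \<Phi> T J" "jts_ann T J = {\<zero>}" and r: "r \<in> carrier S"
    and zero: "\<And>x t. \<lbrakk>x \<in> J; t \<in> carrier T\<rbrakk> \<Longrightarrow>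
      trip S r (f x) (f t) = \<zero>\<^bsub>S\<^esub> \<and> trip S r (f t) (f x) = \<zero>\<^bsub>S\<^esub> \<and> trip S (f x) r (f t) = \<zero>\<^bsub>S\<^esub>"
  shows "r = \<zero>\<^bsub>S\<^esub>"
proof (rule ccontr)
  assume r0: "r \<noteq> \<zero>\<^bsub>S\<^esub>"
  obtain I where I: "jts_ideal \<Phi> T I" "jts_ann T I = {\<zero>}"
    and IK: "\<And>x t. \<lbrakk>x \<in> I; t \<in> carrier T\<rbrakk> \<Longrightarrow>
      trip S r (f x) (f t) \<in> K \<and> trip S r (f t) (f x) \<in> K \<and> trip S (f x) r (f t) \<in> K"
    and ne: "\<exists>x\<in>I. \<exists>t\<in>carrier T. trip S r (f x) (f t) \<noteq> \<zero>\<^bsub>S\<^esub> \<or> trip S r (f t) (f x) \<noteq> \<zero>\<^bsub>S\<^esub> \<or>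
      trip S (f x) r (f t) \<noteq> \<zero>\<^bsub>S\<^esub>"
    by (rule denominators[OF r r0]) (rule that; blast)
  define FJ where "FJ = f ` J"
  have Jc: "x \<in> carrier T" if "x \<in> J" for x using T.jts_idealD(4)[OF J(1) that, of \<zero> \<zero>] by simp
  have c: "j \<in> carrier S" if "j \<in> FJ \<or> j \<in> K" for j using that Jc unfolding FJ_def by auto
  have FJ: "trip S j k l \<in> FJ" "trip S k j l \<in> FJ" "trip S k l j \<in> FJ" if j: "j \<in> FJ" "k \<in> K" "l \<in> K" for j k l
  proof -
    obtain x y z where x: "x \<in> J" "j = f x" "y \<in> carrier T" "k = f y" "z \<in> carrier T" "l = f z"
      using j unfolding FJ_def by blast
    then show "trip S j k l \<in> FJ" "trip S k j l \<in> FJ" "trip S k l j \<in> FJ"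
      using T.jts_idealD[OF J(1) x(1,3,5)] Jc[OF x(1)] unfolding FJ_def by (auto simp flip: f_trip)
  qed
  have z: "trip S r j k = \<zero>\<^bsub>S\<^esub>" "trip S r k j = \<zero>\<^bsub>S\<^esub>" "trip S j r k = \<zero>\<^bsub>S\<^esub>"
    "trip S k j r = \<zero>\<^bsub>S\<^esub>" "trip S j k r = \<zero>\<^bsub>S\<^esub>" "trip S k r j = \<zero>\<^bsub>S\<^esub>" if j: "j \<in> FJ" "k \<in> K" for j k
  proof -
    show z: "trip S r j k = \<zero>\<^bsub>S\<^esub>" "trip S r k j = \<zero>\<^bsub>S\<^esub>" "trip S j r k = \<zero>\<^bsub>S\<^esub>"
      using j zero unfolding FJ_def by auto
    have cc: "j \<in> carrier S" "k \<in> carrier S" using c j by auto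
    show "trip S k j r = \<zero>\<^bsub>S\<^esub>" "trip S j k r = \<zero>\<^bsub>S\<^esub>" "trip S k r j = \<zero>\<^bsub>S\<^esub>"
      using z S.trip_sym[OF cc(2,1) r] S.trip_sym[OF cc r] S.trip_sym[OF cc(2) r cc(1)] by simp_all
  qed
  have z1: "trip S (trip S r s u) t j = \<zero>\<^bsub>S\<^esub>" "trip S (trip S r s u) j t = \<zero>\<^bsub>S\<^esub>"
    "trip S (trip S s r u) t j = \<zero>\<^bsub>S\<^esub>" "trip S (trip S s r u) j t = \<zero>\<^bsub>S\<^esub>"
    if j: "j \<in> FJ" and K: "s \<in> K" "u \<in> K" "t \<in> K" for j s u t
  proof -
    have [simp]: "j \<in> carrier S" "s \<in> carrier S" "u \<in> carrier S" "t \<in> carrier S" "r \<in> carrier S"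
      using c j K r by auto
    have "trip S j t (trip S r s u) = \<zero>\<^bsub>S\<^esub>" "trip S t j (trip S r s u) = \<zero>\<^bsub>S\<^esub>"
      "trip S j t (trip S s r u) = \<zero>\<^bsub>S\<^esub>" "trip S t j (trip S s r u) = \<zero>\<^bsub>S\<^esub>"
      using j K
      by (simp_all add: S.five_linear[of j t] S.five_linear[of t j] z FJ S.M.diff_zero)
    then show "trip S (trip S r s u) t j = \<zero>\<^bsub>S\<^esub>" "trip S (trip S r s u) j t = \<zero>\<^bsub>S\<^esub>"
      "trip S (trip S s r u) t j = \<zero>\<^bsub>S\<^esub>" "trip S (trip S s r u) j t = \<zero>\<^bsub>S\<^esub>"
      by (simp_all add: S.trip_sym[of "trip S r s u"] S.trip_sym[of "trip S s r u"])
  qed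
  \<comment> \<open>With c in the middle slot the identity has to be solved for that slot by
    \<open>tr5_mid\<close>; the remaining terms are covered by \<open>z\<close> and
    \<open>z1\<close>.\<close>
  have z2: "trip S t (trip S r s u) j = \<zero>\<^bsub>S\<^esub>" "trip S t (trip S s r u) j = \<zero>\<^bsub>S\<^esub>"
    if j: "j \<in> FJ" and K: "s \<in> K" "u \<in> K" "t \<in> K" for j s u t
  proof -
    have [simp]: "j \<in> carrier S" "s \<in> carrier S" "u \<in> carrier S" "t \<in> carrier S" "r \<in> carrier S"
      using c j K r by auto
    show "trip S t (trip S r s u) j = \<zero>\<^bsub>S\<^esub>" "trip S t (trip S s r u) j = \<zero>\<^bsub>S\<^esub>"
      using j K S.J.tr5_mid[of s r t u j] S.J.tr5_mid[of r s t u j]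
      by (simp_all add: z z1 FJ S.M.diff_zero)
  qed
  have ann: "c = \<zero>\<^bsub>S\<^esub>" if c: "c \<in> K"
    and cz: "\<And>j t. \<lbrakk>j \<in> FJ; t \<in> K\<rbrakk> \<Longrightarrow> trip S c t j = \<zero>\<^bsub>S\<^esub> \<and> trip S c j t = \<zero>\<^bsub>S\<^esub> \<and> trip S t c j = \<zero>\<^bsub>S\<^esub>" for c
  proof -
    obtain a where a: "a \<in> carrier T" "c = f a" using c by blast
    have "trip T a x y = \<zero> \<and> trip T a y x = \<zero> \<and> trip T y a x = \<zero>" if x: "x \<in> J" and y: "y \<in> carrier T" for x y
    proof -
      have "trip S (f a) (f y) (f x) = \<zero>\<^bsub>S\<^esub> \<and> trip S (f a) (f x) (f y) = \<zero>\<^bsub>S\<^esub> \<and> trip S (f y) (f a) (f x) = \<zero>\<^bsub>S\<^esub>"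
        using cz[of "f x" "f y"] x y a unfolding FJ_def by auto
      then show ?thesis using a Jc[OF x] y by (simp add: f_eq_zero_iff flip: f_trip)
    qed
    then have "a \<in> jts_ann T J" using a unfolding jts_ann_def by simp
    then show ?thesis using J(2) a f_zero by simp
  qed
  obtain x t where x: "x \<in> I" "t \<in> carrier T" and
    ne: "trip S r (f x) (f t) \<noteq> \<zero>\<^bsub>S\<^esub> \<or> trip S r (f t) (f x) \<noteq> \<zero>\<^bsub>S\<^esub> \<or> trip S (f x) r (f t) \<noteq> \<zero>\<^bsub>S\<^esub>"
    using ne by blast
  have xK: "f x \<in> K" "f t \<in> K" using T.jts_idealD(4)[OF I(1) x(1) x(2) x(2)] x(2) by auto
  have k: "trip S r (f x) (f t) \<in> K" "trip S r (f t) (f x) \<in> K" "trip S (f x) r (f t) \<in> K"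
    using IK[OF x] by auto
  have "trip S r (f x) (f t) = \<zero>\<^bsub>S\<^esub>" by (rule ann[OF k(1)]) (simp add: z1 z2 xK)
  moreover have "trip S r (f t) (f x) = \<zero>\<^bsub>S\<^esub>" by (rule ann[OF k(2)]) (simp add: z1 z2 xK)
  moreover have "trip S (f x) r (f t) = \<zero>\<^bsub>S\<^esub>" by (rule ann[OF k(3)]) (simp add: z1 z2 xK)
  ultimately show False using ne by blast
qed

text \<open>The maps agree on \<open>K\<close>, hence on all products of q with its denominators. So
  g q - h q is annihilated by an ideal of T with zero annihilator, and \<open>separation\<close> in
  the target \<open>B\<close> makes it zero. Extensionality turns this into equality of
  functions.\<close>

lemma quotient_map_unique:
  assumes B: "jts_quotients \<Phi> T B e"
    and g: "jts_mono \<Phi> S B g" "\<And>x. x \<in> carrier T \<Longrightarrow> g (f x) = e x"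
    and h: "jts_mono \<Phi> S B h" "\<And>x. x \<in> carrier T \<Longrightarrow> h (f x) = e x"
  shows "g = h"
proof -
  interpret B: jts_quotients \<Phi> T B e by fact
  have map: "g' q \<in> carrier B" "g' (trip S q s u) = trip B (g' q) (g' s) (g' u)" "g' \<in> extensional (carrier S)"
    if g': "jts_mono \<Phi> S B g'" and q: "q \<in> carrier S" "s \<in> carrier S" "u \<in> carrier S" for g' q s u
  proof -
    have c: "\<And>q. q \<in> carrier S \<Longrightarrow> g' q \<in> carrier B"
      and a: "\<And>q s. \<lbrakk>q \<in> carrier S; s \<in> carrier S\<rbrakk> \<Longrightarrow> g' (q \<oplus>\<^bsub>S\<^esub> s) = g' q \<oplus>\<^bsub>B\<^esub> g' s"
      and qd: "\<And>q s. \<lbrakk>q \<in> carrier S; s \<in> carrier S\<rbrakk> \<Longrightarrow> g' (quad S q s) = quad B (g' q) (g' s)"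
      and ex: "g' \<in> extensional (carrier S)"
      using g' unfolding jts_mono_def mod_hom_def PiE_def by auto
    show "g' q \<in> carrier B" "g' \<in> extensional (carrier S)" using c q ex by auto
    have "g' (x \<ominus>\<^bsub>S\<^esub> y) = g' x \<ominus>\<^bsub>B\<^esub> g' y" if "x \<in> carrier S" "y \<in> carrier S" for x y
      by (rule additive_diff_gen[of S B])
        (use that c a S.M.abelian_group_axioms B.S.M.abelian_group_axioms in auto)
    then show "g' (trip S q s u) = trip B (g' q) (g' s) (g' u)"
      unfolding trip_def using q by (simp add: S.quad_closed qd a)
  qed
  have "g q = h q" if q: "q \<in> carrier S" for q
  proof (cases "q = \<zero>\<^bsub>S\<^esub>")
    case True
    have "q = f \<zero>" using True f_zero by simp
    then show ?thesis using g(2) h(2) by simp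
  next
    case False
    obtain J where J: "jts_ideal \<Phi> T J" "jts_ann T J = {\<zero>}"
      and JK: "\<And>x t. \<lbrakk>x \<in> J; t \<in> carrier T\<rbrakk> \<Longrightarrow>
        trip S q (f x) (f t) \<in> K \<and> trip S q (f t) (f x) \<in> K \<and> trip S (f x) q (f t) \<in> K"
      using denominators[OF q False] by metis
    have gq: "g q \<in> carrier B" "h q \<in> carrier B" using map(1) g(1) h(1) q by blast+
    have "g q \<ominus>\<^bsub>B\<^esub> h q = \<zero>\<^bsub>B\<^esub>"
    proof (rule B.separation[OF J])
      show "g q \<ominus>\<^bsub>B\<^esub> h q \<in> carrier B" using gq by simp
      fix x t assume x: "x \<in> J" "t \<in> carrier T"
      have xc: "x \<in> carrier T" using T.jts_idealD(4)[OF J(1) x(1) x(2) x(2)] .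
      have gh: "g k = h k" if "k \<in> K" for k using that g(2) h(2) by auto
      have fc: "f x \<in> carrier S" "f t \<in> carrier S" using xc x by auto
      have eq: "trip B (g q) (e x) (e t) = trip B (h q) (e x) (e t)"
        "trip B (g q) (e t) (e x) = trip B (h q) (e t) (e x)"
        "trip B (e x) (g q) (e t) = trip B (e x) (h q) (e t)"
        using gh[of "trip S q (f x) (f t)"] gh[of "trip S q (f t) (f x)"] gh[of "trip S (f x) q (f t)"] JK[OF x]
          map(2)[OF g(1) q fc] map(2)[OF h(1) q fc] map(2)[OF g(1) q fc(2,1)] map(2)[OF h(1) q fc(2,1)]
          map(2)[OF g(1) fc(1) q fc(2)] map(2)[OF h(1) fc(1) q fc(2)] g(2) h(2) xc x(2) by simp_all
      have ec: "e x \<in> carrier B" "e t \<in> carrier B" using xc x by auto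
      show "trip B (g q \<ominus>\<^bsub>B\<^esub> h q) (e x) (e t) = \<zero>\<^bsub>B\<^esub> \<and> trip B (g q \<ominus>\<^bsub>B\<^esub> h q) (e t) (e x) = \<zero>\<^bsub>B\<^esub> \<and>
        trip B (e x) (g q \<ominus>\<^bsub>B\<^esub> h q) (e t) = \<zero>\<^bsub>B\<^esub>"
        using gq ec eq by (simp add: B.S.J.tr_diff1 B.S.J.tr_diff2 B.S.M.diff_eq_zero)
    qed
    then show ?thesis using gq B.S.M.diff_eq_zero by simp
  qed
  moreover have "g \<in> extensional (carrier S)" "h \<in> extensional (carrier S)"
    using map(3)[OF g(1) S.M.zero_closed S.M.zero_closed S.M.zero_closed]
      map(3)[OF h(1) S.M.zero_closed S.M.zero_closed S.M.zero_closed] by auto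
  ultimately show ?thesis by (intro extensionalityI)
qed

end

section \<open>Essential ideals generated by ideals of the degree one component\<close>

context gr3
begin

text \<open>Generators of the graded ideal spanned by J and its mirror image. The last two sets are
  the degree zero brackets of J with degree -1 and of degree 1 with \<theta> J. Their span is
  already an ideal when J is stable under degree zero and under triple products.\<close>

definition idl_gens :: "'a set \<Rightarrow> 'a set" where
  "idl_gens J = J \<union> \<theta> ` J \<union> {j \<bullet> \<theta> t |j t. j \<in> J \<and> t \<in> G 1} \<union> {t \<bullet> \<theta> j |j t. j \<in> J \<and> t \<in> G 1}"

definition idl :: "'a set \<Rightarrow> 'a set" where
  "idl J = mspan \<Phi> L (idl_gens J)"

text \<open>\<open>J0\<close> and \<open>J1\<close> say that J is an ideal of the triple system in
  degree 1. Stability under \<open>G 0\<close> is listed separately because the abstract algebra may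
  have elements of degree zero that are not sums of brackets of degrees 1 and -1.\<close>

context
  fixes J :: "'a set"
  assumes JG: "submodule J \<Phi> L" "J \<subseteq> G 1"
    and J0: "\<And>w j. \<lbrakk>w \<in> G 0; j \<in> J\<rbrakk> \<Longrightarrow> w \<bullet> j \<in> J"
    and J1: "\<And>t s j. \<lbrakk>t \<in> G 1; s \<in> G 1; j \<in> J\<rbrakk> \<Longrightarrow> (t \<bullet> \<theta> j) \<bullet> s \<in> J \<and> (j \<bullet> \<theta> s) \<bullet> t \<in> J"
begin

lemma J_in: "j \<in> J \<Longrightarrow> j \<in> G 1" "j \<in> J \<Longrightarrow> j \<in> carrier L" "j \<in> J \<Longrightarrow> \<theta> j \<in> G (-1)" "j \<in> J \<Longrightarrow> \<theta> j \<in> carrier L"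
  using JG(2) G_in th_deg by blast+

lemma th_G1: "t \<in> G 1 \<Longrightarrow> \<theta> t \<in> G (-1)" "t \<in> G 1 \<Longrightarrow> \<theta> t \<in> carrier L"
  using G_in th_deg by blast+

lemma idl_gens_deg: "x \<in> idl_gens J \<Longrightarrow> x \<in> G 1 \<or> x \<in> G (-1) \<or> x \<in> G 0"
  unfolding idl_gens_def using J_in th_G1 G_br_pm(1)[of _ 1] by auto

lemma idl_gens_sub: "idl_gens J \<subseteq> carrier L"
  using idl_gens_deg G_in by blast

lemma idl_submodule: "submodule (idl J) \<Phi> L"
  unfolding idl_def by (rule mspan_submodule[OF idl_gens_sub])

lemma idl_gen: "x \<in> idl_gens J \<Longrightarrow> x \<in> idl J"
  unfolding idl_def by (rule mspan_incl)

lemma J_idl: "j \<in> J \<Longrightarrow> j \<in> idl J" "j \<in> J \<Longrightarrow> \<theta> j \<in> idl J"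
  "\<lbrakk>j \<in> J; t \<in> G 1\<rbrakk> \<Longrightarrow> j \<bullet> \<theta> t \<in> idl J" "\<lbrakk>j \<in> J; t \<in> G 1\<rbrakk> \<Longrightarrow> t \<bullet> \<theta> j \<in> idl J"
  by (rule idl_gen, auto simp: idl_gens_def)+

lemma idl_th: "x \<in> idl J \<Longrightarrow> \<theta> x \<in> idl J"
proof -
  have "submodule {x \<in> carrier L. \<theta> x \<in> idl J} \<Phi> L"
    by (rule submodule_linear_set[OF submodule_carrier module_axioms _ _ _ idl_submodule]) (auto simp: th_add th_smult)
  moreover have "idl_gens J \<subseteq> {x \<in> carrier L. \<theta> x \<in> idl J}"
  proof (rule subsetI, intro CollectI conjI)
    fix x assume x: "x \<in> idl_gens J"
    then show "x \<in> carrier L" using idl_gens_sub by blast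
    consider "x \<in> J" | j where "j \<in> J" "x = \<theta> j" | j t where "j \<in> J" "t \<in> G 1" "x = j \<bullet> \<theta> t"
      | j t where "j \<in> J" "t \<in> G 1" "x = t \<bullet> \<theta> j"
      using x unfolding idl_gens_def by blast
    then show "\<theta> x \<in> idl J"
    proof cases
      case 1 then show ?thesis using J_idl by blast
    next
      case 2 then show ?thesis using J_idl J_in by simp
    next
      case 3
      then have "\<theta> x = \<ominus> (t \<bullet> \<theta> j)" using J_in th_G1 G_in br_anti[of "\<theta> j" t] by (simp add: th_br)
      then show ?thesis using J_idl(4)[OF 3(1,2)] submodule_uminus[OF idl_submodule] by simp
    next
      case 4
      then have "\<theta> x = \<ominus> (j \<bullet> \<theta> t)" using J_in th_G1 G_in br_anti[of "\<theta> t" j] by (simp add: th_br)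
      then show ?thesis using J_idl(3)[OF 4(1,2)] submodule_uminus[OF idl_submodule] by simp
    qed
  qed
  ultimately have "idl J \<subseteq> {x \<in> carrier L. \<theta> x \<in> idl J}"
    unfolding idl_def[of J] by (rule mspan_least)
  then show "x \<in> idl J \<Longrightarrow> \<theta> x \<in> idl J" by blast
qed

lemma idl_G1: 
  assumes s: "s \<in> G 1" and x: "x \<in> idl_gens J"
  shows "s \<bullet> x \<in> idl J"
proof -
  have sc: "s \<in> carrier L" using G_in s by blast
  consider "x \<in> J" | j where "j \<in> J" "x = \<theta> j" | j t where "j \<in> J" "t \<in> G 1" "x = j \<bullet> \<theta> t"
    | j t where "j \<in> J" "t \<in> G 1" "x = t \<bullet> \<theta> j"
    using x unfolding idl_gens_def by blast
  then show ?thesis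
  proof cases
    case 1
    then have "s \<bullet> x = \<zero>" using G_br_same[OF s J_in(1)[OF 1]] by simp
    then show ?thesis using submodule_zero[OF idl_submodule] by simp
  next
    case 2 then show ?thesis using J_idl(4) s by blast
  next
    case 3
    have "(j \<bullet> \<theta> t) \<bullet> s \<in> idl J" using J1[OF s 3(2,1)] J_idl(1) by blast
    then show ?thesis using br_anti[of s x] 3 sc J_in th_G1 submodule_uminus[OF idl_submodule] by simp
  next
    case 4
    have "(t \<bullet> \<theta> j) \<bullet> s \<in> idl J" using J1[OF 4(2) s 4(1)] J_idl(1) by blast
    then show ?thesis using br_anti[of s x] 4 sc J_in th_G1 G_in submodule_uminus[OF idl_submodule] by simp
  qed
qed

lemma idl_G1': 
  assumes s: "s \<in> G 1" and x: "x \<in> idl J"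
  shows "s \<bullet> x \<in> idl J"
proof -
  have "submodule {x \<in> carrier L. s \<bullet> x \<in> idl J} \<Phi> L"
    by (rule submodule_linear_set[OF submodule_carrier module_axioms _ _ _ idl_submodule])
      (auto simp: br_lin G_in[OF s])
  moreover have "idl_gens J \<subseteq> {x \<in> carrier L. s \<bullet> x \<in> idl J}" using idl_G1[OF s] idl_gens_sub by blast
  ultimately have "idl J \<subseteq> {x \<in> carrier L. s \<bullet> x \<in> idl J}"
    unfolding idl_def[of J] by (rule mspan_least)
  then show ?thesis using x by blast
qed

lemma idl_G0:
  assumes w: "w \<in> G 0" and x: "x \<in> idl_gens J"
  shows "w \<bullet> x \<in> idl J"
proof -
  have wc: "w \<in> carrier L" using G_in w by blast
  have tw: "\<theta> w \<in> G 0" using th_deg[OF w] by simp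
  have wth: "w \<bullet> \<theta> j = \<theta> (\<theta> w \<bullet> j)" if "j \<in> carrier L" for j using wc that by (simp add: th_br)
  consider "x \<in> J" | j where "j \<in> J" "x = \<theta> j" | j t where "j \<in> J" "t \<in> G 1" "x = j \<bullet> \<theta> t"
    | j t where "j \<in> J" "t \<in> G 1" "x = t \<bullet> \<theta> j"
    using x unfolding idl_gens_def by blast
  then show ?thesis
  proof cases
    case 1 then show ?thesis using J0[OF w] J_idl(1) by blast
  next
    case 2 then show ?thesis using J0[OF tw] J_idl(2) wth J_in by simp
  next
    case 3
    have "w \<bullet> x = (w \<bullet> j) \<bullet> \<theta> t \<oplus> j \<bullet> \<theta> (\<theta> w \<bullet> t)"
      using br_jacobi[of w j "\<theta> t"] 3 wc J_in th_G1 G_in by (simp add: wth)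
    then show ?thesis using J_idl(3)[OF J0[OF w 3(1)] 3(2)] J_idl(3)[OF 3(1) G_br0(1)[OF tw 3(2)]]
        submodule_add[OF idl_submodule] by simp
  next
    case 4
    have "w \<bullet> x = (w \<bullet> t) \<bullet> \<theta> j \<oplus> t \<bullet> \<theta> (\<theta> w \<bullet> j)"
      using br_jacobi[of w t "\<theta> j"] 4 wc J_in th_G1 G_in by (simp add: wth)
    then show ?thesis using J_idl(4)[OF J0[OF tw 4(1)] 4(2)] J_idl(4)[OF 4(1) G_br0(1)[OF w 4(2)]]
        submodule_add[OF idl_submodule] by simp
  qed
qed

lemma idl_ideal: "lie_ideal \<Phi> L (idl J)"
  unfolding idl_def
proof (rule ideal_mspanI[OF idl_gens_sub], fold idl_def)
  fix x y assume x: "x \<in> carrier L" and y: "y \<in> idl_gens J"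
  have yc: "y \<in> carrier L" "y \<in> idl J" using idl_gens_sub idl_gen y by auto
  have px: "p 1 x \<in> G 1" "p 0 x \<in> G 0" "p (-1) x \<in> G (-1)" using p_deg x by auto
  have pc: "p 1 x \<in> carrier L" "p 0 x \<in> carrier L" "p (-1) x \<in> carrier L" using G_in px by blast+
  \<comment> \<open>Degree -1 reduces to degree 1, since the span is invariant under
    \<theta>.\<close>
  have "\<theta> (p (-1) x) \<in> G 1" using th_deg[OF px(3)] by simp
  then have "\<theta> (\<theta> (p (-1) x) \<bullet> \<theta> y) \<in> idl J" using idl_G1' idl_th yc(2) by blast
  then have "p (-1) x \<bullet> y \<in> idl J" using pc yc by (simp add: th_br)
  then have "p 1 x \<bullet> y \<oplus> p 0 x \<bullet> y \<oplus> p (-1) x \<bullet> y \<in> idl J"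
    using idl_G1[OF px(1) y] idl_G0[OF px(2) y] submodule_add[OF idl_submodule] by blast
  then show "x \<otimes> y \<in> idl J" using p_decomp[OF x] pc yc by (simp flip: br_add1)
qed

lemma idl_graded: "graded (idl J)"
  unfolding graded_ideal_def
proof (intro conjI idl_ideal subset_antisym)
  have "(\<Union>j. idl J \<inter> G j) \<subseteq> carrier L" using G_in by blast
  then have "submodule (mspan \<Phi> L (\<Union>j. idl J \<inter> G j)) \<Phi> L" by (rule mspan_submodule)
  moreover have "idl_gens J \<subseteq> mspan \<Phi> L (\<Union>j. idl J \<inter> G j)"
  proof
    fix x assume "x \<in> idl_gens J"
    then have "x \<in> (\<Union>j. idl J \<inter> G j)" using idl_gens_deg[of x] idl_gen[of x] by blast
    then show "x \<in> mspan \<Phi> L (\<Union>j. idl J \<inter> G j)" by (rule mspan_incl)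
  qed
  ultimately show "idl J \<subseteq> mspan \<Phi> L (\<Union>j. idl J \<inter> G j)"
    unfolding idl_def[of J] by (rule mspan_least)
  show "mspan \<Phi> L (\<Union>j. idl J \<inter> G j) \<subseteq> idl J"
    by (rule mspan_least[OF idl_submodule]) blast
qed

text \<open>An ideal D that meets \<open>idl J\<close> in zero commutes with it. By
  \<open>ideal_meets_G1\<close> a nonzero D contains a nonzero u of degree 1. Both u and \<theta> u
  commute with the \<theta>-invariant ideal \<open>idl J\<close>, so the products of u with J and
  degree 1 in \<open>ann\<close> vanish.\<close>

lemma idl_essential:
  assumes ann: "\<And>z. \<lbrakk>z \<in> G 1; \<And>j t. \<lbrakk>j \<in> J; t \<in> G 1\<rbrakk> \<Longrightarrow>
    (z \<bullet> \<theta> j) \<bullet> t = \<zero> \<and> (z \<bullet> \<theta> t) \<bullet> j = \<zero> \<and> (t \<bullet> \<theta> z) \<bullet> j = \<zero>\<rbrakk> \<Longrightarrow> z = \<zero>"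
  shows "essential_ideal \<Phi> L (idl J)"
  unfolding essential_ideal_def
proof (intro conjI allI impI idl_ideal notI)
  fix D assume D: "lie_ideal \<Phi> L D \<and> D \<noteq> {\<zero>}" and DE: "idl J \<inter> D = {\<zero>}"
  obtain x where "x \<in> D" "x \<noteq> \<zero>" using ideal_nonzeroE D by blast
  then obtain u where u: "u \<in> D" "u \<in> G 1" "u \<noteq> \<zero>" using ideal_meets_G1 D by blast
  have uc: "u \<in> carrier L" "\<theta> u \<in> carrier L" using G_in u by auto
  have ue: "u \<bullet> e = \<zero>" if e: "e \<in> idl J" for e
    using idealD(2)[OF idl_ideal uc(1) e] idealD(3)[of D e u] D u(1) idealD(4)[OF idl_ideal e] DE by blast
  have the: "\<theta> u \<bullet> e = \<zero>" if e: "e \<in> idl J" for e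
    using ue[OF idl_th[OF e]] idealD(4)[OF idl_ideal e] uc th_br[of u "\<theta> e"] th_zero by simp
  have "u = \<zero>"
  proof (rule ann[OF u(2)])
    fix j t assume j: "j \<in> J" and t: "t \<in> G 1"
    have c: "j \<in> carrier L" "t \<in> carrier L" "\<theta> t \<in> carrier L" using J_in j G_in t by auto
    have e: "\<theta> t \<bullet> j \<in> idl J" "t \<bullet> j \<in> idl J" using idealD(2)[OF idl_ideal _ J_idl(1)[OF j]] c by auto
    show "(u \<bullet> \<theta> j) \<bullet> t = \<zero> \<and> (u \<bullet> \<theta> t) \<bullet> j = \<zero> \<and> (t \<bullet> \<theta> u) \<bullet> j = \<zero>"
      using ue[OF J_idl(2)[OF j]] ue[OF J_idl(1)[OF j]] ue[OF e(1)] the[OF J_idl(1)[OF j]] the[OF e(2)]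
        br_jacobi1[OF uc(1) c(3,1)] br_jacobi1[OF c(2) uc(2) c(1)] c by (simp add: M.diff_zero)
  qed
  then show False using u(3) by blast
qed

end

end

section \<open>Quotients from an overalgebra\<close>

text \<open>Elements of \<open>M\<close> are seen only through their action on \<open>L\<close>:
  essential ideals and algebras of quotients always refer to \<open>L\<close>, and \<open>M\<close>
  serves as the ambient algebra in which brackets are computed.\<close>

locale lie_extension = L: gr3 \<Phi> L G p \<theta> + M: lie \<Phi> M
  for \<Phi> :: "('k, 'r) ring_scheme" and L :: "('k, 'a, 'm) module_scheme" (structure)
    and G p \<theta> and M :: "('k, 'b, 'n) module_scheme" +
  fixes \<phi> :: "'a \<Rightarrow> 'b" and \<theta>M :: "'b \<Rightarrow> 'b"
  assumes ph_closed [simp, intro]: "x \<in> carrier L \<Longrightarrow> \<phi> x \<in> carrier M"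
    and ph_add: "\<lbrakk>x \<in> carrier L; y \<in> carrier L\<rbrakk> \<Longrightarrow> \<phi> (x \<oplus> y) = \<phi> x \<oplus>\<^bsub>M\<^esub> \<phi> y"
    and ph_smult: "\<lbrakk>a \<in> carrier \<Phi>; x \<in> carrier L\<rbrakk> \<Longrightarrow> \<phi> (a \<odot> x) = a \<odot>\<^bsub>M\<^esub> \<phi> x"
    and ph_br: "\<lbrakk>x \<in> carrier L; y \<in> carrier L\<rbrakk> \<Longrightarrow> \<phi> (x \<otimes> y) = \<phi> x \<otimes>\<^bsub>M\<^esub> \<phi> y"
    and ph_inj: "inj_on \<phi> (carrier L)"
    and thM_closed [simp, intro]: "m \<in> carrier M \<Longrightarrow> \<theta>M m \<in> carrier M"
    and thM_br: "\<lbrakk>m \<in> carrier M; n \<in> carrier M\<rbrakk> \<Longrightarrow> \<theta>M (m \<otimes>\<^bsub>M\<^esub> n) = \<theta>M m \<otimes>\<^bsub>M\<^esub> \<theta>M n"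
    and thM_ph: "x \<in> carrier L \<Longrightarrow> \<theta>M (\<phi> x) = \<phi> (\<theta> x)"
begin

definition dm :: "'b \<Rightarrow> 'a \<Rightarrow> 'a" where
  "dm m x = inv_into (carrier L) \<phi> (m \<otimes>\<^bsub>M\<^esub> \<phi> x)"

definition dom :: "'b \<Rightarrow> 'a set \<Rightarrow> bool" where
  "dom m E \<longleftrightarrow> m \<in> carrier M \<and> essential_ideal \<Phi> L E \<and> (\<forall>x\<in>E. m \<otimes>\<^bsub>M\<^esub> \<phi> x \<in> \<phi> ` carrier L)"

lemma ph_image_submodule: "submodule (\<phi> ` carrier L) \<Phi> M"
proof (rule M.submoduleI)
  have z: "\<phi> \<zero> = \<zero>\<^bsub>M\<^esub>"
    by (rule additive_zero_gen[of L M]) (auto simp: ph_add L.M.abelian_group_axioms M.M.abelian_group_axioms)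
  show "\<zero>\<^bsub>M\<^esub> \<in> \<phi> ` carrier L" using z by (metis imageI L.M.zero_closed)
  fix a assume "a \<in> \<phi> ` carrier L"
  then obtain x where x: "x \<in> carrier L" "a = \<phi> x" by blast
  have "\<ominus>\<^bsub>M\<^esub> a = \<phi> (\<ominus> x)" unfolding x(2)
    by (rule additive_uminus_gen[of L M, symmetric]) (auto simp: ph_add x L.M.abelian_group_axioms M.M.abelian_group_axioms)
  then show "\<ominus>\<^bsub>M\<^esub> a \<in> \<phi> ` carrier L" using x by simp
qed (auto simp flip: ph_add ph_smult)

lemma inv_ph: "m \<in> \<phi> ` carrier L \<Longrightarrow> inv_into (carrier L) \<phi> m \<in> carrier L"
  "m \<in> \<phi> ` carrier L \<Longrightarrow> \<phi> (inv_into (carrier L) \<phi> m) = m"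
  by (auto intro: inv_into_into f_inv_into_f)

lemma domD:
  assumes "dom m E"
  shows "m \<in> carrier M" "essential_ideal \<Phi> L E" "lie_ideal \<Phi> L E"
    "\<And>x. x \<in> E \<Longrightarrow> x \<in> carrier L" "\<And>x. x \<in> E \<Longrightarrow> dm m x \<in> carrier L"
    "\<And>x. x \<in> E \<Longrightarrow> \<phi> (dm m x) = m \<otimes>\<^bsub>M\<^esub> \<phi> x"
proof -
  show "m \<in> carrier M" "essential_ideal \<Phi> L E" using assms unfolding dom_def by auto
  then show E: "lie_ideal \<Phi> L E" using L.essD by blast
  show "x \<in> carrier L" if "x \<in> E" for x using L.idealD(4)[OF E that] .
  show "dm m x \<in> carrier L" "\<phi> (dm m x) = m \<otimes>\<^bsub>M\<^esub> \<phi> x" if "x \<in> E" for x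
    using assms that inv_ph unfolding dom_def dm_def by auto
qed

lemma dm_eqI: "\<lbrakk>y \<in> carrier L; \<phi> y = m \<otimes>\<^bsub>M\<^esub> \<phi> x\<rbrakk> \<Longrightarrow> dm m x = y"
  unfolding dm_def using ph_inj inv_into_f_f by metis

lemma pder_dm:
  assumes m: "dom m E"
  shows "L.pder E (dm m)"
proof -
  note D = domD[OF m]
  have s: "submodule E \<Phi> L" using L.idealD(1)[OF D(3)] .
  show ?thesis unfolding L.pder_def
  proof (intro conjI ballI D(2))
    show "dm m \<in> E \<rightarrow> carrier L" using D(5) by blast
    fix x y assume x: "x \<in> E" and y: "y \<in> E"
    note c = D(4)[OF x] D(4)[OF y] D(5)[OF x] D(5)[OF y]
    show "dm m (x \<oplus> y) = dm m x \<oplus> dm m y"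
      using c D(1) by (intro dm_eqI) (simp_all add: ph_add D(6) x y M.br_add2)
    show "dm m (x \<otimes> y) = (dm m x \<otimes> y) \<oplus> (x \<otimes> dm m y)"
      using c D(1) by (intro dm_eqI) (simp_all add: ph_add ph_br D(6) x y M.br_jacobi[of m "\<phi> x" "\<phi> y"])
  next
    fix a x assume a: "a \<in> carrier \<Phi>" and x: "x \<in> E"
    show "dm m (a \<odot> x) = a \<odot> dm m x"
      using D(4)[OF x] D(5)[OF x] D(1) a by (intro dm_eqI) (simp_all add: ph_smult D(6) x M.br_smult2)
  qed
qed

text \<open>The chosen ideal does not matter, since the same function \<open>dm m\<close> represents
  the class on every admissible domain. Only elements m with some \<open>dom m E\<close> receive a
  meaningful value.\<close>

definition ext :: "'b \<Rightarrow> ('a set \<times> ('a \<Rightarrow> 'a)) set" where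
  "ext m = L.cls (SOME E. dom m E) (dm m)"

lemma ext_eq:
  assumes "dom m E"
  shows "ext m = L.cls E (dm m)"
proof -
  have "dom m (SOME E. dom m E)" using assms by (rule someI)
  then show ?thesis unfolding ext_def using L.cls_eq_iff[OF pder_dm pder_dm] assms by blast
qed

lemma dom_mono: "\<lbrakk>dom m E; essential_ideal \<Phi> L F; F \<subseteq> E\<rbrakk> \<Longrightarrow> dom m F"
  unfolding dom_def by blast

lemma dom_common:
  assumes m: "dom m E" and n: "dom n F"
  shows "dom m (E \<inter> F)" "dom n (E \<inter> F)"
  using dom_mono[OF m] dom_mono[OF n] L.ess_inter[OF domD(2)[OF m] domD(2)[OF n]] by auto

lemma ext_add:
  assumes m: "dom m E" and n: "dom n E"
  shows "dom (m \<oplus>\<^bsub>M\<^esub> n) E" "ext (m \<oplus>\<^bsub>M\<^esub> n) = ext m \<oplus>\<^bsub>L.Q\<^esub> ext n"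
proof -
  note D = domD[OF m] and D' = domD[OF n]
  have ph: "\<phi> (dm m x \<oplus> dm n x) = (m \<oplus>\<^bsub>M\<^esub> n) \<otimes>\<^bsub>M\<^esub> \<phi> x" if x: "x \<in> E" for x
    using x D(1,4-6) D'(1,5,6) by (simp add: ph_add M.br_add1)
  have i: "(m \<oplus>\<^bsub>M\<^esub> n) \<otimes>\<^bsub>M\<^esub> \<phi> x \<in> \<phi> ` carrier L" if x: "x \<in> E" for x
    unfolding ph[OF x, symmetric] using D(5)[OF x] D'(5)[OF x] by simp
  then show dom: "dom (m \<oplus>\<^bsub>M\<^esub> n) E"
    unfolding dom_def using D(1,2) D'(1) by blast
  have "dm (m \<oplus>\<^bsub>M\<^esub> n) x = dm m x \<oplus> dm n x" if x: "x \<in> E" for x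
    using D(5)[OF x] D'(5)[OF x] ph[OF x] by (intro dm_eqI) simp_all
  then show "ext (m \<oplus>\<^bsub>M\<^esub> n) = ext m \<oplus>\<^bsub>L.Q\<^esub> ext n"
    unfolding ext_eq[OF dom] ext_eq[OF m] ext_eq[OF n] L.Q_add[OF pder_dm[OF m] pder_dm[OF n]]
    by (rule L.cls_eqI[OF pder_dm[OF dom]])
qed

lemma ext_smult:
  assumes m: "dom m E" and a: "a \<in> carrier \<Phi>"
  shows "dom (a \<odot>\<^bsub>M\<^esub> m) E" "ext (a \<odot>\<^bsub>M\<^esub> m) = a \<odot>\<^bsub>L.Q\<^esub> ext m"
proof -
  note D = domD[OF m]
  have ph: "\<phi> (a \<odot> dm m x) = (a \<odot>\<^bsub>M\<^esub> m) \<otimes>\<^bsub>M\<^esub> \<phi> x" if x: "x \<in> E" for x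
    using x D(1,4-6) a by (simp add: ph_smult M.br_smult1)
  have i: "(a \<odot>\<^bsub>M\<^esub> m) \<otimes>\<^bsub>M\<^esub> \<phi> x \<in> \<phi> ` carrier L" if x: "x \<in> E" for x
    unfolding ph[OF x, symmetric] using D(5)[OF x] a by simp
  then show dom: "dom (a \<odot>\<^bsub>M\<^esub> m) E"
    unfolding dom_def using D(1,2) a by blast
  have "dm (a \<odot>\<^bsub>M\<^esub> m) x = a \<odot> dm m x" if x: "x \<in> E" for x
    using D(5)[OF x] a ph[OF x] by (intro dm_eqI) simp_all
  then show "ext (a \<odot>\<^bsub>M\<^esub> m) = a \<odot>\<^bsub>L.Q\<^esub> ext m"
    unfolding ext_eq[OF dom] ext_eq[OF m] L.Q_smult[OF pder_dm[OF m] a]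
    by (rule L.cls_eqI[OF pder_dm[OF dom]])
qed

lemma ph_diff: "\<lbrakk>x \<in> carrier L; y \<in> carrier L\<rbrakk> \<Longrightarrow> \<phi> (x \<ominus> y) = \<phi> x \<ominus>\<^bsub>M\<^esub> \<phi> y"
  by (rule additive_diff_gen[of L M]) (auto simp: ph_add L.M.abelian_group_axioms M.M.abelian_group_axioms)

text \<open>The domain shrinks to [E,E]: there the derivation applied first has its values in E, so
  the second one can follow.\<close>

lemma ext_br:
  assumes m: "dom m E" and n: "dom n E"
  shows "dom (m \<otimes>\<^bsub>M\<^esub> n) (lie_derived \<Phi> L E)" "ext (m \<otimes>\<^bsub>M\<^esub> n) = ext m \<otimes>\<^bsub>L.Q\<^esub> ext n"
proof -
  note D = domD[OF m] and D' = domD[OF n]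
  define E' where "E' = lie_derived \<Phi> L E"
  have E': "essential_ideal \<Phi> L E'" "\<And>x. x \<in> E' \<Longrightarrow> x \<in> E"
    unfolding E'_def using L.ess_derived[OF D(2)] L.derived_sub[OF D(3)] by auto
  have in1: "dm m x \<in> E" "dm n x \<in> E" if "x \<in> E'" for x
    using L.pder_derived_into[OF pder_dm[OF m] D(3) subset_refl] L.pder_derived_into[OF pder_dm[OF n] D(3) subset_refl]
      that unfolding E'_def by auto
  have ph: "\<phi> (dm m (dm n x) \<ominus> dm n (dm m x)) = (m \<otimes>\<^bsub>M\<^esub> n) \<otimes>\<^bsub>M\<^esub> \<phi> x" if x: "x \<in> E'" for x
    using x E'(2)[OF x] in1[OF x] D(1,4-6) D'(1,5,6) by (simp add: ph_diff M.br_jacobi1)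
  have c: "dm m (dm n x) \<ominus> dm n (dm m x) \<in> carrier L" if x: "x \<in> E'" for x
    using in1[OF x] D(5) D'(5) by simp
  have i: "(m \<otimes>\<^bsub>M\<^esub> n) \<otimes>\<^bsub>M\<^esub> \<phi> x \<in> \<phi> ` carrier L" if x: "x \<in> E'" for x
    unfolding ph[OF x, symmetric] using c[OF x] by simp
  then have dom: "dom (m \<otimes>\<^bsub>M\<^esub> n) E'"
    unfolding dom_def using D(1) D'(1) E'(1) by blast
  then show "dom (m \<otimes>\<^bsub>M\<^esub> n) (lie_derived \<Phi> L E)" unfolding E'_def .
  have "dm (m \<otimes>\<^bsub>M\<^esub> n) x = dm m (dm n x) \<ominus> dm n (dm m x)" if x: "x \<in> E'" for x
    by (rule dm_eqI[OF c[OF x] ph[OF x]])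
  then show "ext (m \<otimes>\<^bsub>M\<^esub> n) = ext m \<otimes>\<^bsub>L.Q\<^esub> ext n"
    unfolding ext_eq[OF dom] ext_eq[OF m] ext_eq[OF n] L.Q_br[OF pder_dm[OF m] pder_dm[OF n]] E'_def[symmetric]
    by (rule L.cls_eqI[OF pder_dm[OF dom]])
qed

lemma ext_ph:
  assumes x: "x \<in> carrier L"
  shows "dom (\<phi> x) (carrier L)" "ext (\<phi> x) = L.adc x"
proof -
  show dom: "dom (\<phi> x) (carrier L)"
    unfolding dom_def using x L.ess_carrier by (auto simp flip: ph_br)
  have "dm (\<phi> x) y = x \<otimes> y" if "y \<in> carrier L" for y
    using x that by (intro dm_eqI) (simp_all add: ph_br)
  then show "ext (\<phi> x) = L.adc x"
    unfolding ext_eq[OF dom] L.adc_cls by (rule L.cls_eqI[OF pder_dm[OF dom]])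
qed

lemma ext_th:
  assumes m: "dom m E"
  shows "dom (\<theta>M m) (\<theta> ` E)" "ext (\<theta>M m) = L.thQ (ext m)"
proof -
  note D = domD[OF m]
  have c: "\<theta> (dm m (\<theta> z)) \<in> carrier L" "\<phi> (\<theta> (dm m (\<theta> z))) = \<theta>M m \<otimes>\<^bsub>M\<^esub> \<phi> z" if z: "z \<in> \<theta> ` E" for z
  proof -
    have zE: "\<theta> z \<in> E" "z \<in> carrier L" using z D(4) by auto
    show "\<theta> (dm m (\<theta> z)) \<in> carrier L" using D(5)[OF zE(1)] by simp
    show "\<phi> (\<theta> (dm m (\<theta> z))) = \<theta>M m \<otimes>\<^bsub>M\<^esub> \<phi> z"
      using zE D(1) D(5)[OF zE(1)] D(6)[OF zE(1)] by (simp add: thM_br thM_ph flip: thM_ph[of "dm m (\<theta> z)"])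
  qed
  have i: "\<theta>M m \<otimes>\<^bsub>M\<^esub> \<phi> z \<in> \<phi> ` carrier L" if z: "z \<in> \<theta> ` E" for z
    unfolding c(2)[OF z, symmetric] using c(1)[OF z] by simp
  then show dom: "dom (\<theta>M m) (\<theta> ` E)"
    unfolding dom_def using D(1) L.th_image_ess[OF D(2)] by blast
  have "dm (\<theta>M m) z = \<theta> (dm m (\<theta> z))" if z: "z \<in> \<theta> ` E" for z
    by (rule dm_eqI[OF c[OF z]])
  then show "ext (\<theta>M m) = L.thQ (ext m)"
    unfolding ext_eq[OF dom] ext_eq[OF m] L.thQ_cls[OF pder_dm[OF m]]
    by (rule L.cls_eqI[OF pder_dm[OF dom]])
qed

end


section \<open>The TKK-algebra of a double Jordan pair\<close>

lemma mod_sum_simps [simp]: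
  "carrier (mod_sum M N) = carrier M \<times> carrier N"
  "\<zero>\<^bsub>mod_sum M N\<^esub> = (\<zero>\<^bsub>M\<^esub>, \<zero>\<^bsub>N\<^esub>)"
  "p \<oplus>\<^bsub>mod_sum M N\<^esub> q = (fst p \<oplus>\<^bsub>M\<^esub> fst q, snd p \<oplus>\<^bsub>N\<^esub> snd q)"
  "p \<otimes>\<^bsub>mod_sum M N\<^esub> q = (fst p \<otimes>\<^bsub>M\<^esub> fst q, snd p \<otimes>\<^bsub>N\<^esub> snd q)"
  "a \<odot>\<^bsub>mod_sum M N\<^esub> p = (a \<odot>\<^bsub>M\<^esub> fst p, a \<odot>\<^bsub>N\<^esub> snd p)"
  by (simp_all add: mod_sum_def case_prod_beta)

lemma mod_sum_module:
  assumes "module \<Phi> M" "module \<Phi> N"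
  shows "module \<Phi> (mod_sum M N)"
proof -
  interpret M: module \<Phi> M by fact
  interpret N: module \<Phi> N by fact
  show ?thesis
  proof (rule moduleI[OF M.R.is_cring])
    show "abelian_group (mod_sum M N)"
    proof (rule abelian_groupI)
      fix x assume "x \<in> carrier (mod_sum M N)"
      then show "\<exists>y\<in>carrier (mod_sum M N). y \<oplus>\<^bsub>mod_sum M N\<^esub> x = \<zero>\<^bsub>mod_sum M N\<^esub>"
        by (intro bexI[of _ "(\<ominus>\<^bsub>M\<^esub> fst x, \<ominus>\<^bsub>N\<^esub> snd x)"]) (auto simp: M.M.l_neg N.M.l_neg)
    qed (auto simp: M.M.a_ac N.M.a_ac)
  qed (auto simp: M.smult_l_distr N.smult_l_distr M.smult_r_distr N.smult_r_distr M.smult_assoc1 N.smult_assoc1)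
qed

lemma mod_End_simps [simp]:
  "carrier (mod_End \<Phi> M) = mod_hom \<Phi> M M"
  "\<zero>\<^bsub>mod_End \<Phi> M\<^esub> = (\<lambda>x\<in>carrier M. \<zero>\<^bsub>M\<^esub>)"
  "f \<oplus>\<^bsub>mod_End \<Phi> M\<^esub> g = (\<lambda>x\<in>carrier M. f x \<oplus>\<^bsub>M\<^esub> g x)"
  "f \<otimes>\<^bsub>mod_End \<Phi> M\<^esub> g = compose (carrier M) f g"
  "a \<odot>\<^bsub>mod_End \<Phi> M\<^esub> f = (\<lambda>x\<in>carrier M. a \<odot>\<^bsub>M\<^esub> f x)"
  by (simp_all add: mod_End_def)

lemma mod_homD:
  assumes "f \<in> mod_hom \<Phi> M N"
  shows "x \<in> carrier M \<Longrightarrow> f x \<in> carrier N"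
    "\<lbrakk>x \<in> carrier M; y \<in> carrier M\<rbrakk> \<Longrightarrow> f (x \<oplus>\<^bsub>M\<^esub> y) = f x \<oplus>\<^bsub>N\<^esub> f y"
    "\<lbrakk>a \<in> carrier \<Phi>; x \<in> carrier M\<rbrakk> \<Longrightarrow> f (a \<odot>\<^bsub>M\<^esub> x) = a \<odot>\<^bsub>N\<^esub> f x"
    "f \<in> extensional (carrier M)"
  using assms unfolding mod_hom_def PiE_def by auto

lemma mod_hom_eqI:
  assumes "f \<in> mod_hom \<Phi> M N" "g \<in> mod_hom \<Phi> M N" "\<And>x. x \<in> carrier M \<Longrightarrow> f x = g x"
  shows "f = g"
  by (rule extensionalityI[OF mod_homD(4)[OF assms(1)] mod_homD(4)[OF assms(2)] assms(3)])

lemma mod_hom_restrictI: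
  assumes "\<And>x. x \<in> carrier M \<Longrightarrow> f x \<in> carrier N"
    "\<And>x y. \<lbrakk>x \<in> carrier M; y \<in> carrier M\<rbrakk> \<Longrightarrow> f (x \<oplus>\<^bsub>M\<^esub> y) = f x \<oplus>\<^bsub>N\<^esub> f y"
    "\<And>a x. \<lbrakk>a \<in> carrier \<Phi>; x \<in> carrier M\<rbrakk> \<Longrightarrow> f (a \<odot>\<^bsub>M\<^esub> x) = a \<odot>\<^bsub>N\<^esub> f x"
    "module \<Phi> M"
  shows "(\<lambda>x\<in>carrier M. f x) \<in> mod_hom \<Phi> M N"
proof -
  interpret M: module \<Phi> M by fact
  show ?thesis using assms unfolding mod_hom_def by auto
qed

lemma mod_hom_compose:
  assumes "f \<in> mod_hom \<Phi> M M" "g \<in> mod_hom \<Phi> M M" "module \<Phi> M"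
  shows "compose (carrier M) f g \<in> mod_hom \<Phi> M M"
  unfolding compose_def
  by (rule mod_hom_restrictI[OF _ _ _ assms(3)]) (simp_all add: mod_homD[OF assms(1)] mod_homD[OF assms(2)])

lemma mod_End_module:
  assumes "module \<Phi> M"
  shows "module \<Phi> (mod_End \<Phi> M)"
proof -
  interpret M: module \<Phi> M by fact
  note D = mod_homD[of _ \<Phi> M M]
  have comm: "a \<odot>\<^bsub>M\<^esub> (b \<odot>\<^bsub>M\<^esub> x) = b \<odot>\<^bsub>M\<^esub> (a \<odot>\<^bsub>M\<^esub> x)"
    if "a \<in> carrier \<Phi>" "b \<in> carrier \<Phi>" "x \<in> carrier M" for a b x
    using that by (simp add: M.R.m_comm flip: M.smult_assoc1)
  have add: "(\<lambda>x\<in>carrier M. f x \<oplus>\<^bsub>M\<^esub> g x) \<in> mod_hom \<Phi> M M" if "f \<in> mod_hom \<Phi> M M" "g \<in> mod_hom \<Phi> M M" for f g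
    using that by (intro mod_hom_restrictI assms) (simp_all add: D M.smult_r_distr M.M.a_ac)
  have sm: "(\<lambda>x\<in>carrier M. a \<odot>\<^bsub>M\<^esub> f x) \<in> mod_hom \<Phi> M M" if "f \<in> mod_hom \<Phi> M M" "a \<in> carrier \<Phi>" for f a
    using that by (intro mod_hom_restrictI assms) (simp_all add: D M.smult_r_distr comm[OF that(2)])
  have z: "(\<lambda>x\<in>carrier M. \<zero>\<^bsub>M\<^esub>) \<in> mod_hom \<Phi> M M"
    by (intro mod_hom_restrictI assms) simp_all
  show ?thesis
  proof (rule moduleI[OF M.R.is_cring])
    show "abelian_group (mod_End \<Phi> M)"
    proof (rule abelian_groupI)
      fix f assume "f \<in> carrier (mod_End \<Phi> M)"
      then have f: "f \<in> mod_hom \<Phi> M M" by simp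
      show "\<zero>\<^bsub>mod_End \<Phi> M\<^esub> \<oplus>\<^bsub>mod_End \<Phi> M\<^esub> f = f"
        using mod_hom_eqI[OF add[OF z f] f] D(1)[OF f] by simp
      have m: "(\<lambda>x\<in>carrier M. \<ominus>\<^bsub>\<Phi>\<^esub> \<one>\<^bsub>\<Phi>\<^esub> \<odot>\<^bsub>M\<^esub> f x) \<in> mod_hom \<Phi> M M" using sm[OF f] by simp
      have "(\<lambda>x\<in>carrier M. \<ominus>\<^bsub>\<Phi>\<^esub> \<one>\<^bsub>\<Phi>\<^esub> \<odot>\<^bsub>M\<^esub> f x) \<oplus>\<^bsub>mod_End \<Phi> M\<^esub> f = \<zero>\<^bsub>mod_End \<Phi> M\<^esub>"
        using mod_hom_eqI[OF add[OF m f] z] D(1)[OF f] by (simp add: M.smult_l_minus M.M.l_neg)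
      then show "\<exists>g\<in>carrier (mod_End \<Phi> M). g \<oplus>\<^bsub>mod_End \<Phi> M\<^esub> f = \<zero>\<^bsub>mod_End \<Phi> M\<^esub>"
        using bexI[of "\<lambda>g. g \<oplus>\<^bsub>mod_End \<Phi> M\<^esub> f = \<zero>\<^bsub>mod_End \<Phi> M\<^esub>", OF _ m] by simp
    qed (simp_all add: add z D M.M.a_ac cong: restrict_cong)
  qed (simp_all add: add sm D(1-3) M.smult_l_distr M.smult_r_distr M.smult_assoc1
      extensional_restrict[OF D(4)] cong: restrict_cong)
qed

lemma truncate_simps [simp]:
  "carrier (module.truncate T) = carrier T" "add (module.truncate T) = add T"
  "zero (module.truncate T) = zero T" "smult (module.truncate T) = smult T"
  by (simp_all add: module.truncate_def)

lemma a_minus_truncate [simp]: "a_minus (module.truncate T) = a_minus T" "a_inv (module.truncate T) = a_inv T"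
  by (simp_all add: a_minus_def a_inv_def fun_eq_iff m_inv_def)

lemma double_pair_simps [simp]:
  "Vplus (double_pair T) = module.truncate T" "Vminus (double_pair T) = module.truncate T"
  "Qplus (double_pair T) = quad T" "Qminus (double_pair T) = quad T"
  by (simp_all add: double_pair_def)

lemma trip_double_pair [simp]: "trip_plus (double_pair T) = trip T" "trip_minus (double_pair T) = trip T"
  by (simp_all add: fun_eq_iff trip_plus_def trip_minus_def trip_def)

context jts6
begin

abbreviation "V \<equiv> double_pair T"
abbreviation "PE \<equiv> pair_End \<Phi> V"
abbreviation "\<delta> \<equiv> pair_delta V"
abbreviation "com \<equiv> pair_commutator \<Phi> V"
abbreviation "ider \<equiv> carrier (IDer \<Phi> V)"
abbreviation "LT \<equiv> TKK \<Phi> V"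

lemma truncate_module: "module \<Phi> (module.truncate T)"
  by (rule submodule_module(1)[OF submodule_carrier]) simp_all

lemma PE_module: "module \<Phi> PE"
  unfolding pair_End_def double_pair_simps by (intro mod_sum_module mod_End_module truncate_module)

sublocale PE: module \<Phi> "pair_End \<Phi> (double_pair T)"
  by (rule PE_module)

lemma PE_carrier: "\<gamma> \<in> carrier PE \<longleftrightarrow> fst \<gamma> \<in> mod_hom \<Phi> (module.truncate T) (module.truncate T) \<and>
    snd \<gamma> \<in> mod_hom \<Phi> (module.truncate T) (module.truncate T)"
  unfolding pair_End_def by (cases \<gamma>) simp

lemma PE_closed [simp]:
  "\<lbrakk>\<gamma> \<in> carrier PE; x \<in> carrier T\<rbrakk> \<Longrightarrow> fst \<gamma> x \<in> carrier T"
  "\<lbrakk>\<gamma> \<in> carrier PE; x \<in> carrier T\<rbrakk> \<Longrightarrow> snd \<gamma> x \<in> carrier T"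
  using mod_homD(1)[of _ \<Phi> "module.truncate T" "module.truncate T"] unfolding PE_carrier by auto

lemma PE_lin1:
  "\<lbrakk>\<gamma> \<in> carrier PE; x \<in> carrier T; y \<in> carrier T\<rbrakk> \<Longrightarrow> fst \<gamma> (x \<oplus> y) = fst \<gamma> x \<oplus> fst \<gamma> y"
  "\<lbrakk>\<gamma> \<in> carrier PE; x \<in> carrier T; y \<in> carrier T\<rbrakk> \<Longrightarrow> snd \<gamma> (x \<oplus> y) = snd \<gamma> x \<oplus> snd \<gamma> y"
  "\<lbrakk>\<gamma> \<in> carrier PE; a \<in> carrier \<Phi>; x \<in> carrier T\<rbrakk> \<Longrightarrow> fst \<gamma> (a \<odot> x) = a \<odot> fst \<gamma> x"
  "\<lbrakk>\<gamma> \<in> carrier PE; a \<in> carrier \<Phi>; x \<in> carrier T\<rbrakk> \<Longrightarrow> snd \<gamma> (a \<odot> x) = a \<odot> snd \<gamma> x"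
  using mod_homD(2,3)[of _ \<Phi> "module.truncate T" "module.truncate T"] unfolding PE_carrier by auto

lemma PE_lin2:
  "\<lbrakk>\<gamma> \<in> carrier PE; x \<in> carrier T; y \<in> carrier T\<rbrakk> \<Longrightarrow> fst \<gamma> (x \<ominus> y) = fst \<gamma> x \<ominus> fst \<gamma> y"
  "\<lbrakk>\<gamma> \<in> carrier PE; x \<in> carrier T; y \<in> carrier T\<rbrakk> \<Longrightarrow> snd \<gamma> (x \<ominus> y) = snd \<gamma> x \<ominus> snd \<gamma> y"
  "\<lbrakk>\<gamma> \<in> carrier PE; x \<in> carrier T\<rbrakk> \<Longrightarrow> fst \<gamma> (\<ominus> x) = \<ominus> fst \<gamma> x"
  "\<lbrakk>\<gamma> \<in> carrier PE; x \<in> carrier T\<rbrakk> \<Longrightarrow> snd \<gamma> (\<ominus> x) = \<ominus> snd \<gamma> x"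
  "\<gamma> \<in> carrier PE \<Longrightarrow> fst \<gamma> \<zero> = \<zero>" "\<gamma> \<in> carrier PE \<Longrightarrow> snd \<gamma> \<zero> = \<zero>"
  using additive_diff_gen[of T T "fst \<gamma>"] additive_diff_gen[of T T "snd \<gamma>"]
    additive_uminus_gen[of T T "fst \<gamma>"] additive_uminus_gen[of T T "snd \<gamma>"]
    additive_zero_gen[of T T "fst \<gamma>"] additive_zero_gen[of T T "snd \<gamma>"]
  by (auto simp: PE_lin1 M.abelian_group_axioms)

lemma PE_eqI:
  assumes "\<gamma> \<in> carrier PE" "\<mu> \<in> carrier PE" "\<And>z. z \<in> carrier T \<Longrightarrow> fst \<gamma> z = fst \<mu> z"
    "\<And>z. z \<in> carrier T \<Longrightarrow> snd \<gamma> z = snd \<mu> z"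
  shows "\<gamma> = \<mu>"
  using assms unfolding PE_carrier
  by (intro prod_eqI mod_hom_eqI[of _ \<Phi> "module.truncate T" "module.truncate T"]) auto

lemma PE_eval:
  assumes z: "z \<in> carrier T"
  shows "fst (\<gamma> \<oplus>\<^bsub>PE\<^esub> \<mu>) z = fst \<gamma> z \<oplus> fst \<mu> z" "snd (\<gamma> \<oplus>\<^bsub>PE\<^esub> \<mu>) z = snd \<gamma> z \<oplus> snd \<mu> z"
    "fst (a \<odot>\<^bsub>PE\<^esub> \<gamma>) z = a \<odot> fst \<gamma> z" "snd (a \<odot>\<^bsub>PE\<^esub> \<gamma>) z = a \<odot> snd \<gamma> z"
    "fst \<zero>\<^bsub>PE\<^esub> z = \<zero>" "snd \<zero>\<^bsub>PE\<^esub> z = \<zero>"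
    "fst (\<gamma> \<otimes>\<^bsub>PE\<^esub> \<mu>) z = fst \<gamma> (fst \<mu> z)" "snd (\<gamma> \<otimes>\<^bsub>PE\<^esub> \<mu>) z = snd \<gamma> (snd \<mu> z)"
  using z unfolding pair_End_def by (simp_all add: compose_def)

lemma PE_eval_diff:
  assumes z: "z \<in> carrier T" and g: "\<gamma> \<in> carrier PE" "\<mu> \<in> carrier PE"
  shows "fst (\<gamma> \<ominus>\<^bsub>PE\<^esub> \<mu>) z = fst \<gamma> z \<ominus> fst \<mu> z" "snd (\<gamma> \<ominus>\<^bsub>PE\<^esub> \<mu>) z = snd \<gamma> z \<ominus> snd \<mu> z"
  using additive_diff_gen[of PE T "\<lambda>\<gamma>. fst \<gamma> z", OF PE.M.abelian_group_axioms M.abelian_group_axioms _ _ g]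
    additive_diff_gen[of PE T "\<lambda>\<gamma>. snd \<gamma> z", OF PE.M.abelian_group_axioms M.abelian_group_axioms _ _ g] z
  by (auto simp: PE_eval)

lemma PE_mult_closed: "\<lbrakk>\<gamma> \<in> carrier PE; \<mu> \<in> carrier PE\<rbrakk> \<Longrightarrow> \<gamma> \<otimes>\<^bsub>PE\<^esub> \<mu> \<in> carrier PE"
  unfolding PE_carrier unfolding pair_End_def
  by (simp add: mod_hom_compose[OF _ _ truncate_module, simplified])

lemma com_closed [simp]: "\<lbrakk>\<gamma> \<in> carrier PE; \<mu> \<in> carrier PE\<rbrakk> \<Longrightarrow> com \<gamma> \<mu> \<in> carrier PE"
  unfolding pair_commutator_def by (simp add: PE_mult_closed)

lemma com_eval:
  assumes "z \<in> carrier T" "\<gamma> \<in> carrier PE" "\<mu> \<in> carrier PE"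
  shows "fst (com \<gamma> \<mu>) z = fst \<gamma> (fst \<mu> z) \<ominus> fst \<mu> (fst \<gamma> z)"
    "snd (com \<gamma> \<mu>) z = snd \<gamma> (snd \<mu> z) \<ominus> snd \<mu> (snd \<gamma> z)"
  using assms unfolding pair_commutator_def by (simp_all add: PE_mult_closed PE_eval PE_eval_diff)

lemma delta_closed [simp]: "\<lbrakk>x \<in> carrier T; y \<in> carrier T\<rbrakk> \<Longrightarrow> \<delta> x y \<in> carrier PE"
  unfolding PE_carrier unfolding pair_delta_def
  by (auto intro!: mod_hom_restrictI[of "module.truncate T" _ "module.truncate T", simplified] truncate_module
      simp: J.tr_lin smult_r_minus M.minus_add)

lemma delta_eval:
  assumes "z \<in> carrier T"
  shows "fst (\<delta> x y) z = trip T x y z" "snd (\<delta> x y) z = \<ominus> trip T y x z"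
  using assms unfolding pair_delta_def by simp_all

lemmas PE_simps = PE_eval PE_eval_diff com_eval delta_eval PE_lin1 PE_lin2

text \<open>The derivation pairs of the Jordan pair V(T). Since the set is given by equations, it is
  a submodule, and the product rule needs checking only on the generators \<delta>(x,y) to hold on
  all of \<open>ider\<close>.\<close>

definition dp :: "(('a \<Rightarrow> 'a) \<times> ('a \<Rightarrow> 'a)) set" where
  "dp = {\<gamma> \<in> carrier PE. \<forall>x\<in>carrier T. \<forall>y\<in>carrier T. \<forall>z\<in>carrier T.
    fst \<gamma> (trip T x y z) = trip T (fst \<gamma> x) y z \<oplus> trip T x (snd \<gamma> y) z \<oplus> trip T x y (fst \<gamma> z) \<and>
    snd \<gamma> (trip T x y z) = trip T (snd \<gamma> x) y z \<oplus> trip T x (fst \<gamma> y) z \<oplus> trip T x y (snd \<gamma> z)}"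

lemma dpD:
  assumes "\<gamma> \<in> dp"
  shows "\<gamma> \<in> carrier PE"
    "\<lbrakk>x \<in> carrier T; y \<in> carrier T; z \<in> carrier T\<rbrakk> \<Longrightarrow>
      fst \<gamma> (trip T x y z) = trip T (fst \<gamma> x) y z \<oplus> trip T x (snd \<gamma> y) z \<oplus> trip T x y (fst \<gamma> z)"
    "\<lbrakk>x \<in> carrier T; y \<in> carrier T; z \<in> carrier T\<rbrakk> \<Longrightarrow>
      snd \<gamma> (trip T x y z) = trip T (snd \<gamma> x) y z \<oplus> trip T x (fst \<gamma> y) z \<oplus> trip T x y (snd \<gamma> z)"
  using assms unfolding dp_def by auto

lemma dp_diff:
  assumes g: "\<gamma> \<in> dp" and h: "\<mu> \<in> dp"
  shows "\<gamma> \<ominus>\<^bsub>PE\<^esub> \<mu> \<in> dp"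
  using dpD[OF g] dpD[OF h] unfolding dp_def by (auto simp: PE_simps J.tr_lin M.ab_simps)

lemma dp_submodule: "submodule dp \<Phi> PE"
proof (rule PE.submoduleI)
  show "dp \<subseteq> carrier PE" using dpD by blast
  show z: "\<zero>\<^bsub>PE\<^esub> \<in> dp" unfolding dp_def by (auto simp: PE_simps)
  fix \<gamma> assume g: "\<gamma> \<in> dp"
  then show "\<ominus>\<^bsub>PE\<^esub> \<gamma> \<in> dp" using dp_diff[OF z g] dpD(1)[OF g] by (simp add: PE.M.uminus_eq_diff)
  show "a \<odot>\<^bsub>PE\<^esub> \<gamma> \<in> dp" if "a \<in> carrier \<Phi>" for a
    using dpD[OF g] that unfolding dp_def by (auto simp: PE_simps J.tr_lin smult_r_distr)
  fix \<mu> assume h: "\<mu> \<in> dp"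
  show "\<gamma> \<oplus>\<^bsub>PE\<^esub> \<mu> \<in> dp"
    using dpD[OF g] dpD[OF h] unfolding dp_def by (auto simp: PE_simps J.tr_lin M.a_ac)
qed

lemma trip_uminus: 
  "\<lbrakk>x \<in> carrier T; y \<in> carrier T; z \<in> carrier T\<rbrakk> \<Longrightarrow> trip T (\<ominus> x) y z = \<ominus> trip T x y z"
  "\<lbrakk>x \<in> carrier T; y \<in> carrier T; z \<in> carrier T\<rbrakk> \<Longrightarrow> trip T x (\<ominus> y) z = \<ominus> trip T x y z"
  "\<lbrakk>x \<in> carrier T; y \<in> carrier T; z \<in> carrier T\<rbrakk> \<Longrightarrow> trip T x y (\<ominus> z) = \<ominus> trip T x y z"
  using additive_uminus_gen[of T T "\<lambda>x. trip T x y z"] additive_uminus_gen[of T T "\<lambda>y. trip T x y z"]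
    additive_uminus_gen[of T T "\<lambda>z. trip T x y z"]
  by (auto simp: J.tr_lin M.abelian_group_axioms)

text \<open>Both components are the five-linear identity, once for D(x,y) and once for
  -D(y,x).\<close>

lemma delta_dp:
  assumes [simp]: "x \<in> carrier T" "y \<in> carrier T"
  shows "\<delta> x y \<in> dp"
proof -
  have 1: "trip T x y (trip T u v w) = trip T (trip T x y u) v w \<oplus> trip T u (\<ominus> trip T y x v) w \<oplus> trip T u v (trip T x y w)"
    if "u \<in> carrier T" "v \<in> carrier T" "w \<in> carrier T" for u v w
    using five_linear[of x y u v w] that by (simp add: trip_uminus a_minus_def)
  have 2: "\<ominus> trip T y x (trip T u v w) = trip T (\<ominus> trip T y x u) v w \<oplus> trip T u (trip T x y v) w \<oplus> trip T u v (\<ominus> trip T y x w)"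
    if "u \<in> carrier T" "v \<in> carrier T" "w \<in> carrier T" for u v w
    using five_linear[of y x u v w] that by (simp add: trip_uminus) (simp add: M.ab_simps)
  show ?thesis unfolding dp_def using 1 2 by (simp add: delta_eval)
qed

lemma ider_eq: "ider = mspan \<Phi> PE {\<delta> x y |x y. x \<in> carrier T \<and> y \<in> carrier T}"
  unfolding IDer_def by simp

lemma delta_gens: "{\<delta> x y |x y. x \<in> carrier T \<and> y \<in> carrier T} \<subseteq> carrier PE"
  by auto

lemma ider_submodule: "submodule ider \<Phi> PE"
  unfolding ider_eq by (rule PE.mspan_submodule[OF delta_gens])

lemma delta_ider [simp]: "\<lbrakk>x \<in> carrier T; y \<in> carrier T\<rbrakk> \<Longrightarrow> \<delta> x y \<in> ider"
  unfolding ider_eq by (rule PE.mspan_incl) blast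

lemma ider_least:
  assumes "submodule N \<Phi> PE" "\<And>x y. \<lbrakk>x \<in> carrier T; y \<in> carrier T\<rbrakk> \<Longrightarrow> \<delta> x y \<in> N"
  shows "ider \<subseteq> N"
  unfolding ider_eq using assms by (intro PE.mspan_least) auto

lemma ider_dp: "\<gamma> \<in> ider \<Longrightarrow> \<gamma> \<in> dp"
  using ider_least[OF dp_submodule delta_dp] by blast

lemma ider_PE [simp]: "\<gamma> \<in> ider \<Longrightarrow> \<gamma> \<in> carrier PE"
  using ider_dp dpD(1) by blast

text \<open>The product rule of the pair, read as an identity of operators in the last variable. It
  makes \<open>ider\<close> closed under commutators.\<close>

lemma com_delta:
  assumes g: "\<gamma> \<in> dp" and [simp]: "x \<in> carrier T" "y \<in> carrier T"
  shows "com \<gamma> (\<delta> x y) = \<delta> (fst \<gamma> x) y \<oplus>\<^bsub>PE\<^esub> \<delta> x (snd \<gamma> y)"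
proof (rule PE_eqI)
  note [simp] = dpD[OF g]
  show "com \<gamma> (\<delta> x y) \<in> carrier PE" "\<delta> (fst \<gamma> x) y \<oplus>\<^bsub>PE\<^esub> \<delta> x (snd \<gamma> y) \<in> carrier PE" by simp_all
  fix z assume [simp]: "z \<in> carrier T"
  show "fst (com \<gamma> (\<delta> x y)) z = fst (\<delta> (fst \<gamma> x) y \<oplus>\<^bsub>PE\<^esub> \<delta> x (snd \<gamma> y)) z"
    "snd (com \<gamma> (\<delta> x y)) z = snd (\<delta> (fst \<gamma> x) y \<oplus>\<^bsub>PE\<^esub> \<delta> x (snd \<gamma> y)) z"
    by (simp_all add: PE_simps M.ab_simps)
qed

lemma com_ider [simp]:
  assumes g: "\<gamma> \<in> ider" and m: "\<mu> \<in> ider"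
  shows "com \<gamma> \<mu> \<in> ider"
proof -
  have gc: "\<gamma> \<in> carrier PE" using g by simp
  have "submodule {\<mu> \<in> carrier PE. com \<gamma> \<mu> \<in> ider} \<Phi> PE"
  proof (rule PE.submodule_linear_set[OF PE.submodule_carrier PE_module _ _ _ ider_submodule])
    show "com \<gamma> \<in> carrier PE \<rightarrow> carrier PE" using gc by simp
    fix \<mu> assume m: "\<mu> \<in> carrier PE"
    show "com \<gamma> (\<mu> \<oplus>\<^bsub>PE\<^esub> \<nu>) = com \<gamma> \<mu> \<oplus>\<^bsub>PE\<^esub> com \<gamma> \<nu>" if "\<nu> \<in> carrier PE" for \<nu>
      by (rule PE_eqI) (simp_all add: gc m that PE_simps M.ab_simps)
    show "com \<gamma> (a \<odot>\<^bsub>PE\<^esub> \<mu>) = a \<odot>\<^bsub>PE\<^esub> com \<gamma> \<mu>" if "a \<in> carrier \<Phi>" for a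
      by (rule PE_eqI) (simp_all add: gc m that PE_simps smult_diff)
  qed
  moreover have "com \<gamma> (\<delta> x y) \<in> ider" if "x \<in> carrier T" "y \<in> carrier T" for x y
    unfolding com_delta[OF ider_dp[OF g] that] using that gc
    by (intro PE.submodule_add[OF ider_submodule]) simp_all
  ultimately have "ider \<subseteq> {\<mu> \<in> carrier PE. com \<gamma> \<mu> \<in> ider}" by (intro ider_least) simp_all
  then show ?thesis using m by blast
qed

lemma IDer_simps [simp]: "add (IDer \<Phi> V) = add PE" "zero (IDer \<Phi> V) = zero PE" "smult (IDer \<Phi> V) = smult PE"
  unfolding IDer_def by simp_all

lemma IDer_module: "module \<Phi> (IDer \<Phi> V)"
  by (rule PE.submodule_module(1)[OF ider_submodule]) simp_all

section \<open>The Lie algebra structure on TKK(V(T))\<close>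

lemma LT_simps [simp]:
  "carrier LT = carrier T \<times> ider \<times> carrier T"
  "\<zero>\<^bsub>LT\<^esub> = (\<zero>, \<zero>\<^bsub>PE\<^esub>, \<zero>)"
  "(x, \<gamma>, y) \<oplus>\<^bsub>LT\<^esub> (x', \<gamma>', y') = (x \<oplus> x', \<gamma> \<oplus>\<^bsub>PE\<^esub> \<gamma>', y \<oplus> y')"
  "a \<odot>\<^bsub>LT\<^esub> (x, \<gamma>, y) = (a \<odot> x, a \<odot>\<^bsub>PE\<^esub> \<gamma>, a \<odot> y)"
  "(x, \<gamma>, x') \<otimes>\<^bsub>LT\<^esub> (y, \<mu>, y') =
    (fst \<gamma> y \<ominus> fst \<mu> x, com \<gamma> \<mu> \<oplus>\<^bsub>PE\<^esub> \<delta> x y' \<ominus>\<^bsub>PE\<^esub> \<delta> y x', snd \<gamma> y' \<ominus> snd \<mu> x')"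
proof -
  let ?S = "mod_sum (module.truncate T) (mod_sum (IDer \<Phi> V) (module.truncate T))"
  have eq: "carrier LT = carrier ?S" "add LT = add ?S" "zero LT = zero ?S" "smult LT = smult ?S"
    "mult LT = TKK_bracket \<Phi> V"
    unfolding TKK_def by simp_all
  show "carrier LT = carrier T \<times> ider \<times> carrier T"
    "\<zero>\<^bsub>LT\<^esub> = (\<zero>, \<zero>\<^bsub>PE\<^esub>, \<zero>)"
    "(x, \<gamma>, y) \<oplus>\<^bsub>LT\<^esub> (x', \<gamma>', y') = (x \<oplus> x', \<gamma> \<oplus>\<^bsub>PE\<^esub> \<gamma>', y \<oplus> y')"
    "a \<odot>\<^bsub>LT\<^esub> (x, \<gamma>, y) = (a \<odot> x, a \<odot>\<^bsub>PE\<^esub> \<gamma>, a \<odot> y)"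
    "(x, \<gamma>, x') \<otimes>\<^bsub>LT\<^esub> (y, \<mu>, y') =
      (fst \<gamma> y \<ominus> fst \<mu> x, com \<gamma> \<mu> \<oplus>\<^bsub>PE\<^esub> \<delta> x y' \<ominus>\<^bsub>PE\<^esub> \<delta> y x', snd \<gamma> y' \<ominus> snd \<mu> x')"
    unfolding eq by (simp_all add: TKK_bracket_def)
qed

lemma LT_module: "module \<Phi> LT"
proof -
  let ?S = "mod_sum (module.truncate T) (mod_sum (IDer \<Phi> V) (module.truncate T))"
  interpret S: module \<Phi> ?S by (intro mod_sum_module truncate_module IDer_module)
  have eq: "carrier LT = carrier ?S" "add LT = add ?S" "zero LT = zero ?S" "smult LT = smult ?S"
    unfolding TKK_def by simp_all
  show ?thesis by (rule S.submodule_module(1)[OF S.submodule_carrier eq])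
qed

lemma ider_add [simp]: "\<lbrakk>\<gamma> \<in> ider; \<mu> \<in> ider\<rbrakk> \<Longrightarrow> \<gamma> \<oplus>\<^bsub>PE\<^esub> \<mu> \<in> ider"
  and ider_diff [simp]: "\<lbrakk>\<gamma> \<in> ider; \<mu> \<in> ider\<rbrakk> \<Longrightarrow> \<gamma> \<ominus>\<^bsub>PE\<^esub> \<mu> \<in> ider"
  and ider_smult [simp]: "\<lbrakk>a \<in> carrier \<Phi>; \<gamma> \<in> ider\<rbrakk> \<Longrightarrow> a \<odot>\<^bsub>PE\<^esub> \<gamma> \<in> ider"
  and ider_zero [simp]: "\<zero>\<^bsub>PE\<^esub> \<in> ider"
  by (rule PE.submodule_intros[OF ider_submodule]; assumption)+

text \<open>The two outer components come down to symmetry of the triple product. The middle one is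
  an equality of pairs of maps and is checked pointwise, where it becomes the product rule for the
  three derivation pairs.\<close>

lemma LT_jacobi:
  assumes [simp]: "x \<in> carrier T" "x' \<in> carrier T" "\<gamma> \<in> ider" "y \<in> carrier T" "y' \<in> carrier T" "\<mu> \<in> ider"
    "z \<in> carrier T" "z' \<in> carrier T" "\<nu> \<in> ider"
  defines "X \<equiv> (x, \<gamma>, x')" and "Y \<equiv> (y, \<mu>, y')" and "Z \<equiv> (z, \<nu>, z')"
  shows "X \<otimes>\<^bsub>LT\<^esub> (Y \<otimes>\<^bsub>LT\<^esub> Z) = (X \<otimes>\<^bsub>LT\<^esub> Y) \<otimes>\<^bsub>LT\<^esub> Z \<oplus>\<^bsub>LT\<^esub> Y \<otimes>\<^bsub>LT\<^esub> (X \<otimes>\<^bsub>LT\<^esub> Z)"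
proof -
  note d = dpD(2,3)[OF ider_dp[OF assms(3)]] dpD(2,3)[OF ider_dp[OF assms(6)]] dpD(2,3)[OF ider_dp[OF assms(9)]]
  note s = trip_sym[of z y' x] trip_sym[of z x' y] trip_sym[of y x' x] trip_sym[of z' y x'] trip_sym[of z' x y']
    trip_sym[of y' x x'] trip_sym[of y z' x] trip_sym[of y' z x']
  have eqI: "(a, b, c) = (a', b', c')" if "a = a'" "b = b'" "c = c'" for a a' b b' c c' using that by simp
  show ?thesis
    unfolding X_def Y_def Z_def LT_simps
  proof (rule eqI, goal_cases)
    case 1
    show ?case by (simp add: PE_simps s M.ab_simps)
  next
    case 2
    show ?case
      by (rule PE_eqI) (simp_all add: PE_simps d J.tr_lin trip_uminus M.ab_simps)
  next
    case 3
    show ?case by (simp add: PE_simps s M.ab_simps)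
  qed
qed

lemma LT_lie: "lie \<Phi> LT"
proof (intro lie.intro module6.intro LT_module module6_axioms.intro six_unit lie_axioms.intro)
  have eqI: "(a, b, c) = (a', b', c')" if "a = a'" "b = b'" "c = c'" for a a' b b' c c' using that by simp
  fix X Y assume "X \<in> carrier LT" "Y \<in> carrier LT"
  then obtain x \<gamma> x' y \<mu> y' where X: "X = (x, \<gamma>, x')" "Y = (y, \<mu>, y')" and [simp]: "x \<in> carrier T"
    "\<gamma> \<in> ider" "x' \<in> carrier T" "y \<in> carrier T" "\<mu> \<in> ider" "y' \<in> carrier T" by auto
  show "X \<otimes>\<^bsub>LT\<^esub> Y \<in> carrier LT" unfolding X by simp
  show "X \<otimes>\<^bsub>LT\<^esub> X = \<zero>\<^bsub>LT\<^esub>"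
    unfolding X LT_simps
  proof (rule eqI, goal_cases)
    case 2 show ?case by (rule PE_eqI) (simp_all add: PE_simps M.ab_simps)
  qed (simp_all add: M.diff_eq_zero)
  show "(a \<odot>\<^bsub>LT\<^esub> X) \<otimes>\<^bsub>LT\<^esub> Y = a \<odot>\<^bsub>LT\<^esub> (X \<otimes>\<^bsub>LT\<^esub> Y)" if [simp]: "a \<in> carrier \<Phi>" for a
    unfolding X LT_simps
  proof (rule eqI, goal_cases)
    case 2 show ?case
      by (rule PE_eqI) (simp_all add: PE_simps J.tr_lin smult_diff smult_r_distr smult_r_minus)
  qed (simp_all add: PE_simps smult_diff)
  fix Z assume "Z \<in> carrier LT"
  then obtain z \<nu> z' where Z: "Z = (z, \<nu>, z')" and [simp]: "z \<in> carrier T" "\<nu> \<in> ider" "z' \<in> carrier T" by auto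
  show "(X \<oplus>\<^bsub>LT\<^esub> Y) \<otimes>\<^bsub>LT\<^esub> Z = X \<otimes>\<^bsub>LT\<^esub> Z \<oplus>\<^bsub>LT\<^esub> Y \<otimes>\<^bsub>LT\<^esub> Z"
    unfolding X Z LT_simps
  proof (rule eqI, goal_cases)
    case 2 show ?case by (rule PE_eqI) (simp_all add: PE_simps J.tr_lin M.ab_simps)
  qed (simp_all add: PE_simps M.ab_simps)
  show "X \<otimes>\<^bsub>LT\<^esub> (Y \<oplus>\<^bsub>LT\<^esub> Z) = X \<otimes>\<^bsub>LT\<^esub> Y \<oplus>\<^bsub>LT\<^esub> X \<otimes>\<^bsub>LT\<^esub> Z"
    unfolding X Z LT_simps
  proof (rule eqI, goal_cases)
    case 2 show ?case by (rule PE_eqI) (simp_all add: PE_simps J.tr_lin M.ab_simps)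
  qed (simp_all add: PE_simps M.ab_simps)
  show "X \<otimes>\<^bsub>LT\<^esub> (Y \<otimes>\<^bsub>LT\<^esub> Z) = (X \<otimes>\<^bsub>LT\<^esub> Y) \<otimes>\<^bsub>LT\<^esub> Z \<oplus>\<^bsub>LT\<^esub> Y \<otimes>\<^bsub>LT\<^esub> (X \<otimes>\<^bsub>LT\<^esub> Z)"
    unfolding X Z by (rule LT_jacobi) simp_all
qed

sublocale LT: lie \<Phi> "TKK \<Phi> (double_pair T)"
  by (rule LT_lie)

section \<open>Grading, projections and exchange involution of TKK(V(T))\<close>

abbreviation GT where "GT \<equiv> TKK_deg \<Phi> V"

lemma GT_simps:
  "GT 1 = carrier T \<times> {\<zero>\<^bsub>PE\<^esub>} \<times> {\<zero>}" "GT 0 = {\<zero>} \<times> ider \<times> {\<zero>}" "GT (-1) = {\<zero>} \<times> {\<zero>\<^bsub>PE\<^esub>} \<times> carrier T"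
  "\<lbrakk>k \<noteq> 1; k \<noteq> 0; k \<noteq> -1\<rbrakk> \<Longrightarrow> GT k = {\<zero>\<^bsub>LT\<^esub>}"
  unfolding TKK_deg_def by simp_all

lemma com_zero: "\<gamma> \<in> carrier PE \<Longrightarrow> com \<gamma> \<zero>\<^bsub>PE\<^esub> = \<zero>\<^bsub>PE\<^esub>" "\<gamma> \<in> carrier PE \<Longrightarrow> com \<zero>\<^bsub>PE\<^esub> \<gamma> = \<zero>\<^bsub>PE\<^esub>"
  by (rule PE_eqI; simp add: PE_simps M.diff_eq_zero)+

lemma delta_zero: "x \<in> carrier T \<Longrightarrow> \<delta> x \<zero> = \<zero>\<^bsub>PE\<^esub>" "x \<in> carrier T \<Longrightarrow> \<delta> \<zero> x = \<zero>\<^bsub>PE\<^esub>"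
  by (rule PE_eqI; simp add: PE_simps)+

lemma GT_degrees:
  fixes k :: int
  obtains "k = 1" | "k = 0" | "k = -1" | "k \<noteq> 1" "k \<noteq> 0" "k \<noteq> -1"
  by blast

lemma GT_submodule: "submodule (GT k) \<Phi> LT"
proof -
  have "\<ominus>\<^bsub>LT\<^esub> X \<in> GT k" if X: "X \<in> GT k" and sm: "\<And>a. a \<in> carrier \<Phi> \<Longrightarrow> a \<odot>\<^bsub>LT\<^esub> X \<in> GT k" and c: "X \<in> carrier LT" for X
    using sm[of "\<ominus>\<^bsub>\<Phi>\<^esub> \<one>\<^bsub>\<Phi>\<^esub>"] c LT.smult_l_minus[of "\<one>\<^bsub>\<Phi>\<^esub>" X] by simp
  moreover have "GT k \<subseteq> carrier LT" "\<zero>\<^bsub>LT\<^esub> \<in> GT k" "\<And>X Y. \<lbrakk>X \<in> GT k; Y \<in> GT k\<rbrakk> \<Longrightarrow> X \<oplus>\<^bsub>LT\<^esub> Y \<in> GT k"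
    "\<And>a X. \<lbrakk>a \<in> carrier \<Phi>; X \<in> GT k\<rbrakk> \<Longrightarrow> a \<odot>\<^bsub>LT\<^esub> X \<in> GT k"
    by (cases k rule: GT_degrees, auto simp: GT_simps)+
  ultimately show ?thesis by (intro LT.submoduleI) blast+
qed

lemma LT_products:
  "\<lbrakk>x \<in> carrier T; y \<in> carrier T\<rbrakk> \<Longrightarrow> (x, \<zero>\<^bsub>PE\<^esub>, \<zero>) \<otimes>\<^bsub>LT\<^esub> (y, \<zero>\<^bsub>PE\<^esub>, \<zero>) = \<zero>\<^bsub>LT\<^esub>"
  "\<lbrakk>x \<in> carrier T; \<gamma> \<in> ider\<rbrakk> \<Longrightarrow> (x, \<zero>\<^bsub>PE\<^esub>, \<zero>) \<otimes>\<^bsub>LT\<^esub> (\<zero>, \<gamma>, \<zero>) = (\<zero> \<ominus> fst \<gamma> x, \<zero>\<^bsub>PE\<^esub>, \<zero>)"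
  "\<lbrakk>x \<in> carrier T; y \<in> carrier T\<rbrakk> \<Longrightarrow> (x, \<zero>\<^bsub>PE\<^esub>, \<zero>) \<otimes>\<^bsub>LT\<^esub> (\<zero>, \<zero>\<^bsub>PE\<^esub>, y) = (\<zero>, \<delta> x y, \<zero>)"
  "\<lbrakk>\<gamma> \<in> ider; y \<in> carrier T\<rbrakk> \<Longrightarrow> (\<zero>, \<gamma>, \<zero>) \<otimes>\<^bsub>LT\<^esub> (y, \<zero>\<^bsub>PE\<^esub>, \<zero>) = (fst \<gamma> y, \<zero>\<^bsub>PE\<^esub>, \<zero>)"
  "\<lbrakk>\<gamma> \<in> ider; \<mu> \<in> ider\<rbrakk> \<Longrightarrow> (\<zero>, \<gamma>, \<zero>) \<otimes>\<^bsub>LT\<^esub> (\<zero>, \<mu>, \<zero>) = (\<zero>, com \<gamma> \<mu>, \<zero>)"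
  "\<lbrakk>\<gamma> \<in> ider; y \<in> carrier T\<rbrakk> \<Longrightarrow> (\<zero>, \<gamma>, \<zero>) \<otimes>\<^bsub>LT\<^esub> (\<zero>, \<zero>\<^bsub>PE\<^esub>, y) = (\<zero>, \<zero>\<^bsub>PE\<^esub>, snd \<gamma> y)"
  "\<lbrakk>x \<in> carrier T; y \<in> carrier T\<rbrakk> \<Longrightarrow> (\<zero>, \<zero>\<^bsub>PE\<^esub>, x) \<otimes>\<^bsub>LT\<^esub> (y, \<zero>\<^bsub>PE\<^esub>, \<zero>) = (\<zero>, \<zero>\<^bsub>PE\<^esub> \<ominus>\<^bsub>PE\<^esub> \<delta> y x, \<zero>)"
  "\<lbrakk>x \<in> carrier T; \<gamma> \<in> ider\<rbrakk> \<Longrightarrow> (\<zero>, \<zero>\<^bsub>PE\<^esub>, x) \<otimes>\<^bsub>LT\<^esub> (\<zero>, \<gamma>, \<zero>) = (\<zero>, \<zero>\<^bsub>PE\<^esub>, \<zero> \<ominus> snd \<gamma> x)"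
  "\<lbrakk>x \<in> carrier T; y \<in> carrier T\<rbrakk> \<Longrightarrow> (\<zero>, \<zero>\<^bsub>PE\<^esub>, x) \<otimes>\<^bsub>LT\<^esub> (\<zero>, \<zero>\<^bsub>PE\<^esub>, y) = \<zero>\<^bsub>LT\<^esub>"
  by (simp_all add: PE_eval PE_lin2(5,6) com_zero delta_zero M.diff_zero PE.M.diff_zero)

lemma GT_br:
  assumes X: "X \<in> GT i" and Y: "Y \<in> GT j"
  shows "X \<otimes>\<^bsub>LT\<^esub> Y \<in> GT (i + j)"
proof -
  have z: "\<zero>\<^bsub>LT\<^esub> \<in> GT (i + j)" by (rule LT.submodule_zero[OF GT_submodule])
  have c: "X \<in> carrier LT" "Y \<in> carrier LT" using assms LT.submodule_in[OF GT_submodule] by blast+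
  have X0: "X \<otimes>\<^bsub>LT\<^esub> Y \<in> GT (i + j)" if "X = \<zero>\<^bsub>LT\<^esub> \<or> Y = \<zero>\<^bsub>LT\<^esub>"
    using that z LT.br_zero(1)[OF c(2)] LT.br_zero(2)[OF c(1)] by metis
  consider x where "i = 1" "x \<in> carrier T" "X = (x, \<zero>\<^bsub>PE\<^esub>, \<zero>)" | \<gamma> where "i = 0" "\<gamma> \<in> ider" "X = (\<zero>, \<gamma>, \<zero>)"
    | x where "i = -1" "x \<in> carrier T" "X = (\<zero>, \<zero>\<^bsub>PE\<^esub>, x)" | "X = \<zero>\<^bsub>LT\<^esub>"
    using X by (cases i rule: GT_degrees) (auto simp: GT_simps)
  note iX = this
  consider y where "j = 1" "y \<in> carrier T" "Y = (y, \<zero>\<^bsub>PE\<^esub>, \<zero>)" | \<mu> where "j = 0" "\<mu> \<in> ider" "Y = (\<zero>, \<mu>, \<zero>)"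
    | y where "j = -1" "y \<in> carrier T" "Y = (\<zero>, \<zero>\<^bsub>PE\<^esub>, y)" | "Y = \<zero>\<^bsub>LT\<^esub>"
    using Y by (cases j rule: GT_degrees) (auto simp: GT_simps)
  note jY = this
  show ?thesis
    using iX
  proof cases
    case 1
    show ?thesis using jY
    proof cases
      case 1
      then have "X \<otimes>\<^bsub>LT\<^esub> Y = \<zero>\<^bsub>LT\<^esub>"
        using LT_products(1)[OF \<open>x \<in> _\<close> 1(2)] \<open>X = _\<close> by (simp only:)
      then show ?thesis using z by (simp only:)
    next
      case 2 then show ?thesis using \<open>i = 1\<close> \<open>X = _\<close> \<open>x \<in> _\<close> by (simp add: LT_products GT_simps del: LT_simps)
    next
      case 3 then show ?thesis using \<open>i = 1\<close> \<open>X = _\<close> \<open>x \<in> _\<close> by (simp add: LT_products GT_simps del: LT_simps)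
    qed (use X0 in blast)
  next
    case 2
    show ?thesis using jY
    proof cases
      case 1 then show ?thesis using \<open>i = 0\<close> \<open>X = _\<close> \<open>\<gamma> \<in> _\<close> by (simp add: LT_products GT_simps del: LT_simps)
    next
      case 2 then show ?thesis using \<open>i = 0\<close> \<open>X = _\<close> \<open>\<gamma> \<in> _\<close> by (simp add: LT_products GT_simps del: LT_simps)
    next
      case 3 then show ?thesis using \<open>i = 0\<close> \<open>X = _\<close> \<open>\<gamma> \<in> _\<close> by (simp add: LT_products GT_simps del: LT_simps)
    qed (use X0 in blast)
  next
    case 3
    show ?thesis using jY
    proof cases
      case 1 then show ?thesis using \<open>i = -1\<close> \<open>X = _\<close> \<open>x \<in> _\<close> by (simp add: LT_products GT_simps del: LT_simps)
    next
      case 2 then show ?thesis using \<open>i = -1\<close> \<open>X = _\<close> \<open>x \<in> _\<close> by (simp add: LT_products GT_simps del: LT_simps)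
    next
      case 3 then show ?thesis using \<open>i = -1\<close> \<open>X = _\<close> \<open>x \<in> _\<close> z by (simp add: LT_products del: LT_simps)
    qed (use X0 in blast)
  qed (use X0 in blast)
qed

definition TKK_proj :: "int \<Rightarrow> ('a, 'a) tkk \<Rightarrow> ('a, 'a) tkk" where
  "TKK_proj k X = (if k = 1 then (fst X, \<zero>\<^bsub>PE\<^esub>, \<zero>) else if k = 0 then (\<zero>, fst (snd X), \<zero>)
     else if k = -1 then (\<zero>, \<zero>\<^bsub>PE\<^esub>, snd (snd X)) else \<zero>\<^bsub>LT\<^esub>)"

abbreviation "swap \<equiv> \<lambda>\<gamma> :: ('a \<Rightarrow> 'a) \<times> ('a \<Rightarrow> 'a). (snd \<gamma>, fst \<gamma>)"

lemma swap_PE [simp]: "\<gamma> \<in> carrier PE \<Longrightarrow> swap \<gamma> \<in> carrier PE"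
  unfolding PE_carrier by simp

text \<open>On generators the swap of \<delta>(x,y) is -\<delta>(y,x), so \<open>exchange\<close>
  preserves degree zero.\<close>

lemma swap_ider [simp]:
  assumes "\<gamma> \<in> ider"
  shows "swap \<gamma> \<in> ider"
proof -
  have "submodule {\<gamma> \<in> carrier PE. swap \<gamma> \<in> ider} \<Phi> PE"
  proof (rule PE.submodule_linear_set[OF PE.submodule_carrier PE_module _ _ _ ider_submodule])
    fix \<mu> assume m: "\<mu> \<in> carrier PE"
    show "swap (\<mu> \<oplus>\<^bsub>PE\<^esub> \<nu>) = swap \<mu> \<oplus>\<^bsub>PE\<^esub> swap \<nu>" if "\<nu> \<in> carrier PE" for \<nu>
      by (rule PE_eqI) (simp_all add: m that PE_simps)
    show "swap (a \<odot>\<^bsub>PE\<^esub> \<mu>) = a \<odot>\<^bsub>PE\<^esub> swap \<mu>" if "a \<in> carrier \<Phi>" for a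
      by (rule PE_eqI) (simp_all add: m that PE_simps)
  qed simp
  moreover have "swap (\<delta> x y) \<in> ider" if "x \<in> carrier T" "y \<in> carrier T" for x y
  proof -
    have "swap (\<delta> x y) = \<zero>\<^bsub>PE\<^esub> \<ominus>\<^bsub>PE\<^esub> \<delta> y x"
      by (rule PE_eqI) (simp_all add: that PE_simps M.ab_simps)
    then show ?thesis using that by simp
  qed
  ultimately have "ider \<subseteq> {\<gamma> \<in> carrier PE. swap \<gamma> \<in> ider}" by (intro ider_least) simp_all
  then show ?thesis using assms by blast
qed

lemma exchange_eq [simp]: "exchange (x, \<gamma>, y) = (y, swap \<gamma>, x)"
  unfolding exchange_def by (simp add: case_prod_beta)

lemma exchange_closed: "X \<in> carrier LT \<Longrightarrow> exchange X \<in> carrier LT"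
  by (cases X rule: prod_cases3) simp

lemma exchange_br:
  assumes "X \<in> carrier LT" "Y \<in> carrier LT"
  shows "exchange (X \<otimes>\<^bsub>LT\<^esub> Y) = exchange X \<otimes>\<^bsub>LT\<^esub> exchange Y"
proof -
  obtain x \<gamma> x' y \<mu> y' where X: "X = (x, \<gamma>, x')" "Y = (y, \<mu>, y')" and [simp]: "x \<in> carrier T"
    "\<gamma> \<in> ider" "x' \<in> carrier T" "y \<in> carrier T" "\<mu> \<in> ider" "y' \<in> carrier T" using assms by auto
  have [simp]: "swap \<gamma> \<in> carrier PE" "swap \<mu> \<in> carrier PE" by simp_all
  have "swap (com \<gamma> \<mu> \<oplus>\<^bsub>PE\<^esub> \<delta> x y' \<ominus>\<^bsub>PE\<^esub> \<delta> y x') =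
      com (swap \<gamma>) (swap \<mu>) \<oplus>\<^bsub>PE\<^esub> \<delta> x' y \<ominus>\<^bsub>PE\<^esub> \<delta> y' x"
    by (rule PE_eqI) (simp_all add: PE_simps M.ab_simps)
  then show ?thesis unfolding X by simp
qed

text \<open>Identifies the bracket product on degree 1 with the triple product of T; this is what
  makes \<open>TKK_embed\<close> and later \<open>ext\<close> compatible with products.\<close>

lemma TKK_triple:
  assumes "x \<in> carrier T" "y \<in> carrier T" "z \<in> carrier T"
  shows "((x, \<zero>\<^bsub>PE\<^esub>, \<zero>) \<otimes>\<^bsub>LT\<^esub> exchange (y, \<zero>\<^bsub>PE\<^esub>, \<zero>)) \<otimes>\<^bsub>LT\<^esub> (z, \<zero>\<^bsub>PE\<^esub>, \<zero>) = (trip T x y z, \<zero>\<^bsub>PE\<^esub>, \<zero>)"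
proof -
  have "swap \<zero>\<^bsub>PE\<^esub> = \<zero>\<^bsub>PE\<^esub>" by (rule PE_eqI) (simp_all add: PE_simps)
  then show ?thesis
    using assms by (simp add: PE_simps com_zero delta_zero M.diff_zero PE.M.diff_zero)
qed

lemma TKK_gr3:
  assumes nd: "strongly_nondegenerate T"
  shows "gr3 \<Phi> LT GT TKK_proj exchange"
proof (intro gr3.intro LT_lie gr3_axioms.intro)
  fix k i j :: int and X Y a
  show "submodule (GT k) \<Phi> LT" by (rule GT_submodule)
  show "\<lbrakk>k \<noteq> 1; k \<noteq> 0; k \<noteq> -1\<rbrakk> \<Longrightarrow> GT k = {\<zero>\<^bsub>LT\<^esub>}" by (rule GT_simps(4))
  show "\<lbrakk>X \<in> GT i; Y \<in> GT j\<rbrakk> \<Longrightarrow> X \<otimes>\<^bsub>LT\<^esub> Y \<in> GT (i + j)" by (rule GT_br)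
  show "X \<in> carrier LT \<Longrightarrow> TKK_proj k X \<in> GT k"
    "\<lbrakk>X \<in> carrier LT; Y \<in> carrier LT\<rbrakk> \<Longrightarrow> TKK_proj k (X \<oplus>\<^bsub>LT\<^esub> Y) = TKK_proj k X \<oplus>\<^bsub>LT\<^esub> TKK_proj k Y"
    "\<lbrakk>a \<in> carrier \<Phi>; X \<in> carrier LT\<rbrakk> \<Longrightarrow> TKK_proj k (a \<odot>\<^bsub>LT\<^esub> X) = a \<odot>\<^bsub>LT\<^esub> TKK_proj k X"
    "X \<in> GT k \<Longrightarrow> TKK_proj k X = X"
    by (cases k rule: GT_degrees; auto simp: TKK_proj_def GT_simps)+
  show "\<lbrakk>X \<in> GT j; j \<noteq> k\<rbrakk> \<Longrightarrow> TKK_proj k X = \<zero>\<^bsub>LT\<^esub>"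
    by (cases k rule: GT_degrees; cases j rule: GT_degrees; auto simp: TKK_proj_def GT_simps)
  show "X \<in> carrier LT \<Longrightarrow> TKK_proj 1 X \<oplus>\<^bsub>LT\<^esub> TKK_proj 0 X \<oplus>\<^bsub>LT\<^esub> TKK_proj (-1) X = X"
    by (auto simp: TKK_proj_def)
  show "X \<in> carrier LT \<Longrightarrow> exchange X \<in> carrier LT" by (rule exchange_closed)
  show "\<lbrakk>X \<in> carrier LT; Y \<in> carrier LT\<rbrakk> \<Longrightarrow> exchange (X \<otimes>\<^bsub>LT\<^esub> Y) = exchange X \<otimes>\<^bsub>LT\<^esub> exchange Y"
    by (rule exchange_br)
  show "X \<in> carrier LT \<Longrightarrow> exchange (exchange X) = X" by auto
  have sw0: "swap \<zero>\<^bsub>PE\<^esub> = \<zero>\<^bsub>PE\<^esub>" by (rule PE_eqI) (simp_all add: PE_simps)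
  have sw: "swap (\<mu> \<oplus>\<^bsub>PE\<^esub> \<nu>) = swap \<mu> \<oplus>\<^bsub>PE\<^esub> swap \<nu>" if "\<mu> \<in> carrier PE" "\<nu> \<in> carrier PE" for \<mu> \<nu>
    by (rule PE_eqI) (simp_all add: that PE_simps)
  have sws: "swap (a \<odot>\<^bsub>PE\<^esub> \<mu>) = a \<odot>\<^bsub>PE\<^esub> swap \<mu>" if "\<mu> \<in> carrier PE" "a \<in> carrier \<Phi>" for \<mu> a
    by (rule PE_eqI) (simp_all add: that PE_simps)
  show "\<lbrakk>X \<in> carrier LT; Y \<in> carrier LT\<rbrakk> \<Longrightarrow> exchange (X \<oplus>\<^bsub>LT\<^esub> Y) = exchange X \<oplus>\<^bsub>LT\<^esub> exchange Y"
    using sw by auto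
  show "\<lbrakk>a \<in> carrier \<Phi>; X \<in> carrier LT\<rbrakk> \<Longrightarrow> exchange (a \<odot>\<^bsub>LT\<^esub> X) = a \<odot>\<^bsub>LT\<^esub> exchange X"
    using sws by auto
  show "X \<in> GT k \<Longrightarrow> exchange X \<in> GT (- k)"
    by (cases X rule: prod_cases3; cases k rule: GT_degrees; simp add: GT_simps sw0)
next
  fix w assume w: "w \<in> GT 0" and 1: "\<And>x. x \<in> GT 1 \<Longrightarrow> w \<otimes>\<^bsub>LT\<^esub> x = \<zero>\<^bsub>LT\<^esub>"
    and 2: "\<And>x. x \<in> GT (-1) \<Longrightarrow> w \<otimes>\<^bsub>LT\<^esub> x = \<zero>\<^bsub>LT\<^esub>"
  obtain \<gamma> where g: "w = (\<zero>, \<gamma>, \<zero>)" "\<gamma> \<in> ider" using w by (auto simp: GT_simps)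
  have "\<gamma> = \<zero>\<^bsub>PE\<^esub>"
  proof (rule PE_eqI)
    fix z assume z: "z \<in> carrier T"
    show "fst \<gamma> z = fst \<zero>\<^bsub>PE\<^esub> z" using 1[of "(z, \<zero>\<^bsub>PE\<^esub>, \<zero>)"] z g by (simp add: GT_simps PE_simps M.diff_zero)
    show "snd \<gamma> z = snd \<zero>\<^bsub>PE\<^esub> z" using 2[of "(\<zero>, \<zero>\<^bsub>PE\<^esub>, z)"] z g by (simp add: GT_simps PE_simps M.diff_zero)
  qed (use g in simp_all)
  then show "w = \<zero>\<^bsub>LT\<^esub>" using g by simp
next
  fix X assume X: "X \<in> GT 1" and zero: "\<And>Y. Y \<in> GT (-1) \<Longrightarrow> X \<otimes>\<^bsub>LT\<^esub> (X \<otimes>\<^bsub>LT\<^esub> Y) = \<zero>\<^bsub>LT\<^esub>"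
  obtain x where x: "X = (x, \<zero>\<^bsub>PE\<^esub>, \<zero>)" "x \<in> carrier T" using X by (auto simp: GT_simps)
  have "quad T x y = \<zero>" if y: "y \<in> carrier T" for y
  proof -
    \<comment> \<open>The degree 1 component of [X,[X,Y]] is -{x y x}, that is -2 P_x y.\<close>
    have "\<zero> \<ominus> trip T x y x = \<zero>"
      using zero[of "(\<zero>, \<zero>\<^bsub>PE\<^esub>, y)"] x y
      by (simp add: GT_simps PE_simps com_zero delta_zero M.diff_zero PE.M.diff_zero)
    then have "trip T x y x = \<zero>" using x y by (simp add: M.diff_eq_zero)
    then show ?thesis using x y by (simp add: quad_eq)
  qed
  then show "X = \<zero>\<^bsub>LT\<^esub>" using nd x unfolding strongly_nondegenerate_def by simp
qed

end


section \<open>The degree one component is a triple system of M-quotients\<close>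

lemma jts6I:
  assumes "[(6::nat)] \<cdot>\<^bsub>\<Phi>\<^esub> \<one>\<^bsub>\<Phi>\<^esub> \<in> Units \<Phi>" "jordan_triple_system \<Phi> T"
  shows "jts6 \<Phi> T"
  using assms jordan_triple_system.axioms(1)[OF assms(2)]
  by (intro jts6.intro module6.intro module6_axioms.intro)

context jts6
begin

abbreviation "up x \<equiv> (x, \<zero>\<^bsub>PE\<^esub>, \<zero>)"

lemma up_G1: "x \<in> carrier T \<Longrightarrow> up x \<in> GT 1"
  by (simp add: GT_simps)

lemma up_LT: "x \<in> carrier T \<Longrightarrow> up x \<in> carrier LT"
  by simp

lemma up_add: "up (x \<oplus> y) = up x \<oplus>\<^bsub>LT\<^esub> up y" 
  by simp

lemma up_smult: "a \<in> carrier \<Phi> \<Longrightarrow> up (a \<odot> x) = a \<odot>\<^bsub>LT\<^esub> up x"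
  by simp

lemma embed_eq: "x \<in> carrier T \<Longrightarrow> TKK_embed \<Phi> T x = ad_class \<Phi> LT (up x)"
  unfolding TKK_embed_def by simp

lemma embed_M_quotients:
  assumes nd: "strongly_nondegenerate T"
  shows "M_quotients_of \<Phi> T (Qm_TKK_one \<Phi> T) (TKK_embed \<Phi> T)"
    and "Qm_TKK_one \<Phi> T = gr3.Q1 \<Phi> LT GT exchange"
proof -
  interpret L: gr3 \<Phi> LT GT TKK_proj exchange by (rule TKK_gr3[OF nd])
  show Q1: "Qm_TKK_one \<Phi> T = L.Q1"
    unfolding Qm_TKK_one_def L.Q1_def Let_def ..
  have img: "TKK_embed \<Phi> T ` carrier T = L.K1"
    using embed_eq by (auto simp: GT_simps image_iff)
  have "jts_mono \<Phi> T L.Q1 (TKK_embed \<Phi> T)"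
    unfolding jts_mono_def mod_hom_def
  proof (intro conjI CollectI ballI)
    show "TKK_embed \<Phi> T \<in> carrier T \<rightarrow>\<^sub>E carrier L.Q1"
      using embed_eq L.adc_deg[OF up_G1] by (auto simp: TKK_embed_def)
    fix x assume x: "x \<in> carrier T"
    show "TKK_embed \<Phi> T (a \<odot> x) = a \<odot>\<^bsub>L.Q1\<^esub> TKK_embed \<Phi> T x" if a: "a \<in> carrier \<Phi>" for a
      using x a L.adc_smult[OF a up_LT[OF x]] by (simp only: embed_eq smult_closed up_smult L.Q1_simps)
    fix y assume y: "y \<in> carrier T"
    show "TKK_embed \<Phi> T (x \<oplus> y) = TKK_embed \<Phi> T x \<oplus>\<^bsub>L.Q1\<^esub> TKK_embed \<Phi> T y"
      using x y L.adc_add[OF up_LT[OF x] up_LT[OF y]] by (simp only: embed_eq M.a_closed up_add L.Q1_simps)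
    have "L.trQ (ad_class \<Phi> LT (up x)) (ad_class \<Phi> LT (up y)) (ad_class \<Phi> LT (up x)) = ad_class \<Phi> LT (up (trip T x y x))"
      unfolding L.trQ_adc[OF up_LT[OF x] up_LT[OF y] up_LT[OF x]] TKK_triple[OF x y x] ..
    then have "half \<odot>\<^bsub>L.Q\<^esub> L.trQ (ad_class \<Phi> LT (up x)) (ad_class \<Phi> LT (up y)) (ad_class \<Phi> LT (up x)) =
        ad_class \<Phi> LT (half \<odot>\<^bsub>LT\<^esub> up (trip T x y x))"
      using L.adc_smult[OF half_closed up_LT[OF trip_closed[OF x y x]]] by simp
    also have "half \<odot>\<^bsub>LT\<^esub> up (trip T x y x) = up (quad T x y)"
      using x y by (simp add: quad_eq)
    finally show "TKK_embed \<Phi> T (quad T x y) = quad L.Q1 (TKK_embed \<Phi> T x) (TKK_embed \<Phi> T y)"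
      using x y by (simp only: embed_eq quad_closed L.Q1_simps)
  next
    show "inj_on (TKK_embed \<Phi> T) (carrier T)"
    proof (rule inj_onI)
      fix x y assume xy: "x \<in> carrier T" "y \<in> carrier T" "TKK_embed \<Phi> T x = TKK_embed \<Phi> T y"
      then have "ad_class \<Phi> LT (up x) = ad_class \<Phi> LT (up y)" by (simp only: embed_eq)
      then show "x = y" using L.adc_inj[OF up_LT[OF xy(1)] up_LT[OF xy(2)]] by simp
    qed
  qed
  then show "M_quotients_of \<Phi> T (Qm_TKK_one \<Phi> T) (TKK_embed \<Phi> T)"
    unfolding M_quotients_of_def img Q1 using L.Q1_M_quotients by blast
qed

end

section \<open>The universal property\<close>

locale nondegenerate_quotients = jts_quotients \<Phi> T S f
  for \<Phi> :: "('k, 'r) ring_scheme" and T :: "('k, 't, 'm) jts_scheme" (structure) and S :: "('k, 's, 'n) jts_scheme"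
    and f :: "'t \<Rightarrow> 's" +
  assumes nd: "strongly_nondegenerate T"
begin

sublocale L: gr3 \<Phi> "TKK \<Phi> (double_pair T)" "TKK_deg \<Phi> (double_pair T)" T.TKK_proj exchange
  by (rule T.TKK_gr3[OF nd])

text \<open>If \<open>\<kappa>\<close> kills \<open>K\<close>, applying it to the products of \<open>q\<close> with its denominators shows that
  these denominators annihilate \<open>\<kappa> q\<close>.\<close>

lemma dp_fst_kernel:
  assumes k: "\<kappa> \<in> S.dp" and zero: "\<And>t. t \<in> carrier T \<Longrightarrow> fst \<kappa> (f t) = \<zero>\<^bsub>S\<^esub> \<and> snd \<kappa> (f t) = \<zero>\<^bsub>S\<^esub>"
    and q: "q \<in> carrier S"
  shows "fst \<kappa> q = \<zero>\<^bsub>S\<^esub>"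
proof (cases "q = \<zero>\<^bsub>S\<^esub>")
  case True
  then show ?thesis using zero[of \<zero>] f_zero by simp
next
  case False
  note D = S.dpD[OF k]
  have kc: "fst \<kappa> q \<in> carrier S" using D(1) q by simp
  obtain J where J: "jts_ideal \<Phi> T J" "jts_ann T J = {\<zero>}"
    and JK: "\<And>x t. \<lbrakk>x \<in> J; t \<in> carrier T\<rbrakk> \<Longrightarrow>
      trip S q (f x) (f t) \<in> K \<and> trip S q (f t) (f x) \<in> K \<and> trip S (f x) q (f t) \<in> K"
    using denominators[OF q False] by metis
  have zK: "fst \<kappa> c = \<zero>\<^bsub>S\<^esub>" "snd \<kappa> c = \<zero>\<^bsub>S\<^esub>" if "c \<in> K" for c using that zero by auto
  show ?thesis
  proof (rule separation[OF J kc])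
    fix x t assume x: "x \<in> J" and t: "t \<in> carrier T"
    have xc: "x \<in> carrier T" using T.jts_idealD(4)[OF J(1) x t t] .
    have [simp]: "f x \<in> carrier S" "f t \<in> carrier S" using xc t by auto
    have zx: "fst \<kappa> (f x) = \<zero>\<^bsub>S\<^esub>" "snd \<kappa> (f x) = \<zero>\<^bsub>S\<^esub>" "fst \<kappa> (f t) = \<zero>\<^bsub>S\<^esub>" "snd \<kappa> (f t) = \<zero>\<^bsub>S\<^esub>"
      using zero xc t by auto
    have "fst \<kappa> (trip S q (f x) (f t)) = \<zero>\<^bsub>S\<^esub>" "fst \<kappa> (trip S q (f t) (f x)) = \<zero>\<^bsub>S\<^esub>"
      "snd \<kappa> (trip S (f x) q (f t)) = \<zero>\<^bsub>S\<^esub>"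
      using JK[OF x t] zK by auto
    then show "trip S (fst \<kappa> q) (f x) (f t) = \<zero>\<^bsub>S\<^esub> \<and> trip S (fst \<kappa> q) (f t) (f x) = \<zero>\<^bsub>S\<^esub> \<and>
        trip S (f x) (fst \<kappa> q) (f t) = \<zero>\<^bsub>S\<^esub>"
      using q kc by (simp add: D(2,3) zx)
  qed
qed

text \<open>The swapped pair is again a derivation pair, so \<open>dp_fst_kernel\<close> covers both
  components. Consequently an element of \<open>S.ider\<close> is determined by its action on the
  image of T.\<close>

lemma dp_kernel:
  assumes k: "\<kappa> \<in> S.dp" and zero: "\<And>t. t \<in> carrier T \<Longrightarrow> fst \<kappa> (f t) = \<zero>\<^bsub>S\<^esub> \<and> snd \<kappa> (f t) = \<zero>\<^bsub>S\<^esub>"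
  shows "\<kappa> = \<zero>\<^bsub>S.PE\<^esub>"
proof (rule S.PE_eqI)
  have sw: "S.swap \<kappa> \<in> S.dp" using k unfolding S.dp_def by (auto simp: S.swap_PE)
  show "\<kappa> \<in> carrier S.PE" using S.dpD(1)[OF k] .
  fix z assume z: "z \<in> carrier S"
  show "fst \<kappa> z = fst \<zero>\<^bsub>S.PE\<^esub> z" using dp_fst_kernel[OF k zero z] z by (simp add: S.PE_simps)
  show "snd \<kappa> z = snd \<zero>\<^bsub>S.PE\<^esub> z" using dp_fst_kernel[OF sw _ z] zero z by (simp add: S.PE_simps)
qed simp

text \<open>The map from \<open>T.ider\<close> to \<open>S.ider\<close> cannot be read off from
  expressions in the \<delta>(x,y), which are not unique. It is introduced as the relation that
  \<kappa> extends \<gamma> along \<open>f\<close>: this holds for generators, is stable under all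
  operations, and determines \<kappa> by \<open>dp_kernel\<close>.\<close>

definition intertwines where
  "intertwines \<gamma> \<kappa> \<longleftrightarrow> \<kappa> \<in> S.ider \<and>
    (\<forall>t\<in>carrier T. fst \<kappa> (f t) = f (fst \<gamma> t) \<and> snd \<kappa> (f t) = f (snd \<gamma> t))"

lemma intertwines_unique:
  assumes "intertwines \<gamma> \<kappa>" "intertwines \<gamma> \<kappa>'"
  shows "\<kappa> = \<kappa>'"
proof -
  have i: "\<kappa> \<in> S.ider" "\<kappa>' \<in> S.ider" using assms unfolding intertwines_def by auto
  have "\<kappa> \<ominus>\<^bsub>S.PE\<^esub> \<kappa>' = \<zero>\<^bsub>S.PE\<^esub>"
  proof (rule dp_kernel)
    show "\<kappa> \<ominus>\<^bsub>S.PE\<^esub> \<kappa>' \<in> S.dp" using S.dp_diff S.ider_dp i by blast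
    fix t assume t: "t \<in> carrier T"
    have "fst \<kappa> (f t) = fst \<kappa>' (f t)" "snd \<kappa> (f t) = snd \<kappa>' (f t)"
      using assms t unfolding intertwines_def by auto
    moreover have "fst \<kappa>' (f t) \<in> carrier S" "snd \<kappa>' (f t) \<in> carrier S" using i t by auto
    ultimately show "fst (\<kappa> \<ominus>\<^bsub>S.PE\<^esub> \<kappa>') (f t) = \<zero>\<^bsub>S\<^esub> \<and> snd (\<kappa> \<ominus>\<^bsub>S.PE\<^esub> \<kappa>') (f t) = \<zero>\<^bsub>S\<^esub>"
      using t i by (simp add: S.PE_eval_diff S.M.diff_eq_zero)
  qed
  then show ?thesis using i S.PE.M.diff_eq_zero by simp
qed

lemma intertwines_zero: "intertwines \<zero>\<^bsub>T.PE\<^esub> \<zero>\<^bsub>S.PE\<^esub>"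
  unfolding intertwines_def by (simp add: S.PE_simps T.PE_simps f_zero)

lemma intertwines_add: "\<lbrakk>intertwines \<gamma> \<kappa>; intertwines \<mu> \<nu>; \<gamma> \<in> carrier T.PE; \<mu> \<in> carrier T.PE\<rbrakk> \<Longrightarrow>
    intertwines (\<gamma> \<oplus>\<^bsub>T.PE\<^esub> \<mu>) (\<kappa> \<oplus>\<^bsub>S.PE\<^esub> \<nu>)"
  unfolding intertwines_def by (simp add: S.PE_simps T.PE_simps f_add)

lemma intertwines_diff: "\<lbrakk>intertwines \<gamma> \<kappa>; intertwines \<mu> \<nu>; \<gamma> \<in> carrier T.PE; \<mu> \<in> carrier T.PE\<rbrakk> \<Longrightarrow>
    intertwines (\<gamma> \<ominus>\<^bsub>T.PE\<^esub> \<mu>) (\<kappa> \<ominus>\<^bsub>S.PE\<^esub> \<nu>)"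
  unfolding intertwines_def by (simp add: S.PE_simps T.PE_simps f_diff)

lemma intertwines_smult: "\<lbrakk>intertwines \<gamma> \<kappa>; a \<in> carrier \<Phi>; \<gamma> \<in> carrier T.PE\<rbrakk> \<Longrightarrow>
    intertwines (a \<odot>\<^bsub>T.PE\<^esub> \<gamma>) (a \<odot>\<^bsub>S.PE\<^esub> \<kappa>)"
  unfolding intertwines_def by (simp add: S.PE_simps T.PE_simps f_smult)

lemma intertwines_com: "\<lbrakk>intertwines \<gamma> \<kappa>; intertwines \<mu> \<nu>; \<gamma> \<in> carrier T.PE; \<mu> \<in> carrier T.PE\<rbrakk> \<Longrightarrow>
    intertwines (T.com \<gamma> \<mu>) (S.com \<kappa> \<nu>)"
  unfolding intertwines_def by (simp add: S.PE_simps T.PE_simps f_diff)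

lemma intertwines_delta: "\<lbrakk>x \<in> carrier T; y \<in> carrier T\<rbrakk> \<Longrightarrow> intertwines (T.\<delta> x y) (S.\<delta> (f x) (f y))"
  unfolding intertwines_def by (simp add: S.PE_simps T.PE_simps f_trip f_uminus)

lemma intertwines_swap: "intertwines \<gamma> \<kappa> \<Longrightarrow> intertwines (T.swap \<gamma>) (S.swap \<kappa>)"
  unfolding intertwines_def using S.swap_ider by simp

lemma intertwines_exists:
  assumes "\<gamma> \<in> T.ider"
  shows "\<exists>\<kappa>. intertwines \<gamma> \<kappa>"
proof -
  have "submodule {\<gamma> \<in> carrier T.PE. \<exists>\<kappa>. intertwines \<gamma> \<kappa>} \<Phi> T.PE"
  proof (rule T.PE.submoduleI)
    show z: "\<zero>\<^bsub>T.PE\<^esub> \<in> {\<gamma> \<in> carrier T.PE. \<exists>\<kappa>. intertwines \<gamma> \<kappa>}"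
      using intertwines_zero T.PE.M.zero_closed by blast
    fix \<gamma> assume g: "\<gamma> \<in> {\<gamma> \<in> carrier T.PE. \<exists>\<kappa>. intertwines \<gamma> \<kappa>}"
    then obtain \<kappa> where k: "intertwines \<gamma> \<kappa>" and gc: "\<gamma> \<in> carrier T.PE" by blast
    have "intertwines (\<ominus>\<^bsub>T.PE\<^esub> \<gamma>) (\<zero>\<^bsub>S.PE\<^esub> \<ominus>\<^bsub>S.PE\<^esub> \<kappa>)"
      using intertwines_diff[OF intertwines_zero k T.PE.M.zero_closed gc] T.PE.M.uminus_eq_diff[OF gc] by simp
    then show "\<ominus>\<^bsub>T.PE\<^esub> \<gamma> \<in> {\<gamma> \<in> carrier T.PE. \<exists>\<kappa>. intertwines \<gamma> \<kappa>}"
      using T.PE.M.a_inv_closed[OF gc] by blast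
    show "a \<odot>\<^bsub>T.PE\<^esub> \<gamma> \<in> {\<gamma> \<in> carrier T.PE. \<exists>\<kappa>. intertwines \<gamma> \<kappa>}" if "a \<in> carrier \<Phi>" for a
      using g that intertwines_smult by blast
    show "\<gamma> \<oplus>\<^bsub>T.PE\<^esub> \<mu> \<in> {\<gamma> \<in> carrier T.PE. \<exists>\<kappa>. intertwines \<gamma> \<kappa>}"
      if "\<mu> \<in> {\<gamma> \<in> carrier T.PE. \<exists>\<kappa>. intertwines \<gamma> \<kappa>}" for \<mu>
      using g that intertwines_add T.PE.M.a_closed by blast
  qed auto
  then have "T.ider \<subseteq> {\<gamma> \<in> carrier T.PE. \<exists>\<kappa>. intertwines \<gamma> \<kappa>}"
    by (rule T.ider_least) (use intertwines_delta T.delta_closed in blast)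
  then show ?thesis using assms by blast
qed

definition psi where "psi \<gamma> = (THE \<kappa>. intertwines \<gamma> \<kappa>)"

lemma psi_eqI: "intertwines \<gamma> \<kappa> \<Longrightarrow> psi \<gamma> = \<kappa>"
  unfolding psi_def using intertwines_unique by blast

lemma psi: "\<gamma> \<in> T.ider \<Longrightarrow> intertwines \<gamma> (psi \<gamma>)"
  using intertwines_exists psi_eqI by metis

lemma psi_ider [simp]: "\<gamma> \<in> T.ider \<Longrightarrow> psi \<gamma> \<in> S.ider"
  using psi unfolding intertwines_def by blast

lemma psi_apply: "\<lbrakk>\<gamma> \<in> T.ider; t \<in> carrier T\<rbrakk> \<Longrightarrow> fst (psi \<gamma>) (f t) = f (fst \<gamma> t)"
  "\<lbrakk>\<gamma> \<in> T.ider; t \<in> carrier T\<rbrakk> \<Longrightarrow> snd (psi \<gamma>) (f t) = f (snd \<gamma> t)"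
  using psi unfolding intertwines_def by blast+

lemma psi_zero [simp]: "psi \<zero>\<^bsub>T.PE\<^esub> = \<zero>\<^bsub>S.PE\<^esub>"
  by (rule psi_eqI[OF intertwines_zero])

lemma psi_delta: "\<lbrakk>x \<in> carrier T; y \<in> carrier T\<rbrakk> \<Longrightarrow> psi (T.\<delta> x y) = S.\<delta> (f x) (f y)"
  by (rule psi_eqI[OF intertwines_delta])

lemma psi_inj:
  assumes "\<gamma> \<in> T.ider" "\<mu> \<in> T.ider" "psi \<gamma> = psi \<mu>"
  shows "\<gamma> = \<mu>"
proof (rule T.PE_eqI)
  fix z assume z: "z \<in> carrier T"
  have "f (fst \<gamma> z) = f (fst \<mu> z)" "f (snd \<gamma> z) = f (snd \<mu> z)"
    using psi_apply[OF assms(1) z] psi_apply[OF assms(2) z] assms(3) by simp_all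
  then show "fst \<gamma> z = fst \<mu> z" "snd \<gamma> z = snd \<mu> z" using f_eq_iff assms z by auto
qed (use assms in simp_all)

definition ph :: "('t, 't) tkk \<Rightarrow> ('s, 's) tkk" where
  "ph X = (f (fst X), psi (fst (snd X)), f (snd (snd X)))"

lemma ph_simp [simp]: "ph (x, \<gamma>, y) = (f x, psi \<gamma>, f y)"
  unfolding ph_def by simp

sublocale E: lie_extension \<Phi> "TKK \<Phi> (double_pair T)" "TKK_deg \<Phi> (double_pair T)" T.TKK_proj exchange
  "TKK \<Phi> (double_pair S)" ph exchange
proof (intro lie_extension.intro lie_extension_axioms.intro L.gr3_axioms S.LT_lie)
  fix X Y a assume X: "X \<in> carrier T.LT"
  then obtain x \<gamma> x' where X': "X = (x, \<gamma>, x')" and [simp]: "x \<in> carrier T" "\<gamma> \<in> T.ider" "x' \<in> carrier T" by auto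
  show "ph X \<in> carrier S.LT" unfolding X' by simp
  have "psi (a \<odot>\<^bsub>T.PE\<^esub> \<gamma>) = a \<odot>\<^bsub>S.PE\<^esub> psi \<gamma>" if "a \<in> carrier \<Phi>"
    using that by (intro psi_eqI intertwines_smult psi) simp_all
  then show "a \<in> carrier \<Phi> \<Longrightarrow> ph (a \<odot>\<^bsub>T.LT\<^esub> X) = a \<odot>\<^bsub>S.LT\<^esub> ph X"
    unfolding X' by (simp add: f_smult)
  have "psi (T.swap \<gamma>) = S.swap (psi \<gamma>)" by (intro psi_eqI intertwines_swap psi) simp
  then show "exchange (ph X) = ph (exchange X)" unfolding X' by simp
  assume "Y \<in> carrier T.LT"
  then obtain y \<mu> y' where Y': "Y = (y, \<mu>, y')" and [simp]: "y \<in> carrier T" "\<mu> \<in> T.ider" "y' \<in> carrier T" by auto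
  have "psi (\<gamma> \<oplus>\<^bsub>T.PE\<^esub> \<mu>) = psi \<gamma> \<oplus>\<^bsub>S.PE\<^esub> psi \<mu>" by (intro psi_eqI intertwines_add psi) simp_all
  then show "ph (X \<oplus>\<^bsub>T.LT\<^esub> Y) = ph X \<oplus>\<^bsub>S.LT\<^esub> ph Y" unfolding X' Y' by (simp add: f_add)
  have "psi (T.com \<gamma> \<mu> \<oplus>\<^bsub>T.PE\<^esub> T.\<delta> x y' \<ominus>\<^bsub>T.PE\<^esub> T.\<delta> y x') =
      S.com (psi \<gamma>) (psi \<mu>) \<oplus>\<^bsub>S.PE\<^esub> S.\<delta> (f x) (f y') \<ominus>\<^bsub>S.PE\<^esub> S.\<delta> (f y) (f x')"
    by (intro psi_eqI intertwines_diff intertwines_add intertwines_com intertwines_delta psi) simp_all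
  then show "ph (X \<otimes>\<^bsub>T.LT\<^esub> Y) = ph X \<otimes>\<^bsub>S.LT\<^esub> ph Y"
    unfolding X' Y' by (simp add: f_diff psi_apply)
next
  show "inj_on ph (carrier T.LT)"
    by (rule inj_onI) (auto simp: f_eq_iff dest: psi_inj)
next
  fix m n assume "m \<in> carrier S.LT"
  then show "exchange m \<in> carrier S.LT" "n \<in> carrier S.LT \<Longrightarrow> exchange (m \<otimes>\<^bsub>S.LT\<^esub> n) = exchange m \<otimes>\<^bsub>S.LT\<^esub> exchange n"
    using S.exchange_closed S.exchange_br by blast+
qed

lemma ph_GT: "X \<in> T.GT k \<Longrightarrow> ph X \<in> S.GT k"
  by (cases k rule: T.GT_degrees; auto simp: T.GT_simps S.GT_simps f_zero)

text \<open>Injectivity of \<open>f\<close> and \<open>psi\<close> lets the degree of an element of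
  L be read off in the larger algebra, where the values of \<open>dm\<close> are known.\<close>

lemma ph_GT_D: "\<lbrakk>ph X \<in> S.GT k; X \<in> carrier T.LT\<rbrakk> \<Longrightarrow> X \<in> T.GT k"
  using psi_inj[of _ "\<zero>\<^bsub>T.PE\<^esub>"]
  by (cases k rule: T.GT_degrees; auto simp: T.GT_simps S.GT_simps f_eq_zero_iff)

abbreviation PL where "PL \<equiv> ph ` carrier T.LT"

lemma PL_submodule: "submodule PL \<Phi> S.LT"
  by (rule E.ph_image_submodule)

lemma PL_br:
  assumes "a \<in> PL" "b \<in> PL"
  shows "a \<otimes>\<^bsub>S.LT\<^esub> b \<in> PL"
proof -
  obtain x where x: "a = ph x" "x \<in> carrier T.LT" using assms(1) by (rule imageE)
  obtain y where y: "b = ph y" "y \<in> carrier T.LT" using assms(2) by (rule imageE)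
  show ?thesis
    unfolding x(1) y(1) E.ph_br[OF x(2) y(2), symmetric] by (rule imageI[OF T.LT.br_closed[OF x(2) y(2)]])
qed

lemma PL_carrier: "a \<in> PL \<Longrightarrow> a \<in> carrier S.LT"
  using S.LT.submodule_in[OF PL_submodule] .

text \<open>The normaliser of the image of L. For a denominator j, the bracket of q with the degree
  -1 copy of j is \<delta>(q, f j), which preserves \<open>K\<close> but need not come from
  \<open>T.ider\<close>; hence this larger set.\<close>

definition nrm where "nrm = {m \<in> carrier S.LT. \<forall>X\<in>PL. m \<otimes>\<^bsub>S.LT\<^esub> X \<in> PL}"

lemma nrm_submodule: "submodule nrm \<Phi> S.LT"
proof (rule S.LT.submoduleI)
  note i = S.LT.submodule_intros[OF PL_submodule]
  have D: "m \<in> carrier S.LT" "\<And>X. X \<in> PL \<Longrightarrow> m \<otimes>\<^bsub>S.LT\<^esub> X \<in> PL" if "m \<in> nrm" for m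
    using that unfolding nrm_def by blast+
  have I: "m \<in> nrm" if "m \<in> carrier S.LT" "\<And>X. X \<in> PL \<Longrightarrow> m \<otimes>\<^bsub>S.LT\<^esub> X \<in> PL" for m
    using that unfolding nrm_def by blast
  show "nrm \<subseteq> carrier S.LT" using D(1) by blast
  show "\<zero>\<^bsub>S.LT\<^esub> \<in> nrm"
    by (rule I[OF S.LT.M.zero_closed]) (simp only: S.LT.br_zero(1)[OF PL_carrier] i(5))
  fix m assume m: "m \<in> nrm"
  show "\<ominus>\<^bsub>S.LT\<^esub> m \<in> nrm"
    by (rule I[OF S.LT.M.a_inv_closed[OF D(1)[OF m]]])
      (simp only: S.LT.br_uminus1[OF D(1)[OF m] PL_carrier] i(3) D(2)[OF m])
  show "a \<odot>\<^bsub>S.LT\<^esub> m \<in> nrm" if a: "a \<in> carrier \<Phi>" for a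
    by (rule I[OF S.LT.smult_closed[OF a D(1)[OF m]]])
      (simp only: S.LT.br_smult1[OF a D(1)[OF m] PL_carrier] i(2)[OF a] D(2)[OF m])
  fix n assume n: "n \<in> nrm"
  show "m \<oplus>\<^bsub>S.LT\<^esub> n \<in> nrm"
    by (rule I[OF S.LT.M.a_closed[OF D(1)[OF m] D(1)[OF n]]])
      (simp only: S.LT.br_add1[OF D(1)[OF m] D(1)[OF n] PL_carrier] i(1) D(2)[OF m] D(2)[OF n])
qed

lemma PL_nrm: "a \<in> PL \<Longrightarrow> a \<in> nrm"
  unfolding nrm_def using PL_br PL_carrier by blast

lemma up_K_PL: "k \<in> K \<Longrightarrow> S.up k \<in> PL"
proof -
  assume "k \<in> K"
  then obtain c where c: "c \<in> carrier T" "k = f c" by blast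
  then have "S.up k = ph (T.up c)" by (simp add: f_zero)
  then show ?thesis using T.up_LT[OF c(1)] by blast
qed

lemma down_K_PL: "k \<in> K \<Longrightarrow> (\<zero>\<^bsub>S\<^esub>, \<zero>\<^bsub>S.PE\<^esub>, k) \<in> PL"
proof -
  assume "k \<in> K"
  then obtain c where c: "c \<in> carrier T" "k = f c" by blast
  then have "(\<zero>\<^bsub>S\<^esub>, \<zero>\<^bsub>S.PE\<^esub>, k) = ph (\<zero>, \<zero>\<^bsub>T.PE\<^esub>, c)" by (simp add: f_zero)
  moreover have "(\<zero>, \<zero>\<^bsub>T.PE\<^esub>, c) \<in> carrier T.LT" using c by simp
  ultimately show ?thesis by blast
qed

text \<open>Degree zero of L is spanned by the \<delta>(x,y), which are brackets of degree 1 with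
  degree -1. By the Jacobi identity it is enough to test m on these two degrees.\<close>

lemma nrmI:
  assumes m: "m \<in> carrier S.LT"
    and 1: "\<And>x. x \<in> carrier T \<Longrightarrow> m \<otimes>\<^bsub>S.LT\<^esub> ph (T.up x) \<in> PL"
    and 2: "\<And>y. y \<in> carrier T \<Longrightarrow> m \<otimes>\<^bsub>S.LT\<^esub> ph (\<zero>, \<zero>\<^bsub>T.PE\<^esub>, y) \<in> PL"
  shows "m \<in> nrm"
proof -
  have mid: "submodule {\<gamma> \<in> T.ider. m \<otimes>\<^bsub>S.LT\<^esub> ph (\<zero>, \<gamma>, \<zero>) \<in> PL} \<Phi> T.PE"
  proof (rule T.PE.submodule_linear_set[OF T.ider_submodule S.LT_module _ _ _ PL_submodule])
    have c: "ph (\<zero>, \<gamma>, \<zero>) \<in> carrier S.LT" "(\<zero>, \<gamma>, \<zero>) \<in> carrier T.LT" if "\<gamma> \<in> T.ider" for \<gamma>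
      using that by simp_all
    show "(\<lambda>\<gamma>. m \<otimes>\<^bsub>S.LT\<^esub> ph (\<zero>, \<gamma>, \<zero>)) \<in> T.ider \<rightarrow> carrier S.LT"
      using S.LT.br_closed[OF m] c by blast
    fix \<gamma> \<mu> a assume g: "\<gamma> \<in> T.ider"
    show "m \<otimes>\<^bsub>S.LT\<^esub> ph (\<zero>, \<gamma> \<oplus>\<^bsub>T.PE\<^esub> \<mu>, \<zero>) = m \<otimes>\<^bsub>S.LT\<^esub> ph (\<zero>, \<gamma>, \<zero>) \<oplus>\<^bsub>S.LT\<^esub> m \<otimes>\<^bsub>S.LT\<^esub> ph (\<zero>, \<mu>, \<zero>)"
      if h: "\<mu> \<in> T.ider"
    proof -
      have "(\<zero>, \<gamma> \<oplus>\<^bsub>T.PE\<^esub> \<mu>, \<zero>) = (\<zero>, \<gamma>, \<zero>) \<oplus>\<^bsub>T.LT\<^esub> (\<zero>, \<mu>, \<zero>)" by simp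
      then show ?thesis by (simp only: E.ph_add[OF c(2)[OF g] c(2)[OF h]] S.LT.br_add2[OF m c(1)[OF g] c(1)[OF h]])
    qed
    show "m \<otimes>\<^bsub>S.LT\<^esub> ph (\<zero>, a \<odot>\<^bsub>T.PE\<^esub> \<gamma>, \<zero>) = a \<odot>\<^bsub>S.LT\<^esub> (m \<otimes>\<^bsub>S.LT\<^esub> ph (\<zero>, \<gamma>, \<zero>))" if a: "a \<in> carrier \<Phi>"
    proof -
      have "(\<zero>, a \<odot>\<^bsub>T.PE\<^esub> \<gamma>, \<zero>) = a \<odot>\<^bsub>T.LT\<^esub> (\<zero>, \<gamma>, \<zero>)" using a by simp
      then show ?thesis by (simp only: E.ph_smult[OF a c(2)[OF g]] S.LT.br_smult2[OF a m c(1)[OF g]])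
    qed
  qed
  have mid': "T.ider \<subseteq> {\<gamma> \<in> T.ider. m \<otimes>\<^bsub>S.LT\<^esub> ph (\<zero>, \<gamma>, \<zero>) \<in> PL}"
  proof (rule T.ider_least[OF mid], intro CollectI conjI)
    fix x y assume x: "x \<in> carrier T" and y: "y \<in> carrier T"
    show "T.\<delta> x y \<in> T.ider" using x y by simp
    define a where "a = T.up x"
    define b where "b = (\<zero>, \<zero>\<^bsub>T.PE\<^esub>, y)"
    have ab: "a \<in> carrier T.LT" "b \<in> carrier T.LT" unfolding a_def b_def using x y by simp_all
    have "(\<zero>, T.\<delta> x y, \<zero>) = a \<otimes>\<^bsub>T.LT\<^esub> b"
      unfolding a_def b_def using x y
      by (simp add: T.PE_simps T.com_zero T.delta_zero T.M.diff_zero T.PE.M.diff_zero T.M.diff_eq_zero)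
    moreover have "m \<otimes>\<^bsub>S.LT\<^esub> (ph a \<otimes>\<^bsub>S.LT\<^esub> ph b) \<in> PL"
      unfolding S.LT.br_jacobi[OF m E.ph_closed[OF ab(1)] E.ph_closed[OF ab(2)]]
      by (rule S.LT.submodule_add[OF PL_submodule
            PL_br[OF 1[OF x, folded a_def] imageI[OF ab(2)]] PL_br[OF imageI[OF ab(1)] 2[OF y, folded b_def]]])
    ultimately show "m \<otimes>\<^bsub>S.LT\<^esub> ph (\<zero>, T.\<delta> x y, \<zero>) \<in> PL" using E.ph_br[OF ab] by simp
  qed
  have "m \<otimes>\<^bsub>S.LT\<^esub> ph X \<in> PL" if "X \<in> carrier T.LT" for X
  proof -
    obtain x \<gamma> y where X: "X = (x, \<gamma>, y)" and x: "x \<in> carrier T" "\<gamma> \<in> T.ider" "y \<in> carrier T"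
      using \<open>X \<in> carrier T.LT\<close> by auto
    define a b c where "a = T.up x" and "b = (\<zero>, \<gamma>, \<zero>)" and "c = (\<zero>, \<zero>\<^bsub>T.PE\<^esub>, y)"
    have abc: "a \<in> carrier T.LT" "b \<in> carrier T.LT" "c \<in> carrier T.LT" unfolding a_def b_def c_def using x by simp_all
    have Xs: "X = a \<oplus>\<^bsub>T.LT\<^esub> b \<oplus>\<^bsub>T.LT\<^esub> c" unfolding X a_def b_def c_def using x by simp
    have "m \<otimes>\<^bsub>S.LT\<^esub> ph a \<in> PL" "m \<otimes>\<^bsub>S.LT\<^esub> ph b \<in> PL" "m \<otimes>\<^bsub>S.LT\<^esub> ph c \<in> PL"
      using 1[OF x(1)] 2[OF x(3)] mid' x(2) unfolding a_def b_def c_def by blast+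
    moreover have "m \<otimes>\<^bsub>S.LT\<^esub> ph X = m \<otimes>\<^bsub>S.LT\<^esub> ph a \<oplus>\<^bsub>S.LT\<^esub> m \<otimes>\<^bsub>S.LT\<^esub> ph b \<oplus>\<^bsub>S.LT\<^esub> m \<otimes>\<^bsub>S.LT\<^esub> ph c"
      unfolding Xs E.ph_add[OF T.LT.M.a_closed[OF abc(1,2)] abc(3)] E.ph_add[OF abc(1,2)]
      by (simp only: S.LT.br_add2 m abc E.ph_closed S.LT.M.a_closed)
    ultimately show ?thesis using S.LT.submodule_add[OF PL_submodule] by simp
  qed
  then show ?thesis unfolding nrm_def using m by blast
qed

section \<open>Domains obtained from ideals of denominators\<close>

definition up_ideal where "up_ideal J = (\<lambda>x. T.up x) ` J"

context
  fixes J
  assumes J: "jts_ideal \<Phi> T J" and ann: "jts_ann T J = {\<zero>}"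
begin

lemma J_submodule: "submodule J \<Phi> T"
  using J unfolding jts_ideal_def by simp

lemma J_carrier: "x \<in> J \<Longrightarrow> x \<in> carrier T"
  by (rule T.submodule_in[OF J_submodule])

lemma up_ideal_submodule: "submodule (up_ideal J) \<Phi> T.LT"
proof (rule T.LT.submoduleI)
  note i = T.submodule_intros[OF J_submodule]
  show "up_ideal J \<subseteq> carrier T.LT" unfolding up_ideal_def using J_carrier by auto
  show "\<zero>\<^bsub>T.LT\<^esub> \<in> up_ideal J" unfolding up_ideal_def using i(5) by auto
  fix X assume "X \<in> up_ideal J"
  then obtain x where x: "x \<in> J" "X = T.up x" unfolding up_ideal_def by blast
  show sm: "a \<odot>\<^bsub>T.LT\<^esub> X \<in> up_ideal J" if "a \<in> carrier \<Phi>" for a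
    unfolding x(2) T.up_smult[OF that, symmetric] up_ideal_def by (rule imageI[OF i(2)[OF that x(1)]])
  show "\<ominus>\<^bsub>T.LT\<^esub> X \<in> up_ideal J"
    using sm[of "\<ominus>\<^bsub>\<Phi>\<^esub> \<one>\<^bsub>\<Phi>\<^esub>"] T.LT.smult_l_minus[of "\<one>\<^bsub>\<Phi>\<^esub>" X] T.up_LT[OF J_carrier[OF x(1)]] x by simp
  fix Y assume "Y \<in> up_ideal J"
  then obtain y where y: "y \<in> J" "Y = T.up y" unfolding up_ideal_def by blast
  show "X \<oplus>\<^bsub>T.LT\<^esub> Y \<in> up_ideal J"
    unfolding x(2) y(2) T.up_add[symmetric] up_ideal_def by (rule imageI[OF i(1)[OF x(1) y(1)]])
qed

lemma up_ideal_G1: "up_ideal J \<subseteq> T.GT 1"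
  unfolding up_ideal_def using T.up_G1 J_carrier by blast

lemma ider_J:
  assumes "\<gamma> \<in> T.ider" "j \<in> J"
  shows "fst \<gamma> j \<in> J" "snd \<gamma> j \<in> J"
proof -
  note i = T.submodule_intros[OF J_submodule]
  have "submodule {\<gamma> \<in> carrier T.PE. \<forall>j\<in>J. fst \<gamma> j \<in> J \<and> snd \<gamma> j \<in> J} \<Phi> T.PE"
  proof (rule T.PE.submoduleI)
    fix \<gamma> assume g: "\<gamma> \<in> {\<gamma> \<in> carrier T.PE. \<forall>j\<in>J. fst \<gamma> j \<in> J \<and> snd \<gamma> j \<in> J}"
    show "\<ominus>\<^bsub>T.PE\<^esub> \<gamma> \<in> {\<gamma> \<in> carrier T.PE. \<forall>j\<in>J. fst \<gamma> j \<in> J \<and> snd \<gamma> j \<in> J}"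
      using g i J_carrier by (auto simp: T.PE.M.uminus_eq_diff T.PE_simps)
  qed (use i J_carrier in \<open>auto simp: T.PE_simps\<close>)
  moreover have "T.\<delta> x y \<in> {\<gamma> \<in> carrier T.PE. \<forall>j\<in>J. fst \<gamma> j \<in> J \<and> snd \<gamma> j \<in> J}"
    if "x \<in> carrier T" "y \<in> carrier T" for x y
    using that i T.jts_idealD(3)[OF J] J_carrier by (auto simp: T.PE_simps)
  ultimately have "T.ider \<subseteq> {\<gamma> \<in> carrier T.PE. \<forall>j\<in>J. fst \<gamma> j \<in> J \<and> snd \<gamma> j \<in> J}"
    by (rule T.ider_least)
  then show "fst \<gamma> j \<in> J" "snd \<gamma> j \<in> J" using assms by auto
qed

lemma up_ideal_G0:
  assumes "w \<in> T.GT 0" "X \<in> up_ideal J"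
  shows "w \<otimes>\<^bsub>T.LT\<^esub> X \<in> up_ideal J"
proof -
  obtain \<gamma> j where w: "w = (\<zero>, \<gamma>, \<zero>)" "\<gamma> \<in> T.ider" "X = T.up j" "j \<in> J"
    using assms unfolding up_ideal_def by (auto simp: T.GT_simps)
  then have "w \<otimes>\<^bsub>T.LT\<^esub> X = T.up (fst \<gamma> j)"
    using J_carrier[OF w(4)]
    by (simp add: T.PE_simps T.com_zero T.delta_zero T.M.diff_zero T.PE.M.diff_zero)
  then show ?thesis using ider_J(1)[OF w(2,4)] unfolding up_ideal_def by blast
qed

lemma up_ideal_triple:
  assumes "X \<in> T.GT 1" "Y \<in> T.GT 1" "Z \<in> up_ideal J"
  shows "(X \<otimes>\<^bsub>T.LT\<^esub> exchange Z) \<otimes>\<^bsub>T.LT\<^esub> Y \<in> up_ideal J \<and> (Z \<otimes>\<^bsub>T.LT\<^esub> exchange Y) \<otimes>\<^bsub>T.LT\<^esub> X \<in> up_ideal J"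
proof -
  obtain x y j where X: "X = T.up x" "Y = T.up y" "Z = T.up j" and x: "x \<in> carrier T" "y \<in> carrier T" "j \<in> J"
    using assms unfolding up_ideal_def by (auto simp: T.GT_simps)
  show ?thesis
    unfolding X T.TKK_triple[OF x(1) J_carrier[OF x(3)] x(2)] T.TKK_triple[OF J_carrier[OF x(3)] x(2,1)]
    using T.jts_idealD[OF J x(3)] x unfolding up_ideal_def by blast
qed

lemma up_ideal_ann:
  assumes Z: "Z \<in> T.GT 1"
    and zero: "\<And>X Y. \<lbrakk>X \<in> up_ideal J; Y \<in> T.GT 1\<rbrakk> \<Longrightarrow>
      (Z \<otimes>\<^bsub>T.LT\<^esub> exchange X) \<otimes>\<^bsub>T.LT\<^esub> Y = \<zero>\<^bsub>T.LT\<^esub> \<and> (Z \<otimes>\<^bsub>T.LT\<^esub> exchange Y) \<otimes>\<^bsub>T.LT\<^esub> X = \<zero>\<^bsub>T.LT\<^esub> \<and>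
      (Y \<otimes>\<^bsub>T.LT\<^esub> exchange Z) \<otimes>\<^bsub>T.LT\<^esub> X = \<zero>\<^bsub>T.LT\<^esub>"
  shows "Z = \<zero>\<^bsub>T.LT\<^esub>"
proof -
  obtain z where z: "Z = T.up z" "z \<in> carrier T" using Z by (auto simp: T.GT_simps)
  have "trip T z x y = \<zero> \<and> trip T z y x = \<zero> \<and> trip T y z x = \<zero>" if x: "x \<in> J" and y: "y \<in> carrier T" for x y
  proof -
    have "T.up x \<in> up_ideal J" using x unfolding up_ideal_def by blast
    from zero[OF this T.up_G1[OF y]] show ?thesis
      unfolding z(1) T.TKK_triple[OF z(2) J_carrier[OF x] y] T.TKK_triple[OF z(2) y J_carrier[OF x]]
        T.TKK_triple[OF y z(2) J_carrier[OF x]] by simp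
  qed
  then have "z \<in> jts_ann T J" unfolding jts_ann_def using z by simp
  then show ?thesis using ann z by simp
qed

lemmas idl_facts = up_ideal_submodule up_ideal_G1 up_ideal_G0 up_ideal_triple

lemma idl_ess: "essential_ideal \<Phi> T.LT (L.idl (up_ideal J))"
  by (rule L.idl_essential[OF idl_facts up_ideal_ann]) blast+

lemma idl_gr: "graded_ideal \<Phi> T.LT T.GT (L.idl (up_ideal J))"
  by (rule L.idl_graded[OF idl_facts]) blast+

context
  fixes q
  assumes q: "q \<in> carrier S"
    and qK: "\<And>x t. \<lbrakk>x \<in> J; t \<in> carrier T\<rbrakk> \<Longrightarrow>
      trip S q (f x) (f t) \<in> K \<and> trip S q (f t) (f x) \<in> K \<and> trip S (f x) q (f t) \<in> K"
begin

text \<open>The cases follow the degree of the generator. Degree 1 gives zero. Degree 0 gives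
  -{x,y,q} with x or y coming from J, an element of \<open>K\<close>. Degree -1 gives \<delta>(q, f
  j), whose action on degrees 1 and -1 consists, up to sign, of products of q with
  denominators.\<close>

lemma up_q_gens:
  assumes e: "e \<in> L.idl_gens (up_ideal J)"
  shows "S.up q \<otimes>\<^bsub>S.LT\<^esub> ph e \<in> nrm"
proof -
  note s = S.PE_simps S.com_zero S.delta_zero S.M.diff_zero S.PE.M.diff_zero
  have sw: "T.swap \<zero>\<^bsub>T.PE\<^esub> = \<zero>\<^bsub>T.PE\<^esub>" by (rule T.PE_eqI) (simp_all add: T.PE_simps)
  have neg: "\<zero>\<^bsub>S\<^esub> \<ominus>\<^bsub>S\<^esub> k \<in> K" if "k \<in> K" for k
    using S.submodule_diff[OF K_submodule S.submodule_zero[OF K_submodule] that] .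
  have br: "T.up x \<otimes>\<^bsub>T.LT\<^esub> exchange (T.up y) = (\<zero>, T.\<delta> x y, \<zero>)" if "x \<in> carrier T" "y \<in> carrier T" for x y
    using that by (simp add: sw T.PE_simps T.com_zero T.delta_zero T.M.diff_zero T.PE.M.diff_zero)
  have mid: "S.up q \<otimes>\<^bsub>S.LT\<^esub> ph (\<zero>, T.\<delta> x y, \<zero>) = S.up (\<zero>\<^bsub>S\<^esub> \<ominus>\<^bsub>S\<^esub> trip S (f x) (f y) q)"
    if "x \<in> carrier T" "y \<in> carrier T" for x y
    using that q by (simp add: psi_delta f_zero s)
  consider j where "j \<in> J" "e = T.up j" | j where "j \<in> J" "e = exchange (T.up j)"
    | j t where "j \<in> J" "t \<in> carrier T" "e = T.up j \<otimes>\<^bsub>T.LT\<^esub> exchange (T.up t)"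
    | j t where "j \<in> J" "t \<in> carrier T" "e = T.up t \<otimes>\<^bsub>T.LT\<^esub> exchange (T.up j)"
  proof -
    have G1: "\<exists>x\<in>carrier T. t = T.up x" if "t \<in> T.GT 1" for t using that by (auto simp: T.GT_simps)
    have up: "\<exists>x\<in>J. t = T.up x" if "t \<in> up_ideal J" for t using that unfolding up_ideal_def by blast
    have "e \<in> up_ideal J \<or> (\<exists>j\<in>up_ideal J. e = exchange j) \<or>
        (\<exists>j\<in>up_ideal J. \<exists>t\<in>T.GT 1. e = j \<otimes>\<^bsub>T.LT\<^esub> exchange t) \<or>
        (\<exists>j\<in>up_ideal J. \<exists>t\<in>T.GT 1. e = t \<otimes>\<^bsub>T.LT\<^esub> exchange j)"
      using e unfolding L.idl_gens_def by blast
    then show ?thesis using G1 up that by metis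
  qed
  then show ?thesis
  proof cases
    case 1
    have "S.up q \<otimes>\<^bsub>S.LT\<^esub> ph e = \<zero>\<^bsub>S.LT\<^esub>" using 1 q J_carrier by (simp add: f_zero s)
    then show ?thesis using S.LT.submodule_zero[OF nrm_submodule] by simp
  next
    case 2
    have jc: "j \<in> carrier T" using 2 J_carrier by blast
    have m: "S.up q \<otimes>\<^bsub>S.LT\<^esub> ph e = (\<zero>\<^bsub>S\<^esub>, S.\<delta> q (f j), \<zero>\<^bsub>S\<^esub>)"
      using 2 q jc by (simp add: f_zero sw s)
    show ?thesis
      unfolding m
    proof (rule nrmI)
      show "(\<zero>\<^bsub>S\<^esub>, S.\<delta> q (f j), \<zero>\<^bsub>S\<^esub>) \<in> carrier S.LT" using q jc by simp
      fix x assume x: "x \<in> carrier T"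
      have "(\<zero>\<^bsub>S\<^esub>, S.\<delta> q (f j), \<zero>\<^bsub>S\<^esub>) \<otimes>\<^bsub>S.LT\<^esub> ph (T.up x) = S.up (trip S q (f j) (f x))"
        using q jc x by (simp add: f_zero s)
      then show "(\<zero>\<^bsub>S\<^esub>, S.\<delta> q (f j), \<zero>\<^bsub>S\<^esub>) \<otimes>\<^bsub>S.LT\<^esub> ph (T.up x) \<in> PL"
        using up_K_PL qK[OF 2(1) x] by metis
      have "(\<zero>\<^bsub>S\<^esub>, S.\<delta> q (f j), \<zero>\<^bsub>S\<^esub>) \<otimes>\<^bsub>S.LT\<^esub> ph (\<zero>, \<zero>\<^bsub>T.PE\<^esub>, x) =
          (\<zero>\<^bsub>S\<^esub>, \<zero>\<^bsub>S.PE\<^esub>, \<zero>\<^bsub>S\<^esub> \<ominus>\<^bsub>S\<^esub> trip S (f j) q (f x))"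
        using q jc x by (simp add: f_zero s S.M.uminus_eq_diff)
      then show "(\<zero>\<^bsub>S\<^esub>, S.\<delta> q (f j), \<zero>\<^bsub>S\<^esub>) \<otimes>\<^bsub>S.LT\<^esub> ph (\<zero>, \<zero>\<^bsub>T.PE\<^esub>, x) \<in> PL"
        using down_K_PL[OF neg] qK[OF 2(1) x] by metis
    qed
  next
    case 3
    have jc: "j \<in> carrier T" using 3 J_carrier by blast
    have "trip S (f j) (f t) q \<in> K"
      using qK[OF 3(1,2)] S.trip_sym[OF f_closed[OF jc] f_closed[OF 3(2)] q] by simp
    then show ?thesis unfolding 3(3) br[OF jc 3(2)] mid[OF jc 3(2)]
      by (intro PL_nrm up_K_PL neg)
  next
    case 4
    have jc: "j \<in> carrier T" using 4 J_carrier by blast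
    have "trip S (f t) (f j) q \<in> K"
      using qK[OF 4(1,2)] S.trip_sym[OF f_closed[OF 4(2)] f_closed[OF jc] q] by simp
    then show ?thesis unfolding 4(3) br[OF 4(2) jc] mid[OF 4(2) jc]
      by (intro PL_nrm up_K_PL neg)
  qed
qed

lemma up_q_linear:
  assumes V: "submodule V \<Phi> S.LT"
  shows "submodule {e \<in> carrier T.LT. S.up q \<otimes>\<^bsub>S.LT\<^esub> ph e \<in> V} \<Phi> T.LT"
proof (rule T.LT.submodule_linear_set[OF T.LT.submodule_carrier S.LT_module _ _ _ V])
  have u: "S.up q \<in> carrier S.LT" by (rule S.up_LT[OF q])
  show "(\<lambda>e. S.up q \<otimes>\<^bsub>S.LT\<^esub> ph e) \<in> carrier T.LT \<rightarrow> carrier S.LT"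
    using S.LT.br_closed[OF u E.ph_closed] by blast
  fix x assume x: "x \<in> carrier T.LT"
  show "S.up q \<otimes>\<^bsub>S.LT\<^esub> ph (x \<oplus>\<^bsub>T.LT\<^esub> y) = S.up q \<otimes>\<^bsub>S.LT\<^esub> ph x \<oplus>\<^bsub>S.LT\<^esub> S.up q \<otimes>\<^bsub>S.LT\<^esub> ph y"
    if y: "y \<in> carrier T.LT" for y
    by (simp only: E.ph_add[OF x y] S.LT.br_add2[OF u E.ph_closed[OF x] E.ph_closed[OF y]])
  show "S.up q \<otimes>\<^bsub>S.LT\<^esub> ph (a \<odot>\<^bsub>T.LT\<^esub> x) = a \<odot>\<^bsub>S.LT\<^esub> (S.up q \<otimes>\<^bsub>S.LT\<^esub> ph x)" if a: "a \<in> carrier \<Phi>" for a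
    by (simp only: E.ph_smult[OF a x] S.LT.br_smult2[OF a u E.ph_closed[OF x]])
qed

lemma up_q_idl:
  assumes "e \<in> L.idl (up_ideal J)"
  shows "S.up q \<otimes>\<^bsub>S.LT\<^esub> ph e \<in> nrm"
proof -
  have "L.idl_gens (up_ideal J) \<subseteq> carrier T.LT"
    by (rule L.idl_gens_sub[OF idl_facts]) blast+
  then have "L.idl_gens (up_ideal J) \<subseteq> {e \<in> carrier T.LT. S.up q \<otimes>\<^bsub>S.LT\<^esub> ph e \<in> nrm}"
    using up_q_gens by blast
  then have "L.idl (up_ideal J) \<subseteq> {e \<in> carrier T.LT. S.up q \<otimes>\<^bsub>S.LT\<^esub> ph e \<in> nrm}"
    unfolding L.idl_def by (rule T.LT.mspan_least[OF up_q_linear[OF nrm_submodule]])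
  then show ?thesis using assms by blast
qed

text \<open>In [q,[a,b]] = [[q,a],b] + [a,[q,b]] both [q,a] and [q,b] normalise the image of L, so
  both terms lie in it.\<close>

lemma up_q_dom: "E.dom (S.up q) (lie_derived \<Phi> T.LT (L.idl (up_ideal J)))"
  unfolding E.dom_def
proof (intro conjI ballI)
  have u: "S.up q \<in> carrier S.LT" by (rule S.up_LT[OF q])
  then show "S.up q \<in> carrier S.LT" .
  show "essential_ideal \<Phi> T.LT (lie_derived \<Phi> T.LT (L.idl (up_ideal J)))"
    by (rule L.ess_derived[OF idl_ess])
  have I: "lie_ideal \<Phi> T.LT (L.idl (up_ideal J))" by (rule T.LT.essD[OF idl_ess])
  have "S.up q \<otimes>\<^bsub>S.LT\<^esub> ph (a \<otimes>\<^bsub>T.LT\<^esub> b) \<in> PL"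
    if a: "a \<in> L.idl (up_ideal J)" and b: "b \<in> L.idl (up_ideal J)" for a b
  proof -
    have c: "a \<in> carrier T.LT" "b \<in> carrier T.LT" using T.LT.idealD(4)[OF I] a b by auto
    note pc = E.ph_closed[OF c(1)] E.ph_closed[OF c(2)]
    have n: "S.up q \<otimes>\<^bsub>S.LT\<^esub> ph a \<in> nrm" "S.up q \<otimes>\<^bsub>S.LT\<^esub> ph b \<in> nrm" using up_q_idl a b by auto
    have 1: "(S.up q \<otimes>\<^bsub>S.LT\<^esub> ph a) \<otimes>\<^bsub>S.LT\<^esub> ph b \<in> PL" using n(1) c(2) unfolding nrm_def by blast
    have "(S.up q \<otimes>\<^bsub>S.LT\<^esub> ph b) \<otimes>\<^bsub>S.LT\<^esub> ph a \<in> PL" using n(2) c(1) unfolding nrm_def by blast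
    then have "ph a \<otimes>\<^bsub>S.LT\<^esub> (S.up q \<otimes>\<^bsub>S.LT\<^esub> ph b) \<in> PL"
      unfolding S.LT.br_anti[OF pc(1) S.LT.br_closed[OF u pc(2)]]
      by (rule S.LT.submodule_uminus[OF PL_submodule])
    then show ?thesis
      unfolding E.ph_br[OF c] S.LT.br_jacobi[OF u pc] using 1 S.LT.submodule_add[OF PL_submodule] by blast
  qed
  then have "{a \<otimes>\<^bsub>T.LT\<^esub> b |a b. a \<in> L.idl (up_ideal J) \<and> b \<in> L.idl (up_ideal J)} \<subseteq>
      {e \<in> carrier T.LT. S.up q \<otimes>\<^bsub>S.LT\<^esub> ph e \<in> PL}"
    using T.LT.idealD(4)[OF I] T.LT.br_closed by blast
  then have "lie_derived \<Phi> T.LT (L.idl (up_ideal J)) \<subseteq> {e \<in> carrier T.LT. S.up q \<otimes>\<^bsub>S.LT\<^esub> ph e \<in> PL}"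
    unfolding lie_derived_def by (rule T.LT.mspan_least[OF up_q_linear[OF PL_submodule]])
  then show "\<And>x. x \<in> lie_derived \<Phi> T.LT (L.idl (up_ideal J)) \<Longrightarrow> S.up q \<otimes>\<^bsub>S.LT\<^esub> ph x \<in> PL" by blast
qed

end

end

text \<open>\<open>denominators\<close> supplies an ideal only for nonzero q; the zero element is
  the image of zero and has all of L as domain.\<close>

lemma up_dom:
  assumes q: "q \<in> carrier S"
  obtains E where "E.dom (S.up q) E" "graded_ideal \<Phi> T.LT T.GT E"
proof (cases "q = \<zero>\<^bsub>S\<^esub>")
  case True
  have "S.up q = ph (T.up \<zero>)" using True by (simp add: f_zero)
  then have "E.dom (S.up q) (carrier T.LT)" using E.ext_ph(1)[OF T.up_LT[OF T.M.zero_closed]] by simp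
  then show ?thesis using that L.graded_carrier by blast
next
  case False
  obtain J where J: "jts_ideal \<Phi> T J" "jts_ann T J = {\<zero>}"
    and JK: "\<And>x t. \<lbrakk>x \<in> J; t \<in> carrier T\<rbrakk> \<Longrightarrow>
      trip S q (f x) (f t) \<in> K \<and> trip S q (f t) (f x) \<in> K \<and> trip S (f x) q (f t) \<in> K"
    using denominators[OF q False] by metis
  show ?thesis
    by (rule that[OF up_q_dom[OF J q JK] L.graded_derived[OF idl_gr[OF J]]])
qed

lemma ext_deg:
  assumes q: "q \<in> carrier S"
  shows "E.ext (S.up q) \<in> L.Qdeg 1"
proof -
  obtain E where E: "E.dom (S.up q) E" "graded_ideal \<Phi> T.LT T.GT E" using up_dom[OF q] .
  have "E.dm (S.up q) x \<in> T.GT (j + 1)" if x: "x \<in> E" "x \<in> T.GT j" for x j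
  proof (rule ph_GT_D)
    show "ph (E.dm (S.up q) x) \<in> S.GT (j + 1)"
      unfolding E.domD(6)[OF E(1) x(1)] using S.GT_br[OF S.up_G1[OF q] ph_GT[OF x(2)]] by (simp add: add.commute)
    show "E.dm (S.up q) x \<in> carrier T.LT" using E.domD(5)[OF E(1) x(1)] .
  qed
  then show ?thesis
    unfolding E.ext_eq[OF E(1)] using E.pder_dm[OF E(1)] E(2) by (intro L.cls_Qdeg) (auto simp: L.pdeg_def)
qed

lemma ext_br_gen:
  assumes "E.dom m A" "E.dom n B"
  shows "\<exists>C. E.dom (m \<otimes>\<^bsub>S.LT\<^esub> n) C" "E.ext (m \<otimes>\<^bsub>S.LT\<^esub> n) = E.ext m \<otimes>\<^bsub>L.Q\<^esub> E.ext n"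
  using E.ext_br[OF E.dom_common[OF assms]] by auto

text \<open>By \<open>TKK_triple\<close> the product is a double bracket involving
  \<open>exchange\<close> in the TKK-algebra of S, and \<open>ext\<close> respects both the bracket
  and the involution.\<close>

lemma ext_trip:
  assumes q: "q \<in> carrier S" and s: "s \<in> carrier S" and u: "u \<in> carrier S"
  shows "E.ext (S.up (trip S q s u)) = L.trQ (E.ext (S.up q)) (E.ext (S.up s)) (E.ext (S.up u))"
proof -
  obtain A B C where d: "E.dom (S.up q) A" "E.dom (S.up s) B" "E.dom (S.up u) C"
    using up_dom[OF q] up_dom[OF s] up_dom[OF u] by metis
  note t = E.ext_th[OF d(2)]
  obtain D where D: "E.dom (S.up q \<otimes>\<^bsub>S.LT\<^esub> exchange (S.up s)) D" using ext_br_gen(1)[OF d(1) t(1)] by blast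
  show ?thesis
    unfolding S.TKK_triple[OF q s u, symmetric] Qm_trip_def
      ext_br_gen(2)[OF D d(3)] ext_br_gen(2)[OF d(1) t(1)] t(2) ..
qed

section \<open>The canonical map into degree one\<close>

definition ext_map where "ext_map = (\<lambda>q\<in>carrier S. E.ext (S.up q))"

lemma ext_map_f: "x \<in> carrier T \<Longrightarrow> ext_map (f x) = TKK_embed \<Phi> T x"
proof -
  assume x: "x \<in> carrier T"
  have "S.up (f x) = ph (T.up x)" by (simp add: f_zero)
  then show ?thesis
    using x E.ext_ph(2)[OF T.up_LT[OF x]] T.embed_eq[OF x] unfolding ext_map_def by simp
qed

lemma ext_map_linear:
  assumes q: "q \<in> carrier S"
  shows "s \<in> carrier S \<Longrightarrow> E.ext (S.up (q \<oplus>\<^bsub>S\<^esub> s)) = E.ext (S.up q) \<oplus>\<^bsub>L.Q\<^esub> E.ext (S.up s)"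
    and "a \<in> carrier \<Phi> \<Longrightarrow> E.ext (S.up (a \<odot>\<^bsub>S\<^esub> q)) = a \<odot>\<^bsub>L.Q\<^esub> E.ext (S.up q)"
proof -
  obtain A where A: "E.dom (S.up q) A" using up_dom[OF q] by metis
  show "E.ext (S.up (a \<odot>\<^bsub>S\<^esub> q)) = a \<odot>\<^bsub>L.Q\<^esub> E.ext (S.up q)" if a: "a \<in> carrier \<Phi>"
    unfolding S.up_smult[OF a] by (rule E.ext_smult(2)[OF A a])
  show "E.ext (S.up (q \<oplus>\<^bsub>S\<^esub> s)) = E.ext (S.up q) \<oplus>\<^bsub>L.Q\<^esub> E.ext (S.up s)" if s: "s \<in> carrier S"
  proof -
    obtain B where B: "E.dom (S.up s) B" using up_dom[OF s] by metis
    show ?thesis unfolding S.up_add by (rule E.ext_add(2)[OF E.dom_common[OF A B]])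
  qed
qed

text \<open>On \<open>K\<close> the map is the embedding \<open>adc\<close>, which is injective. For
  nonzero r the denominators give a nonzero product in \<open>K\<close>, whose image would be a
  product with a zero factor.\<close>

lemma ext_zero_imp:
  assumes r: "r \<in> carrier S" and z: "E.ext (S.up r) = \<zero>\<^bsub>L.Q\<^esub>"
  shows "r = \<zero>\<^bsub>S\<^esub>"
proof (rule ccontr)
  assume r0: "r \<noteq> \<zero>\<^bsub>S\<^esub>"
  obtain J where J: "jts_ideal \<Phi> T J"
    and JK: "\<And>x t. \<lbrakk>x \<in> J; t \<in> carrier T\<rbrakk> \<Longrightarrow>
      trip S r (f x) (f t) \<in> K \<and> trip S r (f t) (f x) \<in> K \<and> trip S (f x) r (f t) \<in> K"
    and ne: "\<exists>x\<in>J. \<exists>t\<in>carrier T. trip S r (f x) (f t) \<noteq> \<zero>\<^bsub>S\<^esub> \<or> trip S r (f t) (f x) \<noteq> \<zero>\<^bsub>S\<^esub> \<or>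
      trip S (f x) r (f t) \<noteq> \<zero>\<^bsub>S\<^esub>"
    by (rule denominators[OF r r0]) (rule that; blast)
  have kz: "k = \<zero>\<^bsub>S\<^esub>" if k: "k \<in> K" and e: "E.ext (S.up k) = \<zero>\<^bsub>L.Q\<^esub>" for k
  proof -
    obtain c where c: "c \<in> carrier T" "k = f c" using k by blast
    have "L.adc (T.up c) = \<zero>\<^bsub>L.Q\<^esub>"
      using e ext_map_f[OF c(1)] T.embed_eq[OF c(1)] c unfolding ext_map_def by simp
    then have "T.up c = \<zero>\<^bsub>T.LT\<^esub>" using L.adc_eq_zero_iff[OF T.up_LT[OF c(1)]] by blast
    then show ?thesis using c f_zero by simp
  qed
  interpret Q1: jts6 \<Phi> L.Q1 by (rule L.Q1_jts6)
  have tz: "L.trQ \<zero>\<^bsub>L.Q\<^esub> X Y = \<zero>\<^bsub>L.Q\<^esub>" "L.trQ X \<zero>\<^bsub>L.Q\<^esub> Y = \<zero>\<^bsub>L.Q\<^esub>" if "X \<in> L.Qdeg 1" "Y \<in> L.Qdeg 1" for X Y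
    using Q1.J.tr_zero[of X Y] L.Q1_trip[of X "\<zero>\<^bsub>L.Q\<^esub>" Y] L.Q1_trip[of "\<zero>\<^bsub>L.Q\<^esub>" X Y] that
      L.Q.submodule_zero[OF L.Qdeg_submodule[of 1]] by simp_all
  obtain x t where x: "x \<in> J" "t \<in> carrier T" and
    ne: "trip S r (f x) (f t) \<noteq> \<zero>\<^bsub>S\<^esub> \<or> trip S r (f t) (f x) \<noteq> \<zero>\<^bsub>S\<^esub> \<or> trip S (f x) r (f t) \<noteq> \<zero>\<^bsub>S\<^esub>"
    using ne by blast
  have xc: "x \<in> carrier T" using T.jts_idealD(4)[OF J x(1) x(2) x(2)] .
  have c: "f x \<in> carrier S" "f t \<in> carrier S" using xc x by auto
  note d = ext_deg[OF c(1)] ext_deg[OF c(2)]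
  have "E.ext (S.up (trip S r (f x) (f t))) = \<zero>\<^bsub>L.Q\<^esub>" "E.ext (S.up (trip S r (f t) (f x))) = \<zero>\<^bsub>L.Q\<^esub>"
    "E.ext (S.up (trip S (f x) r (f t))) = \<zero>\<^bsub>L.Q\<^esub>"
    unfolding ext_trip[OF r c] ext_trip[OF r c(2,1)] ext_trip[OF c(1) r c(2)] z using tz d by simp_all
  then show False using kz JK[OF x] ne by blast
qed

lemma ext_map_mono: "jts_mono \<Phi> S L.Q1 ext_map"
  unfolding jts_mono_def mod_hom_def
proof (intro conjI CollectI ballI)
  show "ext_map \<in> carrier S \<rightarrow>\<^sub>E carrier L.Q1" unfolding ext_map_def using ext_deg by auto
  fix q assume q: "q \<in> carrier S"
  show "ext_map (a \<odot>\<^bsub>S\<^esub> q) = a \<odot>\<^bsub>L.Q1\<^esub> ext_map q" if "a \<in> carrier \<Phi>" for a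
    using q that ext_map_linear(2)[OF q that] unfolding ext_map_def by simp
  fix s assume s: "s \<in> carrier S"
  show "ext_map (q \<oplus>\<^bsub>S\<^esub> s) = ext_map q \<oplus>\<^bsub>L.Q1\<^esub> ext_map s"
    using q s ext_map_linear(1)[OF q s] unfolding ext_map_def by simp
  show "ext_map (quad S q s) = quad L.Q1 (ext_map q) (ext_map s)"
    using q s ext_map_linear(2)[OF S.trip_closed[OF q s q] S.half_closed] ext_trip[OF q s q]
    unfolding ext_map_def by (simp add: S.quad_closed S.quad_eq)
next
  show "inj_on ext_map (carrier S)"
  proof (rule inj_onI)
    fix q s assume qs: "q \<in> carrier S" "s \<in> carrier S" "ext_map q = ext_map s"
    have c: "E.ext (S.up q) \<in> carrier L.Q" "E.ext (S.up s) \<in> carrier L.Q"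
      using L.Qdeg_in_Q ext_deg qs by blast+
    have "E.ext (S.up (q \<ominus>\<^bsub>S\<^esub> s)) = E.ext (S.up q) \<ominus>\<^bsub>L.Q\<^esub> E.ext (S.up s)"
      by (rule additive_diff_gen[of S L.Q "\<lambda>q. E.ext (S.up q)"])
        (use S.M.abelian_group_axioms L.Q.M.abelian_group_axioms L.Qdeg_in_Q ext_deg ext_map_linear(1) qs in auto)
    then have "E.ext (S.up (q \<ominus>\<^bsub>S\<^esub> s)) = \<zero>\<^bsub>L.Q\<^esub>"
      using qs c L.Q.M.diff_eq_zero unfolding ext_map_def by simp
    then show "q = s" using ext_zero_imp[of "q \<ominus>\<^bsub>S\<^esub> s"] qs S.M.diff_eq_zero by simp
  qed
qed

end

theorem theorem4p10:
  fixes \<Phi> :: "'k ring" and T :: "('k, 't) jts"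
  assumes "cring \<Phi>"
    and "[(6::nat)] \<cdot>\<^bsub>\<Phi>\<^esub> \<one>\<^bsub>\<Phi>\<^esub> \<in> Units \<Phi>"
    and "jordan_triple_system \<Phi> T"
    and "strongly_nondegenerate T"
  shows "M_quotients_of \<Phi> T (Qm_TKK_one \<Phi> T) (TKK_embed \<Phi> T) \<and>
    (\<forall>(S :: ('k, 's) jts) f. M_quotients_of \<Phi> T S f \<longrightarrow>
      (\<exists>!g. jts_mono \<Phi> S (Qm_TKK_one \<Phi> T) g \<and>
            (\<forall>x\<in>carrier T. g (f x) = TKK_embed \<Phi> T x)))"
proof (intro conjI allI impI)
  interpret T: jts6 \<Phi> T by (rule jts6I[OF assms(2,3)])
  interpret L: gr3 \<Phi> T.LT T.GT T.TKK_proj exchange by (rule T.TKK_gr3[OF assms(4)])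
  note Q1 = T.embed_M_quotients(2)[OF assms(4)]
  show mq: "M_quotients_of \<Phi> T (Qm_TKK_one \<Phi> T) (TKK_embed \<Phi> T)"
    by (rule T.embed_M_quotients(1)[OF assms(4)])
  fix S :: "('k, 's) jts" and f
  assume f: "M_quotients_of \<Phi> T S f"
  then have "jordan_triple_system \<Phi> S" unfolding M_quotients_of_def M_quotients_def by simp
  then interpret S: jts6 \<Phi> S by (rule jts6I[OF assms(2)])
  interpret N: nondegenerate_quotients \<Phi> T S f
    by unfold_locales (use f assms(4) in auto)
  \<comment> \<open>The degree one component is itself a triple system of quotients of T, so
    \<open>quotient_map_unique\<close> applies with it as the target.\<close>
  have B: "jts_quotients \<Phi> T (Qm_TKK_one \<Phi> T) (TKK_embed \<Phi> T)"
    using mq T.jts6_axioms L.Q1_jts6 unfolding Q1 by (intro jts_quotients.intro jts_quotients_axioms.intro)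
  show "\<exists>!g. jts_mono \<Phi> S (Qm_TKK_one \<Phi> T) g \<and> (\<forall>x\<in>carrier T. g (f x) = TKK_embed \<Phi> T x)"
  proof (rule ex1I[of _ N.ext_map])
    show "jts_mono \<Phi> S (Qm_TKK_one \<Phi> T) N.ext_map \<and> (\<forall>x\<in>carrier T. N.ext_map (f x) = TKK_embed \<Phi> T x)"
      using N.ext_map_mono N.ext_map_f unfolding Q1 by blast
    fix g assume g: "jts_mono \<Phi> S (Qm_TKK_one \<Phi> T) g \<and> (\<forall>x\<in>carrier T. g (f x) = TKK_embed \<Phi> T x)"
    show "g = N.ext_map"
      by (rule N.quotient_map_unique[OF B]) (use g N.ext_map_mono N.ext_map_f in \<open>auto simp: Q1\<close>)
  qed
qed

end
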